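(* Let $K$ be a finite simplicial complex triangulating a $(p+1)$-dimensional compact orientable manifold. Then the optimal homologous chain problem for $p$-dimensional chains of $K$ can be solved in polynomial time.
   Context: The manifold may have boundary. Each simplex of $K$ is given an arbitrary fixed orientation, and chains have $\mathbb{Z}$ coefficients. Let $m$ and $n$ be the numbers of $p$- and $(p+1)$-simplices of $K$. $[\partial_{p+1}]$ is the $m\times n$ matrix of the simplicial boundary operator $\partial_{p+1}\colon C_{p+1}(K)\to C_p(K)$ in the bases of oriented simplices. A $p$-chain is identified with its coefficient vector in $\mathbb{Z}^m$. Two $p$-chains $\mathbf{c},\mathbf{c}'$ are homologous if $\mathbf{c}=\mathbf{c}'+[\partial_{p+1}]\mathbf{y}$ for some $\mathbf{y}\in\mathbb{Z}^n$. Optimal homologous chain problem (OHCP) for $p$-chains: given a $p$-chain $\mathbf{c}\in\mathbb{Z}^m$ and a real $m\times m$ diagonal matrix $W$ with diagonal entries $w_i$ (the weights of the $p$-simplices; zero or negative weights are allowed), solve $$\min_{\mathbf{x},\mathbf{y}}\ \|W\mathbf{x}\|_1\quad\text{such that}\quad \mathbf{x}=\mathbf{c}+[\partial_{p+1}]\,\mathbf{y},\ \ \mathbf{x}\in\mathbb{Z}^m,\ \mathbf{y}\in\mathbb{Z}^n,$$ where $\|W\mathbf{x}\|_1=\sum_i|w_i||x_i|$. Polynomial time means a number of arithmetic operations polynomial in the number of simplices. *)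

theory Defs
  imports
    "HOL-Analysis.Analysis"
    "HOL-Homology.Homology"
    "HOL-Combinatorics.Permutations"
    "HOL-Computational_Algebra.Polynomial"
    "Jordan_Normal_Form.Matrix"
begin

section \<open>Compact orientable manifolds, possibly with boundary\<close>

definition locally_modelled_at :: "'a topology \<Rightarrow> 'b topology \<Rightarrow> 'a \<Rightarrow> bool" where
  "locally_modelled_at X H x \<longleftrightarrow>
     (\<exists>U V. openin X U \<and> x \<in> U \<and> openin H V \<and>
            subtopology X U homeomorphic_space subtopology H V)"

text \<open>Intended for \<open>n \<ge> 1\<close> only: coordinate \<open>0\<close> is identically zero on \<open>Euclidean_space 0\<close>.\<close>

definition half_space :: "nat \<Rightarrow> (nat \<Rightarrow> real) topology" where
  "half_space n = subtopology (Euclidean_space n) {x. 0 \<le> x 0}"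

definition manifold_with_boundary :: "nat \<Rightarrow> 'a topology \<Rightarrow> bool" where
  "manifold_with_boundary n X \<longleftrightarrow>
     Hausdorff_space X \<and> second_countable X \<and>
     (\<forall>x\<in>topspace X. locally_modelled_at X (half_space n) x)"

definition manifold_interior :: "nat \<Rightarrow> 'a topology \<Rightarrow> 'a topology" where
  "manifold_interior n X =
     subtopology X {x \<in> topspace X. locally_modelled_at X (Euclidean_space n) x}"

text \<open>
  Singular homology with integer coefficients.  An orientation of an \<open>n\<close>-manifold without boundary
  chooses a generator \<open>\<mu> x\<close> of the local homology group \<open>H\<^sub>n(X, X - {x})\<close> at every point, such that
  every point has an open neighbourhood \<open>U\<close> on which all \<open>\<mu> y\<close> are restrictions of one
  class in \<open>H\<^sub>n(X, X - U)\<close>.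
\<close>

definition orientation_on :: "nat \<Rightarrow> 'a topology \<Rightarrow> ('a \<Rightarrow> 'a chain set) \<Rightarrow> bool" where
  "orientation_on n X \<mu> \<longleftrightarrow>
     (\<forall>x\<in>topspace X.
        \<mu> x \<in> carrier (relative_homology_group (int n) X (topspace X - {x})) \<and>
        subgroup_generated (relative_homology_group (int n) X (topspace X - {x})) {\<mu> x}
          = relative_homology_group (int n) X (topspace X - {x})) \<and>
     (\<forall>x\<in>topspace X. \<exists>U. openin X U \<and> x \<in> U \<and>
        (\<exists>\<nu>\<in>carrier (relative_homology_group (int n) X (topspace X - U)).
           \<forall>y\<in>U. hom_induced (int n) X (topspace X - U) X (topspace X - {y}) id \<nu> = \<mu> y))"

text \<open>A manifold with boundary is orientable if its interior is.\<close>

definition compact_orientable_manifold :: "nat \<Rightarrow> 'a topology \<Rightarrow> bool" where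
  "compact_orientable_manifold n X \<longleftrightarrow>
     manifold_with_boundary n X \<and> compact_space X \<and>
     (\<exists>\<mu>. orientation_on n (manifold_interior n X) \<mu>)"


section \<open>Finite simplicial complexes\<close>

text \<open>
  Complexes are abstract, with vertices in \<open>nat\<close>.  The complexes of \<open>HOL-Analysis\<close> live in a fixed
  Euclidean space, so a bound stated for them could depend on the dimension of that space, hence
  on the dimension of the complex.
\<close>

definition finite_simplicial_complex :: "nat set set \<Rightarrow> bool" where
  "finite_simplicial_complex K \<longleftrightarrow>
     finite K \<and> (\<forall>S\<in>K. finite S \<and> S \<noteq> {}) \<and>
     (\<forall>S\<in>K. \<forall>T. T \<subseteq> S \<and> T \<noteq> {} \<longrightarrow> T \<in> K)"

definition simplices :: "nat set set \<Rightarrow> nat \<Rightarrow> nat set set" where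
  "simplices K p = {S \<in> K. card S = Suc p}"

text \<open>The points of the polyhedron, in barycentric coordinates.\<close>

definition geometric_realization :: "nat set set \<Rightarrow> (nat \<Rightarrow> real) topology" where
  "geometric_realization K = subtopology (powertop_real UNIV)
     {f. (\<forall>v. 0 \<le> f v) \<and> {v. f v \<noteq> 0} \<in> K \<and> (\<Sum>v | f v \<noteq> 0. f v) = 1}"

definition triangulates_compact_orientable_manifold :: "nat set set \<Rightarrow> nat \<Rightarrow> bool" where
  "triangulates_compact_orientable_manifold K n \<longleftrightarrow>
     finite_simplicial_complex K \<and> compact_orientable_manifold n (geometric_realization K)"


section \<open>The boundary matrix\<close>

text \<open>
  An oriented simplex is given by an ordering of its vertices, orderings being equivalent if they
  differ by an even permutation.  A basis of \<open>C\<^sub>p(K)\<close> lists every \<open>p\<close>-simplex once, in some order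
  and with some orientation.
\<close>

definition oriented_basis :: "nat set set \<Rightarrow> nat \<Rightarrow> nat list list \<Rightarrow> bool" where
  "oriented_basis K p \<sigma>s \<longleftrightarrow>
     (\<forall>\<sigma>\<in>set \<sigma>s. distinct \<sigma>) \<and> distinct (map set \<sigma>s) \<and> set (map set \<sigma>s) = simplices K p"

text \<open>
  The coefficient \<open>\<epsilon>\<close> with \<open>[\<tau>] = \<epsilon> [\<sigma>]\<close> if the distinct lists \<open>\<sigma>\<close> and \<open>\<tau>\<close> order the same simplex,
  and \<open>0\<close> if they order different ones.
\<close>

definition orientation_sign :: "nat list \<Rightarrow> nat list \<Rightarrow> int" where
  "orientation_sign \<sigma> \<tau> =
     (if set \<sigma> = set \<tau>
      then sign (THE \<pi>. \<pi> permutes {..<length \<sigma>} \<and> permute_list \<pi> \<sigma> = \<tau>)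
      else 0)"

text \<open>
  Column \<open>j\<close> expands \<open>\<partial>[v\<^sub>0,\<dots>,v\<^sub>q] = (\<Sum>k. (-1)\<^sup>k [v\<^sub>0,\<dots>,v\<^sub>k\<^sub>-\<^sub>1,v\<^sub>k\<^sub>+\<^sub>1,\<dots>,v\<^sub>q])\<close>, for the \<open>j\<close>-th simplex of \<open>\<tau>s\<close>,
  in the basis \<open>\<sigma>s\<close>.
\<close>

definition boundary_matrix :: "nat list list \<Rightarrow> nat list list \<Rightarrow> int mat" where
  "boundary_matrix \<sigma>s \<tau>s = Matrix.mat (length \<sigma>s) (length \<tau>s)
     (\<lambda>(i, j). \<Sum>k<length (\<tau>s ! j).
        (- 1) ^ k * orientation_sign (\<sigma>s ! i) (take k (\<tau>s ! j) @ drop (Suc k) (\<tau>s ! j)))"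


section \<open>The optimal homologous chain problem\<close>

definition l1_norm :: "real Matrix.vec \<Rightarrow> real" where
  "l1_norm v = (\<Sum>i<dim_vec v. \<bar>v $ i\<bar>)"

definition ohcp_feasible ::
    "int mat \<Rightarrow> int Matrix.vec \<Rightarrow> int Matrix.vec \<Rightarrow> int Matrix.vec \<Rightarrow> bool" where
  "ohcp_feasible D c x y \<longleftrightarrow>
     x \<in> carrier_vec (dim_row D) \<and> y \<in> carrier_vec (dim_col D) \<and> x = c + D *\<^sub>v y"

definition ohcp_objective :: "real mat \<Rightarrow> int Matrix.vec \<Rightarrow> real" where
  "ohcp_objective W x = l1_norm (W *\<^sub>v map_vec real_of_int x)"

definition ohcp_optimal ::
    "int mat \<Rightarrow> real mat \<Rightarrow> int Matrix.vec \<Rightarrow> int Matrix.vec \<Rightarrow> int Matrix.vec \<Rightarrow> bool" where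
  "ohcp_optimal D W c x y \<longleftrightarrow>
     ohcp_feasible D c x y \<and>
     (\<forall>x' y'. ohcp_feasible D c x' y' \<longrightarrow> ohcp_objective W x \<le> ohcp_objective W x')"


section \<open>Programs and their running time\<close>

text \<open>
  A real random-access machine with named arrays.  Natural-number arrays hold sizes, vertex names
  and addresses, real arrays hold the numerical data; a scalar is an array used at index \<open>0\<close>.  Data
  cannot be moved from real to natural-number arrays (in particular there is no rounding), so reals
  influence control flow only through comparisons.
\<close>

datatype iexp =
    INum nat
  | IGet string iexp
  | IAdd iexp iexp
  | ISub iexp iexp
  | IMul iexp iexp

datatype rexp =
    RNum int
  | RGet string iexp
  | RAdd rexp rexp
  | RSub rexp rexp
  | RMul rexp rexp
  | RDiv rexp rexp

datatype bexp =
    ILess iexp iexp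
  | RLess rexp rexp
  | BNot bexp
  | BAnd bexp bexp

datatype com =
    Skip
  | ISet string iexp iexp
  | RSet string iexp rexp
  | Seq com com
  | Cond bexp com com
  | While bexp com

type_synonym state = "(string \<Rightarrow> nat \<Rightarrow> nat) \<times> (string \<Rightarrow> nat \<Rightarrow> real)"

fun ival :: "iexp \<Rightarrow> state \<Rightarrow> nat" where
  "ival (INum k) s = k"
| "ival (IGet a e) s = fst s a (ival e s)"
| "ival (IAdd e f) s = ival e s + ival f s"
| "ival (ISub e f) s = ival e s - ival f s"
| "ival (IMul e f) s = ival e s * ival f s"

fun rval :: "rexp \<Rightarrow> state \<Rightarrow> real" where
  "rval (RNum k) s = real_of_int k"
| "rval (RGet a e) s = snd s a (ival e s)"
| "rval (RAdd e f) s = rval e s + rval f s"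
| "rval (RSub e f) s = rval e s - rval f s"
| "rval (RMul e f) s = rval e s * rval f s"
| "rval (RDiv e f) s = rval e s / rval f s"

fun bval :: "bexp \<Rightarrow> state \<Rightarrow> bool" where
  "bval (ILess e f) s = (ival e s < ival f s)"
| "bval (RLess e f) s = (rval e s < rval f s)"
| "bval (BNot b) s = (\<not> bval b s)"
| "bval (BAnd b c) s = (bval b s \<and> bval c s)"

text \<open>Evaluating an expression costs one unit per node of its syntax tree.\<close>

fun icost :: "iexp \<Rightarrow> nat" where
  "icost (INum k) = 1"
| "icost (IGet a e) = Suc (icost e)"
| "icost (IAdd e f) = Suc (icost e + icost f)"
| "icost (ISub e f) = Suc (icost e + icost f)"
| "icost (IMul e f) = Suc (icost e + icost f)"

fun rcost :: "rexp \<Rightarrow> nat" where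
  "rcost (RNum k) = 1"
| "rcost (RGet a e) = Suc (icost e)"
| "rcost (RAdd e f) = Suc (rcost e + rcost f)"
| "rcost (RSub e f) = Suc (rcost e + rcost f)"
| "rcost (RMul e f) = Suc (rcost e + rcost f)"
| "rcost (RDiv e f) = Suc (rcost e + rcost f)"

fun bcost :: "bexp \<Rightarrow> nat" where
  "bcost (ILess e f) = Suc (icost e + icost f)"
| "bcost (RLess e f) = Suc (rcost e + rcost f)"
| "bcost (BNot b) = Suc (bcost b)"
| "bcost (BAnd b c) = Suc (bcost b + bcost c)"

definition store :: "('i \<Rightarrow> nat \<Rightarrow> 'v) \<Rightarrow> 'i \<Rightarrow> nat \<Rightarrow> 'v \<Rightarrow> 'i \<Rightarrow> nat \<Rightarrow> 'v" where
  "store mem a k v = mem(a := (mem a)(k := v))"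

text \<open>
  \<open>exec c s t s'\<close>: started in state \<open>s\<close>, the program \<open>c\<close> terminates in state \<open>s'\<close> after \<open>t\<close> elementary
  operations, counting arithmetic, comparisons, memory accesses and branches alike.
\<close>

inductive exec :: "com \<Rightarrow> state \<Rightarrow> nat \<Rightarrow> state \<Rightarrow> bool" where
  "exec Skip s 1 s"
| "exec (ISet a e f) s (Suc (icost e + icost f)) (store (fst s) a (ival e s) (ival f s), snd s)"
| "exec (RSet a e f) s (Suc (icost e + rcost f)) (fst s, store (snd s) a (ival e s) (rval f s))"
| "exec c s t s' \<Longrightarrow> exec d s' u s'' \<Longrightarrow> exec (Seq c d) s (t + u) s''"
| "bval b s \<Longrightarrow> exec c s t s' \<Longrightarrow> exec (Cond b c d) s (Suc (bcost b + t)) s'"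
| "\<not> bval b s \<Longrightarrow> exec d s t s' \<Longrightarrow> exec (Cond b c d) s (Suc (bcost b + t)) s'"
| "\<not> bval b s \<Longrightarrow> exec (While b c) s (Suc (bcost b)) s"
| "bval b s \<Longrightarrow> exec c s t s' \<Longrightarrow> exec (While b c) s' u s'' \<Longrightarrow>
     exec (While b c) s (Suc (bcost b + t + u)) s''"


section \<open>Input and output\<close>

definition array :: "'v::zero list \<Rightarrow> nat \<Rightarrow> 'v" where
  "array xs k = (if k < length xs then xs ! k else 0)"

text \<open>
  The oriented simplices are stored row by row, with \<open>p + 1\<close> vertices per row in \<open>''P''\<close> and \<open>p + 2\<close>
  in \<open>''Q''\<close>.  The program has to compute the boundary matrix itself.
\<close>

definition ohcp_input ::
    "nat \<Rightarrow> nat list list \<Rightarrow> nat list list \<Rightarrow> int Matrix.vec \<Rightarrow> real mat \<Rightarrow> state" where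
  "ohcp_input p \<sigma>s \<tau>s c W =
     ((\<lambda>_. array [])
        (''p'' := array [p], ''m'' := array [length \<sigma>s], ''n'' := array [length \<tau>s],
         ''P'' := array (concat \<sigma>s), ''Q'' := array (concat \<tau>s)),
      (\<lambda>_. array [])
        (''c'' := array (map real_of_int (list_of_vec c)), ''w'' := array (diag_mat W)))"

definition ohcp_output :: "state \<Rightarrow> int Matrix.vec \<Rightarrow> int Matrix.vec \<Rightarrow> bool" where
  "ohcp_output s x y \<longleftrightarrow>
     (\<forall>i<dim_vec x. snd s ''x'' i = real_of_int (x $ i)) \<and>
     (\<forall>j<dim_vec y. snd s ''y'' j = real_of_int (y $ j))"

end

theory Submission
  imports Defs
begin

text \<open>
  Orient the \<open>(p+1)\<close>-simplices coherently.  At a common facet of two of them the manifold is an open piece of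
  Euclidean space, and the path of points leading from one simplex into the other compares the orientation class with
  both simplices; the signs found are opposite, so after flipping columns the rows of the boundary matrix have at
  most one entry \<open>1\<close>, at most one entry \<open>-1\<close> and zeros otherwise.  The flips need no topology to be computed: they
  are propagated along common facets.

  Hence the \<open>p\<close>-simplices are arcs of a network whose vertices are the \<open>(p+1)\<close>-simplices and one outer vertex for the
  missing ends, and homologous chains differ by the tension of a potential \<open>z\<close>.  Minimising
  \<open>\<Sum> \<bar>w i\<bar> * \<bar>c i + z (X i) - z (Y i)\<bar>\<close> over \<open>z\<close> is the dual of the minimum cost circulation problem with capacities
  \<open>\<bar>w i\<bar>\<close> and costs \<open>c i\<close>, and a shortest path potential of the residual network of an optimal circulation solves it.
  The costs are integers, hence so is the potential, although the capacities are real.  Cancelling residual cycles of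
  minimum mean cost finds an optimal circulation in strongly polynomial time.
\<close>

section \<open>Orientations of simplices\<close>

text \<open>No fundamental class is built: from the orientation only one sign per ordered simplex is
  kept, the exponent of the orientation class relative to a fixed generator of the local group of
  \<open>Euclidean_space n\<close>. The changes of chart that occur are affine and reverse
  orientation; explicit paths join their linear parts to the reflection in coordinate 0, so the
  degree of that one map on the sphere suffices. A common facet lies in the interior by invariance
  of domain, applied to the chart of the two simplices. That a facet lies in at most two simplices
  is not shown on its own: three signs 1 or -1 cannot be pairwise opposite.

  The weights are arbitrary reals, so neither scaling nor a least improvement per step limits the
  number of cancellations. Instead, with L bounding arcs and vertices, in every block of 2L^3 rounds
  an arc just used ends up with reduced cost so far below the current mean that its residual value
  never changes again. The number of rounds is thus known in advance, and the program can be written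
  with bounded loops, whose cost is read off the syntax.\<close>

fun inversion_sign :: "nat list \<Rightarrow> int" where
  "inversion_sign [] = 1"
| "inversion_sign (x # xs) = (\<Prod>y\<leftarrow>xs. if x < y then 1 else -1) * inversion_sign xs"

text \<open>Adjacent swaps generate all permutations, so this is antisymmetry on the orderings of
  the single simplex \<open>S\<close>; orderings of other sets are left unconstrained.\<close>

definition alternating :: "nat set \<Rightarrow> (nat list \<Rightarrow> int) \<Rightarrow> bool" where
  "alternating S f \<longleftrightarrow> (\<forall>xs x y ys. distinct (xs @ x # y # ys) \<longrightarrow> set (xs @ x # y # ys) = S \<longrightarrow>
     f (xs @ y # x # ys) = - f (xs @ x # y # ys))"

lemma alternating_swap:
  "alternating S f \<Longrightarrow> distinct (xs @ x # y # ys) \<Longrightarrow> set (xs @ x # y # ys) = S \<Longrightarrow>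
    f (xs @ y # x # ys) = - f (xs @ x # y # ys)"
  by (simp only: alternating_def)

text \<open>Swapping neighbours changes the outcome of one comparison, that of the two vertices
  themselves. The parity of the inversions, which a program can count, thus serves as the reference
  for all orientation signs.\<close>

lemma alternating_inversion_sign: "alternating S inversion_sign"
  unfolding alternating_def
proof (intro allI impI)
  fix xs ys :: "nat list" and x y
  assume "distinct (xs @ x # y # ys)"
  then show "inversion_sign (xs @ y # x # ys) = - inversion_sign (xs @ x # y # ys)"
    by (induction xs) auto
qed

lemma inversion_sign_square: "inversion_sign xs * inversion_sign xs = 1"
proof (induction xs)
  case (Cons x xs)
  have "(\<Prod>y\<leftarrow>xs. if x < y then 1 else - 1 :: int) * (\<Prod>y\<leftarrow>xs. if x < y then 1 else - 1) = 1"
    by (induction xs) auto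
  with Cons show ?case
    by (simp add: mult.assoc mult.left_commute)
qed simp

lemma alternating_Cons:
  assumes "alternating (insert v S) f" "v \<notin> S"
  shows "alternating S (\<lambda>xs. f (v # xs))"
  unfolding alternating_def
proof (intro allI impI)
  fix xs x y ys
  assume "distinct (xs @ x # y # ys)" "set (xs @ x # y # ys) = S"
  then show "f (v # xs @ y # x # ys) = - f (v # xs @ x # y # ys)"
    using alternating_swap[OF assms(1), of "v # xs" x y ys] assms(2) by auto
qed

lemma alternating_move_to_front:
  assumes "alternating S f"
  shows "distinct (xs @ v # ys) \<Longrightarrow> set (xs @ v # ys) = S \<Longrightarrow> f (v # xs @ ys) = (- 1) ^ length xs * f (xs @ v # ys)"
proof (induction xs arbitrary: ys rule: rev_induct)
  case (snoc x xs)
  have "f (v # xs @ x # ys) = (- 1) ^ length xs * f (xs @ v # x # ys)"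
    using snoc.prems by (intro snoc.IH) auto
  moreover have "f (xs @ v # x # ys) = - f (xs @ x # v # ys)"
    using snoc.prems by (intro alternating_swap[OF assms]) auto
  ultimately show ?case by simp
qed simp

text \<open>Two alternating functions on the orderings of one simplex are proportional, so the
  product with \<open>inversion_sign\<close> is constant. The induction moves the head of
  \<open>ys\<close> to the front in \<open>xs\<close>, at the cost of the same power of -1 in both
  factors.\<close>

lemma alternating_inversion_sign_invariant:
  assumes "alternating S f" "distinct xs" "distinct ys" "set xs = S" "set ys = S"
  shows "f xs * inversion_sign xs = f ys * inversion_sign ys"
  using assms
proof (induction ys arbitrary: S f xs)
  case (Cons v ys)
  then obtain as bs where xs: "xs = as @ v # bs"
    by (metis list.set_intros(1) split_list)
  have "f (v # as @ bs) = (- 1) ^ length as * f xs"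
    "inversion_sign (v # as @ bs) = (- 1) ^ length as * inversion_sign xs"
    using alternating_move_to_front[OF Cons.prems(1), of as v bs]
      alternating_move_to_front[OF alternating_inversion_sign[of S], of as v bs] Cons.prems xs by simp_all
  then have 1: "f xs * inversion_sign xs = f (v # as @ bs) * inversion_sign (v # as @ bs)"
    by (simp add: power_mult_distrib[symmetric] mult.assoc mult.left_commute flip: power_add power2_eq_square)
  define S' where "S' = set ys"
  have S': "insert v S' = S" "v \<notin> S'" "set (as @ bs) = S'" "distinct (as @ bs)"
    using Cons.prems xs by (auto simp: S'_def)
  have alt: "alternating S' (\<lambda>zs. f (v # zs))"
    by (rule alternating_Cons) (use Cons.prems(1) S' in simp_all)
  have "f (v # as @ bs) * inversion_sign (as @ bs) = f (v # ys) * inversion_sign ys"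
    by (rule Cons.IH[OF alt S'(4) _ S'(3)]) (use Cons.prems(3) in \<open>simp_all add: S'_def\<close>)
  moreover have "(\<Prod>y\<leftarrow>as @ bs. if v < y then 1 else - 1 :: int) = (\<Prod>y\<leftarrow>ys. if v < y then 1 else - 1)"
  proof -
    have "(\<Prod>y\<leftarrow>zs. if v < y then 1 else - 1 :: int) = (\<Prod>y\<in>set zs. if v < y then 1 else - 1)" if "distinct zs" for zs
      using that by (induction zs) auto
    then show ?thesis
      using S' Cons.prems(3) by (simp only: S'_def distinct.simps)
  qed
  ultimately have "f (v # as @ bs) * inversion_sign (v # as @ bs) = f (v # ys) * inversion_sign (v # ys)"
    by (simp add: mult.left_commute)
  with 1 show ?case by simp
qed simp

text \<open>Gives meaning to the definite description in \<open>orientation_sign\<close>: distinct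
  entries force the permutation.\<close>

lemma unique_permute_list:
  assumes "distinct \<sigma>" "distinct \<tau>" "set \<sigma> = set \<tau>"
  shows "\<exists>!\<pi>. \<pi> permutes {..<length \<sigma>} \<and> permute_list \<pi> \<sigma> = \<tau>"
proof -
  have "mset \<sigma> = mset \<tau>"
    using assms set_eq_iff_mset_eq_distinct by blast
  then obtain \<pi> where "\<pi> permutes {..<length \<sigma>}" "permute_list \<pi> \<sigma> = \<tau>"
    using mset_eq_permutation by metis
  moreover have "\<pi> = \<rho>" if "\<pi> permutes {..<length \<sigma>}" "permute_list \<pi> \<sigma> = \<tau>"
    "\<rho> permutes {..<length \<sigma>}" "permute_list \<rho> \<sigma> = \<tau>" for \<pi> \<rho>
  proof
    fix i
    show "\<pi> i = \<rho> i"
    proof (cases "i < length \<sigma>")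
      case True
      then have "\<sigma> ! \<pi> i = \<sigma> ! \<rho> i"
        using that by (metis permute_list_nth)
      moreover have "\<pi> i < length \<sigma>" "\<rho> i < length \<sigma>"
        using True that permutes_in_image by fastforce+
      ultimately show ?thesis
        using assms(1) nth_eq_iff_index_eq by blast
    next
      case False
      then show ?thesis
        using that permutes_not_in by (metis lessThan_iff)
    qed
  qed
  ultimately show ?thesis by metis
qed

text \<open>A swap at neighbouring positions composes the permutation with a transposition, which
  negates its sign.\<close>

lemma alternating_orientation_sign:
  assumes "distinct \<sigma>"
  shows "alternating (set \<sigma>) (orientation_sign \<sigma>)"
  unfolding alternating_def
proof (intro allI impI)
  fix xs ys :: "nat list" and x y
  let ?l = "xs @ x # y # ys" and ?l' = "xs @ y # x # ys"
  assume d: "distinct ?l" and s: "set ?l = set \<sigma>"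
  let ?P = "\<lambda>\<tau> \<pi>. \<pi> permutes {..<length \<sigma>} \<and> permute_list \<pi> \<sigma> = \<tau>"
  define \<pi> where "\<pi> = (THE \<pi>. ?P ?l \<pi>)"
  have \<pi>: "?P ?l \<pi>"
    unfolding \<pi>_def by (rule theI'[OF unique_permute_list]) (use assms d s in auto)
  have len: "length \<sigma> = length ?l"
    using distinct_card[OF d] distinct_card[OF assms] s by simp
  let ?t = "Transposition.transpose (length xs) (Suc (length xs))"
  have t: "?t permutes {..<length \<sigma>}"
    using len by (intro permutes_swap_id) auto
  have "permute_list ?t ?l = ?l'"
  proof (rule nth_equalityI)
    fix i assume "i < length (permute_list ?t ?l)"
    then have i: "i < length ?l" by simp
    have "permute_list ?t ?l ! i = ?l ! ?t i"
      using t i len by (intro permute_list_nth) auto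
    also have "\<dots> = ?l' ! i"
      by (auto simp: Transposition.transpose_def nth_append nth_Cons' numeral_2_eq_2)
    finally show "permute_list ?t ?l ! i = ?l' ! i" .
  qed simp
  then have "?P ?l' (\<pi> \<circ> ?t)"
    using \<pi> t permute_list_compose[of ?t \<sigma> \<pi>] permutes_compose[of ?t _ \<pi>] by auto
  moreover have "\<exists>!\<pi>. ?P ?l' \<pi>"
    by (rule unique_permute_list) (use assms d s in auto)
  ultimately have "(THE \<pi>. ?P ?l' \<pi>) = \<pi> \<circ> ?t"
    by (rule the1_equality[rotated])
  moreover have "sign (\<pi> \<circ> ?t) = - sign \<pi>"
  proof -
    have "permutation \<pi>" using \<pi> permutation_permutes by blast
    then show ?thesis
      by (subst sign_compose[OF _ permutation_swap_id]) (simp_all add: sign_swap_id)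
  qed
  ultimately show "orientation_sign \<sigma> ?l' = - orientation_sign \<sigma> ?l"
    using s by (auto simp: orientation_sign_def \<pi>_def)
qed

lemma orientation_sign_self: "distinct \<sigma> \<Longrightarrow> orientation_sign \<sigma> \<sigma> = 1"
proof -
  assume "distinct \<sigma>"
  then have "(THE \<pi>. \<pi> permutes {..<length \<sigma>} \<and> permute_list \<pi> \<sigma> = \<sigma>) = id"
    using unique_permute_list[of \<sigma> \<sigma>] permutes_id by (intro the1_equality) auto
  then show ?thesis by (simp add: orientation_sign_def)
qed

text \<open>Multiplied by \<open>inversion_sign\<close> of \<tau>, the sign no longer depends on the
  ordering, and at \<tau> = \<sigma> it is known. This form, free of the chosen permutation, is what
  the program evaluates.\<close>

lemma orientation_sign_eq:
  assumes "distinct \<sigma>" "distinct \<tau>"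
  shows "orientation_sign \<sigma> \<tau> = (if set \<sigma> = set \<tau> then inversion_sign \<sigma> * inversion_sign \<tau> else 0)"
proof (cases "set \<sigma> = set \<tau>")
  case True
  then have "orientation_sign \<sigma> \<tau> * inversion_sign \<tau> = inversion_sign \<sigma>"
    using alternating_inversion_sign_invariant[OF alternating_orientation_sign[OF assms(1)] assms(2,1)]
      orientation_sign_self[OF assms(1)] by simp
  then have "orientation_sign \<sigma> \<tau> * inversion_sign \<tau> * inversion_sign \<tau> = inversion_sign \<sigma> * inversion_sign \<tau>"
    by simp
  then show ?thesis
    using True inversion_sign_square[of \<tau>] by (simp add: mult.assoc)
qed (simp add: orientation_sign_def)

text \<open>With \<open>f\<close> the sign of the simplex in an orientation, the coefficient of the face \<open>\<sigma>\<close> in \<open>\<partial>\<tau>\<close>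
  becomes the sign of the cone \<open>v\<sigma>\<close>.\<close>

lemma alternating_boundary_coefficient:
  assumes "alternating (set \<tau>) f" "distinct \<tau>" "distinct \<sigma>" "k < length \<tau>" "set \<sigma> = set \<tau> - {\<tau> ! k}"
  shows "(- 1) ^ k * orientation_sign \<sigma> (take k \<tau> @ drop (Suc k) \<tau>) * f \<tau> = f (\<tau> ! k # \<sigma>)"
proof -
  let ?\<rho> = "take k \<tau> @ drop (Suc k) \<tau>" and ?v = "\<tau> ! k"
  have \<tau>: "\<tau> = take k \<tau> @ ?v # drop (Suc k) \<tau>"
    using assms(4) by (simp add: id_take_nth_drop)
  have "distinct (take k \<tau> @ ?v # drop (Suc k) \<tau>)" "set \<tau> = set (take k \<tau> @ ?v # drop (Suc k) \<tau>)"
    using assms(2) \<tau> by metis+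
  then have d: "distinct ?\<rho>" "set ?\<rho> = set \<tau> - {?v}"
    by auto
  have "f (?v # ?\<rho>) = (- 1) ^ k * f \<tau>"
    using alternating_move_to_front[OF assms(1), of "take k \<tau>" ?v "drop (Suc k) \<tau>"] assms(2,4)
    by (simp add: \<tau>[symmetric])
  moreover have "alternating (set \<tau> - {?v}) (\<lambda>xs. f (?v # xs))"
    using assms(1,4) by (intro alternating_Cons) (auto simp: insert_absorb)
  from alternating_inversion_sign_invariant[OF this d(1) assms(3) d(2) assms(5)]
  have "f (?v # ?\<rho>) * inversion_sign ?\<rho> = f (?v # \<sigma>) * inversion_sign \<sigma>" .
  then have "f (?v # ?\<rho>) * inversion_sign ?\<rho> * inversion_sign \<sigma> = f (?v # \<sigma>)"
    using inversion_sign_square[of \<sigma>] by (simp add: mult.assoc)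
  ultimately show ?thesis
    using orientation_sign_eq[OF assms(3) d(1)] d(2) assms(5) by (simp add: ac_simps)
qed

section \<open>Local homology of Euclidean space\<close>

lemma Euclidean_space_top_of_set: "Euclidean_space n = top_of_set {x. \<forall>i\<ge>n. x i = 0}"
  by (simp add: Euclidean_space_def euclidean_product_topology)

lemma continuous_map_top_of_setI:
  "continuous_on S f \<Longrightarrow> (\<And>x. x \<in> S \<Longrightarrow> f x \<in> T) \<Longrightarrow> continuous_map (top_of_set S) (top_of_set T) f"
  by (simp add: Pi_iff)

lemma continuous_on_coordinate:
  fixes f :: "'a::topological_space \<Rightarrow> nat \<Rightarrow> real"
  assumes "continuous_on S f"
  shows "continuous_on S (\<lambda>x. f x i)"
  using continuous_on_product_then_coordinatewise[OF assms] .

lemma continuous_on_eval [continuous_intros]: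
  "continuous_on X (\<lambda>x::nat \<Rightarrow> real. x i)"
  "continuous_on Z (\<lambda>z::'a::topological_space \<times> (nat \<Rightarrow> real). snd z i)"
  by (intro continuous_on_coordinate continuous_intros)+

lemma homotopic_with_top_of_set:
  fixes h :: "real \<Rightarrow> (nat \<Rightarrow> real) \<Rightarrow> (nat \<Rightarrow> real)"
  assumes "\<And>i. continuous_on ({0..1} \<times> S) (\<lambda>z. h (fst z) (snd z) i)"
    and "\<And>t x. 0 \<le> t \<Longrightarrow> t \<le> 1 \<Longrightarrow> x \<in> S \<Longrightarrow> h t x \<in> T"
    and "\<And>t. 0 \<le> t \<Longrightarrow> t \<le> 1 \<Longrightarrow> P (h t)"
    and "\<And>x. h 0 x = f x" "\<And>x. h 1 x = g x"
  shows "homotopic_with P (top_of_set S) (top_of_set T) f g"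
proof -
  have "continuous_on ({0..1} \<times> S) (\<lambda>z. h (fst z) (snd z))"
    using assms(1) by (rule continuous_on_coordinatewise_then_product)
  then have "continuous_map (prod_topology (top_of_set {0..1}) (top_of_set S)) (top_of_set T) (\<lambda>z. h (fst z) (snd z))"
    using assms(2) by (auto simp flip: subtopology_Times)
  then show ?thesis
    unfolding homotopic_with_def using assms(3-5) by (intro exI[of _ "\<lambda>z. h (fst z) (snd z)"]) auto
qed

section \<open>The local group of the origin and its reflection\<close>

abbreviation origin :: "nat \<Rightarrow> real" where "origin \<equiv> \<lambda>_. 0"

abbreviation punctured :: "nat \<Rightarrow> (nat \<Rightarrow> real) set" where
  "punctured n \<equiv> topspace (Euclidean_space n) - {origin}"

abbreviation local_group :: "nat \<Rightarrow> (nat \<Rightarrow> real) chain set monoid" where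
  "local_group n \<equiv> relative_homology_group (int n) (Euclidean_space n) (punctured n)"

definition reflect0 :: "(nat \<Rightarrow> real) \<Rightarrow> nat \<Rightarrow> real" where
  "reflect0 = (\<lambda>x i. if i = 0 then - x i else x i)"

lemma iso_imp_inj_on: "f \<in> iso G H \<Longrightarrow> inj_on f (carrier G)"
  by (simp add: iso_def bij_betw_def)

text \<open>The boundary map of the pair followed by radial projection. Euclidean space is
  contractible and the projection is a homotopy equivalence, so both are isomorphisms; both commute
  with the reflection, which transports its known degree from the sphere.\<close>

lemma iso_local_group_nsphere:
  "\<exists>J \<in> iso (local_group (Suc p)) (reduced_homology_group (int p) (nsphere p)).
     \<forall>c\<in>carrier (local_group (Suc p)).
       J (hom_induced (Suc p) (Euclidean_space (Suc p)) (punctured (Suc p)) (Euclidean_space (Suc p)) (punctured (Suc p)) reflect0 c)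
       = hom_induced (int p) (nsphere p) {} (nsphere p) {} reflect0 (J c)"
proof -
  define E where "E = Euclidean_space (Suc p)"
  define S where "S = punctured (Suc p)"
  define g :: "(nat \<Rightarrow> real) \<Rightarrow> nat \<Rightarrow> real" where "g = (\<lambda>x i. x i / sqrt (\<Sum>j\<le>p. (x j)\<^sup>2))"
  define Sph where "Sph = {x::nat \<Rightarrow> real. (\<Sum>i\<le>p. x i ^ 2) = 1 \<and> (\<forall>i>p. x i = 0)}"
  have nsph: "nsphere p = top_of_set Sph"
    by (simp add: nsphere Sph_def euclidean_product_topology)
  have S: "S = {x. (\<forall>i>p. x i = 0) \<and> x \<noteq> origin}"
    by (auto simp: S_def topspace_Euclidean_space Suc_le_eq)
  have Ssub: "S \<subseteq> topspace E"
    by (auto simp: S_def E_def)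
  have ES: "subtopology E S = top_of_set S"
    unfolding E_def Euclidean_space_top_of_set by (simp add: subtopology_subtopology S inf_absorb2 Suc_le_eq subset_iff Collect_mono)
  have pos: "0 < (\<Sum>j\<le>p. (x j)\<^sup>2)" if "x \<in> S" for x
  proof -
    have "\<exists>i\<le>p. x i \<noteq> 0"
      using that by (force simp: S fun_eq_iff not_le[symmetric])
    then obtain i where "x i \<noteq> 0" "i \<le> p" by blast
    then show ?thesis by (intro sum_pos2[of _ i]) auto
  qed
  have refl_sq: "(reflect0 x j)\<^sup>2 = (x j)\<^sup>2" for x j
    by (simp add: reflect0_def)
  have gS: "g x \<in> Sph" if "x \<in> S" for x
    using pos[OF that] that by (auto simp: g_def Sph_def power_divide S simp flip: sum_divide_distrib)
  have SphS: "Sph \<subseteq> S"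
  proof
    fix x assume x: "x \<in> Sph"
    have "x \<noteq> origin"
    proof
      assume "x = origin"
      with x show False by (simp add: Sph_def)
    qed
    then show "x \<in> S" using x by (simp add: S Sph_def)
  qed
  have contg: "continuous_on S g"
    unfolding g_def
  proof (rule continuous_on_coordinatewise_then_product)
    fix i
    have "sqrt (\<Sum>j\<le>p. (x j)\<^sup>2) \<noteq> 0" if "x \<in> S" for x
      using pos[OF that] by simp
    then show "continuous_on S (\<lambda>x. x i / sqrt (\<Sum>j\<le>p. (x j)\<^sup>2))"
      by (intro continuous_intros) auto
  qed
  have contr: "continuous_on X reflect0" for X
    unfolding reflect0_def
  proof (rule continuous_on_coordinatewise_then_product)
    show "continuous_on X (\<lambda>x. if i = 0 then - x i else x i)" for i :: nat
      by (cases "i = 0") (auto intro!: continuous_intros)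
  qed
  have rS: "reflect0 \<in> S \<rightarrow> S" and rSph: "reflect0 \<in> Sph \<rightarrow> Sph"
    by (auto simp: S Sph_def refl_sq) (auto simp: reflect0_def fun_eq_iff split: if_splits)
  have rE: "continuous_map E E reflect0"
    unfolding E_def Euclidean_space_top_of_set using contr by (auto simp: reflect0_def)
  have cg: "continuous_map (top_of_set S) (top_of_set Sph) g"
    using contg gS by auto
  have crS: "continuous_map (top_of_set S) (top_of_set S) reflect0"
    using contr rS by auto
  have crSph: "continuous_map (top_of_set Sph) (top_of_set Sph) reflect0"
    using contr rSph by auto
  have gr: "g \<circ> reflect0 = reflect0 \<circ> g"
    by (auto simp: g_def refl_sq fun_eq_iff) (auto simp: reflect0_def)
    have cid: "continuous_map (top_of_set Sph) (top_of_set S) id"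
      by (rule continuous_map_top_of_setI[OF continuous_on_id']) (metis SphS id_apply subsetD)
    have h1: "homotopic_with (\<lambda>h. True) (top_of_set S) (top_of_set S) (id \<circ> g) id"
    proof (rule homotopic_with_top_of_set[where h="\<lambda>t x i. (1 - t) * g x i + t * x i"])
      fix i
      have "continuous_on ({0..1} \<times> S) (\<lambda>z. g (snd z))"
        by (rule continuous_on_compose2[OF contg]) (auto intro!: continuous_intros)
      from continuous_on_coordinate[OF this]
      show "continuous_on ({0..1} \<times> S) (\<lambda>z. (1 - fst z) * g (snd z) i + fst z * snd z i)"
        by (intro continuous_intros)
      fix t x assume t: "0 \<le> (t::real)" "t \<le> 1" "x \<in> S"
      let ?s = "sqrt (\<Sum>j\<le>p. (x j)\<^sup>2)"
      \<comment> \<open>The straight homotopy rescales x by this positive factor, so it never meets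
        the origin.\<close>
      have "0 < (1 - t) / ?s + t"
        using t pos[of x] by (cases "t = 0") (auto intro: add_nonneg_pos)
      moreover have "(1 - t) * g x i + t * x i = ((1 - t) / ?s + t) * x i" for i
        by (simp add: g_def algebra_simps)
      ultimately show "(\<lambda>i. (1 - t) * g x i + t * x i) \<in> S"
        using t(3) by (auto simp: S fun_eq_iff)
    qed auto
    have "g x = x" if "x \<in> Sph" for x
      using that by (auto simp: g_def Sph_def)
    moreover have "continuous_map (top_of_set Sph) (top_of_set Sph) g"
      by (rule continuous_map_top_of_setI[OF continuous_on_subset[OF contg SphS]]) (metis SphS gS subsetD)
    ultimately have h2: "homotopic_with (\<lambda>k. True) (top_of_set Sph) (top_of_set Sph) (g \<circ> id) id"
      by (intro homotopic_with_equal) simp_all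
  have G: "hom_induced (int p) (top_of_set S) {} (nsphere p) {} g
      \<in> iso (reduced_homology_group (int p) (top_of_set S)) (reduced_homology_group (int p) (nsphere p))"
    unfolding nsph by (rule homotopy_equivalence_reduced_homology_group_isomorphism[OF cg cid h1 h2])
  have ne: "topspace E \<inter> S \<noteq> {}"
  proof -
    have "(\<lambda>i. if i = 0 then 1 else 0) \<in> S" by (auto simp: S fun_eq_iff)
    then show ?thesis using Ssub by blast
  qed
  have D: "hom_boundary (int (Suc p)) E S \<in> iso (relative_homology_group (int (Suc p)) E S) (reduced_homology_group (int p) (top_of_set S))"
    using iso_relative_homology_of_contractible[of E S "int (Suc p)"] ne by (simp add: ES[unfolded E_def] E_def)
  let ?J = "hom_induced (int p) (top_of_set S) {} (nsphere p) {} g \<circ> hom_boundary (int (Suc p)) E S"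
  have "?J \<in> iso (relative_homology_group (int (Suc p)) E S) (reduced_homology_group (int p) (nsphere p))"
    using iso_set_trans[OF D G] .
  moreover have "?J (hom_induced (Suc p) E S E S reflect0 c) = hom_induced (int p) (nsphere p) {} (nsphere p) {} reflect0 (?J c)" for c
  proof -
    have 1: "hom_boundary (int (Suc p)) E S (hom_induced (Suc p) E S E S reflect0 c)
        = hom_induced (int p) (top_of_set S) {} (top_of_set S) {} reflect0 (hom_boundary (int (Suc p)) E S c)"
      using fun_cong[OF naturality_hom_induced[OF rE rS, of "int (Suc p)"], of c] by (simp add: ES)
    have 2: "hom_induced (int p) (top_of_set S) {} (nsphere p) {} g (hom_induced (int p) (top_of_set S) {} (top_of_set S) {} reflect0 d)
       = hom_induced (int p) (nsphere p) {} (nsphere p) {} reflect0 (hom_induced (int p) (top_of_set S) {} (nsphere p) {} g d)" for d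
      unfolding nsph using hom_induced_compose'[OF crS _ cg, of "{}" "{}" "{}" "int p" d] hom_induced_compose'[OF cg _ crSph, of "{}" "{}" "{}" "int p" d]
      by (simp add: gr)
    show ?thesis
      by (simp only: o_apply 1 2)
  qed
  ultimately show ?thesis
    unfolding E_def S_def by blast
qed

lemma local_group_reflect0:
  assumes "n \<ge> 1" "c \<in> carrier (local_group n)"
  shows "hom_induced n (Euclidean_space n) (punctured n) (Euclidean_space n) (punctured n) reflect0 c = inv\<^bsub>local_group n\<^esub> c"
proof -
  obtain p where n: "n = Suc p" using assms(1) by (cases n) auto
  let ?G = "local_group n" and ?H = "reduced_homology_group (int p) (nsphere p)"
  obtain J where J: "J \<in> iso ?G ?H"
    "J (hom_induced n (Euclidean_space n) (punctured n) (Euclidean_space n) (punctured n) reflect0 c)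
       = hom_induced (int p) (nsphere p) {} (nsphere p) {} reflect0 (J c)"
    using iso_local_group_nsphere[of p] assms(2) n by auto
  interpret J: group_hom ?G ?H J
    using J(1) by (simp add: group_hom_def group_hom_axioms_def iso_imp_homomorphism)
  have "hom_induced (int p) (nsphere p) {} (nsphere p) {} reflect0 (J c) = J c [^]\<^bsub>?H\<^esub> (- 1 :: int)"
    using Brouwer_degree2[OF J.hom_closed[OF assms(2)], of reflect0] Brouwer_degree2_reflection[of p]
    by (simp add: reflect0_def)
  also have "\<dots> = J (inv\<^bsub>?G\<^esub> c)"
    using assms(2) by (simp add: J.H.int_pow_neg)
  finally show ?thesis
    using J assms(2) inj_onD[OF iso_imp_inj_on[OF J(1)] _ hom_induced_carrier J.G.inv_closed] by simp
qed

text \<open>Transported from the infinite cyclic reduced homology of the sphere. Orientations are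
  later read off as exponents of this generator.\<close>

lemma local_group_generator:
  assumes "n \<ge> 1"
  obtains g where "g \<in> carrier (local_group n)"
    "\<And>c. c \<in> carrier (local_group n) \<Longrightarrow> \<exists>k::int. c = g [^]\<^bsub>local_group n\<^esub> k"
    "\<And>k::int. g [^]\<^bsub>local_group n\<^esub> k = \<one>\<^bsub>local_group n\<^esub> \<Longrightarrow> k = 0"
proof -
  obtain p where n: "n = Suc p" using assms(1) by (cases n) auto
  let ?G = "local_group n" and ?H = "reduced_homology_group (int p) (nsphere p)"
  obtain J where "J \<in> iso ?G ?H"
    using iso_local_group_nsphere[of p] n by auto
  then have "?G \<cong> integer_group"
    using reduced_homology_group_nsphere(1)[of p] is_isoI iso_trans by blast
  then obtain f where f: "f \<in> iso integer_group ?G"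
    using group.iso_sym[of ?G integer_group] by (auto simp: is_iso_def)
  interpret f: group_hom integer_group ?G f
    using f by (simp add: group_hom_def group_hom_axioms_def iso_imp_homomorphism)
  have fk: "f k = f 1 [^]\<^bsub>?G\<^esub> k" for k :: int
  proof -
    have "f (1 [^]\<^bsub>integer_group\<^esub> k) = f 1 [^]\<^bsub>?G\<^esub> k"
      by (intro f.hom_int_pow) auto
    then show ?thesis by (simp add: group_int_pow_integer_group)
  qed
  show ?thesis
  proof
    show "f 1 \<in> carrier ?G" by (rule f.hom_closed) simp
    show "\<exists>k::int. c = f 1 [^]\<^bsub>?G\<^esub> k" if "c \<in> carrier ?G" for c
    proof -
      have "c \<in> f ` carrier integer_group"
        using f that by (simp add: iso_def bij_betw_def)
      then obtain k where "c = f k" ..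
      then show ?thesis using trans[OF _ fk[of k]] by (intro exI)
    qed
    show "k = 0" if "f 1 [^]\<^bsub>?G\<^esub> k = \<one>\<^bsub>?G\<^esub>" for k :: int
    proof -
      have "f k = f 0" using f.hom_one unfolding fk[of k] that by simp
      then show ?thesis using inj_onD[OF iso_imp_inj_on[OF f]] by simp
    qed
  qed
qed

text \<open>A homeomorphism onto the open image, followed by excision of the complement of the
  image. Excision applies because that complement is closed and lies in the complement of the image
  of \<open>D\<close>, which is open.\<close>

lemma excision_embedding:
  assumes emb: "embedding_map Y M f" and op: "openin M (f ` topspace Y)"
    and D: "D \<subseteq> topspace Y" "closedin M (f ` D)"
  shows "hom_induced p Y (topspace Y - D) M (topspace M - f ` D) f
    \<in> iso (relative_homology_group p Y (topspace Y - D)) (relative_homology_group p M (topspace M - f ` D))"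
proof -
  define Q where "Q = f ` topspace Y"
  have Qsub: "Q \<subseteq> topspace M"
    using op openin_subset by (auto simp: Q_def)
  have hm: "homeomorphic_map Y (subtopology M Q) f"
    using emb by (simp add: embedding_map_def Q_def)
  then obtain g where g: "homeomorphic_maps Y (subtopology M Q) f g"
    using homeomorphic_map_maps by blast
  then have cf: "continuous_map Y (subtopology M Q) f" and cg: "continuous_map (subtopology M Q) Y g"
    and gf: "\<And>y. y \<in> topspace Y \<Longrightarrow> g (f y) = y" and fg: "\<And>x. x \<in> Q \<Longrightarrow> f (g x) = x"
    using Qsub by (auto simp: homeomorphic_maps_def)
  have inj: "inj_on f (topspace Y)"
    using gf by (metis inj_onI)
  have im: "f \<in> (topspace Y - D) \<rightarrow> Q - f ` D"
    using inj D(1) by (auto simp: Q_def inj_on_def)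
  have img: "g \<in> Q - f ` D \<rightarrow> topspace Y - D"
    using gf by (auto simp: Q_def)
  have 1: "hom_induced p Y (topspace Y - D) (subtopology M Q) (Q - f ` D) f
    \<in> iso (relative_homology_group p Y (topspace Y - D)) (relative_homology_group p (subtopology M Q) (Q - f ` D))"
  proof (rule homotopy_equivalence_relative_homology_group_isomorphism[OF cf im cg img])
    show "homotopic_with (\<lambda>h. h \<in> (topspace Y - D) \<rightarrow> (topspace Y - D)) Y Y (g \<circ> f) id"
      by (rule homotopic_with_equal) (use gf cf cg in \<open>auto intro: continuous_map_compose\<close>)
    have "topspace (subtopology M Q) = Q" using Qsub by auto
    then show "homotopic_with (\<lambda>h. h \<in> (Q - f ` D) \<rightarrow> (Q - f ` D)) (subtopology M Q) (subtopology M Q) (f \<circ> g) id"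
      by (intro homotopic_with_equal) (use fg cf cg in \<open>auto intro: continuous_map_compose\<close>)
  qed
  let ?U = "topspace M - Q" and ?T = "topspace M - f ` D"
  have TU: "topspace M - ?U = Q" "?T - ?U = Q - f ` D" "?T \<subseteq> topspace M" "?U \<subseteq> ?T"
    using Qsub D(1) by (auto simp: Q_def)
  have "(M closure_of ?U) \<subseteq> (M interior_of ?T)"
  proof -
    have "closedin M ?U" using op unfolding Q_def by (intro closedin_diff closedin_topspace)
    moreover have "openin M ?T" using D(2) by (intro openin_diff openin_topspace)
    ultimately show ?thesis using TU(4) by (metis closure_of_closedin interior_of_openin)
  qed
  from homology_excision_axiom[OF this TU(3), of p]
  have 2: "hom_induced p (subtopology M Q) (Q - f ` D) M ?T id
      \<in> iso (relative_homology_group p (subtopology M Q) (Q - f ` D)) (relative_homology_group p M ?T)"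
    by (simp only: TU(1,2) subtopology_topspace)
  have "hom_induced p Y (topspace Y - D) M ?T (id \<circ> f)
      = hom_induced p (subtopology M Q) (Q - f ` D) M ?T id \<circ> hom_induced p Y (topspace Y - D) (subtopology M Q) (Q - f ` D) f"
    by (rule hom_induced_compose[OF cf im]) (use Qsub in auto)
  then show ?thesis
    using iso_set_trans[OF 1 2] by simp
qed

section \<open>Translations and the local groups at other points\<close>

definition shift :: "(nat \<Rightarrow> real) \<Rightarrow> (nat \<Rightarrow> real) \<Rightarrow> nat \<Rightarrow> real" where
  "shift z x = (\<lambda>i. x i - z i)"

lemma continuous_map_shift:
  assumes "z \<in> topspace (Euclidean_space n)"
  shows "continuous_map (Euclidean_space n) (Euclidean_space n) (shift z)"
  unfolding Euclidean_space_top_of_set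
proof (rule continuous_map_top_of_setI)
  show "continuous_on {x. \<forall>i\<ge>n. x i = 0} (shift z)"
    unfolding shift_def by (intro continuous_on_coordinatewise_then_product continuous_intros)
qed (use assms in \<open>simp add: shift_def topspace_Euclidean_space\<close>)

lemma homeomorphic_map_shift:
  assumes "z \<in> topspace (Euclidean_space n)"
  shows "homeomorphic_map (Euclidean_space n) (Euclidean_space n) (shift z)"
proof -
  have "homeomorphic_maps (Euclidean_space n) (Euclidean_space n) (shift z) (shift (\<lambda>i. - z i))"
    unfolding homeomorphic_maps_def using assms
    by (intro conjI continuous_map_shift) (auto simp: topspace_Euclidean_space shift_def)
  then show ?thesis using homeomorphic_maps_map by blast
qed

text \<open>Translations identify the local groups at all points with the one at the origin. This is
  the standard orientation of Euclidean space, against which charts are compared.\<close>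

lemma iso_shift:
  assumes V: "openin (Euclidean_space n) V" and z: "z \<in> V"
  shows "hom_induced p (subtopology (Euclidean_space n) V) (V - {z}) (Euclidean_space n) (punctured n) (shift z)
    \<in> iso (relative_homology_group p (subtopology (Euclidean_space n) V) (V - {z}))
          (relative_homology_group p (Euclidean_space n) (punctured n))"
proof -
  let ?E = "Euclidean_space n"
  have zE: "z \<in> topspace ?E" and VE: "V \<subseteq> topspace ?E"
    using V z openin_subset by auto
  have hom: "homeomorphic_map ?E ?E (shift z)"
    by (rule homeomorphic_map_shift[OF zE])
  have top: "topspace (subtopology ?E V) = V" using VE by auto
  have "shift z ` (topspace ?E \<inter> V) = topspace ?E \<inter> shift z ` V"
    using continuous_map_shift[OF zE] VE by (auto simp: continuous_map_def)
  from homeomorphic_map_subtopologies[OF hom this]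
  have "embedding_map (subtopology ?E V) ?E (shift z)"
    by (simp add: embedding_map_def inf_absorb2[OF VE])
  moreover have "openin ?E (shift z ` topspace (subtopology ?E V))"
    unfolding top using hom V by (meson homeomorphic_imp_open_map open_map_def)
  moreover have im: "shift z ` {z} = {origin}" by (simp add: shift_def)
  moreover have "closedin ?E {origin}"
    using Hausdorff_Euclidean_space[of n] by (simp add: closedin_Hausdorff_singleton topspace_Euclidean_space)
  ultimately show ?thesis
    using excision_embedding[of "subtopology ?E V" ?E "shift z" "{z}" p] z zE top by simp
qed

text \<open>The generator is a parameter because signs are exponents relative to it.\<close>

locale infinite_cyclic_group = group G for G (structure) +
  fixes g
  assumes g: "g \<in> carrier G" and gen: "\<And>c. c \<in> carrier G \<Longrightarrow> \<exists>k::int. c = g [^] k"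
    and free: "\<And>k::int. g [^] k = \<one> \<Longrightarrow> k = 0"
begin

lemma iso_image_power:
  assumes f: "f \<in> iso G H" "group H" and "c \<in> carrier H"
  shows "\<exists>!k::int. c = f g [^]\<^bsub>H\<^esub> k"
proof -
  interpret H: group H by fact
  interpret f: group_hom G H f
    using f by (simp add: group_hom_def group_hom_axioms_def iso_imp_homomorphism)
  have "c \<in> f ` carrier G" using f(1) assms(3) by (simp add: iso_def bij_betw_def)
  then obtain d where d: "d \<in> carrier G" "c = f d" by blast
  with gen obtain k :: int where "d = g [^] k" by blast
  with d have k: "c = f g [^]\<^bsub>H\<^esub> k" using f.hom_int_pow[OF g] by simp
  have "l = k" if "c = f g [^]\<^bsub>H\<^esub> l" for l :: int
  proof -
    have "f (g [^] l) = f (g [^] k)" using f.hom_int_pow[OF g] k that by simp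
    then have "g [^] l = g [^] k"
      by (rule inj_onD[OF iso_imp_inj_on[OF f(1)]]) (use g in auto)
    then have "g [^] (l - k) = \<one>" using g by (simp add: int_pow_diff)
    then show ?thesis using free by force
  qed
  with k show ?thesis by blast
qed

text \<open>Both \<open>f g\<close> and \<open>c\<close> generate, so each is a power of the other
  and the exponents multiply to 1.\<close>

lemma iso_image_generator:
  assumes f: "f \<in> iso G H" "group H" and c: "c \<in> carrier H" "subgroup_generated H {c} = H"
    and k: "c = f g [^]\<^bsub>H\<^esub> (k::int)"
  shows "k = 1 \<or> k = -1"
proof -
  interpret H: group H by fact
  have fg: "f g \<in> carrier H" using f(1) g by (auto simp: iso_def hom_def)
  have "f g \<in> carrier (subgroup_generated H {c})" using c fg by simp
  then obtain j :: int where j: "f g = c [^]\<^bsub>H\<^esub> j"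
    using H.carrier_subgroup_generated_by_singleton[OF c(1)] by auto
  have "f g [^]\<^bsub>H\<^esub> (1::int) = f g [^]\<^bsub>H\<^esub> (k * j)"
    using j k fg by (metis H.int_pow_1 H.int_pow_pow)
  moreover have "\<exists>!l::int. f g = f g [^]\<^bsub>H\<^esub> l"
    by (rule iso_image_power[OF f fg])
  ultimately have "k * j = 1"
    using fg H.int_pow_1 by metis
  then show ?thesis by (metis pos_zmult_eq_1_iff_lemma zmult_eq_1_iff)
qed

end

text \<open>Closed boxes serve as small neighbourhoods: they are convex and, by the next lemma,
  compact, and both properties enter the comparison of local orientations at nearby points.\<close>

lemma openin_Euclidean_space_box:
  assumes W: "openin (Euclidean_space n) W" and z: "z \<in> W"
  obtains d where "0 < d" "{x\<in>topspace (Euclidean_space n). \<forall>i<n. \<bar>x i - z i\<bar> \<le> d} \<subseteq> W"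
proof -
  have zE: "\<forall>i\<ge>n. z i = 0" using W z openin_subset by (fastforce simp: topspace_Euclidean_space)
  obtain O' where O': "openin (powertop_real UNIV) O'" "W = O' \<inter> {x. \<forall>i\<ge>n. x i = 0}"
    using W by (auto simp: Euclidean_space_def openin_subtopology)
  have "z \<in> O'" using O'(2) z by blast
  then obtain X where "z \<in> PiE UNIV X" "\<And>i. openin euclideanreal (X i)" "PiE UNIV X \<subseteq> O'"
    using product_topology_open_contains_basis[OF O'(1), of z] by auto
  then have X: "z \<in> PiE UNIV X" "\<And>i. open (X i)" "PiE UNIV X \<subseteq> O'"
    by (simp_all only: open_openin)
  have "\<exists>e>0. \<forall>y. \<bar>y - z i\<bar> \<le> e \<longrightarrow> y \<in> X i" for i
  proof -
    obtain e where "e > 0" "cball (z i) e \<subseteq> X i"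
      using X(1,2) open_contains_cball by (metis PiE_mem UNIV_I)
    then show ?thesis by (auto simp: dist_real_def abs_minus_commute subset_iff)
  qed
  then obtain e where e: "\<And>i. e i > 0" "\<And>i y. \<bar>y - z i\<bar> \<le> e i \<Longrightarrow> y \<in> X i" by metis
  define d where "d = Min (insert 1 (e ` {..<n}))"
  have "0 < d" using e by (auto simp: d_def)
  moreover have "x \<in> W" if x: "x \<in> topspace (Euclidean_space n)" "\<forall>i<n. \<bar>x i - z i\<bar> \<le> d" for x
  proof -
    have "x i \<in> X i" for i
    proof (cases "i < n")
      case True
      then have "d \<le> e i" by (auto simp: d_def)
      then show ?thesis using x(2) True e(2) by fastforce
    next
      case False
      then have "x i = z i" using x(1) zE by (auto simp: topspace_Euclidean_space)
      then show ?thesis using X(1) by auto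
    qed
    then show ?thesis using O' X(3) x(1) by (auto simp: topspace_Euclidean_space)
  qed
  ultimately show ?thesis using that by blast
qed

lemma compactin_Euclidean_space_box:
  assumes "z \<in> topspace (Euclidean_space n)"
  shows "compactin (Euclidean_space n) {x\<in>topspace (Euclidean_space n). \<forall>i<n. \<bar>x i - z i\<bar> \<le> d}"
proof -
  have eq: "{x\<in>topspace (Euclidean_space n). \<forall>i<n. \<bar>x i - z i\<bar> \<le> d}
      = PiE UNIV (\<lambda>i. if i < n then {z i - d..z i + d} else {0})"
    by (auto simp: topspace_Euclidean_space PiE_iff abs_diff_le_iff not_less split: if_splits)
      (metis linorder_not_le)+
  have "compactin (powertop_real UNIV) (PiE UNIV (\<lambda>i. if i < n then {z i - d..z i + d} else {0}))"
    by (auto simp: compactin_PiE)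
  then show ?thesis
    unfolding eq[symmetric] by (auto simp: Euclidean_space_def compactin_subtopology)
qed

section \<open>Oriented manifolds\<close>

lemma local_group_infinite_cyclic:
  assumes "n \<ge> 1"
  obtains g where "infinite_cyclic_group (local_group n) g"
  using local_group_generator[OF assms]
  by (metis group_relative_homology_group infinite_cyclic_group.intro infinite_cyclic_group_axioms.intro)

section \<open>Maps of Euclidean space with degree -1 at the origin\<close>

definition inverts_local_group :: "nat \<Rightarrow> ((nat \<Rightarrow> real) \<Rightarrow> nat \<Rightarrow> real) \<Rightarrow> bool" where
  "inverts_local_group n h \<longleftrightarrow>
     continuous_map (Euclidean_space n) (Euclidean_space n) h \<and> h \<in> punctured n \<rightarrow> punctured n \<and>
     (\<forall>c\<in>carrier (local_group n).
        hom_induced n (Euclidean_space n) (punctured n) (Euclidean_space n) (punctured n) h c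
          = inv\<^bsub>local_group n\<^esub> c)"

lemma inverts_local_group_reflect0:
  assumes "n \<ge> 1"
  shows "inverts_local_group n reflect0"
  unfolding inverts_local_group_def
proof (intro conjI ballI)
  show "continuous_map (Euclidean_space n) (Euclidean_space n) reflect0"
    unfolding Euclidean_space_top_of_set
  proof (rule continuous_map_top_of_setI)
    show "continuous_on {x. \<forall>i\<ge>n. x i = 0} reflect0"
      unfolding reflect0_def
    proof (rule continuous_on_coordinatewise_then_product)
      show "continuous_on {x::nat \<Rightarrow> real. \<forall>i\<ge>n. x i = 0} (\<lambda>x. if i = 0 then - x i else x i)" for i :: nat
        by (cases "i = 0") (auto intro!: continuous_intros)
    qed
  qed (auto simp: reflect0_def)
  show "reflect0 \<in> punctured n \<rightarrow> punctured n"
  proof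
    fix x assume x: "x \<in> punctured n"
    have "reflect0 x \<noteq> origin"
    proof
      assume r: "reflect0 x = origin"
      have "x i = 0" for i
        using fun_cong[OF r, of i] by (auto simp: reflect0_def split: if_splits)
      then show False using x by auto
    qed
    then show "reflect0 x \<in> punctured n"
      using x by (auto simp: reflect0_def topspace_Euclidean_space)
  qed
qed (rule local_group_reflect0[OF assms])

lemma inverts_local_group_homotopic:
  assumes "inverts_local_group n f"
    and hom: "homotopic_with (\<lambda>h. h \<in> punctured n \<rightarrow> punctured n) (Euclidean_space n) (Euclidean_space n) f g"
  shows "inverts_local_group n g"
  using assms homotopic_with_imp_continuous_maps[OF hom] homotopic_with_imp_property[OF hom]
    homology_homotopy_axiom[OF hom]
  unfolding inverts_local_group_def by metis

text \<open>A path of maps that vanish only at the origin is a homotopy of pairs, so both ends act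
  alike on the local group. It takes the place of a determinant: the paths used below consist of
  invertible linear maps.\<close>

lemma inverts_local_group_path:
  fixes h :: "real \<Rightarrow> (nat \<Rightarrow> real) \<Rightarrow> (nat \<Rightarrow> real)"
  assumes f: "inverts_local_group n f"
    and cont: "\<And>i. continuous_on UNIV (\<lambda>z. h (fst z) (snd z) i)"
    and zero: "\<And>t x i. n \<le> i \<Longrightarrow> (\<forall>i\<ge>n. x i = 0) \<Longrightarrow> h t x i = 0"
    and inj: "\<And>t x. 0 \<le> t \<Longrightarrow> t \<le> 1 \<Longrightarrow> (\<forall>i\<ge>n. x i = 0) \<Longrightarrow> h t x = origin \<Longrightarrow> x = origin"
    and ends: "\<And>x. h 0 x = f x" "\<And>x. h 1 x = g x"
  shows "inverts_local_group n g"
proof (rule inverts_local_group_homotopic[OF f])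
  show "homotopic_with (\<lambda>h. h \<in> punctured n \<rightarrow> punctured n) (Euclidean_space n) (Euclidean_space n) f g"
    unfolding Euclidean_space_top_of_set
  proof (rule homotopic_with_top_of_set[where h=h])
    show "continuous_on ({0..1} \<times> {x. \<forall>i\<ge>n. x i = 0}) (\<lambda>z. h (fst z) (snd z) i)" for i
      using cont continuous_on_subset by blast
    show "h t \<in> topspace (top_of_set {x. \<forall>i\<ge>n. x i = 0}) - {origin} \<rightarrow> topspace (top_of_set {x. \<forall>i\<ge>n. x i = 0}) - {origin}"
      if "0 \<le> t" "t \<le> 1" for t
      using zero inj[OF that] by (auto simp: Pi_iff)
  qed (use zero ends in auto)
qed

text \<open>In the plane of the coordinates a and b this is the symmetric matrix with rows (1 - t,
  t) and (t, t - 1): at t = 0 it negates coordinate b, at t = 1 it exchanges the two. Its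
  determinant -((1 - t)^2 + t^2) never vanishes.\<close>

definition swap_path :: "nat \<Rightarrow> nat \<Rightarrow> real \<Rightarrow> (nat \<Rightarrow> real) \<Rightarrow> nat \<Rightarrow> real" where
  "swap_path a b t x = (\<lambda>i. if i = a then (1 - t) * x a + t * x b
                            else if i = b then t * x a - (1 - t) * x b else x i)"

text \<open>The square of the matrix is (1 - t)^2 + t^2 times the identity, which inverts it
  explicitly.\<close>

lemma swap_path_eq_0:
  assumes "a \<noteq> b" "swap_path a b t x = origin"
  shows "x = origin"
proof -
  have 1: "(1 - t) * x a + t * x b = 0" "t * x a - (1 - t) * x b = 0"
    using fun_cong[OF assms(2), of a] fun_cong[OF assms(2), of b] assms(1) by (auto simp: swap_path_def)
  have "((1 - t)\<^sup>2 + t\<^sup>2) * x a = (1 - t) * ((1 - t) * x a + t * x b) + t * (t * x a - (1 - t) * x b)"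
    "((1 - t)\<^sup>2 + t\<^sup>2) * x b = t * ((1 - t) * x a + t * x b) - (1 - t) * (t * x a - (1 - t) * x b)"
    by (simp_all add: power2_eq_square algebra_simps)
  moreover have "(1 - t)\<^sup>2 + t\<^sup>2 \<noteq> 0"
    by (metis add_nonneg_eq_0_iff diff_zero power_zero_numeral zero_le_power2 zero_neq_one power_eq_0_iff)
  ultimately have "x a = 0" "x b = 0"
    unfolding 1 by auto
  moreover have "x i = 0" if "i \<noteq> a" "i \<noteq> b" for i
    using fun_cong[OF assms(2), of i] that by (simp add: swap_path_def)
  ultimately show ?thesis by (metis ext)
qed

lemma inverts_local_group_swap_path:
  assumes "a < n" "b < n" "a \<noteq> b" "inverts_local_group n (swap_path a b s)" "0 \<le> s" "s \<le> 1" "0 \<le> s'" "s' \<le> 1"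
  shows "inverts_local_group n (swap_path a b s')"
proof (rule inverts_local_group_path[OF assms(4), where h="\<lambda>t. swap_path a b ((1 - t) * s + t * s')"])
  fix i
  show "continuous_on UNIV (\<lambda>z. swap_path a b ((1 - fst z) * s + fst z * s') (snd z) i)"
    by (cases "i = a"; cases "i = b") (auto simp: swap_path_def intro!: continuous_intros)
next
  show "x = origin" if "swap_path a b ((1 - t) * s + t * s') x = origin" for t x
    using swap_path_eq_0[OF assms(3) that] .
qed (use assms in \<open>auto simp: swap_path_def\<close>)

lemma swap_path_1: "swap_path a b 1 = swap_path b a 1"
  by (auto simp: swap_path_def fun_eq_iff)

text \<open>Only the negation of coordinate 0 is known so far. Its path to the exchange of b and 0,
  continued backwards with the roles of the two exchanged, gives the negation of b; from there the
  path for a and b leads to the required exchange.\<close>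

lemma inverts_local_group_swap:
  assumes "a < n" "b < n" "a \<noteq> b"
  shows "inverts_local_group n (swap_path a b 1)"
proof -
  have n: "0 < n" using assms by simp
  have r0: "swap_path a 0 0 = reflect0" if "a \<noteq> 0" for a
    using that by (auto simp: swap_path_def reflect0_def fun_eq_iff)
  have refl: "swap_path a b 0 = swap_path c b 0" if "a \<noteq> b" "c \<noteq> b" for a b c
    using that by (auto simp: swap_path_def fun_eq_iff)
  have "inverts_local_group n (swap_path (if b = 0 then a else 0) b 0)"
  proof (cases "b = 0")
    case True
    then show ?thesis using r0 assms inverts_local_group_reflect0[of n] by simp
  next
    case False
    have "inverts_local_group n (swap_path b 0 0)"
      using r0 False inverts_local_group_reflect0[of n] n by simp
    then have "inverts_local_group n (swap_path b 0 1)"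
      by (intro inverts_local_group_swap_path[of b n 0 0 1]) (use assms False n in auto)
    then have "inverts_local_group n (swap_path 0 b 1)"
      by (simp add: swap_path_1)
    then have "inverts_local_group n (swap_path 0 b 0)"
      by (intro inverts_local_group_swap_path[of 0 n b 1 0]) (use assms False n in auto)
    then show ?thesis using False by simp
  qed
  then have "inverts_local_group n (swap_path a b 0)"
    using refl[of a b "if b = 0 then a else 0"] assms by (auto split: if_splits)
  then show ?thesis
    by (intro inverts_local_group_swap_path[of a n b 0 1]) (use assms in auto)
qed

text \<open>At t = 1 the linear part of the affine map that exchanges the first two vertices in
  barycentric coordinates; at t = 0 the reflection.\<close>

definition shear :: "nat \<Rightarrow> real \<Rightarrow> (nat \<Rightarrow> real) \<Rightarrow> nat \<Rightarrow> real" where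
  "shear n t x = (\<lambda>i. if i = 0 then - x 0 - t * (\<Sum>j\<in>{1..<n}. x j) else x i)"

lemma inverts_local_group_shear:
  assumes "n \<ge> 1"
  shows "inverts_local_group n (shear n 1)"
proof (rule inverts_local_group_path[OF inverts_local_group_reflect0[OF assms], where h="shear n"])
  fix i
  show "continuous_on UNIV (\<lambda>z. shear n (fst z) (snd z) i)"
    by (cases "i = 0") (auto simp: shear_def intro!: continuous_intros)
next
  fix t and x :: "nat \<Rightarrow> real" assume eq: "shear n t x = origin"
  have x: "x i = 0" if "i \<noteq> 0" for i
    using fun_cong[OF eq, of i] that by (simp add: shear_def)
  then have "x 0 = 0"
    using fun_cong[OF eq, of 0] by (simp add: shear_def)
  with x show "x = origin" by (metis ext)
qed (use assms in \<open>auto simp: shear_def reflect0_def\<close>)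

section \<open>The sign of a chart against the orientation\<close>

definition standard_class :: "nat \<Rightarrow> (nat \<Rightarrow> real) chain set \<Rightarrow> (nat \<Rightarrow> real) set \<Rightarrow> (nat \<Rightarrow> real) \<Rightarrow> (nat \<Rightarrow> real) chain set \<Rightarrow> bool" where
  "standard_class n g V z \<alpha> \<longleftrightarrow>
     \<alpha> \<in> carrier (relative_homology_group (int n) (subtopology (Euclidean_space n) V) (V - {z})) \<and>
     hom_induced n (subtopology (Euclidean_space n) V) (V - {z}) (Euclidean_space n) (punctured n) (shift z) \<alpha> = g"

text \<open>\<open>k\<close> is the exponent of the orientation class over the image of the standard
  class. One \<open>k\<close> has to serve all points of \<open>V\<close>, which is why connected
  domains are used.\<close>

definition chart_sign :: "nat \<Rightarrow> (nat \<Rightarrow> real) chain set \<Rightarrow> 'a topology \<Rightarrow> ('a \<Rightarrow> 'a chain set) \<Rightarrow>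
    (nat \<Rightarrow> real) set \<Rightarrow> ((nat \<Rightarrow> real) \<Rightarrow> 'a) \<Rightarrow> int \<Rightarrow> bool" where
  "chart_sign n g M \<mu> V \<Phi> k \<longleftrightarrow>
     (\<forall>z\<in>V. \<forall>\<alpha>. standard_class n g V z \<alpha> \<longrightarrow>
        \<mu> (\<Phi> z) = hom_induced n (subtopology (Euclidean_space n) V) (V - {z}) M (topspace M - {\<Phi> z}) \<Phi> \<alpha>
            [^]\<^bsub>relative_homology_group (int n) M (topspace M - {\<Phi> z})\<^esub> k)"

text \<open>Connectedness makes the sign constant, and a point in the domain makes it
  unique.\<close>

definition open_chart :: "nat \<Rightarrow> 'a topology \<Rightarrow> (nat \<Rightarrow> real) set \<Rightarrow> ((nat \<Rightarrow> real) \<Rightarrow> 'a) \<Rightarrow> bool" where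
  "open_chart n M V \<Phi> \<longleftrightarrow> openin (Euclidean_space n) V \<and> connected V \<and> V \<noteq> {} \<and>
     embedding_map (subtopology (Euclidean_space n) V) M \<Phi> \<and> openin M (\<Phi> ` V)"

locale oriented_manifold =
  fixes n :: nat and M :: "'a topology" and \<mu> :: "'a \<Rightarrow> 'a chain set" and g
  assumes n: "1 \<le> n" and haus: "Hausdorff_space M" and orient: "orientation_on n M \<mu>"
    and cyc: "infinite_cyclic_group (local_group n) g"
begin

abbreviation E where "E \<equiv> Euclidean_space n"
abbreviation EV where "EV V \<equiv> subtopology (Euclidean_space n) V"
abbreviation HV where "HV V D \<equiv> relative_homology_group (int n) (subtopology (Euclidean_space n) V) (V - D)"
abbreviation HM where "HM D \<equiv> relative_homology_group (int n) M (topspace M - D)"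
abbreviation push where "push V D \<Phi> \<equiv> hom_induced (int n) (subtopology (Euclidean_space n) V) (V - D) M (topspace M - \<Phi> ` D) \<Phi>"
abbreviation pt where "pt V z \<Phi> \<equiv> hom_induced (int n) (subtopology (Euclidean_space n) V) (V - {z}) M (topspace M - {\<Phi> z}) \<Phi>"
abbreviation sh where "sh V D z \<equiv> hom_induced (int n) (subtopology (Euclidean_space n) V) (V - D) (Euclidean_space n) (punctured n) (shift z)"

lemma shift_punctured: "z \<in> topspace E \<Longrightarrow> W \<subseteq> topspace E \<Longrightarrow> shift z \<in> W - {z} \<rightarrow> punctured n"
proof
  fix x assume z: "z \<in> topspace E" "W \<subseteq> topspace E" and x: "x \<in> W - {z}"
  have "shift z x \<noteq> origin"
  proof
    assume "shift z x = origin"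
    then have "x i = z i" for i by (simp add: shift_def fun_eq_iff)
    then show False using x by auto
  qed
  then show "shift z x \<in> punctured n"
    using z x by (auto simp: topspace_Euclidean_space shift_def subset_iff)
qed

lemma continuous_map_shift_EV: "z \<in> topspace E \<Longrightarrow> continuous_map (EV V) E (shift z)"
  by (rule continuous_map_from_subtopology[OF continuous_map_shift])

lemma chart_sub: "open_chart n M V \<Phi> \<Longrightarrow> V \<subseteq> topspace E"
  by (auto simp: open_chart_def dest: openin_subset)

lemma chart_top: "open_chart n M V \<Phi> \<Longrightarrow> topspace (EV V) = V"
  using chart_sub by auto

lemma chart_cont: "open_chart n M V \<Phi> \<Longrightarrow> continuous_map (EV V) M \<Phi>"
  by (auto simp: open_chart_def embedding_map_def dest!: homeomorphic_imp_continuous_map intro: continuous_map_into_fulltopology)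

lemma chart_in: "open_chart n M V \<Phi> \<Longrightarrow> z \<in> V \<Longrightarrow> \<Phi> z \<in> topspace M"
  using chart_cont chart_top by (metis continuous_map_image_subset_topspace image_subset_iff)

lemma chart_inj: "open_chart n M V \<Phi> \<Longrightarrow> inj_on \<Phi> V"
  by (metis chart_top embedding_imp_closed_map_eq embedding_map_def homeomorphic_imp_injective_map open_chart_def)

lemma chart_complement:
  assumes "open_chart n M V \<Phi>" "D \<subseteq> V"
  shows "\<Phi> \<in> V - D \<rightarrow> topspace M - \<Phi> ` D"
proof
  fix x assume x: "x \<in> V - D"
  then have "\<Phi> x \<notin> \<Phi> ` D"
    using inj_on_image_mem_iff[OF chart_inj[OF assms(1)], of x D] assms(2) by blast
  then show "\<Phi> x \<in> topspace M - \<Phi> ` D"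
    using chart_in[OF assms(1)] x by blast
qed

lemma iso_push:
  assumes "open_chart n M V \<Phi>" "D \<subseteq> V" "closedin M (\<Phi> ` D)"
  shows "push V D \<Phi> \<in> iso (HV V D) (HM (\<Phi> ` D))"
  using excision_embedding[of "EV V" M \<Phi> D "int n"] assms chart_top[OF assms(1)] chart_sub[OF assms(1)]
  by (simp add: open_chart_def)

lemma iso_push_point:
  assumes "open_chart n M V \<Phi>" "z \<in> V"
  shows "pt V z \<Phi> \<in> iso (HV V {z}) (HM {\<Phi> z})"
  using iso_push[OF assms(1), of "{z}"] assms(2) chart_in[OF assms] haus closedin_Hausdorff_singleton[of M "\<Phi> z"]
  by simp

lemma iso_sh:
  assumes "open_chart n M V \<Phi>" "z \<in> V"
  shows "sh V {z} z \<in> iso (HV V {z}) (local_group n)"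
  using iso_shift assms by (auto simp: open_chart_def)

lemma standard_class_exists:
  assumes "open_chart n M V \<Phi>" "z \<in> V"
  shows "\<exists>!\<alpha>. standard_class n g V z \<alpha>"
proof -
  have "g \<in> carrier (local_group n)" by (rule infinite_cyclic_group.g[OF cyc])
  moreover have "sh V {z} z ` carrier (HV V {z}) = carrier (local_group n)"
    using iso_sh[OF assms] by (simp add: iso_def bij_betw_def)
  ultimately have "g \<in> sh V {z} z ` carrier (HV V {z})" by simp
  then obtain \<alpha> where \<alpha>: "g = sh V {z} z \<alpha>" "\<alpha> \<in> carrier (HV V {z})" by (rule imageE)
  show ?thesis
    unfolding standard_class_def
  proof (rule ex1I[of _ \<alpha>])
    show "\<alpha> \<in> carrier (HV V {z}) \<and> sh V {z} z \<alpha> = g" using \<alpha> by simp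
    show "\<beta> = \<alpha>" if "\<beta> \<in> carrier (HV V {z}) \<and> sh V {z} z \<beta> = g" for \<beta>
      by (rule inj_onD[OF iso_imp_inj_on[OF iso_sh[OF assms]]]) (use that \<alpha> in simp_all)
  qed
qed

lemma iso_local_to_manifold:
  assumes "open_chart n M V \<Phi>" "z \<in> V"
  obtains J where "J \<in> iso (local_group n) (HM {\<Phi> z})"
    "\<And>\<alpha>. \<alpha> \<in> carrier (HV V {z}) \<Longrightarrow> J (sh V {z} z \<alpha>) = pt V z \<Phi> \<alpha>"
proof -
  let ?i = "inv_into (carrier (HV V {z})) (sh V {z} z)"
  have 1: "?i \<in> iso (local_group n) (HV V {z})"
    by (rule group.iso_set_sym[OF group_relative_homology_group iso_sh[OF assms]])
  have 2: "?i (sh V {z} z \<alpha>) = \<alpha>" if "\<alpha> \<in> carrier (HV V {z})" for \<alpha>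
    using inv_into_f_f[OF iso_imp_inj_on[OF iso_sh[OF assms]] that] .
  show ?thesis
    using that[of "pt V z \<Phi> \<circ> ?i"] iso_set_trans[OF 1 iso_push_point[OF assms]] 2 by simp
qed

text \<open>Through the chart the local group at the point is infinite cyclic, and the orientation
  class is one of its two generators.\<close>

lemma sign_at_point:
  assumes "open_chart n M V \<Phi>" "z \<in> V" "standard_class n g V z \<alpha>"
  shows "\<exists>!k::int. \<mu> (\<Phi> z) = pt V z \<Phi> \<alpha> [^]\<^bsub>HM {\<Phi> z}\<^esub> k"
    and "\<mu> (\<Phi> z) = pt V z \<Phi> \<alpha> [^]\<^bsub>HM {\<Phi> z}\<^esub> (k::int) \<Longrightarrow> k = 1 \<or> k = -1"
proof -
  obtain J where J: "J \<in> iso (local_group n) (HM {\<Phi> z})" "J g = pt V z \<Phi> \<alpha>"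
    using iso_local_to_manifold[OF assms(1,2)] assms(3) unfolding standard_class_def by metis
  have mu: "\<mu> (\<Phi> z) \<in> carrier (HM {\<Phi> z})" "subgroup_generated (HM {\<Phi> z}) {\<mu> (\<Phi> z)} = HM {\<Phi> z}"
    using orient chart_in[OF assms(1,2)] by (auto simp: orientation_on_def)
  show "\<exists>!k::int. \<mu> (\<Phi> z) = pt V z \<Phi> \<alpha> [^]\<^bsub>HM {\<Phi> z}\<^esub> k"
    using infinite_cyclic_group.iso_image_power[OF cyc J(1) group_relative_homology_group mu(1)] J(2) by simp
  show "k = 1 \<or> k = -1" if "\<mu> (\<Phi> z) = pt V z \<Phi> \<alpha> [^]\<^bsub>HM {\<Phi> z}\<^esub> (k::int)"
    using infinite_cyclic_group.iso_image_generator[OF cyc J(1) group_relative_homology_group mu, of k] J(2) that by simp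
qed

text \<open>Take a compact box \<open>D\<close> around \<open>z0\<close>, inside the chart and
  inside a neighbourhood over which the orientation comes from one class \<nu>. By excision the
  restriction of \<nu> corresponds to a class of \<open>V\<close> relative to the complement of
  \<open>D\<close>. All translations by points of \<open>D\<close> act alike on this class, so one
  exponent is valid throughout the open box \<open>T\<close>.\<close>

lemma sign_locally_constant:
  assumes ch: "open_chart n M V \<Phi>" and z0: "z0 \<in> V"
  shows "\<exists>T k. openin E T \<and> z0 \<in> T \<and> T \<subseteq> V \<and>
    (\<forall>z\<in>T. \<forall>\<alpha>. standard_class n g V z \<alpha> \<longrightarrow> \<mu> (\<Phi> z) = pt V z \<Phi> \<alpha> [^]\<^bsub>HM {\<Phi> z}\<^esub> (k::int))"
proof -
  note VE = chart_sub[OF ch] and top = chart_top[OF ch] and cont = chart_cont[OF ch] and inj = chart_inj[OF ch]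
  from bspec[OF conjunct2[OF orient[unfolded orientation_on_def]] chart_in[OF ch z0]]
  obtain U \<nu> where U: "openin M U" "\<Phi> z0 \<in> U" "\<nu> \<in> carrier (HM U)"
    "\<And>y. y \<in> U \<Longrightarrow> hom_induced (int n) M (topspace M - U) M (topspace M - {y}) id \<nu> = \<mu> y"
    by (elim exE conjE bexE) (rule that, assumption+, erule bspec)
  define W where "W = {z\<in>V. \<Phi> z \<in> U}"
  have "openin (EV V) W"
    using openin_continuous_map_preimage[OF cont U(1)] unfolding top W_def .
  then have W: "openin E W"
    by (rule openin_trans_full) (use ch in \<open>simp add: open_chart_def\<close>)
  have z0W: "z0 \<in> W" using z0 U(2) by (simp add: W_def)
  have z0E: "z0 \<in> topspace E" using VE z0 by auto
  obtain d where d: "0 < d" "{x\<in>topspace E. \<forall>i<n. \<bar>x i - z0 i\<bar> \<le> d} \<subseteq> W"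
    using openin_Euclidean_space_box[OF W z0W] .
  define D where "D = {x\<in>topspace E. \<forall>i<n. \<bar>x i - z0 i\<bar> \<le> d}"
  define T where "T = {x\<in>topspace E. \<forall>i<n. \<bar>x i - z0 i\<bar> < d}"
  have DV: "D \<subseteq> V" and DU: "\<Phi> ` D \<subseteq> U" and TD: "T \<subseteq> D" and z0D: "z0 \<in> D"
  proof -
    have "D \<subseteq> W" using d(2) by (simp add: D_def)
    then show "D \<subseteq> V" "\<Phi> ` D \<subseteq> U" by (auto simp: W_def)
    show "T \<subseteq> D" by (auto simp: D_def T_def less_imp_le)
    show "z0 \<in> D" using z0E d(1) by (simp add: D_def)
  qed
  have T: "openin E T"
  proof -
    have "open {x::nat \<Rightarrow> real. \<bar>x i - z0 i\<bar> < d}" for i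
      by (intro open_Collect_less continuous_intros)
    then have "open (\<Inter>i\<in>{..<n}. {x. \<bar>x i - z0 i\<bar> < d})"
      by (intro open_INT) auto
    moreover have "T = topspace E \<inter> (\<Inter>i\<in>{..<n}. {x. \<bar>x i - z0 i\<bar> < d})"
      by (auto simp: T_def)
    ultimately show ?thesis
      unfolding Euclidean_space_top_of_set by (auto simp: openin_open)
  qed
  \<comment> \<open>Compactness makes the image closed in the Hausdorff space \<open>M\<close>, as
    the excision over \<open>D\<close> requires.\<close>
  have "compactin E D"
    unfolding D_def by (rule compactin_Euclidean_space_box[OF z0E])
  then have "compactin (EV V) D"
    using DV by (simp add: compactin_subtopology)
  then have clD: "closedin M (\<Phi> ` D)"
    using image_compactin[OF _ cont] compactin_imp_closedin[OF haus] by blast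
  have "hom_induced (int n) M (topspace M - U) M (topspace M - \<Phi> ` D) id \<nu> \<in> carrier (HM (\<Phi> ` D))"
    by (rule hom_induced_carrier)
  moreover have "push V D \<Phi> ` carrier (HV V D) = carrier (HM (\<Phi> ` D))"
    using iso_push[OF ch DV clD] by (simp add: iso_def bij_betw_def)
  ultimately have "hom_induced (int n) M (topspace M - U) M (topspace M - \<Phi> ` D) id \<nu> \<in> push V D \<Phi> ` carrier (HV V D)"
    by simp
  then obtain \<nu>' where \<nu>': "\<nu>' \<in> carrier (HV V D)"
    "hom_induced (int n) M (topspace M - U) M (topspace M - \<Phi> ` D) id \<nu> = push V D \<Phi> \<nu>'"
    by blast
  have "sh V D z0 \<nu>' \<in> carrier (local_group n)"
    by (rule hom_induced_carrier)
  then obtain k :: int where k: "sh V D z0 \<nu>' = g [^]\<^bsub>local_group n\<^esub> k"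
    using infinite_cyclic_group.gen[OF cyc] by blast
  have "\<mu> (\<Phi> z) = pt V z \<Phi> \<alpha> [^]\<^bsub>HM {\<Phi> z}\<^esub> k" if z: "z \<in> T" and \<alpha>: "standard_class n g V z \<alpha>" for z \<alpha>
  proof -
    have zD: "z \<in> D" and zV: "z \<in> V" and zE: "z \<in> topspace E"
      using z TD DV VE by auto
    have DE: "\<forall>i\<ge>n. x i = 0" if "x \<in> D" for x
      using that by (simp add: D_def topspace_Euclidean_space)
    define \<beta> where "\<beta> = hom_induced (int n) (EV V) (V - D) (EV V) (V - {z}) id \<nu>'"
    have \<beta>c: "\<beta> \<in> carrier (HV V {z})"
      unfolding \<beta>_def by (rule hom_induced_carrier)
    have idz: "id \<in> V - D \<rightarrow> V - {z}" using zD by auto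
    have "sh V {z} z \<beta> = sh V D z \<nu>'"
      by (simp add: \<beta>_def hom_induced_compose'[OF continuous_map_id idz continuous_map_shift_EV[OF zE] shift_punctured[OF zE VE]])
    also have "\<dots> = sh V D z0 \<nu>'"
    proof (rule fun_cong[OF homology_homotopy_axiom])
      have EVtop: "EV V = top_of_set V"
        using VE by (simp add: Euclidean_space_top_of_set subtopology_subtopology topspace_Euclidean_space inf_absorb2)
      show "homotopic_with (\<lambda>h. h \<in> V - D \<rightarrow> punctured n) (EV V) E (shift z) (shift z0)"
        unfolding EVtop unfolding Euclidean_space_top_of_set
      proof (rule homotopic_with_top_of_set[where h="\<lambda>t. shift (\<lambda>i. (1 - t) * z i + t * z0 i)"])
        show "continuous_on ({0..1} \<times> V) (\<lambda>x. shift (\<lambda>i. (1 - fst x) * z i + fst x * z0 i) (snd x) i)" for i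
          unfolding shift_def by (intro continuous_intros)
      next
        fix t :: real assume t: "0 \<le> t" "t \<le> 1"
        \<comment> \<open>The centre moves from z to \<open>z0\<close> inside the convex box, so
          points outside \<open>D\<close> are never sent to the origin.\<close>
        let ?w = "\<lambda>i. (1 - t) * z i + t * z0 i"
        have "\<bar>?w i - z0 i\<bar> \<le> d" if "i < n" for i
        proof -
          have "?w i - z0 i = (1 - t) * (z i - z0 i)" by (simp add: algebra_simps)
          then have "\<bar>?w i - z0 i\<bar> = (1 - t) * \<bar>z i - z0 i\<bar>" using t by (simp add: abs_mult)
          also have "\<dots> \<le> 1 * d"
            using zD that t by (intro mult_mono) (auto simp: D_def)
          finally show ?thesis by simp
        qed
        then have w: "?w \<in> D"
          using DE[OF zD] DE[OF z0D] by (simp add: D_def topspace_Euclidean_space)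
        have VE': "\<forall>i\<ge>n. x i = 0" if "x \<in> V" for x
          using VE that by (auto simp: topspace_Euclidean_space)
        show "shift ?w \<in> V - D \<rightarrow> topspace (top_of_set {x. \<forall>i\<ge>n. x i = 0}) - {origin}"
        proof
          fix x assume x: "x \<in> V - D"
          then have "x \<noteq> ?w" using w by blast
          then have "shift ?w x \<noteq> origin" by (auto simp: shift_def fun_eq_iff)
          then show "shift ?w x \<in> topspace (top_of_set {x. \<forall>i\<ge>n. x i = 0}) - {origin}"
            using x VE' DE[OF w] by (simp add: shift_def)
        qed
        show "shift ?w x \<in> {x. \<forall>i\<ge>n. x i = 0}" if "x \<in> V" for x
          using VE'[OF that] DE[OF w] by (simp add: shift_def)
      qed simp_all
    qed
    finally have sh\<beta>: "sh V {z} z \<beta> = g [^]\<^bsub>local_group n\<^esub> k" using k by simp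
    interpret sh: group_hom "HV V {z}" "local_group n" "sh V {z} z"
      using iso_sh[OF ch zV] by (simp add: group_hom_def group_hom_axioms_def iso_imp_homomorphism)
    have \<alpha>c: "\<alpha> \<in> carrier (HV V {z})" and sh\<alpha>: "sh V {z} z \<alpha> = g"
      using \<alpha> by (auto simp: standard_class_def)
    have "sh V {z} z (\<alpha> [^]\<^bsub>HV V {z}\<^esub> k) = g [^]\<^bsub>local_group n\<^esub> k"
      using sh.hom_int_pow[OF \<alpha>c] sh\<alpha> by simp
    then have \<beta>: "\<beta> = \<alpha> [^]\<^bsub>HV V {z}\<^esub> k"
      by (intro inj_onD[OF iso_imp_inj_on[OF iso_sh[OF ch zV]] _ \<beta>c] sh.G.int_pow_closed \<alpha>c) (simp only: sh\<beta>)
    interpret pu: group_hom "HV V {z}" "HM {\<Phi> z}" "pt V z \<Phi>"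
      using iso_push_point[OF ch zV] by (simp add: group_hom_def group_hom_axioms_def iso_imp_homomorphism)
    have im1: "\<Phi> \<in> V - {z} \<rightarrow> topspace M - {\<Phi> z}" and im2: "\<Phi> \<in> V - D \<rightarrow> topspace M - \<Phi> ` D"
      using chart_complement[OF ch, of "{z}"] chart_complement[OF ch DV] zV by simp_all
    have "pt V z \<Phi> \<beta> = hom_induced (int n) (EV V) (V - D) M (topspace M - {\<Phi> z}) \<Phi> \<nu>'"
      by (simp add: \<beta>_def hom_induced_compose'[OF continuous_map_id idz cont im1])
    also have "\<dots> = hom_induced (int n) M (topspace M - \<Phi> ` D) M (topspace M - {\<Phi> z}) id (push V D \<Phi> \<nu>')"
    proof -
      have "id \<in> topspace M - \<Phi> ` D \<rightarrow> topspace M - {\<Phi> z}" using zD by auto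
      then show ?thesis
        by (simp add: hom_induced_compose'[OF cont im2 continuous_map_id])
    qed
    also have "\<dots> = hom_induced (int n) M (topspace M - U) M (topspace M - {\<Phi> z}) id \<nu>"
    proof -
      have "id \<in> topspace M - U \<rightarrow> topspace M - \<Phi> ` D" "id \<in> topspace M - \<Phi> ` D \<rightarrow> topspace M - {\<Phi> z}"
        using zD DU by auto
      then show ?thesis
        unfolding \<nu>'(2)[symmetric]
        by (simp add: hom_induced_compose'[OF continuous_map_id _ continuous_map_id])
    qed
    also have "\<dots> = \<mu> (\<Phi> z)"
      using U(4) DU zD by blast
    finally show ?thesis
      unfolding \<beta> using pu.hom_int_pow[OF \<alpha>c] by simp
  qed
  then show ?thesis
    using T z0D TD DV z0E d(1) by (intro exI[of _ T] exI[of _ k]) (auto simp: T_def)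
qed

text \<open>The exponent is locally constant, hence constant on the connected domain.\<close>

lemma chart_sign_exists:
  assumes ch: "open_chart n M V \<Phi>"
  shows "\<exists>!k. chart_sign n g M \<mu> V \<Phi> k" and "chart_sign n g M \<mu> V \<Phi> k \<Longrightarrow> k = 1 \<or> k = -1"
proof -
  define \<alpha> where "\<alpha> z = (THE \<alpha>. standard_class n g V z \<alpha>)" for z
  have \<alpha>: "standard_class n g V z a \<longleftrightarrow> a = \<alpha> z" if "z \<in> V" for z a
    using standard_class_exists[OF ch that] theI'[OF standard_class_exists[OF ch that]] unfolding \<alpha>_def by auto
  define K :: "(nat \<Rightarrow> real) \<Rightarrow> int" where "K z = (THE k. \<mu> (\<Phi> z) = pt V z \<Phi> (\<alpha> z) [^]\<^bsub>HM {\<Phi> z}\<^esub> k)" for z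
  have K: "\<mu> (\<Phi> z) = pt V z \<Phi> (\<alpha> z) [^]\<^bsub>HM {\<Phi> z}\<^esub> (k::int) \<longleftrightarrow> k = K z" if "z \<in> V" for z k
    using sign_at_point(1)[OF ch that, of "\<alpha> z"] theI'[OF sign_at_point(1)[OF ch that, of "\<alpha> z"]] \<alpha>[OF that]
    unfolding K_def by auto
  have cs: "chart_sign n g M \<mu> V \<Phi> k \<longleftrightarrow> (\<forall>z\<in>V. k = K z)" for k
    unfolding chart_sign_def using \<alpha> K by simp
  have "\<exists>T. openin (top_of_set V) T \<and> z0 \<in> T \<and> (\<forall>z\<in>T. K z = K z0)" if z0: "z0 \<in> V" for z0
  proof -
    obtain T k where T: "openin E T" "z0 \<in> T" "T \<subseteq> V"
      "\<forall>z\<in>T. \<forall>a. standard_class n g V z a \<longrightarrow> \<mu> (\<Phi> z) = pt V z \<Phi> a [^]\<^bsub>HM {\<Phi> z}\<^esub> (k::int)"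
      using sign_locally_constant[OF ch z0] by blast
    then have "K z = k" if "z \<in> T" for z
      using K[of z k] \<alpha>[of z] that by blast
    moreover have "openin (top_of_set V) T"
      using T(1,3) chart_sub[OF ch] unfolding Euclidean_space_top_of_set
      by (auto simp: openin_open)
    ultimately show ?thesis using T by auto
  qed
  then have "K constant_on V"
    using ch by (intro locally_constant_imp_constant) (auto simp: open_chart_def)
  then obtain l where l: "\<forall>z\<in>V. K z = l" by (auto simp: constant_on_def)
  obtain z where z: "z \<in> V" using ch by (auto simp: open_chart_def)
  show "\<exists>!k. chart_sign n g M \<mu> V \<Phi> k"
    unfolding cs using l z by metis
  show "k = 1 \<or> k = -1" if "chart_sign n g M \<mu> V \<Phi> k"
    using that sign_at_point(2)[OF ch z, of "\<alpha> z" k] \<alpha>[OF z] K[OF z] z unfolding cs by auto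
qed

text \<open>\<open>A\<close> behaves like an affine map with linear part \<open>h\<close>:
  translating by \<open>A z\<close> after \<open>A\<close> is \<open>h\<close> after translating by
  z. So \<open>A\<close> carries the standard class at z to the inverse of the one at
  \<open>A z\<close>, and the exponent changes sign. The image of \<open>A\<close> may be a part of
  \<open>V\<close>, which allows a simplex to be compared with a star that contains it.\<close>

lemma chart_sign_flip:
  assumes ch: "open_chart n M V \<Phi>" and ch': "open_chart n M V' \<Phi>'"
    and A: "continuous_map (EV V') (EV V) A" "inj_on A V'" and \<Phi>': "\<And>x. x \<in> V' \<Longrightarrow> \<Phi>' x = \<Phi> (A x)"
    and h: "inverts_local_group n h" "\<And>x z. x \<in> V' \<Longrightarrow> z \<in> V' \<Longrightarrow> shift (A z) (A x) = h (shift z x)"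
    and k: "chart_sign n g M \<mu> V \<Phi> k"
  shows "chart_sign n g M \<mu> V' \<Phi>' (- k)"
  unfolding chart_sign_def
proof (intro ballI allI impI)
  fix z \<alpha> assume z: "z \<in> V'" and \<alpha>: "standard_class n g V' z \<alpha>"
  have \<alpha>c: "\<alpha> \<in> carrier (HV V' {z})" and sh\<alpha>: "sh V' {z} z \<alpha> = g"
    using \<alpha> by (auto simp: standard_class_def)
  have AV: "A x \<in> V" if "x \<in> V'" for x
    using A(1) that chart_top[OF ch] chart_top[OF ch'] by (auto simp: continuous_map_def)
  have Az: "A z \<in> V" using AV z by simp
  have imA: "A \<in> V' - {z} \<rightarrow> V - {A z}"
    using AV A(2) z by (auto simp: inj_on_def)
  have zE: "z \<in> topspace E" "A z \<in> topspace E"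
    using chart_sub[OF ch] chart_sub[OF ch'] z Az by auto
  define \<beta> where "\<beta> = hom_induced (int n) (EV V') (V' - {z}) (EV V) (V - {A z}) A \<alpha>"
  have \<beta>c: "\<beta> \<in> carrier (HV V {A z})" unfolding \<beta>_def by (rule hom_induced_carrier)
  have "sh V {A z} (A z) \<beta> = hom_induced (int n) (EV V') (V' - {z}) E (punctured n) (shift (A z) \<circ> A) \<alpha>"
    unfolding \<beta>_def by (rule hom_induced_compose'[OF A(1) imA continuous_map_shift_EV[OF zE(2)] shift_punctured[OF zE(2) chart_sub[OF ch]]])
  also have "\<dots> = hom_induced (int n) (EV V') (V' - {z}) E (punctured n) (h \<circ> shift z) \<alpha>"
    by (rule fun_cong[OF hom_induced_eq]) (use h(2) z chart_top[OF ch'] in simp)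
  also have "\<dots> = hom_induced (int n) E (punctured n) E (punctured n) h (sh V' {z} z \<alpha>)"
    by (rule hom_induced_compose'[symmetric]) (use continuous_map_shift_EV[OF zE(1)] shift_punctured[OF zE(1) chart_sub[OF ch']] h(1) in \<open>auto simp: inverts_local_group_def\<close>)
  also have "\<dots> = inv\<^bsub>local_group n\<^esub> g"
    using h(1) infinite_cyclic_group.g[OF cyc] unfolding sh\<alpha> by (simp add: inverts_local_group_def)
  finally have sh\<beta>: "sh V {A z} (A z) \<beta> = inv\<^bsub>local_group n\<^esub> g" .
  interpret sh: group_hom "HV V {A z}" "local_group n" "sh V {A z} (A z)"
    using iso_sh[OF ch Az] by (simp add: group_hom_def group_hom_axioms_def iso_imp_homomorphism)
  have "standard_class n g V (A z) (inv\<^bsub>HV V {A z}\<^esub> \<beta>)"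
    unfolding standard_class_def using \<beta>c sh\<beta> infinite_cyclic_group.g[OF cyc] by simp
  then have 1: "\<mu> (\<Phi> (A z)) = pt V (A z) \<Phi> (inv\<^bsub>HV V {A z}\<^esub> \<beta>) [^]\<^bsub>HM {\<Phi> (A z)}\<^esub> k"
    using k Az by (simp add: chart_sign_def)
  interpret pu: group_hom "HV V {A z}" "HM {\<Phi> (A z)}" "pt V (A z) \<Phi>"
    using iso_push_point[OF ch Az] by (simp add: group_hom_def group_hom_axioms_def iso_imp_homomorphism)
  have im: "\<Phi> \<in> V - {A z} \<rightarrow> topspace M - {\<Phi> (A z)}"
    using chart_complement[OF ch, of "{A z}"] Az by simp
  have 2: "pt V (A z) \<Phi> \<beta> = pt V' z \<Phi>' \<alpha>"
  proof -
    have "pt V (A z) \<Phi> \<beta> = hom_induced (int n) (EV V') (V' - {z}) M (topspace M - {\<Phi> (A z)}) (\<Phi> \<circ> A) \<alpha>"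
      unfolding \<beta>_def using hom_induced_compose'[OF A(1) imA chart_cont[OF ch] im] by simp
    also have "\<dots> = hom_induced (int n) (EV V') (V' - {z}) M (topspace M - {\<Phi> (A z)}) \<Phi>' \<alpha>"
      by (rule fun_cong[OF hom_induced_eq]) (use \<Phi>' chart_top[OF ch'] in simp)
    finally show ?thesis using \<Phi>' z by simp
  qed
  show "\<mu> (\<Phi>' z) = hom_induced n (EV V') (V' - {z}) M (topspace M - {\<Phi>' z}) \<Phi>' \<alpha> [^]\<^bsub>HM {\<Phi>' z}\<^esub> (- k)"
    using 1 2 pu.hom_inv[OF \<beta>c] pu.hom_closed[OF \<beta>c] \<Phi>'[OF z] by (simp add: pu.H.int_pow_inv pu.H.int_pow_neg)
qed

end

section \<open>Coherent orientation of a triangulation\<close>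

text \<open>Invariance of domain for a target with boundary. In a half-space model around an image
  point the map becomes an injection into Euclidean space of the same dimension, so its image is
  open there; lying in the half-space, it is open in the model as well.\<close>

lemma open_map_into_manifold:
  assumes X: "manifold_with_boundary n X" and V: "openin (Euclidean_space n) V"
    and cont: "continuous_map (subtopology (Euclidean_space n) V) X f" and inj: "inj_on f V"
  shows "openin X (f ` V)"
proof (subst openin_subopen, intro ballI)
  let ?E = "Euclidean_space n"
  fix x assume "x \<in> f ` V"
  then obtain w where w: "w \<in> V" "x = f w" by blast
  have VE: "V \<subseteq> topspace ?E" using V openin_subset by blast
  have top: "topspace (subtopology ?E V) = V" using VE by auto
  have xX: "x \<in> topspace X"
    using continuous_map_image_subset_topspace[OF cont] w top by blast
  then have "locally_modelled_at X (half_space n) x"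
    using X by (simp add: manifold_with_boundary_def)
  then obtain U B where U: "openin X U" "x \<in> U" "openin (half_space n) B"
    "subtopology X U homeomorphic_space subtopology (half_space n) B"
    by (auto simp: locally_modelled_at_def)
  then obtain h where h: "homeomorphic_map (subtopology X U) (subtopology (half_space n) B) h"
    using homeomorphic_space by blast
  have UX: "U \<subseteq> topspace X" using U(1) openin_subset by blast
  have topU: "topspace (subtopology X U) = U" using UX by auto
  define W where "W = {w \<in> V. f w \<in> U}"
  have "openin (subtopology ?E V) W"
    using openin_continuous_map_preimage[OF cont U(1)] unfolding top W_def .
  then have W: "openin ?E W" by (rule openin_trans_full[OF _ V])
  have contW: "continuous_map (subtopology ?E W) (subtopology X U) f"
    unfolding continuous_map_in_subtopology
  proof
    have "subtopology ?E W = subtopology (subtopology ?E V) W"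
      by (simp add: subtopology_subtopology W_def Int_absorb1 subset_iff)
    then show "continuous_map (subtopology ?E W) X f"
      using continuous_map_from_subtopology[OF cont, of W] by simp
    show "f \<in> topspace (subtopology ?E W) \<rightarrow> U" by (auto simp: W_def)
  qed
  have ch: "continuous_map (subtopology X U) (subtopology (half_space n) B) h"
    using h by (rule homeomorphic_imp_continuous_map)
  have "continuous_map (subtopology X U) ?E h"
    using continuous_map_into_fulltopology[OF ch] unfolding half_space_def
    by (rule continuous_map_into_fulltopology)
  then have cE: "continuous_map (subtopology ?E W) ?E (h \<circ> f)"
    using continuous_map_compose[OF contW] by blast
  have injh: "inj_on h U"
    using homeomorphic_imp_injective_map[OF h] topU by simp
  have "inj_on (h \<circ> f) W"
    using inj injh by (intro comp_inj_on) (auto simp: W_def inj_on_def)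
  with invariance_of_domain_Euclidean_space[OF W cE]
  have op: "openin ?E (h ` f ` W)" by (simp add: image_comp)
  have fWU: "f ` W \<subseteq> U" by (auto simp: W_def)
  have "h ` U \<subseteq> topspace (subtopology (half_space n) B)"
    using continuous_map_image_subset_topspace[OF ch] topU by simp
  moreover have "topspace (subtopology (half_space n) B) \<subseteq> B \<inter> {x. 0 \<le> x 0}"
    by (auto simp: half_space_def)
  ultimately have sub: "h ` f ` W \<subseteq> B \<inter> {x. 0 \<le> x 0}"
    using image_mono[OF fWU, of h] by (meson order_trans)
  have "openin (subtopology (half_space n) B) (h ` f ` W)"
    unfolding half_space_def subtopology_subtopology openin_subtopology
    using op sub by (intro exI[of _ "h ` f ` W"]) auto
  from openin_continuous_map_preimage[OF ch this]
  have "openin (subtopology X U) {y \<in> U. h y \<in> h ` f ` W}" unfolding topU .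
  moreover have "{y \<in> U. h y \<in> h ` f ` W} = f ` W"
  proof (rule Set.set_eqI)
    fix y
    show "y \<in> {y \<in> U. h y \<in> h ` f ` W} \<longleftrightarrow> y \<in> f ` W"
      using inj_on_image_mem_iff[OF injh _ fWU, of y] fWU by (cases "y \<in> U") auto
  qed
  ultimately have "openin X (f ` W)"
    using U(1) openin_trans_full by metis
  moreover have "x \<in> f ` W" "f ` W \<subseteq> f ` V"
    using w U(2) by (auto simp: W_def)
  ultimately show "\<exists>T. openin X T \<and> x \<in> T \<and> T \<subseteq> f ` V" by blast
qed

text \<open>The chart itself is a Euclidean model at its image points, so they are interior points.
  For two simplices with a common facet this places the facet in the interior, where the orientation
  is given.\<close>

lemma open_chart_interior:
  assumes X: "manifold_with_boundary n X" and V: "openin (Euclidean_space n) V" "connected V" "V \<noteq> {}"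
    and cont: "continuous_map (subtopology (Euclidean_space n) V) X f" and inj: "inj_on f V"
  shows "open_chart n (manifold_interior n X) V f"
proof -
  let ?E = "Euclidean_space n" and ?I = "{x \<in> topspace X. locally_modelled_at X (Euclidean_space n) x}"
  have VE: "V \<subseteq> topspace ?E" using V openin_subset by blast
  have top: "topspace (subtopology ?E V) = V" using VE by auto
  have "open_map (subtopology ?E V) X f"
    unfolding open_map_def
  proof (intro allI impI)
    fix W assume "openin (subtopology ?E V) W"
    then have W: "openin ?E W" "W \<subseteq> V"
      using V(1) openin_open_subtopology by blast+
    have "subtopology ?E W = subtopology (subtopology ?E V) W"
      using W(2) by (simp add: subtopology_subtopology Int_absorb1)
    then have "continuous_map (subtopology ?E W) X f"
      using continuous_map_from_subtopology[OF cont, of W] by simp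
    then show "openin X (f ` W)"
      using open_map_into_manifold[OF X W(1)] inj_on_subset[OF inj W(2)] by blast
  qed
  then have emb: "embedding_map (subtopology ?E V) X f"
    using injective_open_imp_embedding_map[OF cont] inj top by simp
  have op: "openin X (f ` V)"
    by (rule open_map_into_manifold[OF X V(1) cont inj])
  have "locally_modelled_at X ?E (f z)" if "z \<in> V" for z
    unfolding locally_modelled_at_def
  proof (intro exI conjI)
    show "subtopology X (f ` V) homeomorphic_space subtopology ?E V"
      using emb unfolding embedding_map_def top
      using homeomorphic_map_imp_homeomorphic_space homeomorphic_space_sym by blast
  qed (use op V(1) that in auto)
  then have sub: "f ` V \<subseteq> ?I"
    using op openin_subset by fastforce
  have "openin (subtopology X ?I) (f ` V)"
    using op sub by (auto simp: openin_subtopology)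
  moreover have "embedding_map (subtopology ?E V) (subtopology X ?I) f"
    using emb sub top by (simp add: embedding_map_in_subtopology image_subset_iff_funcset)
  ultimately show ?thesis
    using V by (simp add: open_chart_def manifold_interior_def)
qed

section \<open>Barycentric charts of simplices and of adjacent pairs\<close>

definition open_simplex :: "nat \<Rightarrow> (nat \<Rightarrow> real) set" where
  "open_simplex n = {t. (\<forall>i\<ge>n. t i = 0) \<and> (\<forall>i<n. 0 < t i) \<and> (\<Sum>i<n. t i) < 1}"

text \<open>The coordinates are the weights of all vertices but the first, which receives the
  rest.\<close>

definition simplex_chart :: "nat \<Rightarrow> nat list \<Rightarrow> (nat \<Rightarrow> real) \<Rightarrow> nat \<Rightarrow> real" where
  "simplex_chart n l t v =
     (if v = hd l then 1 - (\<Sum>i<n. t i) else \<Sum>i<n. if tl l ! i = v then t i else 0)"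

text \<open>Two simplices with the common face \<open>s # ss\<close> and the opposite vertices \<open>u\<close>, \<open>w\<close>: the first
  coordinate is the weight of \<open>u\<close> minus the weight of \<open>w\<close>.\<close>

definition open_star :: "nat \<Rightarrow> (nat \<Rightarrow> real) set" where
  "open_star n = {t. (\<forall>i\<ge>n. t i = 0) \<and> (\<forall>i\<in>{1..<n}. 0 < t i) \<and> \<bar>t 0\<bar> + (\<Sum>i\<in>{1..<n}. t i) < 1}"

definition star_chart :: "nat \<Rightarrow> nat \<Rightarrow> nat \<Rightarrow> nat \<Rightarrow> nat list \<Rightarrow> (nat \<Rightarrow> real) \<Rightarrow> nat \<Rightarrow> real" where
  "star_chart n u w s ss t v =
     (if v = u then max (t 0) 0 else if v = w then max (- t 0) 0
      else if v = s then 1 - \<bar>t 0\<bar> - (\<Sum>i\<in>{1..<n}. t i)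
      else \<Sum>i\<in>{1..<n}. if ss ! (i - 1) = v then t i else 0)"

lemma open_simplex_openin: "openin (Euclidean_space n) (open_simplex n)"
proof -
  have "open ((\<Inter>i\<in>{..<n}. {t::nat \<Rightarrow> real. 0 < t i}) \<inter> {t. (\<Sum>i<n. t i) < 1})"
    by (intro open_Int open_INT open_Collect_less ballI continuous_intros finite_lessThan)
  moreover have "open_simplex n = {x. \<forall>i\<ge>n. x i = 0} \<inter> ((\<Inter>i\<in>{..<n}. {t. 0 < t i}) \<inter> {t. (\<Sum>i<n. t i) < 1})"
    by (auto simp: open_simplex_def)
  ultimately show ?thesis
    unfolding Euclidean_space_top_of_set openin_open by blast
qed

lemma open_star_openin: "openin (Euclidean_space n) (open_star n)"
proof -
  have "open ((\<Inter>i\<in>{1..<n}. {t::nat \<Rightarrow> real. 0 < t i}) \<inter> {t. \<bar>t 0\<bar> + (\<Sum>i\<in>{1..<n}. t i) < 1})"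
    by (intro open_Int open_INT open_Collect_less ballI continuous_intros finite_atLeastLessThan)
  moreover have "open_star n = {x. \<forall>i\<ge>n. x i = 0} \<inter> ((\<Inter>i\<in>{1..<n}. {t. 0 < t i}) \<inter> {t. \<bar>t 0\<bar> + (\<Sum>i\<in>{1..<n}. t i) < 1})"
    by (auto simp: open_star_def)
  ultimately show ?thesis
    unfolding Euclidean_space_top_of_set openin_open by blast
qed

text \<open>Convexity, written out coordinatewise.\<close>

lemma connected_if_segments:
  fixes S :: "(nat \<Rightarrow> real) set"
  assumes "\<And>x y t. x \<in> S \<Longrightarrow> y \<in> S \<Longrightarrow> 0 \<le> t \<Longrightarrow> t \<le> 1 \<Longrightarrow> (\<lambda>i. (1 - t) * x i + t * y i) \<in> S"
  shows "connected S"
  unfolding connected_iff_connected_component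
proof (intro ballI)
  fix x y assume xy: "x \<in> S" "y \<in> S"
  let ?f = "\<lambda>t i. (1 - t) * x i + t * y i"
  have "continuous_on {0..1} ?f"
    by (intro continuous_on_coordinatewise_then_product continuous_intros)
  then have "connected (?f ` {0..1::real})"
    by (intro connected_continuous_image) auto
  moreover have "?f ` {0..1} \<subseteq> S" using assms xy by auto
  moreover have "x \<in> ?f ` {0..1}" by (rule image_eqI[where x=0]) simp_all
  moreover have "y \<in> ?f ` {0..1}" by (rule image_eqI[where x=1]) simp_all
  ultimately show "connected_component S x y"
    unfolding connected_component_def by blast
qed

lemma convex_comb_pos: "0 < a \<Longrightarrow> 0 < b \<Longrightarrow> 0 \<le> t \<Longrightarrow> t \<le> 1 \<Longrightarrow> 0 < (1 - t) * a + t * (b::real)"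
  by (cases "t = 0") (auto intro: add_nonneg_pos)

lemma connected_open_simplex: "connected (open_simplex n)"
proof (rule connected_if_segments)
  fix x y and t :: real
  assume xy: "x \<in> open_simplex n" "y \<in> open_simplex n" and t: "0 \<le> t" "t \<le> 1"
  have "0 < (1 - t) * (1 - (\<Sum>i<n. x i)) + t * (1 - (\<Sum>i<n. y i))"
    using xy t by (intro convex_comb_pos) (auto simp: open_simplex_def)
  moreover have "(\<Sum>i<n. (1 - t) * x i + t * y i) = (1 - t) * (\<Sum>i<n. x i) + t * (\<Sum>i<n. y i)"
    by (simp add: sum.distrib sum_distrib_left)
  ultimately have "(\<Sum>i<n. (1 - t) * x i + t * y i) < 1"
    by (simp add: algebra_simps)
  moreover have "0 < (1 - t) * x i + t * y i" if "i < n" for i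
    using xy t that by (intro convex_comb_pos) (auto simp: open_simplex_def)
  ultimately show "(\<lambda>i. (1 - t) * x i + t * y i) \<in> open_simplex n"
    using xy by (simp add: open_simplex_def)
qed

lemma connected_open_star: "connected (open_star n)"
proof (rule connected_if_segments)
  fix x y and t :: real
  assume xy: "x \<in> open_star n" "y \<in> open_star n" and t: "0 \<le> t" "t \<le> 1"
  have "0 < (1 - t) * (1 - \<bar>x 0\<bar> - (\<Sum>i\<in>{1..<n}. x i)) + t * (1 - \<bar>y 0\<bar> - (\<Sum>i\<in>{1..<n}. y i))"
    using xy t by (intro convex_comb_pos) (auto simp: open_star_def)
  moreover have "(\<Sum>i\<in>{1..<n}. (1 - t) * x i + t * y i) = (1 - t) * (\<Sum>i\<in>{1..<n}. x i) + t * (\<Sum>i\<in>{1..<n}. y i)"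
    by (simp add: sum.distrib sum_distrib_left)
  moreover have "\<bar>(1 - t) * x 0 + t * y 0\<bar> \<le> (1 - t) * \<bar>x 0\<bar> + t * \<bar>y 0\<bar>"
    using t abs_triangle_ineq[of "(1 - t) * x 0" "t * y 0"] by (simp add: abs_mult)
  ultimately have "\<bar>(1 - t) * x 0 + t * y 0\<bar> + (\<Sum>i\<in>{1..<n}. (1 - t) * x i + t * y i) < 1"
    by (simp add: algebra_simps)
  moreover have "0 < (1 - t) * x i + t * y i" if "i \<in> {1..<n}" for i
    using xy t that by (intro convex_comb_pos) (auto simp: open_star_def)
  ultimately show "(\<lambda>i. (1 - t) * x i + t * y i) \<in> open_star n"
    using xy by (simp add: open_star_def)
qed

lemma open_simplex_nonempty: "open_simplex n \<noteq> {}"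
proof -
  have "(\<lambda>i. if i < n then 1 / (real n + 1) else 0) \<in> open_simplex n"
    by (simp add: open_simplex_def)
  then show ?thesis by blast
qed

lemma continuous_on_simplex_chart: "continuous_on S (simplex_chart n l)"
proof (rule continuous_on_coordinatewise_then_product)
  fix v
  have "continuous_on S (\<lambda>t. if tl l ! i = v then t i else (0::real))" for i
    by (cases "tl l ! i = v") (auto intro!: continuous_intros)
  then show "continuous_on S (\<lambda>t. simplex_chart n l t v)"
    unfolding simplex_chart_def by (cases "v = hd l") (auto intro!: continuous_intros)
qed

lemma continuous_on_star_chart: "continuous_on S (star_chart n u w s ss)"
proof (rule continuous_on_coordinatewise_then_product)
  fix v
  have "continuous_on S (\<lambda>t. if ss ! (i - 1) = v then t i else (0::real))" for i
    by (cases "ss ! (i - 1) = v") (auto intro!: continuous_intros)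
  then show "continuous_on S (\<lambda>t. star_chart n u w s ss t v)"
    unfolding star_chart_def
    by (cases "v = u"; cases "v = w"; cases "v = s") (auto intro!: continuous_intros)
qed

lemma sum_nth_indicator:
  fixes t :: "nat \<Rightarrow> real"
  assumes "distinct xs" "i < length xs"
  shows "(\<Sum>j<length xs. if xs ! j = xs ! i then t j else 0) = t i"
proof -
  have "(\<Sum>j<length xs. if xs ! j = xs ! i then t j else 0) = (\<Sum>j<length xs. if j = i then t j else 0)"
    using assms by (intro sum.cong) (auto simp: nth_eq_iff_index_eq)
  then show ?thesis using assms by simp
qed

lemma sum_nth_indicator_out:
  fixes t :: "nat \<Rightarrow> real"
  assumes "v \<notin> set xs"
  shows "(\<Sum>j<length xs. if xs ! j = v then t j else 0) = 0"
  using assms by (intro sum.neutral) (auto simp: in_set_conv_nth)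

lemma simplex_chart_values:
  assumes "length vs = n" "distinct (v # vs)"
  shows "simplex_chart n (v # vs) t v = 1 - (\<Sum>i<n. t i)"
    and "i < n \<Longrightarrow> simplex_chart n (v # vs) t (vs ! i) = t i"
    and "x \<notin> set (v # vs) \<Longrightarrow> simplex_chart n (v # vs) t x = 0"
  using assms sum_nth_indicator[of vs i t] sum_nth_indicator_out[of x vs t]
  by (auto simp: simplex_chart_def dest: nth_mem)

lemma star_chart_values:
  assumes "length ss + 1 = n" "distinct (u # w # s # ss)"
  shows "star_chart n u w s ss t u = max (t 0) 0" "star_chart n u w s ss t w = max (- t 0) 0"
    and "star_chart n u w s ss t s = 1 - \<bar>t 0\<bar> - (\<Sum>i\<in>{1..<n}. t i)"
    and "i < length ss \<Longrightarrow> star_chart n u w s ss t (ss ! i) = t (Suc i)"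
    and "x \<notin> set (u # w # s # ss) \<Longrightarrow> star_chart n u w s ss t x = 0"
proof -
  have eq: "(\<Sum>i\<in>{1..<n}. if ss ! (i - 1) = v then t i else 0) = (\<Sum>i<length ss. if ss ! i = v then t (Suc i) else 0)" for v
    using assms(1) sum.shift_bounds_Suc_ivl[of "\<lambda>i. if ss ! (i - 1) = v then t i else 0" 0 "length ss"]
    by (auto simp: lessThan_atLeast0)
  show "star_chart n u w s ss t u = max (t 0) 0" "star_chart n u w s ss t w = max (- t 0) 0"
    "star_chart n u w s ss t s = 1 - \<bar>t 0\<bar> - (\<Sum>i\<in>{1..<n}. t i)"
    using assms(2) by (auto simp: star_chart_def)
  show "star_chart n u w s ss t (ss ! i) = t (Suc i)" if "i < length ss"
  proof -
    have "ss ! i \<noteq> u" "ss ! i \<noteq> w" "ss ! i \<noteq> s"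
      using assms(2) that nth_mem by fastforce+
    then have "star_chart n u w s ss t (ss ! i) = (\<Sum>j<length ss. if ss ! j = ss ! i then t (Suc j) else 0)"
      unfolding star_chart_def eq by simp
    also have "\<dots> = t (Suc i)"
      using sum_nth_indicator[of ss i "\<lambda>j. t (Suc j)"] assms(2) that by simp
    finally show ?thesis .
  qed
  show "star_chart n u w s ss t x = 0" if "x \<notin> set (u # w # s # ss)"
  proof -
    have "star_chart n u w s ss t x = (\<Sum>j<length ss. if ss ! j = x then t (Suc j) else 0)"
      using that unfolding star_chart_def eq by simp
    also have "\<dots> = 0"
      using that by (intro sum_nth_indicator_out) simp
    finally show ?thesis .
  qed
qed

lemma sum_set_nth:
  fixes f :: "nat \<Rightarrow> real"
  assumes "distinct xs"
  shows "sum f (set xs) = (\<Sum>i<length xs. f (xs ! i))"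
  using assms sum.reindex_bij_betw[OF bij_betw_nth[OF assms refl refl], of f] by simp

lemma simplex_chart_realization:
  assumes l: "length vs = n" "distinct (v # vs)" "set (v # vs) \<in> K" and t: "t \<in> open_simplex n"
  shows "simplex_chart n (v # vs) t \<in> topspace (geometric_realization K)"
proof -
  note val = simplex_chart_values[OF l(1,2)]
  let ?f = "simplex_chart n (v # vs) t"
  have pos: "0 < ?f x" if "x \<in> set (v # vs)" for x
    using that val l(1) t by (auto simp: in_set_conv_nth open_simplex_def)
  have supp: "{x. ?f x \<noteq> 0} = set (v # vs)"
  proof (rule Set.set_eqI)
    fix x
    show "x \<in> {x. ?f x \<noteq> 0} \<longleftrightarrow> x \<in> set (v # vs)"
      using pos[of x] val(3)[of x] by (cases "x \<in> set (v # vs)") auto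
  qed
  have "sum ?f (set (v # vs)) = ?f v + sum ?f (set vs)"
    using l(2) by simp
  also have "sum ?f (set vs) = (\<Sum>i<n. t i)"
    using l sum_set_nth[of vs ?f] val(2) by simp
  finally have "sum ?f (set (v # vs)) = 1" using val(1) by simp
  moreover have "0 \<le> ?f x" for x
    using pos[of x] val(3)[of x] by (cases "x \<in> set (v # vs)") auto
  ultimately show ?thesis
    using l(3) supp by (simp add: geometric_realization_def)
qed

text \<open>The support of the point is the common face, enlarged by u or w according to the sign of
  \<open>t 0\<close>; these are the three members of \<open>K\<close> assumed.\<close>

lemma star_chart_realization:
  assumes l: "length ss + 1 = n" "distinct (u # w # s # ss)"
    and K: "set (s # ss) \<in> K" "set (u # s # ss) \<in> K" "set (w # s # ss) \<in> K"
    and t: "t \<in> open_star n"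
  shows "star_chart n u w s ss t \<in> topspace (geometric_realization K)"
proof -
  note val = star_chart_values[OF l]
  let ?f = "star_chart n u w s ss t"
  have pos: "0 < ?f x" if "x \<in> set (s # ss)" for x
    using that val l(1) t by (auto simp: in_set_conv_nth open_star_def)
  have "{x. ?f x \<noteq> 0} = set (s # ss) \<union> (if 0 < t 0 then {u} else if t 0 < 0 then {w} else {})" (is "_ = ?S")
  proof (rule Set.set_eqI)
    fix x
    show "x \<in> {x. ?f x \<noteq> 0} \<longleftrightarrow> x \<in> ?S"
      using pos[of x] val(1,2) val(5)[of x] l(2)
      by (cases "x \<in> set (s # ss)"; cases "x = u"; cases "x = w") (auto simp: max_def)
  qed
  moreover have "?S \<in> K" using K by (auto simp: insert_commute)
  ultimately have K': "{x. ?f x \<noteq> 0} \<in> K" by simp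
  have "(\<Sum>x | ?f x \<noteq> 0. ?f x) = sum ?f (set (u # w # s # ss))"
    using val(5) by (intro sum.mono_neutral_left) auto
  also have "\<dots> = ?f u + ?f w + ?f s + sum ?f (set ss)"
    using l(2) by simp
  also have "sum ?f (set ss) = (\<Sum>i<length ss. t (Suc i))"
    using l sum_set_nth[of ss ?f] val(4) by simp
  also have "\<dots> = (\<Sum>i\<in>{1..<n}. t i)"
    using l(1) sum.shift_bounds_Suc_ivl[of t 0 "length ss"] by (auto simp: lessThan_atLeast0)
  finally have "(\<Sum>x | ?f x \<noteq> 0. ?f x) = 1" using val(1-3) by (simp add: max_def)
  moreover have "0 \<le> ?f x" for x
    using pos[of x] val(1,2) val(5)[of x] by (cases "x \<in> set (u # w # s # ss)") auto
  ultimately show ?thesis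
    using K' by (simp add: geometric_realization_def)
qed

lemma geometric_realization_top_of_set:
  "geometric_realization K = top_of_set (topspace (geometric_realization K))"
  by (simp add: geometric_realization_def euclidean_product_topology)

lemma Euclidean_subspace_top_of_set:
  "openin (Euclidean_space n) V \<Longrightarrow> subtopology (Euclidean_space n) V = top_of_set V"
  using openin_subset[of "Euclidean_space n" V]
  by (simp add: Euclidean_space_top_of_set subtopology_subtopology topspace_Euclidean_space inf_absorb2)

lemma continuous_map_realization:
  assumes "openin (Euclidean_space n) V" "continuous_on V f" "\<And>t. t \<in> V \<Longrightarrow> f t \<in> topspace (geometric_realization K)"
  shows "continuous_map (subtopology (Euclidean_space n) V) (geometric_realization K) f"
  unfolding Euclidean_subspace_top_of_set[OF assms(1)]
  by (subst geometric_realization_top_of_set, rule continuous_map_top_of_setI[OF assms(2)]) (rule assms(3))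

lemma inj_on_simplex_chart:
  assumes "length vs = n" "distinct (v # vs)"
  shows "inj_on (simplex_chart n (v # vs)) (open_simplex n)"
proof (rule inj_onI)
  fix x y assume xy: "x \<in> open_simplex n" "y \<in> open_simplex n" "simplex_chart n (v # vs) x = simplex_chart n (v # vs) y"
  show "x = y"
  proof
    fix i
    show "x i = y i"
    proof (cases "i < n")
      case True
      then show ?thesis
        using simplex_chart_values(2)[OF assms True, of x] simplex_chart_values(2)[OF assms True, of y] xy(3) by simp
    qed (use xy in \<open>simp add: open_simplex_def\<close>)
  qed
qed

lemma inj_on_star_chart:
  assumes "length ss + 1 = n" "distinct (u # w # s # ss)"
  shows "inj_on (star_chart n u w s ss) (open_star n)"
proof (rule inj_onI)
  fix x y assume xy: "x \<in> open_star n" "y \<in> open_star n" "star_chart n u w s ss x = star_chart n u w s ss y"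
  note val = star_chart_values[OF assms]
  show "x = y"
  proof
    fix i
    consider "i = 0" | j where "i = Suc j" "j < length ss" | "n \<le> i"
      by (cases i; cases "i - 1 < length ss") (use assms(1) in auto)
    then show "x i = y i"
    proof cases
      case 1
      have "max (x 0) 0 = max (y 0) 0" "max (- x 0) 0 = max (- y 0) 0"
        using val(1)[of x] val(1)[of y] val(2)[of x] val(2)[of y] xy(3) by simp_all
      then show ?thesis using 1 by (auto simp: max_def split: if_splits)
    next
      case 2
      then show ?thesis using val(4)[of j x] val(4)[of j y] xy(3) by simp
    qed (use xy in \<open>simp add: open_star_def\<close>)
  qed
qed

section \<open>Signs of ordered simplices\<close>

locale triangulated_manifold =
  fixes K :: "nat set set" and n :: nat and \<mu> :: "(nat \<Rightarrow> real) \<Rightarrow> (nat \<Rightarrow> real) chain set"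
    and g :: "(nat \<Rightarrow> real) chain set"
  assumes n1: "1 \<le> n" and complex: "finite_simplicial_complex K"
    and mwb: "manifold_with_boundary n (geometric_realization K)"
    and ori: "orientation_on n (manifold_interior n (geometric_realization K)) \<mu>"
    and gen: "infinite_cyclic_group (local_group n) g"
begin

abbreviation "M \<equiv> manifold_interior n (geometric_realization K)"

sublocale oriented_manifold n M \<mu> g
proof (rule oriented_manifold.intro)
  show "Hausdorff_space M"
    using mwb by (auto simp: manifold_with_boundary_def manifold_interior_def intro: Hausdorff_space_subtopology)
qed (fact n1 ori gen)+

text \<open>The sign of the chart given by the order of the vertices. It is defined on lists so that
  its behaviour under reordering can be stated and proved.\<close>

definition lsign :: "nat list \<Rightarrow> int" where
  "lsign l = (THE k. chart_sign n g M \<mu> (open_simplex n) (simplex_chart n l) k)"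

lemma simplex_open_chart:
  assumes "length vs = n" "distinct (v # vs)" "set (v # vs) \<in> K"
  shows "open_chart n M (open_simplex n) (simplex_chart n (v # vs))"
proof (rule open_chart_interior[OF mwb open_simplex_openin connected_open_simplex open_simplex_nonempty])
  show "continuous_map (subtopology (Euclidean_space n) (open_simplex n)) (geometric_realization K) (simplex_chart n (v # vs))"
    by (rule continuous_map_realization[OF open_simplex_openin continuous_on_simplex_chart simplex_chart_realization[OF assms]])
qed (rule inj_on_simplex_chart[OF assms(1,2)])

lemma lsign_iff:
  assumes "length vs = n" "distinct (v # vs)" "set (v # vs) \<in> K"
  shows "chart_sign n g M \<mu> (open_simplex n) (simplex_chart n (v # vs)) k \<longleftrightarrow> k = lsign (v # vs)"
  using chart_sign_exists(1)[OF simplex_open_chart[OF assms]] theI'[OF chart_sign_exists(1)[OF simplex_open_chart[OF assms]]]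
  unfolding lsign_def by metis

lemma lsign_pm1:
  assumes "length vs = n" "distinct (v # vs)" "set (v # vs) \<in> K"
  shows "lsign (v # vs) = 1 \<or> lsign (v # vs) = -1"
  using chart_sign_exists(2)[OF simplex_open_chart[OF assms], of "lsign (v # vs)"] lsign_iff[OF assms] by blast

lemma continuous_map_open_subset:
  assumes "openin (Euclidean_space n) V" "openin (Euclidean_space n) V'" "continuous_on V' A" "\<And>t. t \<in> V' \<Longrightarrow> A t \<in> V"
  shows "continuous_map (EV V') (EV V) A"
  unfolding Euclidean_subspace_top_of_set[OF assms(1)] Euclidean_subspace_top_of_set[OF assms(2)]
  by (rule continuous_map_top_of_setI[OF assms(3,4)])

text \<open>Vertices behind the first correspond to coordinates, so the swap exchanges two
  coordinates.\<close>

lemma lsign_swap_tail: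
  assumes "length (xs @ x # y # ys) = n" "distinct (v # xs @ x # y # ys)" "set (v # xs @ x # y # ys) \<in> K"
  shows "lsign (v # xs @ y # x # ys) = - lsign (v # xs @ x # y # ys)"
proof -
  let ?l = "xs @ x # y # ys" and ?l' = "xs @ y # x # ys"
  let ?a = "length xs" and ?b = "Suc (length xs)"
  let ?A = "swap_path ?a ?b 1"
  have l': "length ?l' = n" "distinct (v # ?l')" "set (v # ?l') \<in> K"
    using assms by (auto simp: insert_commute)
  have A: "?A t i = (if i = ?a then t ?b else if i = ?b then t ?a else t i)" for t i
    by (simp add: swap_path_def)
  have bn: "?b < n" using assms(1) by simp
  have sumA: "(\<Sum>i<n. ?A t i) = (\<Sum>i<n. t i)" for t
    using bn by (intro sum.reindex_bij_witness[of _ "Transposition.transpose ?a ?b" "Transposition.transpose ?a ?b"])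
      (auto simp: A Transposition.transpose_def split: if_splits)
  have maps: "?A t \<in> open_simplex n" if "t \<in> open_simplex n" for t
    using that bn unfolding open_simplex_def mem_Collect_eq sumA by (auto simp: A)
  have cont: "continuous_on S ?A" for S
  proof (rule continuous_on_coordinatewise_then_product)
    show "continuous_on S (\<lambda>t. ?A t i)" for i
      unfolding A by (cases "i = ?a"; cases "i = ?b") (auto intro!: continuous_intros)
  qed
  have "?A (?A t) = t" for t by (auto simp: A fun_eq_iff)
  then have inj: "inj_on ?A S" for S by (metis inj_onI)
  have eq: "simplex_chart n (v # ?l') t = simplex_chart n (v # ?l) (?A t)" for t
  proof
    fix z
    have "(\<Sum>i<n. if ?l' ! i = z then t i else 0) = (\<Sum>i<n. if ?l ! i = z then ?A t i else 0)"
      using bn by (intro sum.reindex_bij_witness[of _ "Transposition.transpose ?a ?b" "Transposition.transpose ?a ?b"])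
        (auto simp: A Transposition.transpose_def nth_append nth_Cons' split: if_splits)
    then show "simplex_chart n (v # ?l') t z = simplex_chart n (v # ?l) (?A t) z"
      by (simp only: simplex_chart_def sumA list.sel)
  qed
  have "chart_sign n g M \<mu> (open_simplex n) (simplex_chart n (v # ?l')) (- lsign (v # ?l))"
  proof (rule chart_sign_flip[OF simplex_open_chart[OF assms] simplex_open_chart[OF l'], where A="?A" and h="?A"])
    show "continuous_map (EV (open_simplex n)) (EV (open_simplex n)) ?A"
      by (rule continuous_map_open_subset[OF open_simplex_openin open_simplex_openin cont maps])
    show "inj_on ?A (open_simplex n)" by (rule inj)
    show "inverts_local_group n ?A"
      by (rule inverts_local_group_swap) (use bn in simp_all)
    show "shift (?A z) (?A x) = ?A (shift z x)" for x z
      by (auto simp: shift_def A fun_eq_iff)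
    show "chart_sign n g M \<mu> (open_simplex n) (simplex_chart n (v # ?l)) (lsign (v # ?l))"
      using lsign_iff[OF assms] by blast
  qed (rule eq)
  then show ?thesis using lsign_iff[OF l'] by simp
qed

text \<open>The first vertex carries the remaining weight, so the swap replaces coordinate 0 by 1
  minus the sum of all coordinates; the linear part of this affine map is
  \<open>shear n 1\<close>.\<close>

lemma lsign_swap_head:
  assumes "length (w # vs) = n" "distinct (v # w # vs)" "set (v # w # vs) \<in> K"
  shows "lsign (w # v # vs) = - lsign (v # w # vs)"
proof -
  let ?A = "\<lambda>t i. if i = 0 then 1 - (\<Sum>j<n. t j) else (t i :: real)"
  have l': "length (v # vs) = n" "distinct (w # v # vs)" "set (w # v # vs) \<in> K"
    using assms by (auto simp: insert_commute)
  have split: "(\<Sum>j<n. f j) = f 0 + (\<Sum>j\<in>{1..<n}. f j)" for f :: "nat \<Rightarrow> real"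
    using n1 sum.atLeast_Suc_lessThan[of 0 n f] by (simp add: lessThan_atLeast0)
  have tailA: "(\<Sum>j\<in>{1..<n}. ?A t j) = (\<Sum>j\<in>{1..<n}. t j)" for t
    by (intro sum.cong) auto
  have sumA: "(\<Sum>i<n. ?A t i) = 1 - t 0" for t
    unfolding split[of "?A t"] tailA unfolding split[of t] by simp
  have maps: "?A t \<in> open_simplex n" if "t \<in> open_simplex n" for t
    using that n1 unfolding open_simplex_def mem_Collect_eq sumA by auto
  have cont: "continuous_on S ?A" for S
  proof (rule continuous_on_coordinatewise_then_product)
    show "continuous_on S (\<lambda>t. ?A t i)" for i
      by (cases "i = 0") (auto intro!: continuous_intros)
  qed
  have "?A (?A t) = t" for t
    unfolding sumA by (auto simp: fun_eq_iff)
  then have inj: "inj_on ?A S" for S by (rule inj_on_inverseI[where g="?A"])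
  have eq: "simplex_chart n (w # v # vs) t = simplex_chart n (v # w # vs) (?A t)" for t
  proof
    fix z
    have sp: "(\<Sum>i<n. if (x # vs) ! i = z then f i else 0) = (if x = z then f 0 else 0) + (\<Sum>i\<in>{1..<n}. if vs ! (i - 1) = z then f i else 0)"
      for x and f :: "nat \<Rightarrow> real"
      unfolding split by (auto intro!: sum.cong simp: nth_Cons')
    have "(\<Sum>i\<in>{1..<n}. if vs ! (i - 1) = z then ?A t i else 0) = (\<Sum>i\<in>{1..<n}. if vs ! (i - 1) = z then t i else 0)"
      by (intro sum.cong) auto
    moreover have "(\<Sum>i\<in>{1..<n}. if vs ! (i - 1) = z then t i else 0) = 0" if "z = v \<or> z = w"
    proof (intro sum.neutral ballI)
      fix i assume "i \<in> {1..<n}"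
      then have "vs ! (i - 1) \<in> set vs" using assms(1) by (intro nth_mem) auto
      then show "(if vs ! (i - 1) = z then t i else 0) = 0" using assms(2) that by auto
    qed
    ultimately show "simplex_chart n (w # v # vs) t z = simplex_chart n (v # w # vs) (?A t) z"
      using assms(2) unfolding simplex_chart_def list.sel sumA sp by auto
  qed
  have "chart_sign n g M \<mu> (open_simplex n) (simplex_chart n (w # v # vs)) (- lsign (v # w # vs))"
  proof (rule chart_sign_flip[OF simplex_open_chart[OF assms] simplex_open_chart[OF l'], where A="?A" and h="shear n 1"])
    show "continuous_map (EV (open_simplex n)) (EV (open_simplex n)) ?A"
      by (rule continuous_map_open_subset[OF open_simplex_openin open_simplex_openin cont maps])
    show "inj_on ?A (open_simplex n)" by (rule inj)
    show "inverts_local_group n (shear n 1)"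
      by (rule inverts_local_group_shear[OF n1])
    show "shift (?A z) (?A x) = shear n 1 (shift z x)" for x z
      by (auto simp: shift_def shear_def fun_eq_iff split[of x] split[of z] sum_subtractf)
    show "chart_sign n g M \<mu> (open_simplex n) (simplex_chart n (v # w # vs)) (lsign (v # w # vs))"
      using lsign_iff[OF assms] by blast
  qed (rule eq)
  then show ?thesis using lsign_iff[OF l'] by simp
qed

lemma alternating_lsign:
  assumes "S \<in> K" "card S = Suc n"
  shows "alternating S lsign"
  unfolding alternating_def
proof (intro allI impI)
  fix xs x y ys
  assume d: "distinct (xs @ x # y # ys)" "set (xs @ x # y # ys) = S"
  then have len: "length (xs @ x # y # ys) = Suc n"
    using distinct_card[OF d(1)] assms(2) by simp
  show "lsign (xs @ y # x # ys) = - lsign (xs @ x # y # ys)"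
  proof (cases xs)
    case Nil
    then show ?thesis
      using lsign_swap_head[of y ys x] d len assms by simp
  next
    case (Cons v vs)
    then show ?thesis
      using lsign_swap_tail[of vs x y ys v] d len assms by simp
  qed
qed

lemma star_open_chart:
  assumes "length ss + 1 = n" "distinct (u # w # s # ss)"
    and K: "set (s # ss) \<in> K" "set (u # s # ss) \<in> K" "set (w # s # ss) \<in> K"
  shows "open_chart n M (open_star n) (star_chart n u w s ss)"
proof (rule open_chart_interior[OF mwb open_star_openin connected_open_star])
  \<comment> \<open>The centre of the common facet: each of its n vertices has weight 1/n, that of s
    being the remainder.\<close>
  have "(\<lambda>i. if 1 \<le> i \<and> i < n then 1 / real n else 0) \<in> open_star n"
    using n1 by (simp add: open_star_def field_simps of_nat_diff)
  then show "open_star n \<noteq> {}" by blast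
  show "continuous_map (subtopology (Euclidean_space n) (open_star n)) (geometric_realization K) (star_chart n u w s ss)"
    by (rule continuous_map_realization[OF open_star_openin continuous_on_star_chart star_chart_realization[OF assms]])
qed (rule inj_on_star_chart[OF assms(1,2)])

lemma face_in_complex: "S \<in> K \<Longrightarrow> T \<subseteq> S \<Longrightarrow> T \<noteq> {} \<Longrightarrow> T \<in> K"
  using complex unfolding finite_simplicial_complex_def by blast

text \<open>Both simplices are halves of one star, and exchanging u and w reflects its coordinate 0.
  Hence, written with s in front, they receive opposite signs from the sign \<open>k\<close> of the
  star; moving s back behind the opposite vertex negates both.\<close>

lemma lsign_adjacent:
  assumes len: "length ss + 1 = n" and d: "distinct (u # w # s # ss)"
    and K: "set (u # s # ss) \<in> K" "set (w # s # ss) \<in> K"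
  shows "lsign (u # s # ss) + lsign (w # s # ss) = 0"
proof -
  have K0: "set (s # ss) \<in> K"
    using face_in_complex[OF K(1), of "set (s # ss)"] by auto
  note star = star_open_chart[OF len d K0 K]
  note val = star_chart_values[OF len d]
  obtain k where k: "chart_sign n g M \<mu> (open_star n) (star_chart n u w s ss) k"
    using chart_sign_exists(1)[OF star] by blast
  have r0: "reflect0 t 0 = - t 0" and r1: "i \<noteq> 0 \<Longrightarrow> reflect0 t i = t i" for t i
    by (simp_all add: reflect0_def)
  have sumr: "(\<Sum>i\<in>{1..<n}. reflect0 t i) = (\<Sum>i\<in>{1..<n}. t i)" for t
    by (intro sum.cong) (auto simp: r1)
  have rstar: "reflect0 t \<in> open_star n" if "t \<in> open_star n" for t
    using that n1 unfolding open_star_def mem_Collect_eq sumr by (auto simp: r0 r1)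
  have rr: "reflect0 (reflect0 t) = t" for t by (auto simp: reflect0_def fun_eq_iff)
  then have inj: "inj_on reflect0 S" for S by (metis inj_onI)
  have contr: "continuous_on S reflect0" for S
  proof (rule continuous_on_coordinatewise_then_product)
    show "continuous_on S (\<lambda>t. reflect0 t i)" for i
      by (cases "i = 0") (auto simp: reflect0_def intro!: continuous_intros)
  qed
  have sub: "t \<in> open_star n" if "t \<in> open_simplex n" for t
    using that n1 sum.atLeast_Suc_lessThan[of 0 n t] by (auto simp: open_simplex_def open_star_def lessThan_atLeast0)
  have shr: "shift (reflect0 z) (reflect0 x) = reflect0 (shift z x)" for x z
    by (auto simp: shift_def reflect0_def fun_eq_iff)
  have swap: "star_chart n w u s ss t = star_chart n u w s ss (reflect0 t)" for t
  proof
    fix v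
    show "star_chart n w u s ss t v = star_chart n u w s ss (reflect0 t) v"
      using d unfolding star_chart_def sumr r0
      by (auto intro!: sum.cong simp: r1)
  qed
  have d': "distinct (w # u # s # ss)" using d by auto
  note star' = star_open_chart[OF len d' K0 K(2,1)]
  have k': "chart_sign n g M \<mu> (open_star n) (star_chart n w u s ss) (- k)"
    by (rule chart_sign_flip[OF star star' continuous_map_open_subset[OF open_star_openin open_star_openin contr rstar] inj
          swap inverts_local_group_reflect0[OF n1] shr k])
  \<comment> \<open>The simplex of u is compared with the star chart that lists w before u. There
    its points have negative coordinate 0, so the comparison is a reflection, to which
    \<open>chart_sign_flip\<close> applies.\<close>
  have restrict: "lsign (s # u # ss) = - j"
    if u: "length ss + 1 = n" "distinct (u # w # s # ss)" "set (u # s # ss) \<in> K"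
      and open_chart: "open_chart n M (open_star n) (star_chart n w u s ss)"
      and j: "chart_sign n g M \<mu> (open_star n) (star_chart n w u s ss) j" for u w j
  proof -
    have l: "length (u # ss) = n" "distinct (s # u # ss)" "set (s # u # ss) \<in> K"
      using u by (auto simp: insert_commute)
    have maps: "reflect0 t \<in> open_star n" if "t \<in> open_simplex n" for t
      by (rule rstar[OF sub[OF that]])
    have eq: "simplex_chart n (s # u # ss) t = star_chart n w u s ss (reflect0 t)" if t: "t \<in> open_simplex n" for t
    proof
      fix v
      note sval = simplex_chart_values[where t=t, OF l(1,2)]
      have dw: "distinct (w # u # s # ss)" using u by auto
      note stval = star_chart_values[where t="reflect0 t", OF u(1) dw]
      have t0: "0 < t 0" using t n1 by (simp add: open_simplex_def)
      have spl: "(\<Sum>i<n. t i) = t 0 + (\<Sum>i\<in>{1..<n}. t i)"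
        using n1 sum.atLeast_Suc_lessThan[of 0 n t] by (simp add: lessThan_atLeast0)
      consider "v = s" | "v = u" | i where "i < length ss" "v = ss ! i" | "v \<notin> set (s # u # ss)"
        by (metis in_set_conv_nth set_ConsD)
      then show "simplex_chart n (s # u # ss) t v = star_chart n w u s ss (reflect0 t) v"
      proof cases
        case 1
        then show ?thesis using sval(1) stval(3) t0 unfolding sumr r0 spl by simp
      next
        case 2
        then show ?thesis using sval(2)[of 0] stval(2) t0 n1 by (simp add: r0)
      next
        case 3
        then show ?thesis using sval(2)[of "Suc i"] stval(4)[of i] u(1) by (simp add: r1)
      next
        case 4
        show ?thesis
        proof (cases "v = w")
          case True
          then show ?thesis using sval(3)[OF 4] stval(1) t0 by (simp add: r0)
        next
          case False
          then show ?thesis using sval(3)[OF 4] stval(5)[of v] 4 by auto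
        qed
      qed
    qed
    have "chart_sign n g M \<mu> (open_simplex n) (simplex_chart n (s # u # ss)) (- j)"
      by (rule chart_sign_flip[OF open_chart simplex_open_chart[OF l] continuous_map_open_subset[OF open_star_openin open_simplex_openin contr maps] inj
          eq inverts_local_group_reflect0[OF n1] shr j])
    then show ?thesis using lsign_iff[OF l] by simp
  qed
  have "lsign (s # u # ss) = k" "lsign (s # w # ss) = - k"
    using restrict[OF len d K(1) star' k'] restrict[OF len d' K(2) star k] by simp_all
  moreover have "lsign (x # s # ss) = - lsign (s # x # ss)" if "x \<notin> set (s # ss)" "set (x # s # ss) \<in> K" for x
    using lsign_swap_head[of x ss s] that len d by (simp add: insert_commute)
  ultimately show ?thesis using d K by simp
qed

end

section \<open>From simplex signs to matrix entries\<close>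

lemma set_remove_nth:
  assumes "i < length xs" "distinct xs"
  shows "set (take i xs @ drop (Suc i) xs) = set xs - {xs ! i}"
proof -
  have "xs = take i xs @ xs ! i # drop (Suc i) xs"
    using assms(1) by (rule id_take_nth_drop)
  then have "distinct (take i xs @ xs ! i # drop (Suc i) xs)" "set xs = set (take i xs @ xs ! i # drop (Suc i) xs)"
    using assms(2) by metis+
  then show ?thesis by auto
qed

text \<open>At most one face of \<tau> is \<sigma>, so at most one summand survives. Expressed
  through an arbitrary alternating \<open>f\<close>, the coefficient no longer mentions the position
  of the missing vertex.\<close>

lemma boundary_matrix_entry:
  assumes "distinct \<sigma>" "distinct \<tau>" "length \<tau> = Suc (length \<sigma>)"
  defines "b \<equiv> (\<Sum>k<length \<tau>. (- 1) ^ k * orientation_sign \<sigma> (take k \<tau> @ drop (Suc k) \<tau>))"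
  shows "b = 0 \<or> (\<exists>v. v \<notin> set \<sigma> \<and> set \<tau> = insert v (set \<sigma>) \<and>
    (\<forall>f. alternating (set \<tau>) f \<longrightarrow> b * f \<tau> = f (v # \<sigma>)))"
proof (cases "\<exists>k<length \<tau>. set \<sigma> = set \<tau> - {\<tau> ! k}")
  case True
  then obtain k where k: "k < length \<tau>" "set \<sigma> = set \<tau> - {\<tau> ! k}" by blast
  have set: "set (take i \<tau> @ drop (Suc i) \<tau>) = set \<tau> - {\<tau> ! i}" if "i < length \<tau>" for i
    using set_remove_nth[of i \<tau>] that assms(2) by simp
  have "orientation_sign \<sigma> (take i \<tau> @ drop (Suc i) \<tau>) = 0" if "i < length \<tau>" "i \<noteq> k" for i
  proof -
    have "\<tau> ! i \<in> set \<sigma>"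
      using k that assms(2) nth_eq_iff_index_eq[OF assms(2)] by auto
    then show ?thesis using set[OF that(1)] by (auto simp: orientation_sign_def)
  qed
  then have "b = (- 1) ^ k * orientation_sign \<sigma> (take k \<tau> @ drop (Suc k) \<tau>)"
    unfolding b_def using k(1) by (subst sum.remove[of _ k]) (auto intro!: sum.neutral)
  moreover have "\<tau> ! k \<notin> set \<sigma>" "set \<tau> = insert (\<tau> ! k) (set \<sigma>)"
    unfolding k(2) using nth_mem[OF k(1)] by (simp_all add: insert_absorb)
  ultimately show ?thesis
    using alternating_boundary_coefficient[OF _ assms(2,1) k] by blast
next
  case False
  have set: "set (take i \<tau> @ drop (Suc i) \<tau>) = set \<tau> - {\<tau> ! i}" if "i < length \<tau>" for i
    using set_remove_nth[of i \<tau>] that assms(2) by simp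
  have "b = 0"
    unfolding b_def using False set by (intro sum.neutral) (auto simp: orientation_sign_def)
  then show ?thesis ..
qed

text \<open>A flipped nonzero entry is the sign of the cone of the face with the opposite vertex v.
  Distinct simplices over one face have distinct opposite vertices, and
  \<open>lsign_adjacent\<close> makes their signs opposite.\<close>

theorem boundary_matrix_orientable:
  assumes K: "triangulates_compact_orientable_manifold K (p + 1)"
    and \<sigma>s: "oriented_basis K p \<sigma>s" and \<tau>s: "oriented_basis K (p + 1) \<tau>s"
  defines "D \<equiv> boundary_matrix \<sigma>s \<tau>s"
  obtains s :: "nat \<Rightarrow> int" where "\<And>j. s j = 1 \<or> s j = -1"
    "\<And>i j. i < length \<sigma>s \<Longrightarrow> j < length \<tau>s \<Longrightarrow> D $$ (i, j) = 0 \<or> D $$ (i, j) = 1 \<or> D $$ (i, j) = -1"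
    "\<And>i j j'. i < length \<sigma>s \<Longrightarrow> j < length \<tau>s \<Longrightarrow> j' < length \<tau>s \<Longrightarrow> j \<noteq> j' \<Longrightarrow>
       D $$ (i, j) \<noteq> 0 \<Longrightarrow> D $$ (i, j') \<noteq> 0 \<Longrightarrow> s j * D $$ (i, j) + s j' * D $$ (i, j') = 0"
proof -
  let ?n = "p + 1"
  obtain \<mu> where \<mu>: "orientation_on ?n (manifold_interior ?n (geometric_realization K)) \<mu>"
    using K by (auto simp: triangulates_compact_orientable_manifold_def compact_orientable_manifold_def)
  obtain g where g: "infinite_cyclic_group (local_group ?n) g"
    by (rule local_group_infinite_cyclic[of ?n]) auto
  have "finite_simplicial_complex K" "manifold_with_boundary ?n (geometric_realization K)"
    using K unfolding triangulates_compact_orientable_manifold_def compact_orientable_manifold_def by blast+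
  then interpret triangulated_manifold K ?n \<mu> g
    by (intro triangulated_manifold.intro \<mu> g) simp_all
  have \<tau>: "distinct (\<tau>s ! j)" "set (\<tau>s ! j) \<in> K" "card (set (\<tau>s ! j)) = Suc ?n" "length (\<tau>s ! j) = Suc ?n" if "j < length \<tau>s" for j
  proof -
    show 1: "distinct (\<tau>s ! j)" using \<tau>s that by (auto simp: oriented_basis_def)
    have "set (\<tau>s ! j) \<in> simplices K ?n" using \<tau>s that by (auto simp: oriented_basis_def)
    then show "set (\<tau>s ! j) \<in> K" "card (set (\<tau>s ! j)) = Suc ?n" by (auto simp: simplices_def)
    then show "length (\<tau>s ! j) = Suc ?n" using distinct_card[OF 1] by simp
  qed
  have \<sigma>: "distinct (\<sigma>s ! i)" "length (\<sigma>s ! i) = ?n" if "i < length \<sigma>s" for i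
  proof -
    show 1: "distinct (\<sigma>s ! i)" using \<sigma>s that by (auto simp: oriented_basis_def)
    have "set (\<sigma>s ! i) \<in> simplices K p" using \<sigma>s that by (auto simp: oriented_basis_def)
    then show "length (\<sigma>s ! i) = ?n" using distinct_card[OF 1] by (auto simp: simplices_def)
  qed
  have pm1: "lsign l = 1 \<or> lsign l = -1" if "distinct l" "length l = Suc ?n" "set l \<in> K" for l
    using that lsign_pm1[of "tl l" "hd l"] by (cases l) auto
  have entry: "\<exists>v. v \<notin> set (\<sigma>s ! i) \<and> set (\<tau>s ! j) = insert v (set (\<sigma>s ! i)) \<and> D $$ (i, j) * lsign (\<tau>s ! j) = lsign (v # \<sigma>s ! i)"
    if ij: "i < length \<sigma>s" "j < length \<tau>s" and nz: "D $$ (i, j) \<noteq> 0" for i j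
  proof -
    have "D $$ (i, j) = (\<Sum>k<length (\<tau>s ! j). (- 1) ^ k * orientation_sign (\<sigma>s ! i) (take k (\<tau>s ! j) @ drop (Suc k) (\<tau>s ! j)))"
      using ij by (simp add: D_def boundary_matrix_def)
    then show ?thesis
      using boundary_matrix_entry[of "\<sigma>s ! i" "\<tau>s ! j"] \<tau>[OF ij(2)] \<sigma>[OF ij(1)] nz alternating_lsign[of "set (\<tau>s ! j)"] by auto
  qed
  \<comment> \<open>The value 1 beyond the range makes the sign condition hold for all j.\<close>
  define s where "s j = (if j < length \<tau>s then lsign (\<tau>s ! j) else 1)" for j
  have s: "s j = 1 \<or> s j = -1" for j
    using pm1 \<tau> by (auto simp: s_def)
  have D1: "D $$ (i, j) = 0 \<or> D $$ (i, j) = 1 \<or> D $$ (i, j) = -1" if ij: "i < length \<sigma>s" "j < length \<tau>s" for i j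
  proof (cases "D $$ (i, j) = 0")
    case False
    from entry[OF ij this] obtain v where v: "v \<notin> set (\<sigma>s ! i)" "set (\<tau>s ! j) = insert v (set (\<sigma>s ! i))"
      "D $$ (i, j) * lsign (\<tau>s ! j) = lsign (v # \<sigma>s ! i)" by blast
    have "lsign (v # \<sigma>s ! i) = 1 \<or> lsign (v # \<sigma>s ! i) = -1"
      using pm1[of "v # \<sigma>s ! i"] v(1,2) \<sigma>[OF ij(1)] \<tau>(2)[OF ij(2)] by simp
    then show ?thesis using v(3) pm1[of "\<tau>s ! j"] \<tau>[OF ij(2)] by auto
  qed simp
  have inj: "j = j'" if "j < length \<tau>s" "j' < length \<tau>s" "set (\<tau>s ! j) = set (\<tau>s ! j')" for j j'
    using \<tau>s that nth_eq_iff_index_eq[of "map set \<tau>s" j j'] by (auto simp: oriented_basis_def)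
  have cons: "\<exists>a as. \<sigma>s ! i = a # as \<and> length as + 1 = ?n" if "i < length \<sigma>s" for i
    using \<sigma>(2)[OF that] by (cases "\<sigma>s ! i") auto
  have two: "s j * D $$ (i, j) + s j' * D $$ (i, j') = 0"
    if ij: "i < length \<sigma>s" "j < length \<tau>s" "j' < length \<tau>s" "j \<noteq> j'" "D $$ (i, j) \<noteq> 0" "D $$ (i, j') \<noteq> 0" for i j j'
  proof -
    obtain v v' where v: "v \<notin> set (\<sigma>s ! i)" "set (\<tau>s ! j) = insert v (set (\<sigma>s ! i))" "D $$ (i, j) * lsign (\<tau>s ! j) = lsign (v # \<sigma>s ! i)"
      and v': "v' \<notin> set (\<sigma>s ! i)" "set (\<tau>s ! j') = insert v' (set (\<sigma>s ! i))" "D $$ (i, j') * lsign (\<tau>s ! j') = lsign (v' # \<sigma>s ! i)"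
      using entry[OF ij(1,2,5)] entry[OF ij(1,3,6)] by blast
    have "v \<noteq> v'" using inj[OF ij(2,3)] ij(4) v v' by auto
    obtain a as where a: "\<sigma>s ! i = a # as" "length as + 1 = ?n" using cons[OF ij(1)] by blast
    have "lsign (v # a # as) + lsign (v' # a # as) = 0"
    proof (rule lsign_adjacent[OF a(2)])
      show "distinct (v # v' # a # as)"
        using \<open>v \<noteq> v'\<close> v(1) v'(1) \<sigma>(1)[OF ij(1)] by (auto simp: a(1))
      show "set (v # a # as) \<in> K" "set (v' # a # as) \<in> K"
        using \<tau>(2)[OF ij(2)] \<tau>(2)[OF ij(3)] unfolding v(2) v'(2) a(1) by simp_all
    qed
    then show ?thesis
      using v(3) v'(3) ij by (simp add: s_def a(1) mult.commute)
  qed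
  show ?thesis
  proof (rule that)
    show "s j = 1 \<or> s j = -1" for j by (rule s)
    show "D $$ (i, j) = 0 \<or> D $$ (i, j) = 1 \<or> D $$ (i, j) = -1" if "i < length \<sigma>s" "j < length \<tau>s" for i j
      by (rule D1[OF that])
    show "s j * D $$ (i, j) + s j' * D $$ (i, j') = 0"
      if "i < length \<sigma>s" "j < length \<tau>s" "j' < length \<tau>s" "j \<noteq> j'" "D $$ (i, j) \<noteq> 0" "D $$ (i, j') \<noteq> 0" for i j j'
      by (rule two[OF that])
  qed
qed

section \<open>Cancelling cycles of minimum mean cost\<close>

fun walk :: "('e \<Rightarrow> 'v) \<Rightarrow> ('e \<Rightarrow> 'v) \<Rightarrow> 'e set \<Rightarrow> 'v \<Rightarrow> 'e list \<Rightarrow> 'v \<Rightarrow> bool" where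
  "walk src tgt R u [] v \<longleftrightarrow> u = v"
| "walk src tgt R u (e # es) v \<longleftrightarrow> e \<in> R \<and> src e = u \<and> walk src tgt R (tgt e) es v"

lemma walk_append:
  "walk src tgt R u (xs @ ys) w \<longleftrightarrow> (\<exists>v. walk src tgt R u xs v \<and> walk src tgt R v ys w)"
  by (induction xs arbitrary: u) auto

lemma walk_subset: "walk src tgt R u es v \<Longrightarrow> set es \<subseteq> R"
  by (induction es arbitrary: u) auto

lemma walk_mono: "walk src tgt R u es v \<Longrightarrow> set es \<subseteq> R' \<Longrightarrow> walk src tgt R' u es v"
  by (induction es arbitrary: u) auto

lemma walk_telescope:
  fixes f :: "'v \<Rightarrow> real"
  shows "walk src tgt R u es v \<Longrightarrow> (\<Sum>e\<leftarrow>es. f (src e) - f (tgt e)) = f u - f v"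
  by (induction es arbitrary: u) auto

lemma walk_take_drop:
  assumes "walk src tgt R u es v" "k \<le> length es"
  shows "walk src tgt R u (take k es) ((u # map tgt es) ! k) \<and>
         walk src tgt R ((u # map tgt es) ! k) (drop k es) v"
  using assms
proof (induction es arbitrary: u k)
  case (Cons e es)
  then show ?case by (cases k) auto
qed simp

text \<open>Including its start, the walk lists more vertices than \<open>V\<close> contains; the
  part between two visits to the same vertex is closed.\<close>

lemma walk_pigeonhole:
  assumes "walk src tgt R u es v" "finite V" "u \<in> V" "tgt ` R \<subseteq> V" "card V \<le> length es"
  obtains xs ys zs w where "es = xs @ ys @ zs" "ys \<noteq> []"
    "walk src tgt R u xs w" "walk src tgt R w ys w" "walk src tgt R w zs v"
proof -
  let ?vs = "u # map tgt es"
  have "set ?vs \<subseteq> V"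
    using assms walk_subset[OF assms(1)] by auto
  then have "card (set ?vs) < length ?vs"
    using assms(2,5) card_mono[of V "set ?vs"] by simp
  then have "\<not> distinct ?vs"
    using distinct_card[of ?vs] by linarith
  then obtain i j where ij: "i < j" "j < length ?vs" "?vs ! i = ?vs ! j"
    by (metis distinct_conv_nth linorder_neqE_nat)
  let ?w = "?vs ! i"
  have j: "walk src tgt R u (take j es) ?w" "walk src tgt R ?w (drop j es) v"
    using walk_take_drop[OF assms(1), of j] ij by auto
  have nth: "(u # map tgt (take j es)) ! i = ?w"
    using ij by (cases i) auto
  have i: "walk src tgt R u (take i es) ?w" "walk src tgt R ?w (drop i (take j es)) ?w"
    using walk_take_drop[OF j(1), of i] ij nth by auto
  show ?thesis
  proof
    show "es = take i es @ drop i (take j es) @ drop j es"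
      using ij by (metis append.assoc append_take_drop_id less_imp_le min.absorb1 take_take)
    show "drop i (take j es) \<noteq> []"
      using ij by auto
  qed (use i j in auto)
qed

lemma walk_shorten:
  fixes c :: "'e \<Rightarrow> real"
  assumes "walk src tgt R u es v" "finite V" "u \<in> V" "tgt ` R \<subseteq> V"
    and "\<And>w ys. ys \<noteq> [] \<Longrightarrow> walk src tgt R w ys w \<Longrightarrow> 0 \<le> sum_list (map c ys)"
  shows "\<exists>es'. walk src tgt R u es' v \<and> length es' < card V \<and> sum_list (map c es') \<le> sum_list (map c es)"
  using assms(1)
proof (induction "length es" arbitrary: es rule: less_induct)
  case less
  show ?case
  proof (cases "length es < card V")
    case False
    then have le: "card V \<le> length es" by simp
    obtain xs ys zs w where s: "es = xs @ ys @ zs" "ys \<noteq> []"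
      "walk src tgt R u xs w" "walk src tgt R w ys w" "walk src tgt R w zs v"
      by (rule walk_pigeonhole[OF less.prems assms(2-4) le])
    then have "walk src tgt R u (xs @ zs) v" "length (xs @ zs) < length es"
      by (auto simp: walk_append)
    moreover have "sum_list (map c (xs @ zs)) \<le> sum_list (map c es)"
      using assms(5)[OF s(2,4)] s(1) by simp
    moreover obtain es' where "walk src tgt R u es' v" "length es' < card V"
        "sum_list (map c es') \<le> sum_list (map c (xs @ zs))"
      using less.hyps calculation(1,2) by blast
    ultimately show ?thesis
      by (meson order_trans)
  qed (use less.prems in auto)
qed

text \<open>A long closed walk splits into two shorter ones whose lengths and costs add up. So the
  search for a minimum mean can be limited to \<open>card V\<close> arcs.\<close>

lemma closed_walk_mean_ge:
  fixes c :: "'e \<Rightarrow> real"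
  assumes "finite V" "tgt ` R \<subseteq> V"
    and short: "\<And>w ys. ys \<noteq> [] \<Longrightarrow> length ys \<le> card V \<Longrightarrow> walk src tgt R w ys w \<Longrightarrow>
      l * real (length ys) \<le> sum_list (map c ys)"
    and "walk src tgt R u es u" "es \<noteq> []"
  shows "l * real (length es) \<le> sum_list (map c es)"
  using assms(4,5)
proof (induction "length es" arbitrary: es u rule: less_induct)
  case less
  show ?case
  proof (cases "length es \<le> card V")
    case False
    \<comment> \<open>Setting the first arc aside keeps the outer closed walk non-empty once the
      inner one is cut out.\<close>
    obtain e es' where e: "es = e # es'"
      using less.prems by (cases es) auto
    with less.prems have "e \<in> R" "src e = u" and w: "walk src tgt R (tgt e) es' u"
      by auto
    from this have V: "tgt e \<in> V"
      using assms(2) by auto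
    have le: "card V \<le> length es'"
      using False e by simp
    obtain xs ys zs w where s: "es' = xs @ ys @ zs" "ys \<noteq> []"
      "walk src tgt R (tgt e) xs w" "walk src tgt R w ys w" "walk src tgt R w zs u"
      by (rule walk_pigeonhole[OF w assms(1) V assms(2) le])
    have w': "walk src tgt R u (e # xs @ zs) u"
      using s \<open>e \<in> R\<close> \<open>src e = u\<close> by (auto simp: walk_append)
    have "l * real (length (e # xs @ zs)) \<le> sum_list (map c (e # xs @ zs))"
      by (rule less.hyps[OF _ w']) (use e s in auto)
    moreover have "l * real (length ys) \<le> sum_list (map c ys)"
      by (rule less.hyps[OF _ s(4)]) (use e s in auto)
    ultimately show ?thesis
      using e s by (simp add: algebra_simps)
  qed (use less.prems short in auto)
qed

text \<open>Bellman-Ford with start value 0 everywhere: for finitely many arcs, the least cost of a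
  walk with at most k arcs that ends in v and starts anywhere.\<close>

fun bf :: "('e \<Rightarrow> 'v) \<Rightarrow> ('e \<Rightarrow> 'v) \<Rightarrow> 'e set \<Rightarrow> ('e \<Rightarrow> real) \<Rightarrow> nat \<Rightarrow> 'v \<Rightarrow> real" where
  "bf src tgt R c 0 v = 0"
| "bf src tgt R c (Suc k) v =
     Min (insert (bf src tgt R c k v) ((\<lambda>e. bf src tgt R c k (src e) + c e) ` {e\<in>R. tgt e = v}))"

lemma bf_attained:
  assumes "finite R" "src ` R \<subseteq> V" "v \<in> V"
  shows "\<exists>u\<in>V. \<exists>es. walk src tgt R u es v \<and> length es \<le> k \<and> bf src tgt R c k v = sum_list (map c es)"
  using assms(3)
proof (induction k arbitrary: v)
  case 0
  then show ?case by (auto intro!: exI[of _ "[]"])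
next
  case (Suc k)
  let ?S = "insert (bf src tgt R c k v) ((\<lambda>e. bf src tgt R c k (src e) + c e) ` {e\<in>R. tgt e = v})"
  have "Min ?S \<in> ?S"
    using assms by (intro Min_in) auto
  then consider "bf src tgt R c (Suc k) v = bf src tgt R c k v"
    | e where "e \<in> R" "tgt e = v" "bf src tgt R c (Suc k) v = bf src tgt R c k (src e) + c e"
    by auto
  then show ?case
  proof cases
    case 1
    then show ?thesis using Suc by (metis le_SucI)
  next
    case 2
    then have "src e \<in> V"
      using assms by auto
    from Suc.IH[OF this] obtain u es where "u \<in> V" "walk src tgt R u es (src e)" "length es \<le> k"
      "bf src tgt R c k (src e) = sum_list (map c es)"
      by blast
    then have "walk src tgt R u (es @ [e]) v" "length (es @ [e]) \<le> Suc k"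
      "bf src tgt R c (Suc k) v = sum_list (map c (es @ [e]))"
      using 2 by (auto simp: walk_append)
    then show ?thesis using \<open>u \<in> V\<close> by blast
  qed
qed

lemma bf_le:
  assumes "finite R"
  shows "walk src tgt R u es v \<Longrightarrow> length es \<le> k \<Longrightarrow> bf src tgt R c k v \<le> sum_list (map c es)"
proof (induction k arbitrary: v es)
  case (Suc k)
  let ?S = "insert (bf src tgt R c k v) ((\<lambda>e. bf src tgt R c k (src e) + c e) ` {e\<in>R. tgt e = v})"
  have fin: "finite ?S" using assms by auto
  show ?case
  proof (cases "length es \<le> k")
    case True
    then show ?thesis
      using Suc Min_le[OF fin, of "bf src tgt R c k v"] by fastforce
  next
    case False
    then obtain xs e where e: "es = xs @ [e]"
      by (metis le0 list.size(3) rev_exhaust)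
    then have w: "walk src tgt R u xs (src e)" "e \<in> R" "tgt e = v" "length xs \<le> k"
      using Suc.prems by (auto simp: walk_append)
    then have "Min ?S \<le> bf src tgt R c k (src e) + c e"
      by (intro Min_le fin) auto
    then show ?thesis
      using Suc.IH[OF w(1,4)] e by simp
  qed
qed auto

text \<open>Without negative closed walks, fewer than \<open>card V\<close> arcs suffice for a
  cheapest walk, so from level \<open>card V\<close> on the values form a potential.\<close>

lemma bf_potential:
  assumes "finite R" "finite V" "src ` R \<subseteq> V" "tgt ` R \<subseteq> V"
    and "\<And>w ys. ys \<noteq> [] \<Longrightarrow> walk src tgt R w ys w \<Longrightarrow> 0 \<le> sum_list (map c ys)"
    and "e \<in> R" "card V \<le> k"
  shows "bf src tgt R c k (tgt e) \<le> bf src tgt R c k (src e) + c e"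
proof -
  have "src e \<in> V" using assms by auto
  then obtain u es where u: "u \<in> V" "walk src tgt R u es (src e)" "bf src tgt R c k (src e) = sum_list (map c es)"
    using bf_attained[OF assms(1,3)] by metis
  then have "walk src tgt R u (es @ [e]) (tgt e)"
    using assms(6) by (auto simp: walk_append)
  then obtain es' where es': "walk src tgt R u es' (tgt e)" "length es' < card V"
      "sum_list (map c es') \<le> sum_list (map c (es @ [e]))"
    using walk_shorten[of src tgt R u "es @ [e]" "tgt e" V c] u(1) assms(2,4,5) by blast
  then have "length es' \<le> k" using assms(7) by simp
  then have "bf src tgt R c k (tgt e) \<le> sum_list (map c es')"
    using bf_le[OF assms(1) es'(1)] by blast
  then show ?thesis using es' u by simp
qed

section \<open>Residual networks and cycles of minimum mean\<close>

lemma sum_list_lower_eq: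
  fixes g :: "'a \<Rightarrow> real"
  shows "\<forall>e\<in>set es. l \<le> g e \<Longrightarrow> (\<Sum>e\<leftarrow>es. g e) = l * length es \<Longrightarrow> \<forall>e\<in>set es. g e = l"
proof (induction es)
  case Nil show ?case by simp
next
  case (Cons a es)
  define S where "S = (\<Sum>e\<leftarrow>es. g e)"
  define L where "L = l * length es"
  have 1: "L \<le> S"
    using Cons.prems sum_list_mono[of es "\<lambda>_. l" g] by (simp add: sum_list_triv mult.commute S_def L_def)
  have 2: "g a + S = l + L" 
    using Cons.prems(2) by (simp add: distrib_left S_def L_def)
  have 3: "l \<le> g a" using Cons.prems(1) by simp
  have "g a = l" using 1 2 3 by linarith
  have "S = L" using 1 2 3 by linarith
  have "\<forall>e\<in>set es. g e = l" using Cons.IH Cons.prems(1) \<open>S = L\<close> unfolding S_def L_def by simp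
  then show ?case using \<open>g a = l\<close> by simp
qed 

text \<open>For positive m and n the assumptions say that both a/m and b/n exceed their mediant;
  added up, they would make a number smaller than itself.\<close>

lemma mediant_contradiction:
  fixes a b m n :: real
  shows "(a + b) * m < a * (m + n) \<Longrightarrow> (a + b) * n < b * (m + n) \<Longrightarrow> False"
  by (simp add: algebra_simps)

text \<open>Every arc comes with its reverse, of opposite cost, so a circulation is represented by
  the residual capacities of all arcs: moving an amount along e takes it from e and gives it to
  \<open>rev e\<close>.\<close>

locale network =
  fixes A :: "'e set" and V :: "'v set" and src tgt :: "'e \<Rightarrow> 'v" and rev :: "'e \<Rightarrow> 'e"
    and cost :: "'e \<Rightarrow> real"
  assumes fin_A: "finite A" and fin_V: "finite V"
    and src_V: "e \<in> A \<Longrightarrow> src e \<in> V" and tgt_V: "e \<in> A \<Longrightarrow> tgt e \<in> V"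
    and rev_A: "e \<in> A \<Longrightarrow> rev e \<in> A" and rev_rev: "e \<in> A \<Longrightarrow> rev (rev e) = e"
    and src_rev: "e \<in> A \<Longrightarrow> src (rev e) = tgt e"
    and cost_rev: "e \<in> A \<Longrightarrow> cost (rev e) = - cost e"
begin

lemma tgt_rev: "e \<in> A \<Longrightarrow> tgt (rev e) = src e"
  by (metis rev_A rev_rev src_rev)

definition res :: "('e \<Rightarrow> real) \<Rightarrow> 'e set" where
  "res r = {e\<in>A. 0 < r e}"

abbreviation cst :: "'e list \<Rightarrow> real" where
  "cst es \<equiv> sum_list (map cost es)"

definition closed :: "'e set \<Rightarrow> 'e list \<Rightarrow> bool" where
  "closed R es \<longleftrightarrow> es \<noteq> [] \<and> (\<exists>u. walk src tgt R u es u)"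

lemma closed_subset: "closed R es \<Longrightarrow> set es \<subseteq> R"
  unfolding closed_def using walk_subset by metis

text \<open>Among the closed walks of minimum mean cost, a shortest one repeats no arc.\<close>

definition min_mean_cycle :: "('e \<Rightarrow> real) \<Rightarrow> 'e list \<Rightarrow> bool" where
  "min_mean_cycle r es \<longleftrightarrow> closed (res r) es \<and> cst es < 0 \<and>
     (\<forall>es'. closed (res r) es' \<longrightarrow>
        cst es * length es' \<le> cst es' * length es \<and>
        (cst es * length es' = cst es' * length es \<longrightarrow> length es \<le> length es'))"

text \<open>The amount is the least residual capacity on the cycle. For a cycle of minimum mean no
  arc occurs together with its reverse, by \<open>min_mean_cycle_rev\<close>, so at most one
  correction applies to an arc.\<close>

definition push :: "'e list \<Rightarrow> ('e \<Rightarrow> real) \<Rightarrow> 'e \<Rightarrow> real" where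
  "push es r e = r e - (if e \<in> set es then Min (r ` set es) else 0)
                     + (if rev e \<in> set es then Min (r ` set es) else 0)"

text \<open>A form of approximate optimality: for \<open>l = - x\<close> some potential keeps all
  residual reduced costs at or above -x, and for \<open>l = 0\<close> no negative residual cycle is
  left.\<close>

definition mean_ge :: "real \<Rightarrow> ('e \<Rightarrow> real) \<Rightarrow> bool" where
  "mean_ge l r \<longleftrightarrow> (\<forall>es. closed (res r) es \<longrightarrow> l * length es \<le> cst es)"

lemma fin_res: "finite (res r)" and res_A: "res r \<subseteq> A"
  using fin_A by (auto simp: res_def)

text \<open>At a repeated arc the walk splits into two shorter closed walks. As the cycle is a
  shortest one of minimum mean, both would have a strictly larger mean than the whole.\<close>

lemma min_mean_cycle_distinct:
  assumes "min_mean_cycle r es"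
  shows "distinct es"
proof (rule ccontr)
  assume "\<not> distinct es"
  then obtain xs ys zs e where es: "es = xs @ [e] @ ys @ [e] @ zs"
    using not_distinct_decomp by blast
  obtain u where u: "walk src tgt (res r) u es u"
    using assms by (auto simp: min_mean_cycle_def closed_def)
  have 1: "closed (res r) (e # ys)" and 2: "closed (res r) (xs @ [e] @ zs)"
    unfolding closed_def using u by (auto simp: es walk_append)
  let ?a = "cst (e # ys)" and ?b = "cst (xs @ [e] @ zs)"
  let ?m = "real (length (e # ys))" and ?n = "real (length (xs @ [e] @ zs))"
  have "cst es = ?a + ?b" "real (length es) = ?m + ?n"
    by (simp_all add: es)
  moreover have "length (e # ys) < length es" "length (xs @ [e] @ zs) < length es"
    by (simp_all add: es)
  then have "cst es * ?m < ?a * length es" "cst es * ?n < ?b * length es"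
    using assms[unfolded min_mean_cycle_def] 1 2 by (metis linorder_not_le order_le_less)+
  ultimately have "(?a + ?b) * ?m < ?a * (?m + ?n)" "(?a + ?b) * ?n < ?b * (?m + ?n)"
    by metis+
  then show False
    by (rule mediant_contradiction)
qed

text \<open>Raising all costs by x leaves no negative closed walk, so the Bellman-Ford values are a
  potential. Together with the converse below, the minimum mean is the best lower bound on residual
  reduced costs that a potential can achieve.\<close>

lemma mean_ge_potential:
  assumes "mean_ge (- x) r"
  shows "\<exists>f. \<forall>e\<in>res r. - x \<le> cost e + f (src e) - f (tgt e)"
proof -
  let ?c = "\<lambda>e. cost e + x"
  let ?f = "bf src tgt (res r) ?c (card V)"
  have sl: "sum_list (map ?c es) = cst es + x * length es" for es
    by (induction es) (auto simp: algebra_simps)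
  have "?f (tgt e) \<le> ?f (src e) + ?c e" if "e \<in> res r" for e
  proof (rule bf_potential[OF fin_res fin_V _ _ _ that order_refl])
    show "src ` res r \<subseteq> V" "tgt ` res r \<subseteq> V"
      using src_V tgt_V res_A by auto
    show "0 \<le> sum_list (map ?c ys)" if "ys \<noteq> []" "walk src tgt (res r) w ys w" for w ys
      using assms that unfolding sl mean_ge_def closed_def by force
  qed
  then show ?thesis
    by (intro exI[of _ ?f]) (simp add: algebra_simps)
qed

lemma closed_reduced_cost:
  assumes "closed R es"
  shows "(\<Sum>e\<leftarrow>es. cost e + f (src e) - f (tgt e)) = cst es"
proof -
  obtain u where "walk src tgt R u es u"
    using assms by (auto simp: closed_def)
  from walk_telescope[OF this, of f] have "(\<Sum>e\<leftarrow>es. f (src e) - f (tgt e)) = 0"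
    by simp
  moreover have "(\<Sum>e\<leftarrow>es. cost e + f (src e) - f (tgt e)) = cst es + (\<Sum>e\<leftarrow>es. f (src e) - f (tgt e))"
    by (induction es) auto
  ultimately show ?thesis by simp
qed

lemma potential_mean_ge:
  assumes "\<forall>e\<in>res r. l \<le> cost e + f (src e) - f (tgt e)"
  shows "mean_ge l r"
  unfolding mean_ge_def
proof (intro allI impI)
  fix es assume c: "closed (res r) es"
  have "l * length es = (\<Sum>e\<leftarrow>es. l)"
    by (simp add: sum_list_triv)
  also have "\<dots> \<le> (\<Sum>e\<leftarrow>es. cost e + f (src e) - f (tgt e))"
    using assms closed_subset[OF c] by (intro sum_list_mono) auto
  also have "\<dots> = cst es"
    by (rule closed_reduced_cost[OF c])
  finally show "l * length es \<le> cst es" .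
qed

definition mean :: "'e list \<Rightarrow> real" where "mean es = cst es / length es"

lemma min_mean_cycle_mean:
  assumes "min_mean_cycle r es"
  shows "mean_ge (mean es) r" "mean es < 0" "cst es = mean es * length es" "closed (res r) es"
    and "mean_ge l r \<Longrightarrow> l \<le> mean es"
proof -
  have es: "closed (res r) es" "cst es < 0" "0 < real (length es)"
    using assms by (auto simp: min_mean_cycle_def closed_def)
  show "mean es < 0" "cst es = mean es * length es" "closed (res r) es"
    using es by (auto simp: mean_def divide_neg_pos)
  show "mean_ge (mean es) r"
    using assms es by (auto simp: mean_ge_def mean_def min_mean_cycle_def field_simps)
  show "l \<le> mean es" if "mean_ge l r"
    using that es by (auto simp: mean_ge_def mean_def field_simps)
qed

text \<open>Potentials cancel around the cycle, so the average of the reduced costs equals their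
  lower bound, and each of them attains it.\<close>

lemma min_mean_cycle_tight:
  assumes "min_mean_cycle r es" "\<forall>e\<in>res r. mean es \<le> cost e + f (src e) - f (tgt e)" "e \<in> set es"
  shows "cost e + f (src e) - f (tgt e) = mean es"
proof -
  have "\<forall>e\<in>set es. cost e + f (src e) - f (tgt e) = mean es"
    using min_mean_cycle_mean(3,4)[OF assms(1)] assms(2) closed_subset
      closed_reduced_cost[of "res r" es f] by (intro sum_list_lower_eq) auto
  then show ?thesis using assms(3) by blast
qed

text \<open>An arc and its reverse have opposite reduced costs, yet both would equal the negative
  mean.\<close>

lemma min_mean_cycle_rev:
  assumes "min_mean_cycle r es" "e \<in> set es"
  shows "rev e \<notin> set es"
proof
  assume "rev e \<in> set es"
  have e: "e \<in> A"
    using assms min_mean_cycle_mean(4) closed_subset res_A by blast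
  obtain f where "\<forall>e\<in>res r. mean es \<le> cost e + f (src e) - f (tgt e)"
    using mean_ge_potential[of "- mean es" r] min_mean_cycle_mean(1)[OF assms(1)] by auto
  note tight = min_mean_cycle_tight[OF assms(1) this]
  show False
    using tight[OF assms(2)] tight[OF \<open>rev e \<in> set es\<close>] min_mean_cycle_mean(2)[OF assms(1)]
      src_rev[OF e] tgt_rev[OF e] cost_rev[OF e] by simp
qed

lemma push_nonneg:
  assumes "min_mean_cycle r es" "\<forall>e\<in>A. 0 \<le> r e" "e \<in> A"
  shows "0 \<le> push es r e"
proof -
  have "Min (r ` set es) \<le> r e" if "e \<in> set es"
    using that by simp
  moreover have "0 \<le> Min (r ` set es)"
    using min_mean_cycle_mean(4)[OF assms(1)] closed_subset[of "res r" es] assms(2)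
    by (subst Min_ge_iff) (auto simp: closed_def res_def)
  ultimately show ?thesis
    using assms(2,3) by (auto simp: push_def)
qed

lemma res_push:
  assumes "min_mean_cycle r es" "\<forall>e\<in>A. 0 \<le> r e"
  shows "res (push es r) \<subseteq> res r \<union> {e\<in>A. rev e \<in> set es}"
    and "\<exists>e\<in>set es. e \<notin> res (push es r)"
proof -
  have es: "closed (res r) es"
    using min_mean_cycle_mean(4)[OF assms(1)] .
  show "res (push es r) \<subseteq> res r \<union> {e\<in>A. rev e \<in> set es}"
    using closed_subset[OF es] by (auto simp: res_def push_def split: if_splits)
  have "Min (r ` set es) \<in> r ` set es"
    using es by (intro Min_in) (auto simp: closed_def)
  then obtain e where "e \<in> set es" "r e = Min (r ` set es)"
    by auto
  then show "\<exists>e\<in>set es. e \<notin> res (push es r)"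
    using min_mean_cycle_rev[OF assms(1)] by (intro bexI[of _ e]) (auto simp: res_def push_def)
qed

text \<open>New residual arcs are reverses of arcs with negative reduced cost, so their own is
  positive, while a bottleneck arc, whose reduced cost is negative, disappears.\<close>

lemma push_potential:
  assumes "min_mean_cycle r es" "\<forall>e\<in>A. 0 \<le> r e" "\<forall>e\<in>set es. cost e + f (src e) - f (tgt e) < 0"
    and "l \<le> 0" "\<forall>e\<in>res r. l \<le> cost e + f (src e) - f (tgt e)"
  shows "\<forall>e\<in>res (push es r). l \<le> cost e + f (src e) - f (tgt e)"
    and "{e\<in>res (push es r). cost e + f (src e) - f (tgt e) < 0} \<subset>
         {e\<in>res r. cost e + f (src e) - f (tgt e) < 0}"
proof -
  have es: "set es \<subseteq> res r"
    using closed_subset[OF min_mean_cycle_mean(4)[OF assms(1)]] .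
  have new: "0 \<le> cost e + f (src e) - f (tgt e)" if "e \<in> A" "rev e \<in> set es" for e
    using bspec[OF assms(3) that(2)] src_rev[OF that(1)] tgt_rev[OF that(1)] cost_rev[OF that(1)] by simp
  show "\<forall>e\<in>res (push es r). l \<le> cost e + f (src e) - f (tgt e)"
  proof
    fix e assume "e \<in> res (push es r)"
    then consider "e \<in> res r" | "e \<in> A" "rev e \<in> set es"
      using res_push(1)[OF assms(1,2)] by blast
    then show "l \<le> cost e + f (src e) - f (tgt e)"
      using assms(4,5) new[of e] by cases auto
  qed
  obtain e where "e \<in> set es" "e \<notin> res (push es r)"
    using res_push(2)[OF assms(1,2)] by blast
  then have "e \<in> {e\<in>res r. cost e + f (src e) - f (tgt e) < 0} -
         {e\<in>res (push es r). cost e + f (src e) - f (tgt e) < 0}"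
    using assms(3) es by auto
  moreover have "{e\<in>res (push es r). cost e + f (src e) - f (tgt e) < 0} \<subseteq>
         {e\<in>res r. cost e + f (src e) - f (tgt e) < 0}"
  proof
    fix e assume e: "e \<in> {e\<in>res (push es r). cost e + f (src e) - f (tgt e) < 0}"
    then have "\<not> (e \<in> A \<and> rev e \<in> set es)"
      using new[of e] by auto
    then show "e \<in> {e\<in>res r. cost e + f (src e) - f (tgt e) < 0}"
      using res_push(1)[OF assms(1,2)] e by blast
  qed
  ultimately show "{e\<in>res (push es r). cost e + f (src e) - f (tgt e) < 0} \<subset>
         {e\<in>res r. cost e + f (src e) - f (tgt e) < 0}"
    by blast
qed

text \<open>By antisymmetry the arcs leaving a vertex account for its net outflow: what enters along
  e is counted with opposite sign on \<open>rev e\<close>.\<close>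

definition circulation :: "('e \<Rightarrow> real) \<Rightarrow> bool" where
  "circulation h \<longleftrightarrow> (\<forall>e\<in>A. h (rev e) = - h e) \<and> (\<forall>v\<in>V. (\<Sum>e | e \<in> A \<and> src e = v. h e) = 0)"

lemma circulation_zero: "circulation (\<lambda>e. 0)"
  by (simp add: circulation_def)

lemma circulation_add: "circulation g \<Longrightarrow> circulation h \<Longrightarrow> circulation (\<lambda>e. g e + h e)"
  by (simp add: circulation_def sum.distrib)

lemma circulation_minus: "circulation h \<Longrightarrow> circulation (\<lambda>e. - h e)"
  by (simp add: circulation_def sum_negf)

lemma sum_rev: "(\<Sum>e | e \<in> A \<and> P (src e) (tgt e). h (rev e)) = (\<Sum>e | e \<in> A \<and> P (tgt e) (src e). h e)"
  by (rule sum.reindex_bij_witness[of _ rev rev]) (auto simp: rev_A rev_rev src_rev tgt_rev)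

text \<open>No arc of the cycle repeats, so each carries the amount once, and the indicator of a
  vertex telescopes to 0 along the closed walk.\<close>

lemma circulation_push:
  assumes "min_mean_cycle r es"
  shows "circulation (\<lambda>e. push es r e - r e)"
proof -
  have dist: "distinct es" and cl: "closed (res r) es"
    using min_mean_cycle_distinct min_mean_cycle_mean(4) assms by auto
  then have sub: "set es \<subseteq> A"
    using closed_subset res_A by blast
  obtain u where u: "walk src tgt (res r) u es u"
    using cl by (auto simp: closed_def)
  define d where "d = Min (r ` set es)"
  have push: "push es r e - r e = (if rev e \<in> set es then d else 0) - (if e \<in> set es then d else 0)" for e
    by (simp add: push_def d_def)
  have "(\<Sum>e | e \<in> A \<and> src e = v. push es r e - r e) = 0" for v
  proof -
    have restr: "(\<Sum>e | e \<in> A \<and> f e = v. if e \<in> set es then d else 0) = (\<Sum>e\<leftarrow>es. if f e = v then d else 0)" for f :: "'e \<Rightarrow> 'v"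
    proof -
      have "(\<Sum>e | e \<in> A \<and> f e = v. if e \<in> set es then d else 0) = (\<Sum>e\<in>A. if e \<in> set es \<and> f e = v then d else 0)"
        using fin_A by (subst sum.inter_filter) (auto intro!: sum.cong)
      also have "\<dots> = (\<Sum>e\<in>set es. if f e = v then d else 0)"
        using fin_A sub by (intro sum.mono_neutral_cong_right) auto
      finally show ?thesis
        using dist by (simp add: sum_list_distinct_conv_sum_set)
    qed
    have "(\<Sum>e | e \<in> A \<and> src e = v. if rev e \<in> set es then d else 0) =
        (\<Sum>e | e \<in> A \<and> tgt e = v. if e \<in> set es then d else 0)"
      using sum_rev[where P="\<lambda>x y. x = v" and h="\<lambda>e. if e \<in> set es then d else 0"] by simp
    moreover have "(\<Sum>e\<leftarrow>es. (if src e = v then d else 0) - (if tgt e = v then d else 0)) = 0"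
      using walk_telescope[OF u, of "\<lambda>w. if w = v then d else 0"] by simp
    ultimately show ?thesis
      unfolding push sum_subtractf restr by (simp add: sum_list_subtractf)
  qed
  then show ?thesis
    by (auto simp: circulation_def push rev_rev)
qed

text \<open>If the tail of e could not be reached from its head along positive arcs, no positive arc
  would leave the reachable set \<open>S\<close>, whereas \<open>rev e\<close> leaves it with a
  negative value: the net outflow of \<open>S\<close> would be negative instead of 0.\<close>

lemma circulation_cycle:
  assumes h: "circulation h" and e: "e \<in> A" "0 < h e"
  shows "\<exists>es. closed {e\<in>A. 0 < h e} es \<and> e \<in> set es \<and> length es \<le> card V"
proof -
  let ?R = "{e\<in>A. 0 < h e}"
  define S where "S = {v\<in>V. \<exists>es. walk src tgt ?R (tgt e) es v}"
  have "src e \<in> S"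
  proof (rule ccontr)
    assume "src e \<notin> S"
    have "tgt e \<in> S"
      using e tgt_V by (auto simp: S_def intro!: exI[of _ "[]"])
    have step: "tgt a \<in> S" if "a \<in> A" "src a \<in> S" "0 < h a" for a
    proof -
      from that(2) obtain es where "walk src tgt ?R (tgt e) es (src a)"
        by (auto simp: S_def)
      then have "walk src tgt ?R (tgt e) (es @ [a]) (tgt a)"
        using that by (auto simp: walk_append)
      then show ?thesis
        using that tgt_V unfolding S_def by blast
    qed
    have finS: "finite S" using fin_V by (auto simp: S_def)
    have "(\<Sum>v\<in>S. \<Sum>a | a \<in> A \<and> src a = v. h a) = 0"
      using h by (intro sum.neutral) (auto simp: circulation_def S_def)
    also have "(\<Sum>v\<in>S. \<Sum>a | a \<in> A \<and> src a = v. h a) = (\<Sum>a | a \<in> A \<and> src a \<in> S. h a)"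
      using finS fin_A sum.group[of "{a\<in>A. src a \<in> S}" S src h]
      by (simp add: image_subset_iff) (smt (verit, best) Collect_cong sum.cong)
    also have "\<dots> = (\<Sum>a | a \<in> A \<and> (src a \<in> S \<and> tgt a \<in> S). h a) + (\<Sum>a | a \<in> A \<and> (src a \<in> S \<and> tgt a \<notin> S). h a)"
      using fin_A by (subst sum.union_disjoint[symmetric]) (auto intro!: sum.cong)
    finally have sum0: "(\<Sum>a | a \<in> A \<and> (src a \<in> S \<and> tgt a \<in> S). h a) + (\<Sum>a | a \<in> A \<and> (src a \<in> S \<and> tgt a \<notin> S). h a) = 0" .
    have "(\<Sum>a | a \<in> A \<and> (src a \<in> S \<and> tgt a \<in> S). h a) = (\<Sum>a | a \<in> A \<and> (src a \<in> S \<and> tgt a \<in> S). h (rev a))"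
      using sum_rev[where P="\<lambda>x y. x \<in> S \<and> y \<in> S" and h=h] by (simp add: conj_commute)
    also have "\<dots> = (\<Sum>a | a \<in> A \<and> (src a \<in> S \<and> tgt a \<in> S). - h a)"
      using h by (intro sum.cong) (auto simp: circulation_def)
    finally have "(\<Sum>a | a \<in> A \<and> (src a \<in> S \<and> tgt a \<in> S). h a) = 0"
      by (simp add: sum_negf)
    moreover have "(\<Sum>a | a \<in> A \<and> (src a \<in> S \<and> tgt a \<notin> S). h a) < 0"
    proof -
      let ?B = "{a. a \<in> A \<and> (src a \<in> S \<and> tgt a \<notin> S)}"
      have "rev e \<in> ?B" "h (rev e) < 0"
        using e \<open>src e \<notin> S\<close> \<open>tgt e \<in> S\<close> h by (auto simp: rev_A src_rev tgt_rev circulation_def)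
      moreover have "h a \<le> 0" if "a \<in> ?B" for a
        using step[of a] that by force
      ultimately have "sum h ?B < (\<Sum>a\<in>?B. 0)"
        using fin_A by (intro sum_strict_mono_ex1) auto
      then show ?thesis by simp
    qed
    ultimately show False using sum0 by simp
  qed
  then obtain es where es: "walk src tgt ?R (tgt e) es (src e)"
    by (auto simp: S_def)
  have "tgt e \<in> V" "tgt ` ?R \<subseteq> V"
    using e tgt_V by auto
  \<comment> \<open>With zero costs \<open>walk_shorten\<close> bounds the number of arcs alone;
    adding e gives at most \<open>card V\<close>.\<close>
  from walk_shorten[OF es fin_V this, of "\<lambda>_. 0"] obtain es' where
    "walk src tgt ?R (tgt e) es' (src e)" "length es' < card V"
    by auto
  then show ?thesis
    using e by (intro exI[of _ "e # es'"]) (auto simp: closed_def)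
qed

text \<open>One arc contributes at least 0 and each of the others at least -x, so the average is at
  least -x times 1 - 1/L.\<close>

lemma reduced_cost_nonneg_mean:
  assumes "closed (res r) es" "length es \<le> L" "0 < x"
    and "\<forall>e\<in>res r. - x \<le> cost e + f (src e) - f (tgt e)"
    and e: "e \<in> set es" "0 \<le> cost e + f (src e) - f (tgt e)"
  shows "- (1 - 1 / real L) * x \<le> mean es"
proof -
  let ?c = "\<lambda>e. cost e + f (src e) - f (tgt e)"
  obtain xs ys where es: "es = xs @ e # ys"
    using e(1) split_list by metis
  have ge: "- x * length zs \<le> sum_list (map ?c zs)" if "set zs \<subseteq> set es" for zs
    using assms(4) closed_subset[OF assms(1)] that sum_list_mono[of zs "\<lambda>_. - x" ?c]
    by (auto simp: sum_list_triv mult.commute)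
  have "- x * (length xs + length ys) \<le> sum_list (map ?c xs) + sum_list (map ?c ys)"
    using ge[of xs] ge[of ys] unfolding es by (simp add: distrib_left subset_insertI2)
  also have "\<dots> \<le> sum_list (map ?c es)"
    using e(2) es by simp
  also have "\<dots> = cst es"
    by (rule closed_reduced_cost[OF assms(1)])
  finally have "- x * (real (length es) - 1) \<le> cst es"
    by (simp add: es)
  then have "- x * (real (length es) - 1) / length es \<le> mean es"
    unfolding mean_def using es by (intro divide_right_mono) auto
  moreover have "- x * (real (length es) - 1) / length es = - x * (1 - 1 / length es)"
    using es by (simp add: field_simps)
  moreover have "x * (1 - 1 / length es) \<le> x * (1 - 1 / L)"
    using es assms(2,3) by (intro mult_left_mono diff_left_mono divide_left_mono) auto
  ultimately have "- (x * (1 - 1 / L)) \<le> mean es"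
    by simp
  then show ?thesis
    by (simp only: mult_minus_left mult.commute[of _ x])
qed

end

text \<open>(1 - 1/L)^L is at most exp(-1) and so at most 1/2; raised to the power 2L this is at
  most 2^(-2L), which is below 1/(2L).\<close>

lemma geometric_halving:
  assumes "1 \<le> L"
  shows "(1 - 1 / real L) ^ (2 * L * L) \<le> 1 / (2 * real L)"
proof -
  have "(1 - 1 / real L) ^ L \<le> exp (- 1 / real L) ^ L"
    using assms exp_ge_add_one_self[of "- 1 / real L"] by (intro power_mono) auto
  also have "\<dots> = exp (- 1)"
    using assms by (simp flip: exp_of_nat_mult)
  also have "\<dots> \<le> 1 / 2"
    using exp_ge_add_one_self[of 1] by (simp add: exp_minus field_simps)
  finally have "((1 - 1 / real L) ^ L) ^ (2 * L) \<le> (1 / 2) ^ (2 * L)"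
    using assms by (intro power_mono) auto
  also have "\<dots> \<le> 1 / (2 * real L)"
    using of_nat_less_two_power[of "2 * L", where 'a = real] assms by (simp add: power_one_over field_simps)
  finally show ?thesis
    by (simp add: power_mult[symmetric] mult.assoc mult.commute mult.left_commute)
qed

section \<open>The bound on the number of cancellations\<close>

locale cancelling = network +
  fixes L T :: nat and r :: "nat \<Rightarrow> 'a \<Rightarrow> real" and es :: "nat \<Rightarrow> 'a list"
  assumes L: "1 \<le> L" "card A \<le> L" "card V \<le> L"
    and nonneg0: "e \<in> A \<Longrightarrow> 0 \<le> r 0 e"
    and step: "t < T \<Longrightarrow> min_mean_cycle (r t) (es t)" "t < T \<Longrightarrow> r (Suc t) = push (es t) (r t)"
begin

lemma nonneg: "t \<le> T \<Longrightarrow> \<forall>e\<in>A. 0 \<le> r t e"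
proof (induction t)
  case (Suc t)
  then show ?case
    using push_nonneg[OF step(1)[of t]] step(2)[of t] by auto
qed (use nonneg0 in auto)

lemma circulation_diff: "t \<le> T \<Longrightarrow> circulation (\<lambda>e. r t e - r 0 e)"
proof (induction t)
  case (Suc t)
  then have "circulation (\<lambda>e. r (Suc t) e - r t e)"
    using circulation_push[OF step(1)[of t]] step(2)[of t] by auto
  from circulation_add[OF this Suc.IH] Suc.prems show ?case by simp
qed (use circulation_zero in simp)

definition eps :: "nat \<Rightarrow> real" where "eps t = - mean (es t)"

lemma eps_pos: "t < T \<Longrightarrow> 0 < eps t"
  using min_mean_cycle_mean(2)[OF step(1)] by (simp add: eps_def)

lemma mean_ge_eps: "t < T \<Longrightarrow> mean_ge (- eps t) (r t)"
  using min_mean_cycle_mean(1)[OF step(1)] by (simp add: eps_def)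

lemma eps_le: "t < T \<Longrightarrow> mean_ge (- x) (r t) \<Longrightarrow> eps t \<le> x"
  using min_mean_cycle_mean(5)[OF step(1), of t "- x"] by (simp add: eps_def)

lemma length_le: "t < T \<Longrightarrow> length (es t) \<le> L"
proof -
  assume t: "t < T"
  have "set (es t) \<subseteq> A"
    using closed_subset[OF min_mean_cycle_mean(4)[OF step(1)[OF t]]] res_A[of "r t"] by auto
  then have "card (set (es t)) \<le> L"
    using L card_mono[OF fin_A] order_trans by blast
  then show ?thesis
    using distinct_card[OF min_mean_cycle_distinct[OF step(1)[OF t]]] by simp
qed

lemma potential_exists:
  assumes "t < T"
  obtains f where "\<forall>e\<in>res (r t). - eps t \<le> cost e + f (src e) - f (tgt e)"
  using mean_ge_potential[OF mean_ge_eps[OF assms]] by auto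

text \<open>The arcs of the cancelled cycle are tight, hence of negative reduced cost, so the
  potential of the round remains valid for the new residual network and bounds the next
  mean.\<close>

lemma eps_Suc: "Suc t < T \<Longrightarrow> eps (Suc t) \<le> eps t"
proof -
  assume t: "Suc t < T"
  obtain f where f: "\<forall>e\<in>res (r t). - eps t \<le> cost e + f (src e) - f (tgt e)"
    using potential_exists[of t] t by auto
  have "cost e + f (src e) - f (tgt e) < 0" if "e \<in> set (es t)" for e
    using min_mean_cycle_tight[OF step(1)[of t] _ that, of f] f t eps_pos[of t] by (simp add: eps_def)
  then have "\<forall>e\<in>res (r (Suc t)). - eps t \<le> cost e + f (src e) - f (tgt e)"
    using push_potential(1)[OF step(1)[of t] nonneg[of t], of f "- eps t"] f t eps_pos[of t] step(2)[of t]
    by auto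
  then show ?thesis
    using eps_le[OF t potential_mean_ge] by blast
qed

lemma eps_antimono: "s \<le> t \<Longrightarrow> t < T \<Longrightarrow> eps t \<le> eps s"
  by (induction t rule: dec_induct) (auto dest: eps_Suc)

text \<open>As long as only arcs of negative reduced cost are cancelled, their number decreases.\<close>

lemma eps_phase:
  assumes "t + L < T"
  shows "eps (t + L) \<le> (1 - 1 / real L) * eps t"
proof -
  obtain f where f: "\<forall>e\<in>res (r t). - eps t \<le> cost e + f (src e) - f (tgt e)"
    using potential_exists[of t] assms by auto
  define N where "N s = {e\<in>res (r s). cost e + f (src e) - f (tgt e) < 0}" for s
  define neg where "neg s \<longleftrightarrow> (\<forall>e\<in>set (es s). cost e + f (src e) - f (tgt e) < 0)" for s
  \<comment> \<open>While only arcs of negative reduced cost are cancelled, the potential of round t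
    stays valid, and every round removes one of at most L negative residual arcs.\<close>
  have inv: "(\<forall>e\<in>res (r (t + j)). - eps t \<le> cost e + f (src e) - f (tgt e)) \<and> card (N (t + j)) + j \<le> L"
    if "j \<le> L" "\<forall>i<j. neg (t + i)" for j
    using that
  proof (induction j)
    case 0
    have "card (N t) \<le> card A"
      using fin_A res_A by (intro card_mono) (auto simp: N_def)
    then show ?case using f L by auto
  next
    case (Suc j)
    have s: "t + j < T" "min_mean_cycle (r (t + j)) (es (t + j))" "\<forall>e\<in>A. 0 \<le> r (t + j) e" "neg (t + j)"
      "r (Suc (t + j)) = push (es (t + j)) (r (t + j))"
      using Suc.prems assms step[of "t + j"] nonneg[of "t + j"] by auto
    have IH: "\<forall>e\<in>res (r (t + j)). - eps t \<le> cost e + f (src e) - f (tgt e)" "card (N (t + j)) + j \<le> L"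
      using Suc by auto
    have le: "- eps t \<le> 0"
      using eps_pos[of t] assms by simp
    have "N (t + Suc j) \<subset> N (t + j)"
      using push_potential(2)[OF s(2,3) s(4)[unfolded neg_def] le IH(1)] s(5) by (simp add: N_def)
    moreover have "finite (N (t + j))"
      using fin_res by (auto simp: N_def)
    ultimately have "card (N (t + Suc j)) < card (N (t + j))"
      by (rule psubset_card_mono[rotated])
    then show ?case
      using push_potential(1)[OF s(2,3) s(4)[unfolded neg_def] le IH(1)] s(5) IH(2) by simp
  qed
  have "\<exists>j\<le>L. \<not> neg (t + j)"
  proof (rule ccontr)
    assume *: "\<not> (\<exists>j\<le>L. \<not> neg (t + j))"
    then have "card (N (t + L)) = 0"
      using inv[of L] by auto
    then have "N (t + L) = {}"
      using fin_res[of "r (t + L)"] by (simp add: N_def)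
    moreover have cl: "closed (res (r (t + L))) (es (t + L))"
      using min_mean_cycle_mean(4)[OF step(1)[OF assms]] .
    then obtain e where "e \<in> set (es (t + L))"
      by (cases "es (t + L)") (auto simp: closed_def)
    then have "e \<in> N (t + L)"
      using * closed_subset[OF cl] by (auto simp: N_def neg_def)
    ultimately show False by simp
  qed
  \<comment> \<open>The first round that uses an arc of non-negative reduced cost. Up to it the
    invariant holds, and its mean is closer to 0 by the factor 1 - 1/L.\<close>
  define j where "j = (LEAST j. \<not> neg (t + j))"
  have j: "j \<le> L" "\<not> neg (t + j)" "\<forall>i<j. neg (t + i)"
    using \<open>\<exists>j\<le>L. \<not> neg (t + j)\<close> unfolding j_def
    by (metis (mono_tags, lifting) LeastI Least_le order_trans, metis (mono_tags, lifting) LeastI,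
        metis (mono_tags, lifting) not_less_Least)
  then obtain e where e: "e \<in> set (es (t + j))" "0 \<le> cost e + f (src e) - f (tgt e)"
    by (auto simp: neg_def not_less)
  have tj: "t + j < T" "t < T"
    using j assms by auto
  have "- (1 - 1 / real L) * eps t \<le> mean (es (t + j))"
    using reduced_cost_nonneg_mean[OF min_mean_cycle_mean(4)[OF step(1)[OF tj(1)]] length_le[OF tj(1)]
      eps_pos[OF tj(2)] _ e] inv[OF j(1,3)] by blast
  then have "eps (t + j) \<le> (1 - 1 / real L) * eps t"
    unfolding eps_def by (simp only: mult_minus_left)
  then show ?thesis
    using eps_antimono[of "t + j" "t + L"] j assms by simp
qed

lemma eps_phases: "t + k * L < T \<Longrightarrow> eps (t + k * L) \<le> (1 - 1 / real L) ^ k * eps t"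
proof (induction k)
  case (Suc k)
  have "eps (t + Suc k * L) \<le> (1 - 1 / real L) * eps (t + k * L)"
    using eps_phase[of "t + k * L"] Suc.prems by (simp add: ac_simps)
  also have "\<dots> \<le> (1 - 1 / real L) * ((1 - 1 / real L) ^ k * eps t)"
    using Suc L by (intro mult_left_mono) auto
  finally show ?case by simp
qed simp

text \<open>This is 2 * L * L phases of L rounds each; by \<open>geometric_halving\<close> they
  shrink \<open>eps\<close> by the factor 2 * L.\<close>

abbreviation B :: nat where "B \<equiv> 2 * L * L * L"

lemma eps_block:
  assumes "t + B < T"
  shows "2 * real L * eps (t + B) \<le> eps t"
proof -
  have "eps (t + B) \<le> (1 - 1 / real L) ^ (2 * L * L) * eps t"
    using eps_phases[of t "2 * L * L"] assms by simp
  also have "\<dots> \<le> 1 / (2 * real L) * eps t"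
    using geometric_halving[OF L(1)] eps_pos[of t] assms by (intro mult_right_mono) auto
  finally show ?thesis
    using L by (simp add: field_simps)
qed

text \<open>An arc of reduced cost at most -2Lx is not residual at s. If its residual value were
  positive at s', the difference of the two states would contain a closed walk through it whose
  other arcs have reduced cost at most x; as this walk has at most L arcs, its mean would be below
  -x.\<close>

lemma frozen_arc:
  assumes s: "s < T" "s' < T" "eps s \<le> x" "eps s' \<le> x" "0 < x"
    and f: "\<forall>e\<in>res (r s). - x \<le> cost e + f (src e) - f (tgt e)"
    and e: "e \<in> A" "cost e + f (src e) - f (tgt e) \<le> - (2 * real L * x)"
  shows "r s' e = r s e"
proof (rule ccontr)
  assume ne: "r s' e \<noteq> r s e"
  have "1 * x \<le> real L * x"
    using L(1) s(5) by (intro mult_right_mono) auto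
  then have Lx: "x \<le> real L * x" by simp
  have "e \<notin> res (r s)"
  proof
    assume "e \<in> res (r s)"
    with f have "- x \<le> cost e + f (src e) - f (tgt e)" by blast
    with e(2) Lx s(5) show False by linarith
  qed
  then have "r s e = 0"
    using e(1) nonneg[of s] s(1) by (force simp: res_def)
  moreover have "0 \<le> r s' e"
    using e(1) nonneg[of s'] s(2) by auto
  ultimately have pos: "0 < r s' e - r s e"
    using ne by simp
  have circ: "circulation (\<lambda>e. r s' e - r s e)"
    using circulation_add[OF circulation_diff[of s'] circulation_minus[OF circulation_diff[of s]]] s by simp
  obtain g where g: "closed {e\<in>A. 0 < r s' e - r s e} g" "e \<in> set g" "length g \<le> card V"
    using circulation_cycle[OF circ e(1) pos] by blast
  \<comment> \<open>Where the residual value has grown, that of the reverse arc has fallen, so the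
    reverse was residual at s and the potential bounds its reduced cost from below.\<close>
  have ub: "cost a + f (src a) - f (tgt a) \<le> x" if "a \<in> set g" for a
  proof -
    have a: "a \<in> A" "0 < r s' a - r s a"
      using that closed_subset[OF g(1)] by auto
    then have "r s' (rev a) - r s (rev a) < 0" "rev a \<in> A"
      using circ rev_A by (auto simp: circulation_def)
    then have "rev a \<in> res (r s)"
      using nonneg[of s'] s(2) by (force simp: res_def)
    then show ?thesis
      using bspec[OF f, of "rev a"] src_rev[OF a(1)] tgt_rev[OF a(1)] cost_rev[OF a(1)] by simp
  qed
  have "set g \<subseteq> res (r s')"
    using closed_subset[OF g(1)] nonneg[of s] s(1) by (force simp: res_def)
  then have cl: "closed (res (r s')) g"
    using g(1) walk_mono unfolding closed_def by metis
  obtain xs ys where xy: "g = xs @ e # ys"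
    using g(2) split_list by metis
  let ?c = "\<lambda>e. cost e + f (src e) - f (tgt e)"
  have le: "sum_list (map ?c zs) \<le> x * length zs" if "set zs \<subseteq> set g" for zs
    using ub that sum_list_mono[of zs ?c "\<lambda>_. x"] by (auto simp: sum_list_triv mult.commute)
  have "cst g = sum_list (map ?c xs) + ?c e + sum_list (map ?c ys)"
    using closed_reduced_cost[OF cl, of f] xy by simp
  also have "\<dots> \<le> x * length xs - 2 * real L * x + x * length ys"
    using le[of xs] le[of ys] e(2) unfolding xy by (simp add: subset_insertI2)
  finally have 1: "cst g \<le> x * length g - x - 2 * (real L * x)"
    by (simp add: xy algebra_simps)
  have "- (eps s' * length g) \<le> cst g"
    using mean_ge_eps[OF s(2)] cl by (simp add: mean_ge_def)
  then have 2: "- (x * length g) \<le> cst g"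
    using mult_right_mono[OF s(4), of "real (length g)"] by simp
  have 3: "x * length g \<le> real L * x"
    using g(3) L(3) s(5) by (subst mult.commute, intro mult_right_mono) auto
  have contradiction: "False" if "c \<le> l - x - 2 * m" "- l \<le> c" "l \<le> m" for c l m :: real
    using that s(5) by simp
  show False
    by (rule contradiction[OF 1 2 3])
qed

definition frozen :: "nat \<Rightarrow> 'a set" where
  "frozen t = {e\<in>A. \<forall>s. t \<le> s \<longrightarrow> s < T \<longrightarrow> r s e = r t e}"

text \<open>Measured by the potential of round t + B, the cycle of round t still has mean - eps t,
  so one of its arcs has reduced cost at most this, which is at most -2L times
  \<open>eps (t + B)\<close>. This arc is frozen from round t + B on, although round t changed
  it.\<close>

lemma frozen_block:
  assumes "t + B < T"
  shows "frozen t \<subset> frozen (t + B)"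
proof -
  have "1 \<le> L * L * L"
    using L(1) by simp
  \<comment> \<open>Ensures Suc t < T, so that the change made in round t counts for
    \<open>frozen t\<close>.\<close>
  then have B: "2 \<le> B" by simp
  have t: "t < T" "Suc t < T"
    using assms B by (linarith, linarith)
  let ?x = "eps (t + B)"
  obtain f where f: "\<forall>e\<in>res (r (t + B)). - ?x \<le> cost e + f (src e) - f (tgt e)"
    using potential_exists[OF assms] by auto
  note es = step(1)[OF t(1)]
  let ?c = "\<lambda>e. cost e + f (src e) - f (tgt e)"
  have "\<exists>e\<in>set (es t). ?c e \<le> - eps t"
  proof (rule ccontr)
    assume *: "\<not> ?thesis"
    have "(\<Sum>e\<leftarrow>es t. - eps t) < (\<Sum>e\<leftarrow>es t. ?c e)"
      using * min_mean_cycle_mean(4)[OF es] by (intro sum_list_strict_mono) (auto simp: closed_def)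
    then show False
      using closed_reduced_cost[OF min_mean_cycle_mean(4)[OF es], of f] min_mean_cycle_mean(3)[OF es]
      by (simp add: sum_list_triv eps_def mult.commute)
  qed
  then obtain e where e: "e \<in> set (es t)" "?c e \<le> - eps t" by blast
  have sub: "set (es t) \<subseteq> res (r t)"
    using closed_subset[OF min_mean_cycle_mean(4)[OF es]] .
  have eA: "e \<in> A"
    using e(1) sub by (auto simp: res_def)
  have Mpos: "0 < Min (r t ` set (es t))"
    using e(1) sub by (subst Min_gr_iff) (auto simp: res_def)
  have "?c e \<le> - (2 * real L * ?x)"
    using e(2) eps_block[OF assms] by linarith
  then have "r s e = r (t + B) e" if "t + B \<le> s" "s < T" for s
    by (rule frozen_arc[OF assms that(2) order_refl eps_antimono[OF that] eps_pos[OF assms] f eA])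
  then have "e \<in> frozen (t + B)"
    unfolding frozen_def using eA by blast
  moreover have "r (Suc t) e \<noteq> r t e"
    using step(2)[OF t(1)] e(1) min_mean_cycle_rev[OF es e(1)] Mpos by (simp add: push_def)
  then have "e \<notin> frozen t"
    using t(2) eA by (auto simp: frozen_def intro!: exI[of _ "Suc t"])
  moreover have "frozen t \<subseteq> frozen (t + B)"
  proof
    fix a assume a: "a \<in> frozen t"
    have eq: "r s a = r t a" if "t \<le> s" "s < T" for s
      using a that unfolding frozen_def by blast
    have "r s a = r (t + B) a" if "t + B \<le> s" "s < T" for s
      using eq[of s] eq[of "t + B"] that assms by simp
    then show "a \<in> frozen (t + B)"
      using a unfolding frozen_def by blast
  qed
  ultimately show ?thesis by blast
qed

text \<open>Every block freezes a new arc, and there are at most L arcs.\<close>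

lemma length_bound: "T \<le> (L + 1) * B"
proof (rule ccontr)
  assume *: "\<not> ?thesis"
  have "k \<le> card (frozen (k * B))" if "k \<le> L + 1" for k
    using that
  proof (induction k)
    case (Suc k)
    have "Suc k * B \<le> (L + 1) * B"
      using Suc.prems by (intro mult_right_mono) auto
    moreover have "Suc k * B = k * B + B" by simp
    ultimately have "k * B + B < T"
      using * by linarith
    then have "card (frozen (k * B)) < card (frozen (k * B + B))"
      using fin_A by (intro psubset_card_mono frozen_block) (auto simp: frozen_def)
    then show ?case using Suc by (simp add: add.commute)
  qed simp
  from this[of "L + 1"] have "L + 1 \<le> card A"
    using card_mono[OF fin_A, of "frozen ((L + 1) * B)"] by (auto simp: frozen_def)
  then show False using L by simp
qed

end

section \<open>Programs with bounded loops\<close>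

text \<open>The limit of a loop is the value of a scalar on entry, so every program denotes a total
  function on states and its running time can be bounded from its syntax. While loops appear in the
  compiled form alone.\<close>

datatype loop =
    LSkip
  | LI string iexp iexp
  | LR string iexp rexp
  | LSeq loop loop
  | LIf bexp loop loop
  | LFor string string loop

definition upd :: "string \<Rightarrow> nat \<Rightarrow> state \<Rightarrow> state" where
  "upd x k s = (store (fst s) x 0 k, snd s)"

primrec run :: "loop \<Rightarrow> state \<Rightarrow> state" where
  "run LSkip = (\<lambda>s. s)"
| "run (LI a e f) = (\<lambda>s. (store (fst s) a (ival e s) (ival f s), snd s))"
| "run (LR a e f) = (\<lambda>s. (fst s, store (snd s) a (ival e s) (rval f s)))"
| "run (LSeq c d) = (\<lambda>s. run d (run c s))"
| "run (LIf b c d) = (\<lambda>s. if bval b s then run c s else run d s)"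
| "run (LFor x b c) =
     (\<lambda>s. ((\<lambda>s. let s' = run c s in upd x (Suc (fst s' x 0)) s') ^^ fst s b 0) (upd x 0 s))"

primrec compile :: "loop \<Rightarrow> com" where
  "compile LSkip = Skip"
| "compile (LI a e f) = ISet a e f"
| "compile (LR a e f) = RSet a e f"
| "compile (LSeq c d) = Seq (compile c) (compile d)"
| "compile (LIf b c d) = Cond b (compile c) (compile d)"
| "compile (LFor x b c) =
     Seq (ISet x (INum 0) (INum 0))
       (While (ILess (IGet x (INum 0)) (IGet b (INum 0)))
         (Seq (compile c) (ISet x (INum 0) (IAdd (IGet x (INum 0)) (INum 1)))))"

primrec wi :: "loop \<Rightarrow> string set" where
  "wi LSkip = {}" | "wi (LI a e f) = {a}" | "wi (LR a e f) = {}"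
| "wi (LSeq c d) = wi c \<union> wi d" | "wi (LIf b c d) = wi c \<union> wi d" | "wi (LFor x b c) = insert x (wi c)"

primrec wr :: "loop \<Rightarrow> string set" where
  "wr LSkip = {}" | "wr (LI a e f) = {}" | "wr (LR a e f) = {a}"
| "wr (LSeq c d) = wr c \<union> wr d" | "wr (LIf b c d) = wr c \<union> wr d" | "wr (LFor x b c) = wr c"

primrec bounds :: "loop \<Rightarrow> string set" where
  "bounds LSkip = {}" | "bounds (LI a e f) = {}" | "bounds (LR a e f) = {}"
| "bounds (LSeq c d) = bounds c \<union> bounds d" | "bounds (LIf b c d) = bounds c \<union> bounds d"
| "bounds (LFor x b c) = insert b (bounds c)"

primrec counters_ok :: "loop \<Rightarrow> bool" where
  "counters_ok LSkip = True" | "counters_ok (LI a e f) = True" | "counters_ok (LR a e f) = True"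
| "counters_ok (LSeq c d) = (counters_ok c \<and> counters_ok d)"
| "counters_ok (LIf b c d) = (counters_ok c \<and> counters_ok d)"
| "counters_ok (LFor x b c) = (x \<notin> wi c \<and> counters_ok c)"

text \<open>A polynomial in a common bound on all loop limits; conditionals pay for both branches.
  For a loop, 9 = 3 + 6 covers the initialisation and the failing last test, and 12 = 6 + 6 the test
  and the increment of one iteration.\<close>

primrec cost_poly :: "loop \<Rightarrow> nat poly" where
  "cost_poly LSkip = [:1:]"
| "cost_poly (LI a e f) = [:Suc (icost e + icost f):]"
| "cost_poly (LR a e f) = [:Suc (icost e + rcost f):]"
| "cost_poly (LSeq c d) = cost_poly c + cost_poly d"
| "cost_poly (LIf b c d) = [:Suc (bcost b):] + cost_poly c + cost_poly d"
| "cost_poly (LFor x b c) = [:9:] + [:0, 1:] * ([:12:] + cost_poly c)"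

lemma store_apply: "store mem a k v = (\<lambda>b. if b = a then (mem a)(k := v) else mem b)"
  by (auto simp: store_def)

lemma fst_upd: "fst (upd x k s) a = (if a = x then (fst s x)(0 := k) else fst s a)"
  and snd_upd [simp]: "snd (upd x k s) = snd s"
  by (simp_all add: upd_def store_apply)

lemma run_frame:
  "a \<notin> wi c \<Longrightarrow> fst (run c s) a = fst s a"
  "a \<notin> wr c \<Longrightarrow> snd (run c s) a = snd s a"
proof (induction c arbitrary: s)
  case (LFor x b c)
  { case 1
    have "fst (((\<lambda>s. let s' = run c s in upd x (Suc (fst s' x 0)) s') ^^ k) s) a = fst s a" for k s
      using 1 LFor.IH(1) by (induction k) (auto simp: Let_def fst_upd)
    then show ?case using 1 by (simp add: fst_upd) }
  { case 2
    have "snd (((\<lambda>s. let s' = run c s in upd x (Suc (fst s' x 0)) s') ^^ k) s) a = snd s a" for k s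
      using 2 LFor.IH(2) by (induction k) (auto simp: Let_def)
    then show ?case by simp }
qed (auto simp: store_apply)

text \<open>The invariant rule with the frame built in: arrays that the body does not write keep
  their values from before the loop, so the invariant describes only the written ones.\<close>

lemma run_LFor_induct:
  assumes "x \<notin> wi c" and init: "Inv 0 (upd x 0 s)"
    and step: "\<And>k s'. k < fst s b 0 \<Longrightarrow> Inv k s' \<Longrightarrow> fst s' x 0 = k \<Longrightarrow>
      (\<And>a. a \<notin> wi c \<Longrightarrow> a \<noteq> x \<Longrightarrow> fst s' a = fst s a) \<Longrightarrow> (\<And>a. a \<notin> wr c \<Longrightarrow> snd s' a = snd s a) \<Longrightarrow>
      Inv (Suc k) (upd x (Suc k) (run c s'))"
  shows "Inv (fst s b 0) (run (LFor x b c) s)"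
proof -
  let ?F = "\<lambda>s. let s' = run c s in upd x (Suc (fst s' x 0)) s'"
  have "k \<le> fst s b 0 \<Longrightarrow> Inv k ((?F ^^ k) (upd x 0 s)) \<and> fst ((?F ^^ k) (upd x 0 s)) x 0 = k \<and>
      (\<forall>a. a \<notin> wi c \<longrightarrow> a \<noteq> x \<longrightarrow> fst ((?F ^^ k) (upd x 0 s)) a = fst s a) \<and>
      (\<forall>a. a \<notin> wr c \<longrightarrow> snd ((?F ^^ k) (upd x 0 s)) a = snd s a)" for k
  proof (induction k)
    case 0
    then show ?case using init by (simp add: fst_upd)
  next
    case (Suc k)
    let ?s = "(?F ^^ k) (upd x 0 s)"
    have IH: "Inv k ?s" "fst ?s x 0 = k" "\<And>a. a \<notin> wi c \<Longrightarrow> a \<noteq> x \<Longrightarrow> fst ?s a = fst s a"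
      "\<And>a. a \<notin> wr c \<Longrightarrow> snd ?s a = snd s a"
      using Suc by auto
    have x: "fst (run c ?s) x 0 = k" using run_frame(1)[OF assms(1), of ?s] IH(2) by simp
    have F: "(?F ^^ Suc k) (upd x 0 s) = upd x (Suc k) (run c ?s)"
      using x by (simp add: Let_def)
    show ?case
      unfolding F using step[OF _ IH] Suc.prems IH(3,4) run_frame[of _ c ?s] by (auto simp: fst_upd)
  qed
  then show ?thesis by simp
qed

text \<open>\<open>run\<close> reads the limit once, the while loop before every iteration; they
  agree because no limit is written. The body leaves the counter alone, so each iteration raises it
  by exactly one.\<close>

lemma exec_compile:
  assumes "counters_ok c" "bounds c \<inter> wi c = {}" "\<forall>b\<in>bounds c. fst s b 0 \<le> B"
  shows "\<exists>t \<le> poly (cost_poly c) B. exec (compile c) s t (run c s)"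
  using assms
proof (induction c arbitrary: s)
  case LSkip
  then show ?case using exec.intros(1)[of s] by auto
next
  case (LI a e f)
  then show ?case using exec.intros(2)[of a e f s] by auto
next
  case (LR a e f)
  then show ?case using exec.intros(3)[of a e f s] by auto
next
  case (LSeq c d)
  obtain t where t: "t \<le> poly (cost_poly c) B" "exec (compile c) s t (run c s)"
    using LSeq.IH(1)[of s] LSeq.prems by auto
  have "fst (run c s) b = fst s b" if "b \<in> bounds d" for b
    using LSeq.prems that by (intro run_frame) auto
  then obtain u where u: "u \<le> poly (cost_poly d) B" "exec (compile d) (run c s) u (run d (run c s))"
    using LSeq.IH(2)[of "run c s"] LSeq.prems by auto
  show ?case
    using exec.intros(4)[OF t(2) u(2)] t(1) u(1) by (intro exI[of _ "t + u"]) auto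
next
  case (LIf b c d)
  show ?case
  proof (cases "bval b s")
    case True
    obtain t where t: "t \<le> poly (cost_poly c) B" "exec (compile c) s t (run c s)"
      using LIf.IH(1)[of s] LIf.prems by auto
    show ?thesis
      using exec.intros(5)[OF True t(2), of "compile d"] t(1) True
      by (intro exI[of _ "Suc (bcost b + t)"]) auto
  next
    case False
    obtain t where t: "t \<le> poly (cost_poly d) B" "exec (compile d) s t (run d s)"
      using LIf.IH(2)[of s] LIf.prems by auto
    show ?thesis
      using exec.intros(6)[OF False t(2), of "compile c"] t(1) False
      by (intro exI[of _ "Suc (bcost b + t)"]) auto
  qed
next
  case (LFor x b c)
  define F where "F = (\<lambda>s. let s' = run c s in upd x (Suc (fst s' x 0)) s')"
  have F: "F s = upd x (Suc (fst (run c s) x 0)) (run c s)" for s by (simp add: F_def Let_def)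
  let ?g = "ILess (IGet x (INum 0)) (IGet b (INum 0))"
  let ?inc = "ISet x (INum 0) (IAdd (IGet x (INum 0)) (INum 1))"
  let ?C = "poly (cost_poly c) B"
  have xb: "x \<noteq> b" and bc: "b \<notin> wi c" and xc: "x \<notin> wi c" using LFor.prems by auto
  have loop: "\<exists>t \<le> 6 + k * (12 + ?C). exec (While ?g (Seq (compile c) ?inc)) s t ((F ^^ k) s)"
    if "fst s b 0 - fst s x 0 = k" "fst s x 0 \<le> fst s b 0" "\<forall>b\<in>bounds c. fst s b 0 \<le> B" for k s
    using that
  proof (induction k arbitrary: s)
    case 0
    then have "\<not> bval ?g s" by simp
    from exec.intros(7)[OF this] show ?case by (intro exI[of _ 6]) (simp add: numeral_eq_Suc)
  next
    case (Suc k)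
    then have g: "bval ?g s" by simp
    obtain t where t: "t \<le> ?C" "exec (compile c) s t (run c s)"
      using LFor.IH[of s] LFor.prems Suc.prems by auto
    have fr: "fst (run c s) b = fst s b" "fst (run c s) x = fst s x"
      using run_frame(1)[OF bc] run_frame(1)[OF xc] by auto
    have "exec ?inc (run c s) 6 (F s)"
      using exec.intros(2)[of x "INum 0" "IAdd (IGet x (INum 0)) (INum 1)" "run c s"]
      by (simp add: F upd_def numeral_eq_Suc)
    from exec.intros(4)[OF t(2) this]
    have body: "exec (Seq (compile c) ?inc) s (t + 6) (F s)" .
    have "fst (F s) a = fst s a" if "a \<in> bounds c" for a
    proof -
      have "a \<notin> wi c" "a \<noteq> x" using LFor.prems(2) that by auto
      then show ?thesis using run_frame(1)[of a c s] by (simp add: F fst_upd)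
    qed
    moreover have "fst (F s) b 0 = fst s b 0" "fst (F s) x 0 = Suc (fst s x 0)"
      using fr xb by (simp_all add: F fst_upd)
    ultimately have "\<exists>u \<le> 6 + k * (12 + ?C). exec (While ?g (Seq (compile c) ?inc)) (F s) u ((F ^^ k) (F s))"
      by (intro Suc.IH) (use Suc.prems in simp_all)
    then obtain u where u: "u \<le> 6 + k * (12 + ?C)" "exec (While ?g (Seq (compile c) ?inc)) (F s) u ((F ^^ k) (F s))"
      by blast
    have "(F ^^ Suc k) s = (F ^^ k) (F s)" by (simp add: funpow_swap1)
    then have "exec (While ?g (Seq (compile c) ?inc)) s (Suc (bcost ?g + (t + 6) + u)) ((F ^^ Suc k) s)"
      using exec.intros(8)[OF g body u(2)] by simp
    moreover have "Suc (bcost ?g + (t + 6) + u) \<le> 6 + Suc k * (12 + ?C)"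
      using u(1) t(1) by simp
    ultimately show ?case by blast
  qed
  have "\<forall>a\<in>bounds c. fst (upd x 0 s) a 0 \<le> B"
    using LFor.prems by (auto simp: fst_upd)
  then have "\<exists>t \<le> 6 + fst s b 0 * (12 + ?C). exec (While ?g (Seq (compile c) ?inc)) (upd x 0 s) t ((F ^^ fst s b 0) (upd x 0 s))"
    using xb by (intro loop) (simp_all add: fst_upd)
  then obtain t where t: "t \<le> 6 + fst s b 0 * (12 + ?C)"
    "exec (While ?g (Seq (compile c) ?inc)) (upd x 0 s) t ((F ^^ fst s b 0) (upd x 0 s))"
    by blast
  have "exec (ISet x (INum 0) (INum 0)) s 3 (upd x 0 s)"
    using exec.intros(2)[of x "INum 0" "INum 0" s] by (simp add: upd_def numeral_eq_Suc)
  from exec.intros(4)[OF this t(2)]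
  have "exec (compile (LFor x b c)) s (3 + t) (run (LFor x b c) s)" by (simp add: F_def)
  moreover have "fst s b 0 * (12 + ?C) \<le> B * (12 + ?C)"
    using LFor.prems by (intro mult_right_mono) auto
  moreover from this have "3 + t \<le> poly (cost_poly (LFor x b c)) B"
    using t(1) by (simp add: algebra_simps)
  ultimately show ?case by blast
qed

section \<open>Computing the boundary matrix\<close>

abbreviation (input) "Sc a \<equiv> IGet a (INum 0)"
abbreviation (input) "Rc a \<equiv> RGet a (INum 0)"
abbreviation (input) "INe e f \<equiv> BNot (BAnd (BNot (ILess e f)) (BNot (ILess f e)))"
abbreviation (input) "RNe e f \<equiv> BNot (BAnd (BNot (RLess e f)) (BNot (RLess f e)))"

text \<open>The real scalar \<open>s\<close> collects the sign of one summand of the boundary coefficient; the face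
  of \<open>\<tau>\<close> opposite to vertex \<open>k\<close> is \<open>\<sigma>\<close> if the number \<open>q\<close> of common vertices is \<open>p + 1\<close>.\<close>

definition prog_count :: loop where
  "prog_count = LFor ''a'' ''d'' (LFor ''b'' ''f''
     (LIf (BAnd (INe (Sc ''b'') (Sc ''k''))
            (BNot (INe (IGet ''P'' (IAdd (IMul (Sc ''i'') (Sc ''d'')) (Sc ''a'')))
                       (IGet ''Q'' (IAdd (IMul (Sc ''j'') (Sc ''f'')) (Sc ''b''))))))
       (LI ''q'' (INum 0) (IAdd (Sc ''q'') (INum 1))) LSkip))"

definition prog_flip :: loop where
  "prog_flip = LR ''s'' (INum 0) (RSub (RNum 0) (Rc ''s''))"

text \<open>Multiplies the sign by the parity of the inversions in row \<open>r\<close> of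
  \<open>M\<close>, that is, by the \<open>inversion_sign\<close> of that row.\<close>

definition prog_inv :: "string \<Rightarrow> string \<Rightarrow> string \<Rightarrow> loop" where
  "prog_inv M r l = LFor ''a'' l (LFor ''b'' l
     (LIf (BAnd (ILess (Sc ''a'') (Sc ''b''))
            (BNot (ILess (IGet M (IAdd (IMul (Sc r) (Sc l)) (Sc ''a'')))
                         (IGet M (IAdd (IMul (Sc r) (Sc l)) (Sc ''b''))))))
       prog_flip LSkip))"

text \<open>Compares vertex k with the other vertices of \<tau>. Moving it to the front shows that
  this sign times \<open>inversion_sign\<close> of \<tau> is (-1)^k times
  \<open>inversion_sign\<close> of the face, so the program forms neither the power of -1 nor the
  list of the face.\<close>

definition prog_row :: loop where
  "prog_row = LFor ''b'' ''f''
     (LIf (BAnd (INe (Sc ''b'') (Sc ''k''))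
            (BNot (ILess (IGet ''Q'' (IAdd (IMul (Sc ''j'') (Sc ''f'')) (Sc ''k'')))
                         (IGet ''Q'' (IAdd (IMul (Sc ''j'') (Sc ''f'')) (Sc ''b''))))))
       prog_flip LSkip)"

definition prog_entry :: loop where
  "prog_entry = LSeq (LR ''D'' (IAdd (IMul (Sc ''i'') (Sc ''n'')) (Sc ''j'')) (RNum 0))
     (LFor ''k'' ''f''
       (LSeq (LI ''q'' (INum 0) (INum 0)) (LSeq (LR ''s'' (INum 0) (RNum 1))
         (LSeq prog_count (LSeq (prog_inv ''P'' ''i'' ''d'') (LSeq (prog_inv ''Q'' ''j'' ''f'') (LSeq prog_row
           (LIf (INe (Sc ''q'') (Sc ''d'')) LSkip
             (LR ''D'' (IAdd (IMul (Sc ''i'') (Sc ''n'')) (Sc ''j''))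
               (RAdd (RGet ''D'' (IAdd (IMul (Sc ''i'') (Sc ''n'')) (Sc ''j''))) (Rc ''s'')))))))))))"

definition prog_boundary :: loop where
  "prog_boundary = LFor ''i'' ''m'' (LFor ''j'' ''n'' prog_entry)"

lemma run_count:
  assumes "fst s ''q'' 0 = 0"
  shows "fst (run prog_count s) ''q'' 0 = (\<Sum>a<fst s ''d'' 0. \<Sum>b<fst s ''f'' 0.
    if b \<noteq> fst s ''k'' 0 \<and> fst s ''P'' (fst s ''i'' 0 * fst s ''d'' 0 + a) = fst s ''Q'' (fst s ''j'' 0 * fst s ''f'' 0 + b)
    then 1 else 0)" (is "_ = (\<Sum>a<_. \<Sum>b<?f. ?g a b)")
  unfolding prog_count_def
proof (rule run_LFor_induct[where Inv="\<lambda>k s'. fst s' ''q'' 0 = (\<Sum>a<k. \<Sum>b<?f. ?g a b)"])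
  show "fst (upd ''a'' 0 s) ''q'' 0 = (\<Sum>a<0. \<Sum>b<?f. ?g a b)" using assms by (simp add: fst_upd)
  fix x and s1 :: state
  assume q1: "fst s1 ''q'' 0 = (\<Sum>a<x. \<Sum>b<?f. ?g a b)" and x1: "fst s1 ''a'' 0 = x"
    and fr1: "\<And>a. a \<notin> wi (LFor ''b'' ''f'' (LIf (BAnd (INe (Sc ''b'') (Sc ''k''))
            (BNot (INe (IGet ''P'' (IAdd (IMul (Sc ''i'') (Sc ''d'')) (Sc ''a'')))
                       (IGet ''Q'' (IAdd (IMul (Sc ''j'') (Sc ''f'')) (Sc ''b''))))))
       (LI ''q'' (INum 0) (IAdd (Sc ''q'') (INum 1))) LSkip)) \<Longrightarrow> a \<noteq> ''a'' \<Longrightarrow> fst s1 a = fst s a"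
  have fr: "fst s1 ''f'' = fst s ''f''" "fst s1 ''k'' = fst s ''k''" "fst s1 ''P'' = fst s ''P''" "fst s1 ''Q'' = fst s ''Q''"
     "fst s1 ''i'' = fst s ''i''" "fst s1 ''j'' = fst s ''j''" "fst s1 ''d'' = fst s ''d''"
    by (simp_all add: fr1)
  have "fst (run (LFor ''b'' ''f'' (LIf (BAnd (INe (Sc ''b'') (Sc ''k''))
            (BNot (INe (IGet ''P'' (IAdd (IMul (Sc ''i'') (Sc ''d'')) (Sc ''a'')))
                       (IGet ''Q'' (IAdd (IMul (Sc ''j'') (Sc ''f'')) (Sc ''b''))))))
       (LI ''q'' (INum 0) (IAdd (Sc ''q'') (INum 1))) LSkip)) s1) ''q'' 0
     = (\<Sum>a<x. \<Sum>b<?f. ?g a b) + (\<Sum>b<fst s1 ''f'' 0. ?g x b)"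
    by (rule run_LFor_induct[where Inv="\<lambda>y s'. fst s' ''q'' 0 = (\<Sum>a<x. \<Sum>b<?f. ?g a b) + (\<Sum>b<y. ?g x b)"])
      (auto simp: fst_upd q1 x1 fr store_apply)
  then show "fst (upd ''a'' (Suc x) (run (LFor ''b'' ''f'' (LIf (BAnd (INe (Sc ''b'') (Sc ''k''))
            (BNot (INe (IGet ''P'' (IAdd (IMul (Sc ''i'') (Sc ''d'')) (Sc ''a'')))
                       (IGet ''Q'' (IAdd (IMul (Sc ''j'') (Sc ''f'')) (Sc ''b''))))))
       (LI ''q'' (INum 0) (IAdd (Sc ''q'') (INum 1))) LSkip)) s1)) ''q'' 0 = (\<Sum>a<Suc x. \<Sum>b<?f. ?g a b)"
    by (simp add: fst_upd fr)
qed simp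

lemma run_inv:
  assumes "M \<notin> {''a'', ''b''}" "r \<notin> {''a'', ''b''}" "l \<notin> {''a'', ''b''}"
  shows "snd (run (prog_inv M r l) s) ''s'' 0 = snd s ''s'' 0 * (\<Prod>a<fst s l 0. \<Prod>b<fst s l 0.
    if a < b \<and> \<not> fst s M (fst s r 0 * fst s l 0 + a) < fst s M (fst s r 0 * fst s l 0 + b) then - 1 else 1)"
   (is "_ = _ * (\<Prod>a<?l. \<Prod>b<?l. ?g a b)")
proof -
  define inner where "inner = LFor ''b'' l
     (LIf (BAnd (ILess (Sc ''a'') (Sc ''b''))
            (BNot (ILess (IGet M (IAdd (IMul (Sc r) (Sc l)) (Sc ''a'')))
                         (IGet M (IAdd (IMul (Sc r) (Sc l)) (Sc ''b''))))))
       prog_flip LSkip)"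
  have wi: "wi inner = {''b''}" by (simp add: inner_def prog_flip_def)
  have "snd (run (LFor ''a'' l inner) s) ''s'' 0 = snd s ''s'' 0 * (\<Prod>a<?l. \<Prod>b<?l. ?g a b)"
  proof (rule run_LFor_induct[where Inv="\<lambda>k s'. snd s' ''s'' 0 = snd s ''s'' 0 * (\<Prod>a<k. \<Prod>b<?l. ?g a b)"])
    fix x and s1 :: state
    assume q1: "snd s1 ''s'' 0 = snd s ''s'' 0 * (\<Prod>a<x. \<Prod>b<?l. ?g a b)" and x1: "fst s1 ''a'' 0 = x"
      and fr1: "\<And>a. a \<notin> wi inner \<Longrightarrow> a \<noteq> ''a'' \<Longrightarrow> fst s1 a = fst s a"
    have fr: "fst s1 M = fst s M" "fst s1 r = fst s r" "fst s1 l = fst s l"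
      using assms by (simp_all add: fr1 wi)
    have "snd (run inner s1) ''s'' 0 = (snd s ''s'' 0 * (\<Prod>a<x. \<Prod>b<?l. ?g a b)) * (\<Prod>b<fst s1 l 0. ?g x b)"
      unfolding inner_def
      by (rule run_LFor_induct[where Inv="\<lambda>y s'. snd s' ''s'' 0 = (snd s ''s'' 0 * (\<Prod>a<x. \<Prod>b<?l. ?g a b)) * (\<Prod>b<y. ?g x b)"])
        (use assms in \<open>auto simp: fst_upd q1 x1 fr store_apply prog_flip_def\<close>)
    then show "snd (upd ''a'' (Suc x) (run inner s1)) ''s'' 0 = snd s ''s'' 0 * (\<Prod>a<Suc x. \<Prod>b<?l. ?g a b)"
      by (simp add: fr)
  qed (simp_all add: wi)
  then show ?thesis by (simp add: prog_inv_def inner_def)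
qed

lemma run_row:
  "snd (run prog_row s) ''s'' 0 = snd s ''s'' 0 * (\<Prod>b<fst s ''f'' 0.
    if b \<noteq> fst s ''k'' 0 \<and> \<not> fst s ''Q'' (fst s ''j'' 0 * fst s ''f'' 0 + fst s ''k'' 0) < fst s ''Q'' (fst s ''j'' 0 * fst s ''f'' 0 + b)
    then - 1 else 1)" (is "_ = _ * (\<Prod>b<_. ?g b)")
  unfolding prog_row_def
  by (rule run_LFor_induct[where Inv="\<lambda>y s'. snd s' ''s'' 0 = snd s ''s'' 0 * (\<Prod>b<y. ?g b)"])
    (auto simp: fst_upd store_apply prog_flip_def)

text \<open>One summand of a matrix entry in the form in which the program obtains it; the count of
  matches acts as the face test.\<close>

definition entry_term :: "nat list \<Rightarrow> nat list \<Rightarrow> nat \<Rightarrow> real" where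
  "entry_term \<sigma> \<tau> k =
     (if (\<Sum>a<length \<sigma>. \<Sum>b<length \<tau>. if b \<noteq> k \<and> \<sigma> ! a = \<tau> ! b then 1 else 0) = length \<sigma>
      then (\<Prod>a<length \<sigma>. \<Prod>b<length \<sigma>. if a < b \<and> \<not> \<sigma> ! a < \<sigma> ! b then - 1 else 1) *
           (\<Prod>a<length \<tau>. \<Prod>b<length \<tau>. if a < b \<and> \<not> \<tau> ! a < \<tau> ! b then - 1 else 1) *
           (\<Prod>b<length \<tau>. if b \<noteq> k \<and> \<not> \<tau> ! k < \<tau> ! b then - 1 else 1)
      else 0)"

definition row_of :: "(nat \<Rightarrow> nat) \<Rightarrow> nat \<Rightarrow> nat \<Rightarrow> nat list" where
  "row_of M l i = map (\<lambda>a. M (i * l + a)) [0..<l]"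

lemma row_of_simps [simp]: "length (row_of M l i) = l" "a < l \<Longrightarrow> row_of M l i ! a = M (i * l + a)"
  by (simp_all add: row_of_def)

lemma run_entry:
  "snd (run prog_entry s) ''D'' = (snd s ''D'')(fst s ''i'' 0 * fst s ''n'' 0 + fst s ''j'' 0 :=
     (\<Sum>k<fst s ''f'' 0. entry_term (row_of (fst s ''P'') (fst s ''d'' 0) (fst s ''i'' 0))
        (row_of (fst s ''Q'') (fst s ''f'' 0) (fst s ''j'' 0)) k))"
proof -
  let ?i = "fst s ''i'' 0 * fst s ''n'' 0 + fst s ''j'' 0"
  let ?\<sigma> = "row_of (fst s ''P'') (fst s ''d'' 0) (fst s ''i'' 0)"
  let ?\<tau> = "row_of (fst s ''Q'') (fst s ''f'' 0) (fst s ''j'' 0)"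
  let ?D = "IAdd (IMul (Sc ''i'') (Sc ''n'')) (Sc ''j'')"
  define pre where "pre = LSeq (LI ''q'' (INum 0) (INum 0)) (LR ''s'' (INum 0) (RNum 1))"
  define last where "last = LIf (INe (Sc ''q'') (Sc ''d'')) LSkip (LR ''D'' ?D (RAdd (RGet ''D'' ?D) (Rc ''s'')))"
  define body where "body = LSeq pre (LSeq prog_count (LSeq (prog_inv ''P'' ''i'' ''d'') (LSeq (prog_inv ''Q'' ''j'' ''f'') (LSeq prog_row last))))"
  have W: "wi prog_count = {''a'', ''b'', ''q''}" "wr prog_count = {}" "wi (prog_inv M r l) = {''a'', ''b''}" "wr (prog_inv M r l) = {''s''}"
     "wi prog_row = {''b''}" "wr prog_row = {''s''}" for M r l
    by (auto simp: prog_count_def prog_inv_def prog_row_def prog_flip_def)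
  have wib: "wi body = {''a'', ''b'', ''q''}" "wr body = {''s'', ''D''}"
    by (auto simp: body_def pre_def last_def W)
  let ?s0 = "run (LR ''D'' ?D (RNum 0)) s"
  have "snd (run (LFor ''k'' ''f'' body) ?s0) ''D'' = (snd s ''D'')(?i := \<Sum>k<fst ?s0 ''f'' 0. entry_term ?\<sigma> ?\<tau> k)"
  proof (rule run_LFor_induct[where Inv="\<lambda>y s'. snd s' ''D'' = (snd s ''D'')(?i := \<Sum>k<y. entry_term ?\<sigma> ?\<tau> k)"])
    fix k and s1 :: state
    assume k: "k < fst ?s0 ''f'' 0" and D: "snd s1 ''D'' = (snd s ''D'')(?i := \<Sum>k<k. entry_term ?\<sigma> ?\<tau> k)"
      and k1: "fst s1 ''k'' 0 = k" and fr1: "\<And>a. a \<notin> wi body \<Longrightarrow> a \<noteq> ''k'' \<Longrightarrow> fst s1 a = fst ?s0 a"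
    have fr: "fst s1 a = fst s a" if "a \<in> {''P'', ''Q'', ''i'', ''j'', ''d'', ''f'', ''n''}" for a
      using fr1[of a] that by (auto simp: wib)
    define s2 where "s2 = run pre s1"
    define s3 where "s3 = run prog_count s2"
    define s4 where "s4 = run (prog_inv ''P'' ''i'' ''d'') s3"
    define s5 where "s5 = run (prog_inv ''Q'' ''j'' ''f'') s4"
    define s6 where "s6 = run prog_row s5"
    have f2: "fst s2 a = fst s1 a" if "a \<noteq> ''q''" for a using that by (simp add: s2_def pre_def store_apply)
    have f3: "fst s3 a = fst s2 a" if "a \<notin> {''a'', ''b'', ''q''}" for a unfolding s3_def using that by (intro run_frame) (simp add: W)
    have f4: "fst s4 a = fst s3 a" if "a \<notin> {''a'', ''b''}" for a unfolding s4_def using that by (intro run_frame) (simp add: W)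
    have f5: "fst s5 a = fst s4 a" if "a \<notin> {''a'', ''b''}" for a unfolding s5_def using that by (intro run_frame) (simp add: W)
    have f6: "fst s6 a = fst s5 a" if "a \<notin> {''a'', ''b''}" for a unfolding s6_def using that by (intro run_frame) (simp add: W)
    have g3: "snd s3 a = snd s2 a" for a unfolding s3_def by (intro run_frame) (simp add: W)
    have g6: "snd s6 ''D'' = snd s1 ''D''"
      unfolding s6_def s5_def s4_def s3_def s2_def by (subst run_frame, simp add: W)+ (simp add: pre_def store_apply)
    have all: "fst s' a = fst s a" if "a \<in> {''P'', ''Q'', ''i'', ''j'', ''d'', ''f'', ''n''}" "s' \<in> {s1, s2, s3, s4, s5, s6}" for a s'
      using that fr[of a] f2[of a] f3[of a] f4[of a] f5[of a] f6[of a] by auto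
    have kk: "fst s' ''k'' 0 = k" if "s' \<in> {s1, s2, s3, s4, s5, s6}" for s'
      using that k1 f2[of "''k''"] f3[of "''k''"] f4[of "''k''"] f5[of "''k''"] f6[of "''k''"] by auto
    have q: "fst s6 ''q'' 0 = (\<Sum>a<length ?\<sigma>. \<Sum>b<length ?\<tau>. if b \<noteq> k \<and> ?\<sigma> ! a = ?\<tau> ! b then 1 else 0)"
    proof -
      have "fst s2 ''q'' 0 = 0" by (simp add: s2_def pre_def store_apply)
      from run_count[OF this] show ?thesis
        using f4[of "''q''"] f5[of "''q''"] f6[of "''q''"] by (simp add: s3_def[symmetric] all kk)
    qed
    have "snd s2 ''s'' 0 = 1" by (simp add: s2_def pre_def store_apply)
    then have sg: "snd s6 ''s'' 0 = (\<Prod>a<length ?\<sigma>. \<Prod>b<length ?\<sigma>. if a < b \<and> \<not> ?\<sigma> ! a < ?\<sigma> ! b then - 1 else 1) *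
           (\<Prod>a<length ?\<tau>. \<Prod>b<length ?\<tau>. if a < b \<and> \<not> ?\<tau> ! a < ?\<tau> ! b then - 1 else 1) *
           (\<Prod>b<length ?\<tau>. if b \<noteq> k \<and> \<not> ?\<tau> ! k < ?\<tau> ! b then - 1 else 1)"
      unfolding s6_def run_row unfolding s5_def
      using run_inv[of "''Q''" "''j''" "''f''" s4] run_inv[of "''P''" "''i''" "''d''" s3] k
      by (simp add: s5_def[symmetric] s4_def[symmetric] all kk g3 store_apply)
    have d6: "fst s6 ''d'' 0 = length ?\<sigma>" by (simp add: all)
    have idx6: "ival ?D s6 = ?i" by (simp add: all)
    have E: "entry_term ?\<sigma> ?\<tau> k = (if fst s6 ''q'' 0 = length ?\<sigma> then snd s6 ''s'' 0 else 0)"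
      by (simp only: entry_term_def q sg)
    have "snd (run body s1) ''D'' = snd (run last s6) ''D''"
      by (simp only: body_def s2_def s3_def s4_def s5_def s6_def run.simps)
    also have "\<dots> = (if fst s6 ''q'' 0 = length ?\<sigma> then (snd s6 ''D'')(?i := snd s6 ''D'' ?i + snd s6 ''s'' 0) else snd s6 ''D'')"
      unfolding last_def run.simps rval.simps idx6 bval.simps ival.simps d6 by (auto simp: store_apply all)
    also have "\<dots> = (snd s1 ''D'')(?i := snd s1 ''D'' ?i + entry_term ?\<sigma> ?\<tau> k)"
      by (simp add: E g6)
    finally show "snd (upd ''k'' (Suc k) (run body s1)) ''D'' = (snd s ''D'')(?i := \<Sum>k<Suc k. entry_term ?\<sigma> ?\<tau> k)"
      using D by (simp add: fun_eq_iff)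
  qed (auto simp: wib store_apply)
  moreover have "run prog_entry s = run (LFor ''k'' ''f'' body) ?s0"
    by (simp only: prog_entry_def body_def pre_def last_def run.simps)
  ultimately show ?thesis by (simp add: store_apply)
qed

lemma index_eq_iff:
  fixes n :: nat
  assumes "j < n" "j' < n"
  shows "i * n + j = i' * n + j' \<longleftrightarrow> i = i' \<and> j = j'"
proof -
  have "(i * n + j) div n = i" "(i * n + j) mod n = j" "(i' * n + j') div n = i'" "(i' * n + j') mod n = j'"
    using assms by simp_all
  then show ?thesis by metis
qed

lemma run_boundary:
  assumes "i < fst s ''m'' 0" "j < fst s ''n'' 0"
  shows "snd (run prog_boundary s) ''D'' (i * fst s ''n'' 0 + j) =
     (\<Sum>k<fst s ''f'' 0. entry_term (row_of (fst s ''P'') (fst s ''d'' 0) i) (row_of (fst s ''Q'') (fst s ''f'' 0) j) k)"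
proof -
  let ?n = "fst s ''n'' 0"
  let ?e = "\<lambda>i j. \<Sum>k<fst s ''f'' 0. entry_term (row_of (fst s ''P'') (fst s ''d'' 0) i) (row_of (fst s ''Q'') (fst s ''f'' 0) j) k"
  have W: "wi prog_entry = {''k'', ''a'', ''b'', ''q''}" "wr prog_entry = {''s'', ''D''}"
    by (auto simp: prog_entry_def prog_count_def prog_inv_def prog_row_def prog_flip_def)
  note idx = index_eq_iff[of _ ?n]
  have "\<forall>i<fst s ''m'' 0. \<forall>j<?n. snd (run prog_boundary s) ''D'' (i * ?n + j) = ?e i j"
    unfolding prog_boundary_def
  proof (rule run_LFor_induct[where Inv="\<lambda>x s'. \<forall>i<x. \<forall>j<?n. snd s' ''D'' (i * ?n + j) = ?e i j"])
    fix x and s1 :: state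
    assume D: "\<forall>i<x. \<forall>j<?n. snd s1 ''D'' (i * ?n + j) = ?e i j" and x: "fst s1 ''i'' 0 = x"
      and fr1: "\<And>a. a \<notin> wi (LFor ''j'' ''n'' prog_entry) \<Longrightarrow> a \<noteq> ''i'' \<Longrightarrow> fst s1 a = fst s a"
    have fr: "fst s1 a = fst s a" if "a \<in> {''P'', ''Q'', ''d'', ''f'', ''n''}" for a
      using fr1[of a] that by (auto simp: W)
    have "(\<forall>i<x. \<forall>j<?n. snd (run (LFor ''j'' ''n'' prog_entry) s1) ''D'' (i * ?n + j) = ?e i j) \<and>
        (\<forall>j<fst s1 ''n'' 0. snd (run (LFor ''j'' ''n'' prog_entry) s1) ''D'' (x * ?n + j) = ?e x j)"
    proof (rule run_LFor_induct[where Inv="\<lambda>y s'. (\<forall>i<x. \<forall>j<?n. snd s' ''D'' (i * ?n + j) = ?e i j) \<and>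
        (\<forall>j<y. snd s' ''D'' (x * ?n + j) = ?e x j)"])
      fix y and s2 :: state
      assume y: "y < fst s1 ''n'' 0" and D2: "(\<forall>i<x. \<forall>j<?n. snd s2 ''D'' (i * ?n + j) = ?e i j) \<and>
        (\<forall>j<y. snd s2 ''D'' (x * ?n + j) = ?e x j)" and y2: "fst s2 ''j'' 0 = y"
        and fr2: "\<And>a. a \<notin> wi prog_entry \<Longrightarrow> a \<noteq> ''j'' \<Longrightarrow> fst s2 a = fst s1 a"
      have f: "fst s2 a = fst s a" if "a \<in> {''P'', ''Q'', ''d'', ''f'', ''n''}" for a
        using fr2[of a] fr[of a] that by (auto simp: W)
      have i2: "fst s2 ''i'' 0 = x" using fr2[of "''i''"] x by (simp add: W)
      have yn: "y < ?n" using y fr by simp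
      have "snd (run prog_entry s2) ''D'' = (snd s2 ''D'')(x * ?n + y := ?e x y)"
        unfolding run_entry by (simp add: f i2 y2)
      then show "(\<forall>i<x. \<forall>j<?n. snd (upd ''j'' (Suc y) (run prog_entry s2)) ''D'' (i * ?n + j) = ?e i j) \<and>
        (\<forall>j<Suc y. snd (upd ''j'' (Suc y) (run prog_entry s2)) ''D'' (x * ?n + j) = ?e x j)"
        using D2 yn idx by (auto simp: less_Suc_eq)
    qed (use D in \<open>auto simp: W\<close>)
    then show "\<forall>i<Suc x. \<forall>j<?n. snd (upd ''i'' (Suc x) (run (LFor ''j'' ''n'' prog_entry) s1)) ''D'' (i * ?n + j) = ?e i j"
      using fr[of "''n''"] by (auto simp: less_Suc_eq)
  qed (auto simp: W)
  then show ?thesis using assms by blast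
qed

lemma inversion_sign_nth:
  "real_of_int (inversion_sign xs) = (\<Prod>a<length xs. \<Prod>b<length xs. if a < b \<and> \<not> xs ! a < xs ! b then - 1 else 1)"
proof (induction xs)
  case (Cons x xs)
  have "real_of_int (\<Prod>y\<leftarrow>xs. if x < y then 1 else -1) = (\<Prod>b<length xs. if \<not> x < xs ! b then - 1 else 1)"
    by (induction xs) (auto simp: prod.lessThan_Suc_shift simp del: prod.lessThan_Suc)
  then show ?case
    using Cons by (simp add: prod.lessThan_Suc_shift del: prod.lessThan_Suc)
qed simp

text \<open>A vertex of \<sigma> matches at most one position of \<tau>, so the count reaches the
  length of \<sigma> exactly if \<sigma> lies in the face, and then the two coincide because they
  have equally many vertices. The sign comes from moving vertex k of \<tau> to the front.\<close>

lemma entry_term_eq: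
  assumes d: "distinct \<sigma>" "distinct \<tau>" "length \<tau> = Suc (length \<sigma>)" and k: "k < length \<tau>"
  shows "entry_term \<sigma> \<tau> k = real_of_int ((- 1) ^ k * orientation_sign \<sigma> (take k \<tau> @ drop (Suc k) \<tau>))"
proof -
  let ?\<rho> = "take k \<tau> @ drop (Suc k) \<tau>"
  have \<tau>: "\<tau> = take k \<tau> @ \<tau> ! k # drop (Suc k) \<tau>" using k by (rule id_take_nth_drop)
  have d': "distinct (take k \<tau> @ \<tau> ! k # drop (Suc k) \<tau>)" "set \<tau> = set (take k \<tau> @ \<tau> ! k # drop (Suc k) \<tau>)"
    using d(2) \<tau> by metis+
  then have \<rho>: "distinct ?\<rho>" "set ?\<rho> = set \<tau> - {\<tau> ! k}" by auto
  have mem: "(\<Sum>b<length \<tau>. if b \<noteq> k \<and> x = \<tau> ! b then 1 else 0) = (if x \<in> set ?\<rho> then 1 else (0::nat))" for x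
  proof (cases "x \<in> set ?\<rho>")
    case True
    then obtain c where c: "c < length \<tau>" "x = \<tau> ! c" "c \<noteq> k"
      unfolding \<rho>(2) by (auto simp: in_set_conv_nth)
    have "(\<Sum>b<length \<tau>. if b \<noteq> k \<and> x = \<tau> ! b then 1 else 0) = (\<Sum>b<length \<tau>. if b = c then 1 else (0::nat))"
      using c d(2) by (intro sum.cong) (auto simp: nth_eq_iff_index_eq)
    then show ?thesis using c True by simp
  next
    case False
    then have "(\<Sum>b<length \<tau>. if b \<noteq> k \<and> x = \<tau> ! b then 1 else 0) = (0::nat)"
      unfolding \<rho>(2) using nth_eq_iff_index_eq[OF d(2) _ k] by (intro sum.neutral) auto
    then show ?thesis using False by simp
  qed
  have "(\<Sum>a<length \<sigma>. \<Sum>b<length \<tau>. if b \<noteq> k \<and> \<sigma> ! a = \<tau> ! b then 1 else 0) = card {a\<in>{..<length \<sigma>}. \<sigma> ! a \<in> set ?\<rho>}"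
    unfolding mem by (simp add: sum.If_cases Int_def)
  also have "\<dots> = length \<sigma> \<longleftrightarrow> set \<sigma> \<subseteq> set ?\<rho>"
  proof
    assume "card {a\<in>{..<length \<sigma>}. \<sigma> ! a \<in> set ?\<rho>} = length \<sigma>"
    then have "{a\<in>{..<length \<sigma>}. \<sigma> ! a \<in> set ?\<rho>} = {..<length \<sigma>}"
      by (intro card_subset_eq) auto
    then have "\<sigma> ! a \<in> set ?\<rho>" if "a < length \<sigma>" for a using that by blast
    then show "set \<sigma> \<subseteq> set ?\<rho>" by (metis in_set_conv_nth subsetI)
  next
    assume "set \<sigma> \<subseteq> set ?\<rho>"
    then have "{a\<in>{..<length \<sigma>}. \<sigma> ! a \<in> set ?\<rho>} = {..<length \<sigma>}"
      using nth_mem by blast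
    then show "card {a\<in>{..<length \<sigma>}. \<sigma> ! a \<in> set ?\<rho>} = length \<sigma>" by simp
  qed
  also have "\<dots> \<longleftrightarrow> set \<sigma> = set ?\<rho>"
  proof -
    have "card (set \<sigma>) = length \<sigma>" "card (set ?\<rho>) = length ?\<rho>"
      using distinct_card[OF d(1)] distinct_card[OF \<rho>(1)] by blast+
    moreover have "length ?\<rho> = length \<sigma>" using d(3) k by simp
    ultimately show ?thesis using card_subset_eq[of "set ?\<rho>" "set \<sigma>"] by auto
  qed
  finally have match: "(\<Sum>a<length \<sigma>. \<Sum>b<length \<tau>. if b \<noteq> k \<and> \<sigma> ! a = \<tau> ! b then 1 else 0) = length \<sigma> \<longleftrightarrow> set \<sigma> = set ?\<rho>" .
  define g :: "nat \<Rightarrow> int" where "g = (\<lambda>y. if \<tau> ! k < y then 1 else - 1)"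
  have "(\<Prod>y\<leftarrow>?\<rho>. g y) = (\<Prod>y\<in>set ?\<rho>. g y)"
    using \<rho>(1) by (simp only: prod.distinct_set_conv_list)
  also have "\<dots> = (\<Prod>y\<in>(\<lambda>b. \<tau> ! b) ` ({..<length \<tau>} - {k}). g y)"
  proof -
    have "set ?\<rho> = (\<lambda>b. \<tau> ! b) ` ({..<length \<tau>} - {k})"
      unfolding \<rho>(2) using nth_eq_iff_index_eq[OF d(2) _ k] by (auto simp: in_set_conv_nth)
    then show ?thesis by simp
  qed
  also have "\<dots> = (\<Prod>b\<in>{..<length \<tau>} - {k}. g (\<tau> ! b))"
    using d(2) by (subst prod.reindex) (auto simp: inj_on_def nth_eq_iff_index_eq)
  also have "\<dots> = (\<Prod>b<length \<tau>. if b \<noteq> k \<and> \<not> \<tau> ! k < \<tau> ! b then - 1 else 1)"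
    using k by (subst (2) prod.remove[of _ k]) (auto simp: g_def intro!: prod.cong split: if_splits)
  finally have row: "(\<Prod>y\<leftarrow>?\<rho>. g y) = (\<Prod>b<length \<tau>. if b \<noteq> k \<and> \<not> \<tau> ! k < \<tau> ! b then - 1 else 1)" .
  have "inversion_sign (\<tau> ! k # ?\<rho>) = (- 1) ^ k * inversion_sign \<tau>"
    using alternating_move_to_front[OF alternating_inversion_sign[of "set \<tau>"], of "take k \<tau>" "\<tau> ! k" "drop (Suc k) \<tau>"] d(2) k
    by (simp add: \<tau>[symmetric])
  then have 1: "(\<Prod>y\<leftarrow>?\<rho>. g y) * inversion_sign ?\<rho> = (- 1) ^ k * inversion_sign \<tau>"
    by (simp add: g_def)
  have sq: "(\<Prod>y\<leftarrow>?\<rho>. g y) * (\<Prod>y\<leftarrow>?\<rho>. g y) = 1"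
  proof -
    have "(\<Prod>y\<leftarrow>zs. g y) * (\<Prod>y\<leftarrow>zs. g y) = 1" for zs
      by (induction zs) (auto simp: g_def)
    then show ?thesis .
  qed
  \<comment> \<open>The row sign squares to 1 and is inserted twice: one copy combines with the sign
    of the face, the other remains.\<close>
  have "(- 1) ^ k * inversion_sign ?\<rho> = (- 1) ^ k * ((\<Prod>y\<leftarrow>?\<rho>. g y) * (\<Prod>y\<leftarrow>?\<rho>. g y)) * inversion_sign ?\<rho>"
    unfolding sq by simp
  also have "\<dots> = (- 1) ^ k * (\<Prod>y\<leftarrow>?\<rho>. g y) * ((\<Prod>y\<leftarrow>?\<rho>. g y) * inversion_sign ?\<rho>)"
    by (simp only: ac_simps)
  also have "\<dots> = ((- 1) ^ k * (- 1) ^ k) * inversion_sign \<tau> * (\<Prod>y\<leftarrow>?\<rho>. g y)"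
    unfolding 1 by (simp only: ac_simps)
  also have "(- 1) ^ k * (- 1) ^ k = (1::int)"
    by (simp flip: power_mult_distrib)
  finally have "(- 1) ^ k * inversion_sign ?\<rho> = inversion_sign \<tau> * (\<Prod>y\<leftarrow>?\<rho>. g y)" by simp
  then have "(- 1) ^ k * orientation_sign \<sigma> ?\<rho> = (if set \<sigma> = set ?\<rho> then inversion_sign \<sigma> * inversion_sign \<tau> * (\<Prod>y\<leftarrow>?\<rho>. g y) else 0)"
    unfolding orientation_sign_eq[OF d(1) \<rho>(1)] by (simp add: mult.left_commute mult.assoc)
  then have 2: "real_of_int ((- 1) ^ k * orientation_sign \<sigma> ?\<rho>) =
      (if set \<sigma> = set ?\<rho> then real_of_int (inversion_sign \<sigma>) * real_of_int (inversion_sign \<tau>) * real_of_int (\<Prod>y\<leftarrow>?\<rho>. g y) else 0)"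
    by simp
  have 3: "real_of_int (\<Prod>y\<leftarrow>?\<rho>. g y) = (\<Prod>b<length \<tau>. if b \<noteq> k \<and> \<not> \<tau> ! k < \<tau> ! b then - 1 else 1)"
    unfolding row of_int_prod by (intro prod.cong) auto
  show ?thesis
    unfolding entry_term_def match 2 3 inversion_sign_nth by (rule refl)
qed

lemma array_concat_row:
  assumes "\<And>xs. xs \<in> set xss \<Longrightarrow> length xs = l" "i < length xss"
  shows "row_of (array (concat xss)) l i = xss ! i"
proof -
  have len: "length (concat xss) = length xss * l"
    using assms(1) by (induction xss) auto
  have nth: "concat xss ! (i * l + a) = xss ! i ! a" if "a < l" for a
    using assms that
  proof (induction xss arbitrary: i)
    case (Cons xs xss)
    then show ?case by (cases i) (auto simp: nth_append add.assoc)
  qed simp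
  have "i * l + a < length xss * l" if "a < l" for a
    using mult_le_mono1[of "Suc i" "length xss" l] assms(2) that by simp
  then show ?thesis
    using assms by (intro nth_equalityI) (auto simp: array_def len nth)
qed

lemma run_boundary_matrix:
  assumes \<sigma>s: "oriented_basis K p \<sigma>s" and \<tau>s: "oriented_basis K (p + 1) \<tau>s"
    and s: "fst s ''m'' 0 = length \<sigma>s" "fst s ''n'' 0 = length \<tau>s" "fst s ''d'' 0 = p + 1" "fst s ''f'' 0 = p + 2"
      "fst s ''P'' = array (concat \<sigma>s)" "fst s ''Q'' = array (concat \<tau>s)"
    and ij: "i < length \<sigma>s" "j < length \<tau>s"
  shows "snd (run prog_boundary s) ''D'' (i * length \<tau>s + j) = real_of_int (boundary_matrix \<sigma>s \<tau>s $$ (i, j))"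
proof -
  have len: "length xs = Suc q" "distinct xs" if "oriented_basis K q xss" "xs \<in> set xss" for q xs xss
  proof -
    have "set xs \<in> simplices K q" "distinct xs" using that by (auto simp: oriented_basis_def)
    then show "length xs = Suc q" "distinct xs" using distinct_card[of xs] by (auto simp: simplices_def)
  qed
  have rows: "row_of (array (concat \<sigma>s)) (p + 1) i = \<sigma>s ! i" "row_of (array (concat \<tau>s)) (p + 2) j = \<tau>s ! j"
    using len(1)[OF \<sigma>s] len(1)[OF \<tau>s] ij by (auto intro!: array_concat_row)
  note \<sigma> = len[OF \<sigma>s nth_mem[OF ij(1)]] and \<tau> = len[OF \<tau>s nth_mem[OF ij(2)]]
  have "snd (run prog_boundary s) ''D'' (i * length \<tau>s + j) = (\<Sum>k<p + 2. entry_term (\<sigma>s ! i) (\<tau>s ! j) k)"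
    using run_boundary[of i s j] ij by (simp only: s rows)
  also have "\<dots> = (\<Sum>k<length (\<tau>s ! j). real_of_int ((- 1) ^ k * orientation_sign (\<sigma>s ! i) (take k (\<tau>s ! j) @ drop (Suc k) (\<tau>s ! j))))"
    using \<sigma> \<tau> by (intro sum.cong) (auto simp: entry_term_eq)
  also have "\<dots> = real_of_int (boundary_matrix \<sigma>s \<tau>s $$ (i, j))"
    using ij by (simp add: boundary_matrix_def)
  finally show ?thesis .
qed

section \<open>Computing the network\<close>

definition DD :: "string \<Rightarrow> rexp" where
  "DD a = RGet ''D'' (IAdd (IMul (Sc ''i'') (Sc ''n'')) (Sc a))"

text \<open>\<open>C\<close> holds the component labels of the columns and \<open>S\<close> their
  signs relative to the component. Component \<open>r\<close> is absorbed into component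
  \<open>q\<close>, its signs being multiplied by a common factor.\<close>

definition prog_relabel :: loop where
  "prog_relabel = LFor ''j'' ''n''
     (LIf (INe (IGet ''C'' (Sc ''j'')) (Sc ''r'')) LSkip
        (LSeq (LR ''S'' (Sc ''j'') (RMul (RGet ''S'' (Sc ''j'')) (Rc ''s''))) (LI ''C'' (Sc ''j'') (Sc ''q''))))"

definition prog_merge :: loop where
  "prog_merge = LIf (BAnd (ILess (Sc ''a'') (Sc ''b'')) (BAnd (RNe (DD ''a'') (RNum 0))
       (BAnd (RNe (DD ''b'') (RNum 0)) (INe (IGet ''C'' (Sc ''a'')) (IGet ''C'' (Sc ''b''))))))
     (LSeq (LI ''q'' (INum 0) (IGet ''C'' (Sc ''a'')))
       (LSeq (LI ''r'' (INum 0) (IGet ''C'' (Sc ''b'')))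
         (LSeq (LR ''s'' (INum 0) (RSub (RNum 0) (RMul (RMul (RGet ''S'' (Sc ''a'')) (DD ''a''))
              (RMul (RGet ''S'' (Sc ''b'')) (DD ''b'')))))
           prog_relabel)))
     LSkip"

definition prog_flips :: loop where
  "prog_flips = LSeq (LFor ''j'' ''n'' (LSeq (LI ''C'' (Sc ''j'') (Sc ''j'')) (LR ''S'' (Sc ''j'') (RNum 1))))
     (LFor ''i'' ''m'' (LFor ''a'' ''n'' (LFor ''b'' ''n'' prog_merge)))"

lemma run_relabel:
  "(\<forall>x<fst s ''n'' 0. fst (run prog_relabel s) ''C'' x = (if fst s ''C'' x = fst s ''r'' 0 then fst s ''q'' 0 else fst s ''C'' x) \<and>
     snd (run prog_relabel s) ''S'' x = (if fst s ''C'' x = fst s ''r'' 0 then snd s ''S'' x * snd s ''s'' 0 else snd s ''S'' x))"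
proof -
  let ?P = "\<lambda>y s'. \<forall>x. fst s' ''C'' x = (if x < y \<and> fst s ''C'' x = fst s ''r'' 0 then fst s ''q'' 0 else fst s ''C'' x) \<and>
     snd s' ''S'' x = (if x < y \<and> fst s ''C'' x = fst s ''r'' 0 then snd s ''S'' x * snd s ''s'' 0 else snd s ''S'' x)"
  have "?P (fst s ''n'' 0) (run prog_relabel s)"
    unfolding prog_relabel_def
  proof (rule run_LFor_induct[where Inv="?P"])
    fix k and s1 :: state
    assume I: "?P k s1" and k: "fst s1 ''j'' 0 = k"
      and fi: "\<And>a. a \<notin> wi (LIf (INe (IGet ''C'' (Sc ''j'')) (Sc ''r'')) LSkip
        (LSeq (LR ''S'' (Sc ''j'') (RMul (RGet ''S'' (Sc ''j'')) (Rc ''s''))) (LI ''C'' (Sc ''j'') (Sc ''q'')))) \<Longrightarrow> a \<noteq> ''j'' \<Longrightarrow> fst s1 a = fst s a"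
      and fr: "\<And>a. a \<notin> wr (LIf (INe (IGet ''C'' (Sc ''j'')) (Sc ''r'')) LSkip
        (LSeq (LR ''S'' (Sc ''j'') (RMul (RGet ''S'' (Sc ''j'')) (Rc ''s''))) (LI ''C'' (Sc ''j'') (Sc ''q'')))) \<Longrightarrow> snd s1 a = snd s a"
    have f: "fst s1 ''r'' = fst s ''r''" "fst s1 ''q'' = fst s ''q''" "snd s1 ''s'' = snd s ''s''"
      by (simp_all add: fi fr)
    have Ck: "fst s1 ''C'' k = fst s ''C'' k" "snd s1 ''S'' k = snd s ''S'' k" using I by simp_all
    show "?P (Suc k) (upd ''j'' (Suc k) (run (LIf (INe (IGet ''C'' (Sc ''j'')) (Sc ''r'')) LSkip
        (LSeq (LR ''S'' (Sc ''j'') (RMul (RGet ''S'' (Sc ''j'')) (Rc ''s''))) (LI ''C'' (Sc ''j'') (Sc ''q'')))) s1))"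
      using I Ck by (auto simp: fst_upd store_apply k f less_Suc_eq)
  qed (auto simp: fst_upd)
  then show ?thesis by simp
qed

text \<open>\<open>t\<close> stands for the signs provided by topology. On each component the
  computed signs equal \<open>t\<close> up to a common factor, expressed by the constancy of the
  product; \<open>Done\<close> lists the pairs of columns already examined in each row.\<close>

definition flip_state :: "nat \<Rightarrow> (nat \<Rightarrow> real) \<Rightarrow> (nat \<Rightarrow> real) \<Rightarrow> (nat \<times> nat \<times> nat) set \<Rightarrow> state \<Rightarrow> bool" where
  "flip_state n d t Done s \<longleftrightarrow> fst s ''n'' 0 = n \<and> snd s ''D'' = d \<and>
     (\<forall>j<n. snd s ''S'' j = 1 \<or> snd s ''S'' j = -1) \<and>
     (\<forall>j<n. \<forall>k<n. fst s ''C'' j = fst s ''C'' k \<longrightarrow> snd s ''S'' j * t j = snd s ''S'' k * t k) \<and>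
     (\<forall>(i, a, b)\<in>Done. a < n \<longrightarrow> b < n \<longrightarrow> a < b \<longrightarrow> d (i * n + a) \<noteq> 0 \<longrightarrow> d (i * n + b) \<noteq> 0 \<longrightarrow>
        fst s ''C'' a = fst s ''C'' b)"

lemma flip_state_upd:
  assumes "x \<in> {''i'', ''j'', ''a'', ''b''}"
  shows "flip_state n d t Done (upd x k s) \<longleftrightarrow> flip_state n d t Done s"
  using assms by (auto simp: flip_state_def fst_upd)

lemma triples_False: "{(i, a, b). False} = {}"
  by simp

lemma flip_product:
  fixes Sa Sb ta tb da db :: real
  assumes "Sb * Sb = 1" "da * da = 1" "tb * db = - (ta * da)"
  shows "Sb * - (Sa * da * (Sb * db)) * tb = Sa * ta"
proof -
  have "Sb * - (Sa * da * (Sb * db)) * tb = (Sb * Sb) * Sa * da * (- (tb * db))" by simp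
  then show ?thesis using assms by simp
qed

lemma product_swap:
  fixes a b f t u :: real
  assumes "a * t = b * u"
  shows "a * f * t = b * f * u"
proof -
  have "a * f * t = (a * t) * f" "b * f * u = (b * u) * f" by simp_all
  then show ?thesis using assms by simp
qed

text \<open>\<open>t\<close> is only known to exist: it enters the invariant and is not an input of
  the program.\<close>

locale flippable =
  fixes m n :: nat and d t :: "nat \<Rightarrow> real"
  assumes d: "i < m \<Longrightarrow> j < n \<Longrightarrow> d (i * n + j) = 0 \<or> d (i * n + j) = 1 \<or> d (i * n + j) = -1"
    and t: "t j = 1 \<or> t j = -1"
    and dt: "i < m \<Longrightarrow> a < n \<Longrightarrow> b < n \<Longrightarrow> a \<noteq> b \<Longrightarrow> d (i * n + a) \<noteq> 0 \<Longrightarrow> d (i * n + b) \<noteq> 0 \<Longrightarrow>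
      t a * d (i * n + a) + t b * d (i * n + b) = 0"
begin

text \<open>The factor is minus the product of the two flipped entries, which makes them opposite.
  Since \<open>t\<close> makes them opposite too, the products of \<open>S\<close> and
  \<open>t\<close> on the two components become equal.\<close>

lemma run_merge:
  assumes s: "flip_state n d t Done s" and i: "fst s ''i'' 0 = i" "i < m"
    and a: "fst s ''a'' 0 = a" "a < n" and b: "fst s ''b'' 0 = b" "b < n"
  shows "flip_state n d t (insert (i, a, b) Done) (run prog_merge s)"
proof -
  let ?c = "fst s ''C''" and ?S = "snd s ''S''"
  have sn: "fst s ''n'' 0 = n" and sD: "snd s ''D'' = d" and S1: "\<And>j. j < n \<Longrightarrow> ?S j = 1 \<or> ?S j = -1"
    and St: "\<And>j k. j < n \<Longrightarrow> k < n \<Longrightarrow> ?c j = ?c k \<Longrightarrow> ?S j * t j = ?S k * t k"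
    and Dn: "\<And>i a b. (i, a, b) \<in> Done \<Longrightarrow> a < n \<Longrightarrow> b < n \<Longrightarrow> a < b \<Longrightarrow> d (i * n + a) \<noteq> 0 \<Longrightarrow> d (i * n + b) \<noteq> 0 \<Longrightarrow> ?c a = ?c b"
  proof -
    show "fst s ''n'' 0 = n" "snd s ''D'' = d" using s unfolding flip_state_def by blast+
    show "?S j = 1 \<or> ?S j = -1" if "j < n" for j using s that unfolding flip_state_def by blast
    show "?S j * t j = ?S k * t k" if "j < n" "k < n" "?c j = ?c k" for j k
      using s that unfolding flip_state_def by blast
    show "?c a = ?c b" if h: "(i, a, b) \<in> Done" "a < n" "b < n" "a < b" "d (i * n + a) \<noteq> 0" "d (i * n + b) \<noteq> 0" for i a b
    proof -
      have "\<forall>(i, a, b)\<in>Done. a < n \<longrightarrow> b < n \<longrightarrow> a < b \<longrightarrow> d (i * n + a) \<noteq> 0 \<longrightarrow> d (i * n + b) \<noteq> 0 \<longrightarrow> ?c a = ?c b"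
        using s unfolding flip_state_def by blast
      from bspec[OF this h(1)] show ?thesis using h(2-) by simp
    qed
  qed
  let ?cond = "a < b \<and> d (i * n + a) \<noteq> 0 \<and> d (i * n + b) \<noteq> 0 \<and> ?c a \<noteq> ?c b"
  let ?g = "BAnd (ILess (Sc ''a'') (Sc ''b'')) (BAnd (RNe (DD ''a'') (RNum 0))
       (BAnd (RNe (DD ''b'') (RNum 0)) (INe (IGet ''C'' (Sc ''a'')) (IGet ''C'' (Sc ''b'')))))"
  have g: "bval ?g s \<longleftrightarrow> ?cond"
    using i a b sn sD by (auto simp: DD_def)
  show ?thesis
  proof (cases ?cond)
    case False
    then have eq: "run prog_merge s = s" using g unfolding prog_merge_def by (simp only: run.simps if_False)
    have new: "\<forall>(i, a, b)\<in>insert (i, a, b) Done. a < n \<longrightarrow> b < n \<longrightarrow> a < b \<longrightarrow> d (i * n + a) \<noteq> 0 \<longrightarrow> d (i * n + b) \<noteq> 0 \<longrightarrow> ?c a = ?c b"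
      using Dn False by blast
    note c = s[unfolded flip_state_def]
    show ?thesis
      unfolding flip_state_def eq
      using conjI[OF c[THEN conjunct1] conjI[OF c[THEN conjunct2, THEN conjunct1] conjI[OF c[THEN conjunct2, THEN conjunct2, THEN conjunct1]
        conjI[OF c[THEN conjunct2, THEN conjunct2, THEN conjunct2, THEN conjunct1] new]]]] .
  next
    case True
    let ?fl = "- (?S a * d (i * n + a) * (?S b * d (i * n + b)))"
    define s1 where "s1 = run (LSeq (LI ''q'' (INum 0) (IGet ''C'' (Sc ''a'')))
       (LSeq (LI ''r'' (INum 0) (IGet ''C'' (Sc ''b'')))
         (LR ''s'' (INum 0) (RSub (RNum 0) (RMul (RMul (RGet ''S'' (Sc ''a'')) (DD ''a''))
              (RMul (RGet ''S'' (Sc ''b'')) (DD ''b''))))))) s"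
    have s1: "fst s1 ''n'' = fst s ''n''" "fst s1 ''C'' = ?c" "snd s1 ''S'' = ?S" "snd s1 ''D'' = d"
      "fst s1 ''q'' 0 = ?c a" "fst s1 ''r'' 0 = ?c b" "snd s1 ''s'' 0 = ?fl"
      using i a b sn sD by (simp_all add: s1_def store_apply DD_def)
    have "run prog_merge s = run prog_relabel s1"
      using g True unfolding prog_merge_def s1_def by (simp only: run.simps if_True simp_thms)
    moreover define s2 where "s2 = run prog_relabel s1"
    have C2: "fst s2 ''C'' x = (if ?c x = ?c b then ?c a else ?c x)" and S2: "snd s2 ''S'' x = (if ?c x = ?c b then ?S x * ?fl else ?S x)"
      if "x < n" for x
      using run_relabel[of s1] that unfolding s2_def by (simp_all add: s1 sn)
    have f2: "fst s2 ''n'' = fst s ''n''" "snd s2 ''D'' = d"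
      unfolding s2_def using run_frame[of _ prog_relabel s1] by (simp_all add: s1 prog_relabel_def)
    have da: "d (i * n + a) * d (i * n + a) = 1" "d (i * n + b) * d (i * n + b) = 1"
      using d[OF i(2) a(2)] d[OF i(2) b(2)] True by auto
    have SS: "?S a * ?S a = 1" "?S b * ?S b = 1" using S1[OF a(2)] S1[OF b(2)] by auto
    have fl1: "?fl = 1 \<or> ?fl = -1"
      using d[OF i(2) a(2)] d[OF i(2) b(2)] True S1[OF a(2)] S1[OF b(2)] by auto
    have tb: "t b * d (i * n + b) = - (t a * d (i * n + a))"
      using dt[OF i(2) a(2) b(2)] True by simp
    have key: "?S b * ?fl * t b = ?S a * t a"
      using flip_product[OF SS(2) da(1) tb] .
    have keyx: "?S x * ?fl * t x = ?S a * t a" if "x < n" "?c x = ?c b" for x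
      using product_swap[OF St[OF that(1) b(2) that(2)], of ?fl] key by (rule trans)
    have "flip_state n d t (insert (i, a, b) Done) s2"
      unfolding flip_state_def
    proof (intro conjI allI impI ballI)
      show "fst s2 ''n'' 0 = n" "snd s2 ''D'' = d" using f2 sn by simp_all
      show "snd s2 ''S'' j = 1 \<or> snd s2 ''S'' j = -1" if "j < n" for j
        using S2[OF that] S1[OF that] fl1 by auto
      show "snd s2 ''S'' j * t j = snd s2 ''S'' k * t k" if "j < n" "k < n" "fst s2 ''C'' j = fst s2 ''C'' k" for j k
      proof -
        have "snd s2 ''S'' x * t x = (if ?c x = ?c b then ?S a * t a else ?S x * t x)" if "x < n" for x
          using S2[OF that] keyx[OF that] by simp
        moreover have "?S x * t x = ?S a * t a" if "x < n" "?c x = ?c a" for x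
          using St[OF that(1) a(2) that(2)] .
        ultimately show ?thesis
          using that C2[of j] C2[of k] St[of j k] by (auto split: if_splits)
      qed
      show "case z of (i, a, b) \<Rightarrow> a < n \<longrightarrow> b < n \<longrightarrow> a < b \<longrightarrow> d (i * n + a) \<noteq> 0 \<longrightarrow> d (i * n + b) \<noteq> 0 \<longrightarrow> fst s2 ''C'' a = fst s2 ''C'' b"
        if z: "z \<in> insert (i, a, b) Done" for z
      proof -
        obtain i' a' b' where z': "z = (i', a', b')" by (cases z)
        have "fst s2 ''C'' a' = fst s2 ''C'' b'" if h: "a' < n" "b' < n" "a' < b'" "d (i' * n + a') \<noteq> 0" "d (i' * n + b') \<noteq> 0"
        proof (cases "z = (i, a, b)")
          case True
          then show ?thesis using C2[OF h(1)] C2[OF h(2)] z' by auto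
        next
          case False
          then have "?c a' = ?c b'" using z z' Dn h by blast
          then show ?thesis using C2[OF h(1)] C2[OF h(2)] by simp
        qed
        then show ?thesis using z' by simp
      qed
    qed
    ultimately show ?thesis by (simp add: s2_def)
  qed
qed

text \<open>In the end two columns with a common row belong to one component, where \<open>S\<close>
  is \<open>t\<close> or its negative; cancellation in that row passes from \<open>t\<close> to
  \<open>S\<close>.\<close>

lemma run_flips:
  assumes s: "fst s ''n'' 0 = n" "fst s ''m'' 0 = m" "snd s ''D'' = d"
  defines "s' \<equiv> run prog_flips s"
  shows "\<And>j. j < n \<Longrightarrow> snd s' ''S'' j = 1 \<or> snd s' ''S'' j = -1"
    and "\<And>i a b. i < m \<Longrightarrow> a < n \<Longrightarrow> b < n \<Longrightarrow> a \<noteq> b \<Longrightarrow> d (i * n + a) \<noteq> 0 \<Longrightarrow> d (i * n + b) \<noteq> 0 \<Longrightarrow>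
      snd s' ''S'' a * d (i * n + a) + snd s' ''S'' b * d (i * n + b) = 0"
proof -
  let ?init = "LFor ''j'' ''n'' (LSeq (LI ''C'' (Sc ''j'') (Sc ''j'')) (LR ''S'' (Sc ''j'') (RNum 1)))"
  let ?P = "\<lambda>y s1. \<forall>j<y. fst s1 ''C'' j = j \<and> snd s1 ''S'' j = 1"
  have "?P (fst s ''n'' 0) (run ?init s)"
    by (rule run_LFor_induct[where Inv="?P"]) (auto simp: fst_upd store_apply less_Suc_eq)
  moreover have "fst (run ?init s) ''n'' = fst s ''n''" "fst (run ?init s) ''m'' = fst s ''m''" "snd (run ?init s) ''D'' = snd s ''D''"
    by (rule run_frame, simp)+
  ultimately have 0: "flip_state n d t {} (run ?init s)" "fst (run ?init s) ''m'' 0 = m"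
    using s by (auto simp: flip_state_def)
  have W: "wi prog_merge = {''q'', ''r'', ''j'', ''C''}"
    by (auto simp: prog_merge_def prog_relabel_def)
  have "flip_state n d t {(i, a, b). i < fst (run ?init s) ''m'' 0 \<and> a < n \<and> b < n}
      (run (LFor ''i'' ''m'' (LFor ''a'' ''n'' (LFor ''b'' ''n'' prog_merge))) (run ?init s))"
  proof (rule run_LFor_induct[where Inv="\<lambda>x. flip_state n d t {(i, a, b). i < x \<and> a < n \<and> b < n}"])
    fix x and s1 :: state
    assume x: "x < fst (run ?init s) ''m'' 0" and I: "flip_state n d t {(i, a, b). i < x \<and> a < n \<and> b < n} s1" and x1: "fst s1 ''i'' 0 = x"
    let ?D0 = "{(i, a, b). i < x \<and> a < n \<and> b < n}"
    have n1: "fst s1 ''n'' 0 = n" using I by (simp add: flip_state_def)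
    have "flip_state n d t (?D0 \<union> {(i, a, b). i = x \<and> a < fst s1 ''n'' 0 \<and> b < n}) (run (LFor ''a'' ''n'' (LFor ''b'' ''n'' prog_merge)) s1)"
    proof (rule run_LFor_induct[where Inv="\<lambda>y. flip_state n d t (?D0 \<union> {(i, a, b). i = x \<and> a < y \<and> b < n})"])
      fix y and s2 :: state
      assume y: "y < fst s1 ''n'' 0" and I2: "flip_state n d t (?D0 \<union> {(i, a, b). i = x \<and> a < y \<and> b < n}) s2" and y2: "fst s2 ''a'' 0 = y"
        and f2: "\<And>a. a \<notin> wi (LFor ''b'' ''n'' prog_merge) \<Longrightarrow> a \<noteq> ''a'' \<Longrightarrow> fst s2 a = fst s1 a"
      let ?D1 = "?D0 \<union> {(i, a, b). i = x \<and> a < y \<and> b < n}"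
      have i2: "fst s2 ''i'' 0 = x" using f2[of "''i''"] x1 by (simp add: W)
      have n2: "fst s2 ''n'' 0 = n" using I2 by (simp add: flip_state_def)
      have "flip_state n d t (?D1 \<union> {(i, a, b). i = x \<and> a = y \<and> b < fst s2 ''n'' 0}) (run (LFor ''b'' ''n'' prog_merge) s2)"
      proof (rule run_LFor_induct[where Inv="\<lambda>z. flip_state n d t (?D1 \<union> {(i, a, b). i = x \<and> a = y \<and> b < z})"])
        fix z and s3 :: state
        assume z: "z < fst s2 ''n'' 0" and I3: "flip_state n d t (?D1 \<union> {(i, a, b). i = x \<and> a = y \<and> b < z}) s3" and z3: "fst s3 ''b'' 0 = z"
          and f3: "\<And>a. a \<notin> wi prog_merge \<Longrightarrow> a \<noteq> ''b'' \<Longrightarrow> fst s3 a = fst s2 a"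
        have "fst s3 ''i'' 0 = x" "fst s3 ''a'' 0 = y" using f3[of "''i''"] f3[of "''a''"] i2 y2 by (simp_all add: W)
        from run_merge[OF I3 this(1) _ this(2) _ z3] x y z n1 n2 0(2)
        have "flip_state n d t (insert (x, y, z) (?D1 \<union> {(i, a, b). i = x \<and> a = y \<and> b < z})) (run prog_merge s3)"
          by simp
        moreover have "insert (x, y, z) (?D1 \<union> {(i, a, b). i = x \<and> a = y \<and> b < z}) = ?D1 \<union> {(i, a, b). i = x \<and> a = y \<and> b < Suc z}"
          by (auto simp: less_Suc_eq)
        ultimately show "flip_state n d t (?D1 \<union> {(i, a, b). i = x \<and> a = y \<and> b < Suc z}) (upd ''b'' (Suc z) (run prog_merge s3))"
          by (simp add: flip_state_upd)
      qed (use I2 in \<open>simp_all add: W flip_state_upd triples_False\<close>)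
      moreover have "?D1 \<union> {(i, a, b). i = x \<and> a = y \<and> b < fst s2 ''n'' 0} = ?D0 \<union> {(i, a, b). i = x \<and> a < Suc y \<and> b < n}"
        using n2 by (auto simp: less_Suc_eq)
      ultimately show "flip_state n d t (?D0 \<union> {(i, a, b). i = x \<and> a < Suc y \<and> b < n}) (upd ''a'' (Suc y) (run (LFor ''b'' ''n'' prog_merge) s2))"
        by (simp add: flip_state_upd)
    qed (use I in \<open>simp_all add: W flip_state_upd triples_False\<close>)
    moreover have "?D0 \<union> {(i, a, b). i = x \<and> a < fst s1 ''n'' 0 \<and> b < n} = {(i, a, b). i < Suc x \<and> a < n \<and> b < n}"
      using n1 by (auto simp: less_Suc_eq)
    ultimately show "flip_state n d t {(i, a, b). i < Suc x \<and> a < n \<and> b < n} (upd ''i'' (Suc x) (run (LFor ''a'' ''n'' (LFor ''b'' ''n'' prog_merge)) s1))"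
      by (simp add: flip_state_upd)
  qed (use 0(1) in \<open>simp_all add: W flip_state_upd triples_False\<close>)
  then have fin: "flip_state n d t {(i, a, b). i < m \<and> a < n \<and> b < n} s'"
    using 0(2) by (simp add: s'_def prog_flips_def)
  show S: "snd s' ''S'' j = 1 \<or> snd s' ''S'' j = -1" if "j < n" for j
    using fin that by (simp add: flip_state_def)
  have lt: "snd s' ''S'' a * d (i * n + a) + snd s' ''S'' b * d (i * n + b) = 0"
    if "i < m" "a < n" "b < n" "a < b" "d (i * n + a) \<noteq> 0" "d (i * n + b) \<noteq> 0" for i a b
  proof -
    have "fst s' ''C'' a = fst s' ''C'' b"
      using fin that by (auto simp: flip_state_def)
    then have "snd s' ''S'' a * t a = snd s' ''S'' b * t b"
      using fin that(2,3) unfolding flip_state_def by blast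
    then show ?thesis
      using dt[OF that(1-3)] that(4-6) S[OF that(2)] S[OF that(3)] t[of a] t[of b] by auto
  qed
  show "snd s' ''S'' a * d (i * n + a) + snd s' ''S'' b * d (i * n + b) = 0"
    if "i < m" "a < n" "b < n" "a \<noteq> b" "d (i * n + a) \<noteq> 0" "d (i * n + b) \<noteq> 0" for i a b
    using lt[of i a b] lt[of i b a] that by (cases "a < b") auto
qed

end

section \<open>Ends, capacities and costs of the arcs\<close>

definition prog_ends :: loop where
  "prog_ends = LFor ''j'' ''n''
     (LSeq (LIf (RLess (RNum 0) (RMul (DD ''j'') (RGet ''S'' (Sc ''j'')))) (LI ''X'' (Sc ''i'') (Sc ''j'')) LSkip)
           (LIf (RLess (RMul (DD ''j'') (RGet ''S'' (Sc ''j''))) (RNum 0)) (LI ''Y'' (Sc ''i'') (Sc ''j'')) LSkip))"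

definition prog_arc_ends :: loop where
  "prog_arc_ends = LSeq (LI ''X'' (IAdd (Sc ''i'') (Sc ''m'')) (IGet ''Y'' (Sc ''i'')))
     (LSeq (LI ''Y'' (IAdd (Sc ''i'') (Sc ''m'')) (IGet ''X'' (Sc ''i'')))
     (LSeq (LI ''V'' (Sc ''i'') (IAdd (Sc ''i'') (Sc ''m'')))
       (LI ''V'' (IAdd (Sc ''i'') (Sc ''m'')) (Sc ''i''))))"

text \<open>The initial circulation is 0 on arcs that admit values from -|w| to |w|, so the residual
  capacities in both directions are |w|.\<close>

definition prog_arc_data :: loop where
  "prog_arc_data = LSeq (LR ''G'' (Sc ''i'') (RGet ''c'' (Sc ''i'')))
     (LSeq (LR ''G'' (IAdd (Sc ''i'') (Sc ''m'')) (RSub (RNum 0) (RGet ''c'' (Sc ''i''))))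
     (LSeq (LIf (RLess (RGet ''w'' (Sc ''i'')) (RNum 0))
              (LR ''R'' (Sc ''i'') (RSub (RNum 0) (RGet ''w'' (Sc ''i''))))
              (LR ''R'' (Sc ''i'') (RGet ''w'' (Sc ''i''))))
       (LR ''R'' (IAdd (Sc ''i'') (Sc ''m'')) (RGet ''R'' (Sc ''i'')))))"

definition prog_arcs :: loop where
  "prog_arcs = LFor ''i'' ''m'' (LSeq (LI ''X'' (Sc ''i'') (Sc ''n'')) (LSeq (LI ''Y'' (Sc ''i'') (Sc ''n''))
     (LSeq prog_ends (LSeq prog_arc_ends prog_arc_data))))"

text \<open>\<open>n\<close> is the outer vertex, which serves as end if the row has no entry of the
  required sign.\<close>

definition end_ok :: "nat \<Rightarrow> (nat \<Rightarrow> real) \<Rightarrow> nat \<Rightarrow> bool" where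
  "end_ok n e x \<longleftrightarrow> (\<forall>j<n. 0 < e j \<longrightarrow> x = j) \<and> ((\<forall>j<n. \<not> 0 < e j) \<longrightarrow> x = n)"

lemma run_ends:
  fixes s :: state
  defines "n \<equiv> fst s ''n'' 0" and "i \<equiv> fst s ''i'' 0"
  defines "e \<equiv> \<lambda>j. snd s ''D'' (i * n + j) * snd s ''S'' j"
  assumes XY: "fst s ''X'' i = n" "fst s ''Y'' i = n"
    and uniq: "\<And>a b. a < n \<Longrightarrow> b < n \<Longrightarrow> a \<noteq> b \<Longrightarrow> e a \<noteq> 0 \<Longrightarrow> e b \<noteq> 0 \<Longrightarrow> e a + e b = 0"
  shows "end_ok n e (fst (run prog_ends s) ''X'' i)" "end_ok n (\<lambda>j. - e j) (fst (run prog_ends s) ''Y'' i)"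
    "\<And>x. x \<noteq> i \<Longrightarrow> fst (run prog_ends s) ''X'' x = fst s ''X'' x" "\<And>x. x \<noteq> i \<Longrightarrow> fst (run prog_ends s) ''Y'' x = fst s ''Y'' x"
proof -
  let ?body = "LSeq (LIf (RLess (RNum 0) (RMul (DD ''j'') (RGet ''S'' (Sc ''j'')))) (LI ''X'' (Sc ''i'') (Sc ''j'')) LSkip)
           (LIf (RLess (RMul (DD ''j'') (RGet ''S'' (Sc ''j''))) (RNum 0)) (LI ''Y'' (Sc ''i'') (Sc ''j'')) LSkip)"
  let ?P = "\<lambda>y s1. (\<forall>j<y. 0 < e j \<longrightarrow> fst s1 ''X'' i = j) \<and> ((\<forall>j<y. \<not> 0 < e j) \<longrightarrow> fst s1 ''X'' i = n) \<and>
     (\<forall>j<y. e j < 0 \<longrightarrow> fst s1 ''Y'' i = j) \<and> ((\<forall>j<y. \<not> e j < 0) \<longrightarrow> fst s1 ''Y'' i = n) \<and>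
     (\<forall>x. x \<noteq> i \<longrightarrow> fst s1 ''X'' x = fst s ''X'' x \<and> fst s1 ''Y'' x = fst s ''Y'' x)"
  have "?P (fst s ''n'' 0) (run prog_ends s)"
    unfolding prog_ends_def
  proof (rule run_LFor_induct[where Inv="?P"])
    fix y and s1 :: state
    assume y: "y < fst s ''n'' 0" and I: "?P y s1" and y1: "fst s1 ''j'' 0 = y"
      and fi: "\<And>a. a \<notin> wi ?body \<Longrightarrow> a \<noteq> ''j'' \<Longrightarrow> fst s1 a = fst s a"
      and fr: "\<And>a. a \<notin> wr ?body \<Longrightarrow> snd s1 a = snd s a"
    have f: "fst s1 ''i'' 0 = i" "fst s1 ''n'' 0 = n" "snd s1 ''D'' = snd s ''D''" "snd s1 ''S'' = snd s ''S''"
      by (simp_all add: fi fr i_def n_def)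
    have ey: "rval (RMul (DD ''j'') (RGet ''S'' (Sc ''j''))) (g, snd s1) = e y" if "g ''j'' 0 = y" "g ''i'' 0 = i" "g ''n'' 0 = n" for g
      by (simp add: DD_def that f e_def)
    have yn: "y < n" using y by (simp add: n_def)
    \<comment> \<open>Nonzero entries of a row are pairwise opposite, so no earlier one has the sign
      of the current one and no end already found is overwritten.\<close>
    have up: "\<not> 0 < e j" if "j < y" "0 < e y" for j
      using uniq[of j y] that yn by force
    have un: "\<not> e j < 0" if "j < y" "e y < 0" for j
      using uniq[of j y] that yn by force
    have g0: "rval (RMul (DD ''j'') (RGet ''S'' (Sc ''j''))) s1 = e y"
      using ey[of "fst s1"] y1 f by simp
    define s2 where "s2 = run ?body s1"
    have s2: "fst s2 ''X'' x = (if x = i \<and> 0 < e y then y else fst s1 ''X'' x)"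
      "fst s2 ''Y'' x = (if x = i \<and> e y < 0 then y else fst s1 ''Y'' x)" for x
      using y1 f g0 ey[of "fst (store (fst s1) ''X'' i y, snd s1)"] unfolding s2_def run.simps bval.simps
      by (auto simp: store_apply)
    have "?P (Suc y) s2"
    proof (intro conjI allI impI)
      show "fst s2 ''X'' i = j" if "j < Suc y" "0 < e j" for j
        using I that up s2(1)[of i] by (cases "j = y") (auto simp: less_Suc_eq)
      show "fst s2 ''X'' i = n" if "\<forall>j<Suc y. \<not> 0 < e j"
        using I that s2(1)[of i] by auto
      show "fst s2 ''Y'' i = j" if "j < Suc y" "e j < 0" for j
        using I that un s2(2)[of i] by (cases "j = y") (auto simp: less_Suc_eq)
      show "fst s2 ''Y'' i = n" if "\<forall>j<Suc y. \<not> e j < 0"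
        using I that s2(2)[of i] by auto
      show "fst s2 ''X'' x = fst s ''X'' x" "fst s2 ''Y'' x = fst s ''Y'' x" if "x \<noteq> i" for x
        using I that s2[of x] by auto
    qed
    then show "?P (Suc y) (upd ''j'' (Suc y) (run ?body s1))"
      by (simp add: fst_upd s2_def)
  qed (use XY in \<open>auto simp: fst_upd\<close>)
  then show "end_ok n e (fst (run prog_ends s) ''X'' i)" "end_ok n (\<lambda>j. - e j) (fst (run prog_ends s) ''Y'' i)"
    "\<And>x. x \<noteq> i \<Longrightarrow> fst (run prog_ends s) ''X'' x = fst s ''X'' x" "\<And>x. x \<noteq> i \<Longrightarrow> fst (run prog_ends s) ''Y'' x = fst s ''Y'' x"
    by (auto simp: end_ok_def n_def)
qed

lemma run_arcs:
  fixes s :: state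
  defines "m \<equiv> fst s ''m'' 0" and "n \<equiv> fst s ''n'' 0"
  defines "e \<equiv> \<lambda>i j. snd s ''D'' (i * n + j) * snd s ''S'' j" and "s' \<equiv> run prog_arcs s"
  assumes uniq: "\<And>i a b. i < m \<Longrightarrow> a < n \<Longrightarrow> b < n \<Longrightarrow> a \<noteq> b \<Longrightarrow> e i a \<noteq> 0 \<Longrightarrow> e i b \<noteq> 0 \<Longrightarrow> e i a + e i b = 0"
    and i: "i < m"
  shows "end_ok n (e i) (fst s' ''X'' i) \<and> end_ok n (\<lambda>j. - e i j) (fst s' ''Y'' i) \<and>
    fst s' ''X'' (i + m) = fst s' ''Y'' i \<and> fst s' ''Y'' (i + m) = fst s' ''X'' i \<and>
    fst s' ''V'' i = i + m \<and> fst s' ''V'' (i + m) = i \<and>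
    snd s' ''G'' i = snd s ''c'' i \<and> snd s' ''G'' (i + m) = - snd s ''c'' i \<and>
    snd s' ''R'' i = \<bar>snd s ''w'' i\<bar> \<and> snd s' ''R'' (i + m) = \<bar>snd s ''w'' i\<bar>"
proof -
  let ?body = "LSeq (LI ''X'' (Sc ''i'') (Sc ''n'')) (LSeq (LI ''Y'' (Sc ''i'') (Sc ''n'')) (LSeq prog_ends (LSeq prog_arc_ends prog_arc_data)))"
  let ?Q = "\<lambda>s' i. end_ok n (e i) (fst s' ''X'' i) \<and> end_ok n (\<lambda>j. - e i j) (fst s' ''Y'' i) \<and>
    fst s' ''X'' (i + m) = fst s' ''Y'' i \<and> fst s' ''Y'' (i + m) = fst s' ''X'' i \<and>
    fst s' ''V'' i = i + m \<and> fst s' ''V'' (i + m) = i \<and>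
    snd s' ''G'' i = snd s ''c'' i \<and> snd s' ''G'' (i + m) = - snd s ''c'' i \<and>
    snd s' ''R'' i = \<bar>snd s ''w'' i\<bar> \<and> snd s' ''R'' (i + m) = \<bar>snd s ''w'' i\<bar>"
  have W: "wi prog_ends = {''j'', ''X'', ''Y''}" "wr prog_ends = {}" "wi prog_arc_ends = {''X'', ''Y'', ''V''}" "wr prog_arc_ends = {}"
    "wi prog_arc_data = {}" "wr prog_arc_data = {''G'', ''R''}"
    by (auto simp: prog_ends_def prog_arc_ends_def prog_arc_data_def)
  have "\<forall>i<fst s ''m'' 0. ?Q (run prog_arcs s) i"
    unfolding prog_arcs_def
  proof (rule run_LFor_induct[where Inv="\<lambda>x s'. \<forall>i<x. ?Q s' i"])
    fix x and s1 :: state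
    assume x: "x < fst s ''m'' 0" and I: "\<forall>i<x. ?Q s1 i" and x1: "fst s1 ''i'' 0 = x"
      and fi: "\<And>a. a \<notin> wi ?body \<Longrightarrow> a \<noteq> ''i'' \<Longrightarrow> fst s1 a = fst s a"
      and fr: "\<And>a. a \<notin> wr ?body \<Longrightarrow> snd s1 a = snd s a"
    have f: "fst s1 ''n'' 0 = n" "fst s1 ''m'' 0 = m" "snd s1 ''D'' = snd s ''D''" "snd s1 ''S'' = snd s ''S''"
      "snd s1 ''c'' = snd s ''c''" "snd s1 ''w'' = snd s ''w''"
      by (simp_all add: fi fr W n_def m_def)
    have xm: "x < m" using x by (simp add: m_def)
    define s2 where "s2 = run (LSeq (LI ''X'' (Sc ''i'') (Sc ''n'')) (LI ''Y'' (Sc ''i'') (Sc ''n''))) s1"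
    define s3 where "s3 = run prog_ends s2"
    define sa where "sa = run prog_arc_ends s3"
    define s4 where "s4 = run prog_arc_data sa"
    have f2: "fst s2 ''n'' 0 = n" "fst s2 ''m'' 0 = m" "fst s2 ''i'' 0 = x" "snd s2 = snd s1" "fst s2 ''V'' = fst s1 ''V''"
      "fst s2 ''X'' = (fst s1 ''X'')(x := n)" "fst s2 ''Y'' = (fst s1 ''Y'')(x := n)"
      using x1 f by (simp_all add: s2_def store_apply)
    have e2': "snd s2 ''D'' (fst s2 ''i'' 0 * fst s2 ''n'' 0 + j) * snd s2 ''S'' j = e x j" for j
      by (simp add: f2 f e_def)
    have E: "end_ok n (e x) (fst s3 ''X'' x)" "end_ok n (\<lambda>j. - e x j) (fst s3 ''Y'' x)"
      "\<And>z. z \<noteq> x \<Longrightarrow> fst s3 ''X'' z = fst s1 ''X'' z" "\<And>z. z \<noteq> x \<Longrightarrow> fst s3 ''Y'' z = fst s1 ''Y'' z"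
      using run_ends[of s2, unfolded e2', unfolded f2(1-3)] uniq[OF xm] unfolding s3_def[symmetric]
      by (simp_all add: f2(6,7))
    have f3: "fst s3 ''n'' 0 = n" "fst s3 ''m'' 0 = m" "fst s3 ''i'' 0 = x" "snd s3 a = snd s1 a" "fst s3 ''V'' = fst s1 ''V''" for a
      using run_frame[of _ prog_ends s2] f2 by (simp_all add: s3_def W)
    have sa: "fst sa ''X'' = (fst s3 ''X'')(x + m := fst s3 ''Y'' x)" "fst sa ''Y'' = (fst s3 ''Y'')(x + m := fst s3 ''X'' x)"
      "fst sa ''V'' = (fst s1 ''V'')(x := x + m, x + m := x)" "fst sa ''i'' 0 = x" "fst sa ''m'' 0 = m" "snd sa = snd s3"
      using xm by (simp_all add: sa_def prog_arc_ends_def store_apply f3)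
    have sG: "snd s4 ''G'' = (snd s1 ''G'')(x := snd s ''c'' x, x + m := - snd s ''c'' x)"
      using xm by (simp add: s4_def prog_arc_data_def store_apply sa f3 f if_distrib[of snd] if_distrib[of fst])
    have sR: "snd s4 ''R'' = (snd s1 ''R'')(x := \<bar>snd s ''w'' x\<bar>, x + m := \<bar>snd s ''w'' x\<bar>)"
      using xm by (cases "snd s ''w'' x < 0") (simp_all add: s4_def prog_arc_data_def store_apply sa f3 f)
    have "fst s4 = fst sa" by (simp add: fun_eq_iff s4_def run_frame W)
    note s4 = this sa sG sR
    have "?Q s4 i" if "i < Suc x" for i
      using that I xm E by (cases "i = x") (auto simp: s4 less_Suc_eq)
    moreover have "run ?body s1 = s4" by (simp only: run.simps s2_def s3_def sa_def s4_def)
    ultimately show "\<forall>i<Suc x. ?Q (upd ''i'' (Suc x) (run ?body s1)) i"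
      by (simp add: fst_upd)
  qed (simp_all add: W)
  then show ?thesis using i by (simp add: m_def s'_def)
qed

text \<open>The row applied to \<open>z\<close> is the tension of \<open>z\<close> on the arc; with
  the value 0 at the outer vertex, a missing end contributes nothing.\<close>

lemma ends_sum:
  fixes e z :: "nat \<Rightarrow> real"
  assumes e: "\<And>j. j < n \<Longrightarrow> e j = 0 \<or> e j = 1 \<or> e j = -1"
    and uniq: "\<And>a b. a < n \<Longrightarrow> b < n \<Longrightarrow> a \<noteq> b \<Longrightarrow> e a \<noteq> 0 \<Longrightarrow> e b \<noteq> 0 \<Longrightarrow> e a + e b = 0"
    and x: "end_ok n e x" and y: "end_ok n (\<lambda>j. - e j) y" and zn: "z n = 0"
  shows "(\<Sum>j<n. e j * z j) = z x - z y" and "x \<le> n" "y \<le> n"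
proof -
  have pos: "(\<Sum>j<n. if 0 < f j then z j else 0) = z x" and le: "x \<le> n" if "end_ok n f x" for f x
  proof -
    show "x \<le> n" using that unfolding end_ok_def by (metis less_imp_le order_refl)
    show "(\<Sum>j<n. if 0 < f j then z j else 0) = z x"
    proof (cases "\<exists>j<n. 0 < f j")
      case True
      then obtain j where j: "j < n" "0 < f j" by blast
      then have "x = j" using that by (simp add: end_ok_def)
      have "(\<Sum>k<n. if 0 < f k then z k else 0) = (\<Sum>k<n. if k = j then z k else 0)"
      proof (intro sum.cong refl)
        fix k assume "k \<in> {..<n}"
        then have "0 < f k \<longleftrightarrow> k = j" using that j \<open>x = j\<close> unfolding end_ok_def by blast
        then show "(if 0 < f k then z k else 0) = (if k = j then z k else 0)" by simp
      qed
      then show ?thesis using j \<open>x = j\<close> by simp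
    next
      case False
      then have "x = n" using that by (auto simp: end_ok_def)
      then show ?thesis using False zn by (auto intro!: sum.neutral)
    qed
  qed
  show "x \<le> n" "y \<le> n" using le x y by blast+
  have "(\<Sum>j<n. e j * z j) = (\<Sum>j<n. (if 0 < e j then z j else 0) - (if 0 < - e j then z j else 0))"
    by (intro sum.cong refl) (use e in force)
  then show "(\<Sum>j<n. e j * z j) = z x - z y"
    using pos[OF x] pos[OF y] by (simp add: sum_subtractf)
qed

section \<open>Finding a cycle of minimum mean cost\<close>

fun trace :: "(nat \<Rightarrow> nat) \<Rightarrow> (nat \<Rightarrow> nat \<Rightarrow> nat \<Rightarrow> nat) \<Rightarrow> nat \<Rightarrow> nat \<Rightarrow> nat \<Rightarrow> nat list" where
  "trace src b u 0 v = []"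
| "trace src b u (Suc k) v = trace src b u k (src (b (Suc k) u v)) @ [b (Suc k) u v]"

lemma length_trace [simp]: "length (trace src b u k v) = k"
  by (induction k arbitrary: v) auto

text \<open>\<open>rev\<close> is the identity beyond \<open>A\<close>, so that pushing along a
  cycle alters nothing there and the residual array after a round equals \<open>push\<close> as a
  function.\<close>

locale nat_network = network "{..<A}" "{..<N}" src tgt rev cost
  for A N :: nat and src tgt rev :: "nat \<Rightarrow> nat" and cost :: "nat \<Rightarrow> real" +
  assumes rev_out: "A \<le> e \<Longrightarrow> rev e = e"
begin

lemma res_iff: "e \<in> res r \<longleftrightarrow> e < A \<and> 0 < r e"
  by (simp add: res_def)

lemma src_N: "e \<in> res r \<Longrightarrow> src e < N" and tgt_N: "e \<in> res r \<Longrightarrow> tgt e < N"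
  using src_V tgt_V by (auto simp: res_def)

text \<open>In these tables, \<open>o'\<close> flags the existence of a walk with exactly k arcs
  from u to v and takes the place of infinite costs; \<open>h\<close> is the least cost of such a
  walk and, in the later levels, \<open>b\<close> its last arc. Exact lengths are kept apart because
  means are compared.\<close>

definition base_ok :: "(nat \<Rightarrow> nat \<Rightarrow> nat \<Rightarrow> nat) \<Rightarrow> (nat \<Rightarrow> nat \<Rightarrow> nat \<Rightarrow> real) \<Rightarrow> bool" where
  "base_ok o' h \<longleftrightarrow> (\<forall>u<N. \<forall>v<N. 0 < o' 0 u v \<longleftrightarrow> u = v) \<and> (\<forall>u<N. h 0 u u = 0)"

definition level_ok :: "(nat \<Rightarrow> real) \<Rightarrow> (nat \<Rightarrow> nat \<Rightarrow> nat \<Rightarrow> nat) \<Rightarrow> (nat \<Rightarrow> nat \<Rightarrow> nat \<Rightarrow> real) \<Rightarrow>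
    (nat \<Rightarrow> nat \<Rightarrow> nat \<Rightarrow> nat) \<Rightarrow> nat \<Rightarrow> nat \<Rightarrow> bool" where
  "level_ok r o' h b k u \<longleftrightarrow>
     (\<forall>v<N. 0 < o' (Suc k) u v \<longrightarrow> b (Suc k) u v \<in> res r \<and> tgt (b (Suc k) u v) = v \<and>
        0 < o' k u (src (b (Suc k) u v)) \<and> h (Suc k) u v = h k u (src (b (Suc k) u v)) + cost (b (Suc k) u v)) \<and>
     (\<forall>e\<in>res r. 0 < o' k u (src e) \<longrightarrow>
        0 < o' (Suc k) u (tgt e) \<and> h (Suc k) u (tgt e) \<le> h k u (src e) + cost e)"

lemma level_ok_cong:
  assumes "\<And>v. v < N \<Longrightarrow> o1 k u v = o2 k u v \<and> h1 k u v = h2 k u v"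
    and "\<And>v. v < N \<Longrightarrow> o1 (Suc k) u v = o2 (Suc k) u v \<and> h1 (Suc k) u v = h2 (Suc k) u v \<and> b1 (Suc k) u v = b2 (Suc k) u v"
  shows "level_ok r o1 h1 b1 k u \<longleftrightarrow> level_ok r o2 h2 b2 k u"
  unfolding level_ok_def using assms src_N[of _ r] tgt_N[of _ r] by (intro conj_cong all_cong ball_cong refl) auto

lemma table_le:
  assumes base: "base_ok o' h" and lev: "\<And>k. k < K \<Longrightarrow> level_ok r o' h b k u" and u: "u < N"
  shows "walk src tgt (res r) u es v \<Longrightarrow> length es \<le> K \<Longrightarrow>
    v < N \<and> 0 < o' (length es) u v \<and> h (length es) u v \<le> cst es"
proof (induction es arbitrary: v rule: rev_induct)
  case Nil
  then show ?case using base u by (auto simp: base_ok_def)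
next
  case (snoc e es)
  then have w: "walk src tgt (res r) u es (src e)" "e \<in> res r" "tgt e = v" "length es \<le> K" "length es < K"
    by (auto simp: walk_append)
  from snoc.IH[OF w(1,4)] lev[OF w(5)] w(2,3) tgt_N[OF w(2)] show ?case
    unfolding level_ok_def by fastforce
qed

lemma table_trace:
  assumes base: "base_ok o' h" and lev: "\<And>k. k < K \<Longrightarrow> level_ok r o' h b k u" and u: "u < N"
  shows "k \<le> K \<Longrightarrow> v < N \<Longrightarrow> 0 < o' k u v \<Longrightarrow>
    walk src tgt (res r) u (trace src b u k v) v \<and> cst (trace src b u k v) = h k u v"
proof (induction k arbitrary: v)
  case 0
  then show ?case using base u by (auto simp: base_ok_def)
next
  case (Suc k)
  let ?e = "b (Suc k) u v"
  have e: "?e \<in> res r" "tgt ?e = v" "0 < o' k u (src ?e)" "h (Suc k) u v = h k u (src ?e) + cost ?e"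
    using lev[of k] Suc.prems by (auto simp: level_ok_def)
  from Suc.IH[of "src ?e"] Suc.prems(1) src_N[OF e(1)] e(3)
  have "walk src tgt (res r) u (trace src b u k (src ?e)) (src ?e)" "cst (trace src b u k (src ?e)) = h k u (src ?e)"
    by auto
  then show ?case using e by (auto simp: walk_append)
qed

text \<open>\<open>P\<close> collects the pairs of a length (minus one) and a start vertex examined so far.\<close>

definition best_ok :: "(nat \<times> nat) set \<Rightarrow> (nat \<Rightarrow> nat \<Rightarrow> nat \<Rightarrow> nat) \<Rightarrow> (nat \<Rightarrow> nat \<Rightarrow> nat \<Rightarrow> real) \<Rightarrow> nat \<Rightarrow> nat \<Rightarrow> real \<Rightarrow> bool" where
  "best_ok P o' h l s best \<longleftrightarrow>
     (\<forall>(k, u)\<in>P. 0 < o' (Suc k) u u \<longrightarrow> best \<le> h (Suc k) u u / real (Suc k)) \<and>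
     (l = 0 \<longrightarrow> best = 0) \<and>
     (0 < l \<longrightarrow> best < 0 \<and> (l - 1, s) \<in> P \<and> 0 < o' l s s \<and> best = h l s s / real l \<and>
        (\<forall>(k, u)\<in>P. Suc k < l \<longrightarrow> 0 < o' (Suc k) u u \<longrightarrow> best < h (Suc k) u u / real (Suc k)))"

lemma best_ok_cong:
  assumes "\<And>k u. (k, u) \<in> P \<Longrightarrow> o1 (Suc k) u u = o2 (Suc k) u u \<and> h1 (Suc k) u u = h2 (Suc k) u u"
  shows "best_ok P o1 h1 l s best \<longleftrightarrow> best_ok P o2 h2 l s best"
proof -
  have "best_ok P o1 h1 l s best \<Longrightarrow> best_ok P o2 h2 l s best"
    if "\<And>k u. (k, u) \<in> P \<Longrightarrow> o1 (Suc k) u u = o2 (Suc k) u u \<and> h1 (Suc k) u u = h2 (Suc k) u u" for o1 o2 h1 h2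
    using that that[of "l - 1" s] unfolding best_ok_def by (cases l) (auto simp: case_prod_beta split_beta)
  then show ?thesis using assms by (metis (no_types, lifting))
qed

text \<open>Lengths are visited in increasing order and only strict improvements are accepted, so
  the walk kept is a shortest one among those of minimum mean.\<close>

lemma best_ok_step:
  assumes best: "best_ok P o' h l s best" and k: "\<And>k' u'. (k', u') \<in> P \<Longrightarrow> k' \<le> k"
  shows "best_ok (insert (k, u) P) o' h
     (if 0 < o' (Suc k) u u \<and> h (Suc k) u u / real (Suc k) < best then Suc k else l)
     (if 0 < o' (Suc k) u u \<and> h (Suc k) u u / real (Suc k) < best then u else s)
     (if 0 < o' (Suc k) u u \<and> h (Suc k) u u / real (Suc k) < best then h (Suc k) u u / real (Suc k) else best)"
proof (cases "0 < o' (Suc k) u u \<and> h (Suc k) u u / real (Suc k) < best")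
  case True
  have "best \<le> 0" using best by (cases l) (auto simp: best_ok_def)
  then have "h (Suc k) u u / real (Suc k) < 0" using True by linarith
  moreover have "\<forall>(k', u')\<in>P. 0 < o' (Suc k') u' u' \<longrightarrow> h (Suc k) u u / real (Suc k) < h (Suc k') u' u' / real (Suc k')"
    using best True unfolding best_ok_def by fastforce
  ultimately show ?thesis
    using True by (auto simp: best_ok_def less_imp_le)
next
  case False
  have "l \<le> Suc k"
  proof (cases l)
    case (Suc l')
    then have "(l', s) \<in> P" using best by (auto simp: best_ok_def)
    then show ?thesis using k Suc by auto
  qed simp
  then show ?thesis
    unfolding if_not_P[OF False] using best False by (auto simp: best_ok_def)
qed

text \<open>Closed walks with at most N arcs determine the minimum mean, and the tables cover them
  from every start vertex. Length 0 encodes that none has negative cost.\<close>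

lemma best_ok_final:
  assumes base: "base_ok o' h" and lev: "\<And>k u. k < N \<Longrightarrow> u < N \<Longrightarrow> level_ok r o' h b k u"
    and best: "best_ok {(k, u). k < N \<and> u < N} o' h l s best"
  shows "l = 0 \<Longrightarrow> mean_ge 0 r"
    and "0 < l \<Longrightarrow> l \<le> N \<and> s < N \<and> min_mean_cycle r (trace src b s l s)"
proof -
  have short: "0 < o' (length ys) w w \<and> best * real (length ys) \<le> h (length ys) w w \<and> h (length ys) w w \<le> cst ys \<and> w < N"
    if ys: "ys \<noteq> []" "length ys \<le> card {..<N}" "walk src tgt (res r) w ys w" for w ys
  proof -
    obtain e ys' where e: "ys = e # ys'" using ys(1) by (cases ys) auto
    then have "e \<in> res r" "src e = w" using ys(3) by auto
    then have w: "w < N" using src_N by blast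
    from table_le[OF base _ w ys(3), of N b] lev w ys(2)
    have t: "0 < o' (length ys) w w" "h (length ys) w w \<le> cst ys" by auto
    have "(length ys - 1, w) \<in> {(k, u). k < N \<and> u < N}" using w ys(1,2) by (cases ys) auto
    then have "best \<le> h (length ys) w w / real (length ys)"
      using best t(1) ys(1) unfolding best_ok_def by (cases ys) auto
    then show ?thesis using t w ys(1) by (simp add: pos_le_divide_eq)
  qed
  have sub: "tgt ` res r \<subseteq> {..<N}" using tgt_N by auto
  have all: "best * real (length es) \<le> cst es" if "closed (res r) es" for es
  proof -
    have "\<exists>u. walk src tgt (res r) u es u" "es \<noteq> []" using that unfolding closed_def by blast+
    then obtain u where "walk src tgt (res r) u es u" "es \<noteq> []" by blast
    from closed_walk_mean_ge[OF fin_V sub _ this, where l=best and c=cost] show ?thesis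
      using short by (meson order_trans)
  qed
  show "mean_ge 0 r" if "l = 0"
    using all best that unfolding mean_ge_def best_ok_def by auto
  show "l \<le> N \<and> s < N \<and> min_mean_cycle r (trace src b s l s)" if l: "0 < l"
  proof -
    have s: "l - 1 < N" "s < N" "best < 0" "0 < o' l s s" "best = h l s s / real l"
      and strict: "\<And>k u. k < N \<Longrightarrow> u < N \<Longrightarrow> Suc k < l \<Longrightarrow> 0 < o' (Suc k) u u \<Longrightarrow> best < h (Suc k) u u / real (Suc k)"
      using best l unfolding best_ok_def by auto
    have lN: "l \<le> N" using s(1) l by simp
    let ?es = "trace src b s l s"
    have t: "walk src tgt (res r) s ?es s" "cst ?es = h l s s"
      using table_trace[OF base _ s(2) lN s(2,4), where b=b and r=r] lev s(2) by auto
    have cst: "cst ?es = best * real l" using t(2) s(5) l by simp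
    have "min_mean_cycle r ?es"
      unfolding min_mean_cycle_def
    proof (intro conjI allI impI)
      show "closed (res r) ?es" using t(1) l by (auto simp: closed_def dest: arg_cong[where f=length])
      show "cst ?es < 0" using cst s(3) l by (simp add: mult_neg_pos)
      fix es' assume es': "closed (res r) es'"
      have "best * real (length es') * real l \<le> cst es' * real l"
        using all[OF es'] by (intro mult_right_mono) auto
      then show "cst ?es * real (length es') \<le> cst es' * real (length ?es)"
        by (simp add: cst ac_simps)
      assume eq: "cst ?es * real (length es') = cst es' * real (length ?es)"
      then have eq': "best * real (length es') = cst es'"
        using l by (simp add: cst)
      show "length ?es \<le> length es'"
      proof (rule ccontr)
        assume "\<not> ?thesis"
        then have less: "length es' < l" by simp
        obtain w where w: "walk src tgt (res r) w es' w" "es' \<noteq> []" using es' unfolding closed_def by blast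
        have sh: "0 < o' (length es') w w" "h (length es') w w \<le> cst es'" "w < N"
          using short[OF w(2) _ w(1)] less lN by auto
        have "best < h (length es') w w / real (length es')"
          using strict[of "length es' - 1" w] w(2) less lN sh by (cases es') auto
        then have "best * real (length es') < h (length es') w w"
          using w(2) by (simp add: pos_less_divide_eq)
        then show False using eq' sh(2) by simp
      qed
    qed
    then show ?thesis using lN s(2) by simp
  qed
qed

end

section \<open>Filling the tables\<close>

definition IX :: "iexp \<Rightarrow> iexp \<Rightarrow> iexp \<Rightarrow> iexp" where
  "IX k u v = IAdd (IMul (IAdd (IMul k (Sc ''N'')) u) (Sc ''N'')) v"

definition ix :: "nat \<Rightarrow> nat \<Rightarrow> nat \<Rightarrow> nat \<Rightarrow> nat" where
  "ix N k u v = (k * N + u) * N + v"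

lemma ival_IX [simp]: "ival (IX k u v) s = ix (fst s ''N'' 0) (ival k s) (ival u s) (ival v s)"
  by (simp add: IX_def ix_def)

lemma ix_eq_iff: "u < N \<Longrightarrow> v < N \<Longrightarrow> u' < N \<Longrightarrow> v' < N \<Longrightarrow> ix N k u v = ix N k' u' v' \<longleftrightarrow> k = k' \<and> u = u' \<and> v = v'"
  unfolding ix_def using index_eq_iff[of v N v' "k * N + u" "k' * N + u'"] index_eq_iff[of u N u' k k'] by auto

abbreviation "TT \<equiv> IX (IAdd (Sc ''k'') (INum 1)) (Sc ''u'') (IGet ''Y'' (Sc ''e''))"
abbreviation "FF \<equiv> IX (Sc ''k'') (Sc ''u'') (IGet ''X'' (Sc ''e''))"
abbreviation "UU \<equiv> IX (IAdd (Sc ''k'') (INum 1)) (Sc ''u'') (Sc ''u'')"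
abbreviation "CAND \<equiv> RAdd (RGet ''H'' FF) (RGet ''G'' (Sc ''e''))"

text \<open>Only the flags are reset; outdated entries of the other tables are shielded by
  them.\<close>

definition prog_clear :: loop where
  "prog_clear = LFor ''v'' ''N'' (LI ''O'' (IX (IAdd (Sc ''k'') (INum 1)) (Sc ''u'') (Sc ''v'')) (INum 0))"

definition prog_relax :: loop where
  "prog_relax = LIf (BAnd (RLess (RNum 0) (RGet ''R'' (Sc ''e''))) (ILess (INum 0) (IGet ''O'' FF)))
     (LIf (BAnd (ILess (INum 0) (IGet ''O'' TT)) (BNot (RLess CAND (RGet ''H'' TT)))) LSkip
        (LSeq (LR ''H'' TT CAND) (LSeq (LI ''B'' TT (Sc ''e'')) (LI ''O'' TT (INum 1)))))
     LSkip"

text \<open>The real scalar \<open>l\<close> is a second counter equal to k + 1, since the mean is a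
  quotient of reals; the natural scalar of the same name keeps the length of the best walk.\<close>

definition prog_best :: loop where
  "prog_best = LIf (BAnd (ILess (INum 0) (IGet ''O'' UU)) (RLess (RDiv (RGet ''H'' UU) (Rc ''l'')) (Rc ''b'')))
     (LSeq (LR ''b'' (INum 0) (RDiv (RGet ''H'' UU) (Rc ''l'')))
       (LSeq (LI ''l'' (INum 0) (IAdd (Sc ''k'') (INum 1))) (LI ''s'' (INum 0) (Sc ''u''))))
     LSkip"

definition prog_level :: loop where
  "prog_level = LSeq prog_clear (LFor ''e'' ''A'' prog_relax)"

text \<open>Truncated subtraction sets the flags of level 0: 1 - ((u - v) + (v - u)) is 1 for u = v
  and 0 otherwise.\<close>

definition prog_search :: loop where
  "prog_search = LSeq (LI ''l'' (INum 0) (INum 0)) (LSeq (LR ''b'' (INum 0) (RNum 0)) (LSeq (LR ''l'' (INum 0) (RNum 0))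
     (LSeq (LFor ''u'' ''N'' (LFor ''v'' ''N'' (LI ''O'' (IX (INum 0) (Sc ''u'') (Sc ''v'')) (ISub (INum 1)
                (IAdd (ISub (Sc ''u'') (Sc ''v'')) (ISub (Sc ''v'') (Sc ''u'')))))))
     (LSeq (LFor ''u'' ''N'' (LR ''H'' (IX (INum 0) (Sc ''u'') (Sc ''u'')) (RNum 0)))
       (LFor ''k'' ''N'' (LSeq (LR ''l'' (INum 0) (RAdd (Rc ''l'') (RNum 1)))
          (LFor ''u'' ''N'' (LSeq prog_level prog_best))))))))"

definition oT :: "nat \<Rightarrow> state \<Rightarrow> nat \<Rightarrow> nat \<Rightarrow> nat \<Rightarrow> nat" where "oT N s k u v = fst s ''O'' (ix N k u v)"
definition bT :: "nat \<Rightarrow> state \<Rightarrow> nat \<Rightarrow> nat \<Rightarrow> nat \<Rightarrow> nat" where "bT N s k u v = fst s ''B'' (ix N k u v)"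
definition hT :: "nat \<Rightarrow> state \<Rightarrow> nat \<Rightarrow> nat \<Rightarrow> nat \<Rightarrow> real" where "hT N s k u v = snd s ''H'' (ix N k u v)"

lemma wi_wr_search:
  "wi prog_clear = {''v'', ''O''}" "wr prog_clear = {}" "wi prog_relax = {''B'', ''O''}" "wr prog_relax = {''H''}"
  "wi prog_best = {''l'', ''s''}" "wr prog_best = {''b''}"
  "wi prog_level = {''v'', ''O'', ''B'', ''e''}" "wr prog_level = {''H''}"
  by (auto simp: prog_clear_def prog_relax_def prog_best_def prog_level_def)

context nat_network
begin

definition net :: "state \<Rightarrow> bool" where
  "net s \<longleftrightarrow> fst s ''N'' 0 = N \<and> fst s ''A'' 0 = A \<and> fst s ''X'' = src \<and> fst s ''Y'' = tgt \<and> snd s ''G'' = cost \<and>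
     (\<forall>e<A. fst s ''V'' e = rev e)"

lemma net_frame:
  assumes "net s" "\<And>a. a \<in> {''N'', ''A'', ''X'', ''Y'', ''V''} \<Longrightarrow> fst s' a = fst s a" "snd s' ''G'' = snd s ''G''"
  shows "net s'"
  using assms by (simp add: net_def)

lemma run_clear:
  assumes s: "net s" "fst s ''k'' 0 = k" "fst s ''u'' 0 = u"
  shows "fst (run prog_clear s) ''O'' i = (if \<exists>v<N. i = ix N (Suc k) u v then 0 else fst s ''O'' i)"
proof -
  have N: "fst s ''N'' 0 = N" using s(1) by (simp add: net_def)
  let ?P = "\<lambda>y s1. \<forall>i. fst s1 ''O'' i = (if \<exists>v<y. i = ix N (Suc k) u v then 0 else fst s ''O'' i)"
  have "?P (fst s ''N'' 0) (run prog_clear s)"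
    unfolding prog_clear_def
  proof (rule run_LFor_induct[where Inv="?P"])
    fix y and s1 :: state
    assume I: "?P y s1" and y: "fst s1 ''v'' 0 = y"
      and fi: "\<And>a. a \<notin> wi (LI ''O'' (IX (IAdd (Sc ''k'') (INum 1)) (Sc ''u'') (Sc ''v'')) (INum 0)) \<Longrightarrow> a \<noteq> ''v'' \<Longrightarrow> fst s1 a = fst s a"
    have "fst s1 ''k'' 0 = k" "fst s1 ''u'' 0 = u" "fst s1 ''N'' 0 = N" using s N by (simp_all add: fi)
    then show "?P (Suc y) (upd ''v'' (Suc y) (run (LI ''O'' (IX (IAdd (Sc ''k'') (INum 1)) (Sc ''u'') (Sc ''v'')) (INum 0)) s1))"
      using I y by (auto simp: fst_upd store_apply less_Suc_eq)
  qed (auto simp: fst_upd)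
  then show ?thesis by (simp add: N)
qed

text \<open>Row k + 1 of the start vertex u is computed from row k, which is not written meanwhile;
  so the loop invariant may quote row k in the initial state.\<close>

lemma run_level:
  assumes s: "net s" "snd s ''R'' = r" "fst s ''k'' 0 = k" "fst s ''u'' 0 = u" "u < N"
  defines "s' \<equiv> run prog_level s"
  shows "level_ok r (oT N s') (hT N s') (bT N s') k u"
    and "\<And>k' u' v. u' < N \<Longrightarrow> v < N \<Longrightarrow> (k', u') \<noteq> (Suc k, u) \<Longrightarrow>
      oT N s' k' u' v = oT N s k' u' v \<and> hT N s' k' u' v = hT N s k' u' v \<and> bT N s' k' u' v = bT N s k' u' v"
proof -
  define s0 where "s0 = run prog_clear s"
  have f0: "fst s0 a = fst s a" if "a \<notin> {''v'', ''O''}" for a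
    unfolding s0_def by (rule run_frame) (use that in \<open>simp add: wi_wr_search\<close>)
  have r0: "snd s0 a = snd s a" for a
    unfolding s0_def by (rule run_frame) (simp add: wi_wr_search)
  have net0: "net s0" by (rule net_frame[OF s(1)]) (auto simp: f0 r0)
  have o0: "oT N s0 (Suc k) u v = 0" if "v < N" for v
    unfolding oT_def s0_def using run_clear[OF s(1,3,4)] that by auto
  have o0': "oT N s0 k' u' v = oT N s k' u' v" if "u' < N" "v < N" "(k', u') \<noteq> (Suc k, u)" for k' u' v
    unfolding oT_def s0_def using run_clear[OF s(1,3,4)] that ix_eq_iff[OF that(1,2) s(5)] by auto
  define Inv where "Inv y s1 \<longleftrightarrow> net s1 \<and>
     (\<forall>k' u' v. u' < N \<longrightarrow> v < N \<longrightarrow> (k', u') \<noteq> (Suc k, u) \<longrightarrow>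
        oT N s1 k' u' v = oT N s k' u' v \<and> hT N s1 k' u' v = hT N s k' u' v \<and> bT N s1 k' u' v = bT N s k' u' v) \<and>
     (\<forall>v<N. 0 < oT N s1 (Suc k) u v \<longrightarrow> bT N s1 (Suc k) u v \<in> res r \<and> tgt (bT N s1 (Suc k) u v) = v \<and>
        0 < oT N s k u (src (bT N s1 (Suc k) u v)) \<and>
        hT N s1 (Suc k) u v = hT N s k u (src (bT N s1 (Suc k) u v)) + cost (bT N s1 (Suc k) u v)) \<and>
     (\<forall>e<y. e \<in> res r \<longrightarrow> 0 < oT N s k u (src e) \<longrightarrow>
        0 < oT N s1 (Suc k) u (tgt e) \<and> hT N s1 (Suc k) u (tgt e) \<le> hT N s k u (src e) + cost e)" for y s1
  have "Inv (fst s0 ''A'' 0) (run (LFor ''e'' ''A'' prog_relax) s0)"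
  proof (rule run_LFor_induct[where Inv=Inv])
    have "net (upd ''e'' 0 s0)" by (rule net_frame[OF net0]) (auto simp: fst_upd)
    moreover have "oT N (upd ''e'' 0 s0) = oT N s0" "hT N (upd ''e'' 0 s0) = hT N s" "bT N (upd ''e'' 0 s0) = bT N s"
      by (simp_all add: oT_def hT_def bT_def fst_upd fun_eq_iff r0 f0)
    ultimately show "Inv 0 (upd ''e'' 0 s0)"
      unfolding Inv_def using o0 o0' by auto
  next
    fix e and s1 :: state
    assume e: "e < fst s0 ''A'' 0" and I: "Inv e s1" and e1: "fst s1 ''e'' 0 = e"
      and fi: "\<And>a. a \<notin> wi prog_relax \<Longrightarrow> a \<noteq> ''e'' \<Longrightarrow> fst s1 a = fst s0 a"
      and fr: "\<And>a. a \<notin> wr prog_relax \<Longrightarrow> snd s1 a = snd s0 a"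
    have eA: "e < A" using e net0 by (simp add: net_def)
    have ST: "src e < N" "tgt e < N" using src_V[of e] tgt_V[of e] eA by auto
    have net1: "net s1" using I by (simp add: Inv_def)
    have c1: "fst s1 ''k'' 0 = k" "fst s1 ''u'' 0 = u" "snd s1 ''R'' = r" "fst s1 ''N'' 0 = N" "fst s1 ''X'' = src"
      "fst s1 ''Y'' = tgt" "snd s1 ''G'' = cost"
      using net1 s by (simp_all add: fi fr wi_wr_search f0 r0 net_def)
    let ?t = "ix N (Suc k) u (tgt e)" and ?f = "ix N k u (src e)"
    have tf: "?t \<noteq> ?f" using ix_eq_iff[OF s(5) ST(2) s(5) ST(1)] by simp
    define s2 where "s2 = run prog_relax s1"
    let ?cand = "hT N s k u (src e) + cost e"
    have old: "oT N s1 k u (src e) = oT N s k u (src e)" "hT N s1 k u (src e) = hT N s k u (src e)"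
      using I s(5) ST(1) unfolding Inv_def by auto
    let ?c1 = "e \<in> res r \<and> 0 < oT N s k u (src e)"
    let ?c2 = "0 < oT N s1 (Suc k) u (tgt e) \<and> \<not> ?cand < hT N s1 (Suc k) u (tgt e)"
    have s2: "s2 = (if ?c1 \<and> \<not> ?c2 then
        (store (store (fst s1) ''B'' ?t e) ''O'' ?t 1, store (snd s1) ''H'' ?t ?cand) else s1)"
      unfolding s2_def prog_relax_def
      using old eA by (auto simp: e1 c1 res_iff oT_def hT_def store_apply)
    have ixt: "ix N k' u' v = ?t \<longleftrightarrow> (k', u', v) = (Suc k, u, tgt e)" if "u' < N" "v < N" for k' u' v
      using ix_eq_iff[OF that s(5) ST(2)] by auto
    show "Inv (Suc e) (upd ''e'' (Suc e) (run prog_relax s1))"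
    proof (cases "?c1 \<and> \<not> ?c2")
      case False
      have s21: "run prog_relax s1 = s1" using s2 unfolding if_not_P[OF False] s2_def .
      have net': "net (upd ''e'' (Suc e) s1)" by (rule net_frame[OF net1]) (auto simp: fst_upd)
      have T: "oT N (upd ''e'' (Suc e) s1) = oT N s1" "hT N (upd ''e'' (Suc e) s1) = hT N s1" "bT N (upd ''e'' (Suc e) s1) = bT N s1"
        by (simp_all add: oT_def hT_def bT_def fst_upd fun_eq_iff)
      show ?thesis
        unfolding s21 Inv_def T
      proof (intro conjI allI impI net')
        fix a assume a: "a < Suc e" "a \<in> res r" "0 < oT N s k u (src a)"
        have "0 < oT N s1 (Suc k) u (tgt a) \<and> hT N s1 (Suc k) u (tgt a) \<le> hT N s k u (src a) + cost a"
        proof (cases "a = e")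
          case True
          then show ?thesis using False a by auto
        next
          case False
          then show ?thesis using I a unfolding Inv_def by auto
        qed
        then show "0 < oT N s1 (Suc k) u (tgt a)" "hT N s1 (Suc k) u (tgt a) \<le> hT N s k u (src a) + cost a" by auto
      qed (use I in \<open>auto simp: Inv_def\<close>)
    next
      case True
      then have s2': "s2 = (store (store (fst s1) ''B'' ?t e) ''O'' ?t 1, store (snd s1) ''H'' ?t ?cand)"
        using s2 by simp
      let ?s3 = "upd ''e'' (Suc e) s2"
      have net': "net ?s3" by (rule net_frame[OF net1]) (auto simp: fst_upd s2' store_apply)
      have T: "oT N ?s3 k' u' v = (if (k', u', v) = (Suc k, u, tgt e) then 1 else oT N s1 k' u' v)"
        "hT N ?s3 k' u' v = (if (k', u', v) = (Suc k, u, tgt e) then ?cand else hT N s1 k' u' v)"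
        "bT N ?s3 k' u' v = (if (k', u', v) = (Suc k, u, tgt e) then e else bT N s1 k' u' v)" if "u' < N" "v < N" for k' u' v
        using ixt[OF that] by (auto simp: oT_def hT_def bT_def fst_upd s2' store_apply)
      have "Inv (Suc e) ?s3"
        unfolding Inv_def
      proof (intro conjI net')
        show "\<forall>k' u' v. u' < N \<longrightarrow> v < N \<longrightarrow> (k', u') \<noteq> (Suc k, u) \<longrightarrow>
          oT N ?s3 k' u' v = oT N s k' u' v \<and> hT N ?s3 k' u' v = hT N s k' u' v \<and> bT N ?s3 k' u' v = bT N s k' u' v"
          using I T unfolding Inv_def by auto
        show "\<forall>v<N. 0 < oT N ?s3 (Suc k) u v \<longrightarrow> bT N ?s3 (Suc k) u v \<in> res r \<and> tgt (bT N ?s3 (Suc k) u v) = v \<and>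
          0 < oT N s k u (src (bT N ?s3 (Suc k) u v)) \<and>
          hT N ?s3 (Suc k) u v = hT N s k u (src (bT N ?s3 (Suc k) u v)) + cost (bT N ?s3 (Suc k) u v)"
        proof (intro allI impI)
          fix v assume v: "v < N" "0 < oT N ?s3 (Suc k) u v"
          show "bT N ?s3 (Suc k) u v \<in> res r \<and> tgt (bT N ?s3 (Suc k) u v) = v \<and>
            0 < oT N s k u (src (bT N ?s3 (Suc k) u v)) \<and>
            hT N ?s3 (Suc k) u v = hT N s k u (src (bT N ?s3 (Suc k) u v)) + cost (bT N ?s3 (Suc k) u v)"
          proof (cases "v = tgt e")
            case True
            with T[OF s(5) ST(2), of "Suc k"] \<open>?c1 \<and> \<not> ?c2\<close> show ?thesis by simp
          next
            case False
            with T[OF s(5) v(1), of "Suc k"] v I show ?thesis unfolding Inv_def by simp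
          qed
        qed
        show "\<forall>a<Suc e. a \<in> res r \<longrightarrow> 0 < oT N s k u (src a) \<longrightarrow>
          0 < oT N ?s3 (Suc k) u (tgt a) \<and> hT N ?s3 (Suc k) u (tgt a) \<le> hT N s k u (src a) + cost a"
        proof (intro allI impI)
          fix a assume a: "a < Suc e" "a \<in> res r" "0 < oT N s k u (src a)"
          show "0 < oT N ?s3 (Suc k) u (tgt a) \<and> hT N ?s3 (Suc k) u (tgt a) \<le> hT N s k u (src a) + cost a"
          proof (cases "a = e")
            case True
            then show ?thesis using T[OF s(5) ST(2), of "Suc k"] by simp
          next
            case False
            then have Ia: "0 < oT N s1 (Suc k) u (tgt a)" "hT N s1 (Suc k) u (tgt a) \<le> hT N s k u (src a) + cost a"
              using I a unfolding Inv_def by auto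
            show ?thesis
            proof (cases "tgt a = tgt e")
              case True
              then have "?cand < hT N s1 (Suc k) u (tgt a)" using \<open>?c1 \<and> \<not> ?c2\<close> Ia(1) by auto
              then show ?thesis using T[OF s(5) ST(2), of "Suc k"] True Ia(2) by simp
            next
              case False
              then show ?thesis using T[OF s(5) tgt_N[OF a(2)], of "Suc k"] Ia by simp
            qed
          qed
        qed
      qed
      then show ?thesis by (simp add: s2_def)
    qed
  qed (simp add: wi_wr_search)
  moreover have "fst s0 ''A'' 0 = A" using net0 by (simp add: net_def)
  moreover have "run (LFor ''e'' ''A'' prog_relax) s0 = s'"
    by (simp only: s'_def prog_level_def s0_def run.simps)
  ultimately have I: "Inv A s'" by simp
  show un: "oT N s' k' u' v = oT N s k' u' v \<and> hT N s' k' u' v = hT N s k' u' v \<and> bT N s' k' u' v = bT N s k' u' v"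
    if "u' < N" "v < N" "(k', u') \<noteq> (Suc k, u)" for k' u' v
    using I that unfolding Inv_def by blast
  show "level_ok r (oT N s') (hT N s') (bT N s') k u"
    unfolding level_ok_def
  proof (intro conjI allI impI ballI)
    fix v assume v: "v < N" "0 < oT N s' (Suc k) u v"
    let ?b = "bT N s' (Suc k) u v"
    have b: "?b \<in> res r" "tgt ?b = v" "0 < oT N s k u (src ?b)" "hT N s' (Suc k) u v = hT N s k u (src ?b) + cost ?b"
      using I v unfolding Inv_def by blast+
    show "?b \<in> res r" "tgt ?b = v" using b by auto
    show "0 < oT N s' k u (src ?b)" "hT N s' (Suc k) u v = hT N s' k u (src ?b) + cost ?b"
      using b un[OF s(5) src_N[OF b(1)], of k] by auto
  next
    fix e assume e: "e \<in> res r" "0 < oT N s' k u (src e)"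
    have "e < A" using e(1) by (simp add: res_iff)
    then have "0 < oT N s' (Suc k) u (tgt e) \<and> hT N s' (Suc k) u (tgt e) \<le> hT N s k u (src e) + cost e"
      using I e un[OF s(5) src_N[OF e(1)], of k] unfolding Inv_def by auto
    then show "0 < oT N s' (Suc k) u (tgt e)" "hT N s' (Suc k) u (tgt e) \<le> hT N s' k u (src e) + cost e"
      using un[OF s(5) src_N[OF e(1)], of k] by auto
  qed
qed

end

section \<open>Computing a minimum cost circulation\<close>

text \<open>The table of last arcs is followed backwards from the start vertex, \<open>l - h\<close>
  being the level of the arc stored at \<open>h\<close>. The loop limit is \<open>N\<close>, with a
  test against \<open>l\<close>, because \<open>l\<close> is written by the program and cannot be a
  limit. At \<open>h = 0\<close> the minimum is initialised.\<close>

definition prog_extract :: loop where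
  "prog_extract = LSeq (LI ''z'' (INum 0) (Sc ''s'')) (LFor ''h'' ''N'' (LIf (ILess (Sc ''h'') (Sc ''l''))
     (LSeq (LI ''Z'' (Sc ''h'') (IGet ''B'' (IX (ISub (Sc ''l'') (Sc ''h'')) (Sc ''s'') (Sc ''z''))))
       (LSeq (LIf (BAnd (ILess (INum 0) (Sc ''h'')) (BNot (RLess (RGet ''R'' (IGet ''Z'' (Sc ''h''))) (Rc ''d'')))) LSkip
            (LR ''d'' (INum 0) (RGet ''R'' (IGet ''Z'' (Sc ''h'')))))
         (LI ''z'' (INum 0) (IGet ''X'' (IGet ''Z'' (Sc ''h''))))))
     LSkip))"

definition prog_push :: loop where
  "prog_push = LFor ''h'' ''N'' (LIf (ILess (Sc ''h'') (Sc ''l''))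
     (LSeq (LR ''R'' (IGet ''Z'' (Sc ''h'')) (RSub (RGet ''R'' (IGet ''Z'' (Sc ''h''))) (Rc ''d'')))
       (LR ''R'' (IGet ''V'' (IGet ''Z'' (Sc ''h''))) (RAdd (RGet ''R'' (IGet ''V'' (IGet ''Z'' (Sc ''h'')))) (Rc ''d''))))
     LSkip)"

definition prog_round :: loop where
  "prog_round = LSeq prog_search (LSeq prog_extract prog_push)"

lemma wi_wr_round:
  "wi prog_search = {''l'', ''s'', ''u'', ''v'', ''O'', ''B'', ''e'', ''k''}" "wr prog_search = {''b'', ''l'', ''H''}"
  "wi prog_extract = {''z'', ''h'', ''Z''}" "wr prog_extract = {''d''}"
  "wi prog_push = {''h''}" "wr prog_push = {''R''}"
  by (auto simp: prog_search_def prog_extract_def prog_push_def wi_wr_search)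

context nat_network
begin

definition search_inv :: "(nat \<times> nat) set \<Rightarrow> (nat \<Rightarrow> real) \<Rightarrow> state \<Rightarrow> bool" where
  "search_inv P r s \<longleftrightarrow> net s \<and> snd s ''R'' = r \<and> base_ok (oT N s) (hT N s) \<and>
     (\<forall>(k, u)\<in>P. level_ok r (oT N s) (hT N s) (bT N s) k u) \<and>
     best_ok P (oT N s) (hT N s) (fst s ''l'' 0) (fst s ''s'' 0) (snd s ''b'' 0)"

lemma search_inv_frame:
  assumes "search_inv P r s"
    and "\<And>a. a \<in> {''N'', ''A'', ''X'', ''Y'', ''V'', ''O'', ''B'', ''l'', ''s''} \<Longrightarrow> fst s' a = fst s a"
    and "\<And>a. a \<in> {''G'', ''R'', ''H'', ''b''} \<Longrightarrow> snd s' a = snd s a"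
  shows "search_inv P r s'"
proof -
  have "oT N s' = oT N s" "bT N s' = bT N s" "hT N s' = hT N s"
    using assms by (simp_all add: oT_def bT_def hT_def fun_eq_iff)
  moreover have "net s' = net s" using assms by (simp add: net_def)
  ultimately show ?thesis using assms by (simp add: search_inv_def)
qed

lemma search_inv_upd:
  assumes "search_inv P r s" "x \<in> {''k'', ''u''}"
  shows "search_inv P r (upd x i s)"
  by (rule search_inv_frame[OF assms(1)]) (use assms(2) in \<open>auto simp: fst_upd\<close>)

text \<open>Row k + 1 of u is written. A pair (k', u') of \<open>P\<close> involves the rows k' and
  k' + 1 of u', neither of which is that one, so everything recorded about \<open>P\<close> remains
  true.\<close>

lemma run_visit:
  assumes inv: "search_inv P r s" and s: "fst s ''k'' 0 = k" "fst s ''u'' 0 = u" "snd s ''l'' 0 = real (Suc k)"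
    and u: "u < N" and P: "\<And>k' u'. (k', u') \<in> P \<Longrightarrow> k' \<le> k \<and> u' < N \<and> (k', u') \<noteq> (k, u)"
  shows "search_inv (insert (k, u) P) r (run (LSeq prog_level prog_best) s)"
proof -
  have I: "net s" "snd s ''R'' = r" "base_ok (oT N s) (hT N s)"
      "\<forall>(k, u)\<in>P. level_ok r (oT N s) (hT N s) (bT N s) k u"
      "best_ok P (oT N s) (hT N s) (fst s ''l'' 0) (fst s ''s'' 0) (snd s ''b'' 0)"
    using inv unfolding search_inv_def by blast+
  define s1 where "s1 = run prog_level s"
  define s2 where "s2 = run prog_best s1"
  note lev = run_level[OF I(1,2) s(1,2) u, folded s1_def]
  have f1: "fst s1 a = fst s a" if "a \<notin> {''v'', ''O'', ''B'', ''e''}" for a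
    unfolding s1_def by (rule run_frame) (use that in \<open>simp add: wi_wr_search\<close>)
  have r1: "snd s1 a = snd s a" if "a \<noteq> ''H''" for a
    unfolding s1_def by (rule run_frame) (use that in \<open>simp add: wi_wr_search\<close>)
  have net1: "net s1" by (rule net_frame[OF I(1)]) (auto simp: f1 r1)
  have base1: "base_ok (oT N s1) (hT N s1)"
    using I(3) lev(2)[of _ _ 0] unfolding base_ok_def by simp
  have lev1: "level_ok r (oT N s1) (hT N s1) (bT N s1) k' u'" if "(k', u') \<in> P" for k' u'
  proof -
    have "level_ok r (oT N s) (hT N s) (bT N s) k' u'" using I(4) that by blast
    moreover have "(k', u') \<noteq> (Suc k, u)" "(Suc k', u') \<noteq> (Suc k, u)" "u' < N" using P[OF that] by auto
    ultimately show ?thesis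
      using level_ok_cong[of "oT N s1" k' u' "oT N s" "hT N s1" "hT N s" "bT N s1" "bT N s" r]
        lev(2)[of u' _ k'] lev(2)[of u' _ "Suc k'"] by auto
  qed
  have best1: "best_ok P (oT N s1) (hT N s1) (fst s1 ''l'' 0) (fst s1 ''s'' 0) (snd s1 ''b'' 0)"
  proof -
    have "oT N s1 (Suc k') u' u' = oT N s (Suc k') u' u' \<and> hT N s1 (Suc k') u' u' = hT N s (Suc k') u' u'"
      if "(k', u') \<in> P" for k' u'
      using P[OF that] lev(2)[of u' u' "Suc k'"] by auto
    from best_ok_cong[of P "oT N s1" "oT N s" "hT N s1" "hT N s", OF this] show ?thesis
      using I(5) by (simp add: f1 r1)
  qed
  let ?h = "hT N s1 (Suc k) u u / real (Suc k)"
  let ?c = "0 < oT N s1 (Suc k) u u \<and> ?h < snd s1 ''b'' 0"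
  have c1: "fst s1 ''k'' 0 = k" "fst s1 ''u'' 0 = u" "snd s1 ''l'' 0 = real (Suc k)" "fst s1 ''N'' 0 = N"
    using s I(1) by (simp_all add: f1 r1 net_def)
  have s2: "s2 = (if ?c then (store (store (fst s1) ''l'' 0 (Suc k)) ''s'' 0 u, store (snd s1) ''b'' 0 ?h) else s1)"
    unfolding s2_def prog_best_def by (cases ?c) (simp_all add: c1 oT_def hT_def store_apply del: of_nat_Suc cong: if_cong)
  have f2: "fst s2 a = fst s1 a" if "a \<notin> {''l'', ''s''}" for a
    using that by (simp add: s2 store_apply)
  have r2: "snd s2 a = snd s1 a" if "a \<noteq> ''b''" for a
    using that by (simp add: s2 store_apply)
  have T: "oT N s2 = oT N s1" "bT N s2 = bT N s1" "hT N s2 = hT N s1"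
    by (simp_all add: oT_def bT_def hT_def fun_eq_iff f2 r2)
  have net2: "net s2" by (rule net_frame[OF net1]) (auto simp: f2 r2)
  have LB: "fst s2 ''l'' 0 = (if ?c then Suc k else fst s1 ''l'' 0)" "fst s2 ''s'' 0 = (if ?c then u else fst s1 ''s'' 0)"
    "snd s2 ''b'' 0 = (if ?c then ?h else snd s1 ''b'' 0)"
    by (simp_all add: s2 store_apply)
  have "best_ok (insert (k, u) P) (oT N s2) (hT N s2) (fst s2 ''l'' 0) (fst s2 ''s'' 0) (snd s2 ''b'' 0)"
    unfolding T LB by (rule best_ok_step[OF best1]) (use P in blast)
  moreover have "\<forall>(k, u)\<in>insert (k, u) P. level_ok r (oT N s2) (hT N s2) (bT N s2) k u"
    unfolding T using lev(1) lev1 by blast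
  moreover have "run (LSeq prog_level prog_best) s = s2" by (simp only: run.simps s1_def s2_def)
  ultimately show ?thesis
    using net2 base1 T I(2) by (simp add: search_inv_def r1 r2)
qed

lemma run_search:
  assumes s: "net s" "snd s ''R'' = r"
  shows "search_inv {(k, u). k < N \<and> u < N} r (run prog_search s)"
proof -
  let ?set = "LI ''O'' (IX (INum 0) (Sc ''u'') (Sc ''v'')) (ISub (INum 1)
                (IAdd (ISub (Sc ''u'') (Sc ''v'')) (ISub (Sc ''v'') (Sc ''u''))))"
  let ?fill = "LR ''H'' (IX (INum 0) (Sc ''u'') (Sc ''u'')) (RNum 0)"
  let ?visits = "LFor ''u'' ''N'' (LSeq prog_level prog_best)"
  define s1 where "s1 = run (LSeq (LI ''l'' (INum 0) (INum 0)) (LSeq (LR ''b'' (INum 0) (RNum 0)) (LR ''l'' (INum 0) (RNum 0)))) s"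
  define s2 where "s2 = run (LFor ''u'' ''N'' (LFor ''v'' ''N'' ?set)) s1"
  define s3 where "s3 = run (LFor ''u'' ''N'' ?fill) s2"
  define s4 where "s4 = run (LFor ''k'' ''N'' (LSeq (LR ''l'' (INum 0) (RAdd (Rc ''l'') (RNum 1))) ?visits)) s3"
  have s4: "run prog_search s = s4"
    by (simp only: run.simps prog_search_def s1_def s2_def s3_def s4_def)
  have f1: "fst s1 a = fst s a" if "a \<noteq> ''l''" for a using that by (simp add: s1_def store_apply)
  have r1: "snd s1 a = snd s a" if "a \<noteq> ''b''" "a \<noteq> ''l''" for a using that by (simp add: s1_def store_apply)
  have z1: "fst s1 ''l'' 0 = 0" "snd s1 ''b'' 0 = 0" "snd s1 ''l'' 0 = 0" by (simp_all add: s1_def store_apply)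
  have N1: "fst s1 ''N'' 0 = N" using s by (simp add: f1 net_def)
  have f2: "fst s2 a = fst s1 a" if "a \<notin> {''u'', ''v'', ''O''}" for a
    unfolding s2_def by (rule run_frame) (use that in simp)
  have r2: "snd s2 a = snd s1 a" for a unfolding s2_def by (rule run_frame) simp
  have f3: "fst s3 a = fst s2 a" if "a \<noteq> ''u''" for a
    unfolding s3_def by (rule run_frame) (use that in simp)
  have r3: "snd s3 a = snd s2 a" if "a \<noteq> ''H''" for a
    unfolding s3_def by (rule run_frame) (use that in simp)
  have o2: "\<forall>u v. v < N \<longrightarrow> u < fst s1 ''N'' 0 \<longrightarrow> (0 < oT N s2 0 u v \<longleftrightarrow> u = v)"
    unfolding s2_def
  proof (rule run_LFor_induct[where Inv="\<lambda>x t. \<forall>u v. v < N \<longrightarrow> u < x \<longrightarrow> (0 < oT N t 0 u v \<longleftrightarrow> u = v)"])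
    fix x and t :: state
    assume x: "x < fst s1 ''N'' 0" and I: "\<forall>u v. v < N \<longrightarrow> u < x \<longrightarrow> (0 < oT N t 0 u v \<longleftrightarrow> u = v)" and tx: "fst t ''u'' 0 = x"
      and fi: "\<And>a. a \<notin> wi (LFor ''v'' ''N'' ?set) \<Longrightarrow> a \<noteq> ''u'' \<Longrightarrow> fst t a = fst s1 a"
    have xN: "x < N" "fst t ''N'' 0 = N" using x N1 by (simp_all add: fi)
    let ?P = "\<lambda>y t. \<forall>u v. v < N \<longrightarrow> u < x \<or> u = x \<and> v < y \<longrightarrow> (0 < oT N t 0 u v \<longleftrightarrow> u = v)"
    have "?P (fst t ''N'' 0) (run (LFor ''v'' ''N'' ?set) t)"
    proof (rule run_LFor_induct[where Inv="?P"])
      fix y and t1 :: state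
      assume y: "y < fst t ''N'' 0" and J: "?P y t1" and ty: "fst t1 ''v'' 0 = y"
        and fi1: "\<And>a. a \<notin> wi ?set \<Longrightarrow> a \<noteq> ''v'' \<Longrightarrow> fst t1 a = fst t a"
      have yN: "y < N" "fst t1 ''N'' 0 = N" "fst t1 ''u'' 0 = x" using y xN tx by (simp_all add: fi1)
      have O: "oT N (upd ''v'' (Suc y) (run ?set t1)) 0 u v = (if u = x \<and> v = y then 1 - ((x - y) + (y - x)) else oT N t1 0 u v)"
        if "u < N" "v < N" for u v
        using ix_eq_iff[OF that xN(1) yN(1), of 0 0] by (auto simp: oT_def fst_upd store_apply ty yN)
      show "?P (Suc y) (upd ''v'' (Suc y) (run ?set t1))"
      proof (intro allI impI)
        fix u v assume v: "v < N" "u < x \<or> u = x \<and> v < Suc y"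
        then have uN: "u < N" using xN by auto
        show "0 < oT N (upd ''v'' (Suc y) (run ?set t1)) 0 u v \<longleftrightarrow> u = v"
        proof (cases "u = x \<and> v = y")
          case True
          then show ?thesis unfolding O[OF uN v(1)] by auto
        next
          case False
          then have "u < x \<or> u = x \<and> v < y" using v by auto
          then show ?thesis unfolding O[OF uN v(1)] if_not_P[OF False] using J v(1) by blast
        qed
      qed
    next
      show "?P 0 (upd ''v'' 0 t)" using I by (simp add: oT_def fst_upd)
    qed simp
    then show "\<forall>u v. v < N \<longrightarrow> u < Suc x \<longrightarrow> (0 < oT N (upd ''u'' (Suc x) (run (LFor ''v'' ''N'' ?set) t)) 0 u v \<longleftrightarrow> u = v)"
      using xN by (simp add: oT_def fst_upd less_Suc_eq del: run.simps)
  qed simp_all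
  have h3: "\<forall>u<fst s2 ''N'' 0. hT N s3 0 u u = 0"
    unfolding s3_def
  proof (rule run_LFor_induct[where Inv="\<lambda>x t. \<forall>u<x. hT N t 0 u u = 0"])
    fix x and t :: state
    assume x: "x < fst s2 ''N'' 0" and I: "\<forall>u<x. hT N t 0 u u = 0" and tx: "fst t ''u'' 0 = x"
      and fi: "\<And>a. a \<notin> wi ?fill \<Longrightarrow> a \<noteq> ''u'' \<Longrightarrow> fst t a = fst s2 a"
    have "fst t ''N'' 0 = N" using N1 by (simp add: fi f2)
    then show "\<forall>u<Suc x. hT N (upd ''u'' (Suc x) (run ?fill t)) 0 u u = 0"
      using I tx by (auto simp: hT_def store_apply less_Suc_eq)
  qed simp_all
  have net3: "net s3" by (rule net_frame[OF s(1)]) (auto simp: f1 f2 f3 r1 r2 r3)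
  have N3: "fst s2 ''N'' 0 = N" "fst s3 ''N'' 0 = N" using N1 by (simp_all add: f2 f3)
  have o3: "oT N s3 = oT N s2" by (simp add: oT_def fun_eq_iff f3)
  have base: "base_ok (oT N s3) (hT N s3)"
    using o2 h3 N1 N3 unfolding o3 base_ok_def by simp
  have inv0: "search_inv {} r s3"
    using net3 base s(2) z1 by (simp add: search_inv_def best_ok_def f2 f3 r1 r2 r3)
  let ?Inv = "\<lambda>k t. search_inv {(k', u). k' < k \<and> u < N} r t \<and> snd t ''l'' 0 = real k"
  have "?Inv (fst s3 ''N'' 0) s4"
    unfolding s4_def
  proof (rule run_LFor_induct[where Inv="?Inv"])
    show "''k'' \<notin> wi (LSeq (LR ''l'' (INum 0) (RAdd (Rc ''l'') (RNum 1))) ?visits)" by (simp add: wi_wr_search)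
    have "{(k', u). k' < (0::nat) \<and> u < N} = {}" by auto
    then show "?Inv 0 (upd ''k'' 0 s3)" using search_inv_upd[OF inv0, of "''k''" 0] z1 by (simp add: r2 r3)
  next
    fix k and t :: state
    assume I: "?Inv k t" and tk: "fst t ''k'' 0 = k"
      and fi: "\<And>a. a \<notin> wi (LSeq (LR ''l'' (INum 0) (RAdd (Rc ''l'') (RNum 1))) ?visits) \<Longrightarrow> a \<noteq> ''k'' \<Longrightarrow> fst t a = fst s3 a"
    define t1 where "t1 = run (LR ''l'' (INum 0) (RAdd (Rc ''l'') (RNum 1))) t"
    have t1: "fst t1 = fst t" "snd t1 ''l'' 0 = real (Suc k)" "\<And>a. a \<noteq> ''l'' \<Longrightarrow> snd t1 a = snd t a"
      using I by (simp_all add: t1_def store_apply)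
    have inv1: "search_inv {(k', u). k' < k \<and> u < N} r t1"
      by (rule search_inv_frame[OF conjunct1[OF I]]) (auto simp: t1)
    have N': "fst t1 ''N'' 0 = N" using N3 by (simp add: t1 fi wi_wr_search)
    let ?J = "\<lambda>y t. search_inv ({(k', u). k' < k \<and> u < N} \<union> {(k', u). k' = k \<and> u < y}) r t"
    have "?J (fst t1 ''N'' 0) (run ?visits t1)"
    proof (rule run_LFor_induct[where Inv="?J"])
      show "''u'' \<notin> wi (LSeq prog_level prog_best)" by (simp add: wi_wr_search)
      show "?J 0 (upd ''u'' 0 t1)" using search_inv_upd[OF inv1, of "''u''" 0] by simp
    next
      fix y and t2 :: state
      assume y: "y < fst t1 ''N'' 0" and J: "?J y t2" and ty: "fst t2 ''u'' 0 = y"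
        and fi1: "\<And>a. a \<notin> wi (LSeq prog_level prog_best) \<Longrightarrow> a \<noteq> ''u'' \<Longrightarrow> fst t2 a = fst t1 a"
        and fr1: "\<And>a. a \<notin> wr (LSeq prog_level prog_best) \<Longrightarrow> snd t2 a = snd t1 a"
      have yN: "y < N" using y N' by simp
      have kl: "fst t2 ''k'' 0 = k" "snd t2 ''l'' 0 = real (Suc k)"
        using tk t1 by (simp_all add: fi1 fr1 wi_wr_search)
      have "search_inv (insert (k, y) ({(k', u). k' < k \<and> u < N} \<union> {(k', u). k' = k \<and> u < y})) r (run (LSeq prog_level prog_best) t2)"
        by (rule run_visit[OF J kl(1) ty kl(2) yN]) (use yN in auto)
      moreover have "insert (k, y) ({(k', u). k' < k \<and> u < N} \<union> {(k', u). k' = k \<and> u < y}) = {(k', u). k' < k \<and> u < N} \<union> {(k', u). k' = k \<and> u < Suc y}"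
        by auto
      ultimately show "?J (Suc y) (upd ''u'' (Suc y) (run (LSeq prog_level prog_best) t2))"
        using search_inv_upd by simp
    qed
    moreover have "{(k', u). k' < k \<and> u < N} \<union> {(k', u). k' = k \<and> u < N} = {(k', u). k' < Suc k \<and> u < N}" by auto
    ultimately have "search_inv {(k', u). k' < Suc k \<and> u < N} r (run ?visits t1)" by (simp only: N')
    moreover have "snd (run ?visits t1) ''l'' 0 = real (Suc k)"
      using run_frame(2)[of "''l''" ?visits t1] t1 by (simp add: wi_wr_search)
    moreover have "run (LSeq (LR ''l'' (INum 0) (RAdd (Rc ''l'') (RNum 1))) ?visits) t = run ?visits t1"
      by (simp only: run.simps(4) t1_def)
    ultimately show "?Inv (Suc k) (upd ''k'' (Suc k) (run (LSeq (LR ''l'' (INum 0) (RAdd (Rc ''l'') (RNum 1))) ?visits) t))"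
      using search_inv_upd by (simp only: snd_upd) blast
  qed
  then show ?thesis unfolding s4 using N3 by simp
qed

lemma run_extract:
  fixes s :: state
  assumes s: "net s" "fst s ''l'' 0 = l" "fst s ''s'' 0 = u" "l \<le> N"
  defines "Z \<equiv> fst (run prog_extract s) ''Z''"
  shows "trace src (bT N s) u l u = List.rev (map Z [0..<l])"
    and "0 < l \<Longrightarrow> snd (run prog_extract s) ''d'' 0 = Min (snd s ''R'' ` Z ` {..<l})"
proof -
  let ?R = "snd s ''R''"
  let ?upd = "LSeq (LI ''Z'' (Sc ''h'') (IGet ''B'' (IX (ISub (Sc ''l'') (Sc ''h'')) (Sc ''s'') (Sc ''z''))))
       (LSeq (LIf (BAnd (ILess (INum 0) (Sc ''h'')) (BNot (RLess (RGet ''R'' (IGet ''Z'' (Sc ''h''))) (Rc ''d'')))) LSkip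
            (LR ''d'' (INum 0) (RGet ''R'' (IGet ''Z'' (Sc ''h'')))))
         (LI ''z'' (INum 0) (IGet ''X'' (IGet ''Z'' (Sc ''h'')))))"
  let ?body = "LIf (ILess (Sc ''h'') (Sc ''l'')) ?upd LSkip"
  define s1 where "s1 = run (LI ''z'' (INum 0) (Sc ''s'')) s"
  have f1: "fst s1 a = fst s a" if "a \<noteq> ''z''" for a using that by (simp add: s1_def store_apply)
  have z1: "fst s1 ''z'' 0 = u" "snd s1 = snd s" using s by (simp_all add: s1_def store_apply)
  \<comment> \<open>The part of the cycle still to be read, followed by the arcs stored so far in
    reverse; iterations from l on change nothing, hence \<open>min y l\<close>.\<close>
  let ?P = "\<lambda>y t. trace src (bT N s) u l u = trace src (bT N s) u (l - y) (fst t ''z'' 0) @ List.rev (map (fst t ''Z'') [0..<min y l]) \<and>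
     (0 < y \<longrightarrow> 0 < l \<longrightarrow> snd t ''d'' 0 = Min (?R ` fst t ''Z'' ` {..<min y l}))"
  have "?P (fst s1 ''N'' 0) (run (LFor ''h'' ''N'' ?body) s1)"
  proof (rule run_LFor_induct[where Inv="?P"])
    show "?P 0 (upd ''h'' 0 s1)" using z1 by (simp add: fst_upd)
  next
    fix y and t :: state
    assume I: "?P y t" and ty: "fst t ''h'' 0 = y"
      and fi: "\<And>a. a \<notin> wi ?body \<Longrightarrow> a \<noteq> ''h'' \<Longrightarrow> fst t a = fst s1 a"
      and fr: "\<And>a. a \<notin> wr ?body \<Longrightarrow> snd t a = snd s1 a"
    have c: "fst t ''N'' 0 = N" "fst t ''l'' 0 = l" "fst t ''s'' 0 = u" "fst t ''B'' = fst s ''B''" "fst t ''X'' = src" "snd t ''R'' = ?R"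
      using s by (simp_all add: fi fr f1 z1 net_def)
    show "?P (Suc y) (upd ''h'' (Suc y) (run ?body t))"
    proof (cases "y < l")
      case False
      then have "run ?body t = t" using ty c by simp
      then show ?thesis using I False by (auto simp: fst_upd min_def)
    next
      case True
      let ?e = "bT N s (l - y) u (fst t ''z'' 0)"
      define t1 where "t1 = run (LI ''Z'' (Sc ''h'') (IGet ''B'' (IX (ISub (Sc ''l'') (Sc ''h'')) (Sc ''s'') (Sc ''z'')))) t"
      have t1: "t1 = (store (fst t) ''Z'' y ?e, snd t)" by (simp add: t1_def ty c bT_def)
      define t2 where "t2 = run ?upd t"
      have t2: "t2 = (store (fst t1) ''z'' 0 (src ?e), if 0 < y \<and> \<not> ?R ?e < snd t ''d'' 0 then snd t else store (snd t) ''d'' 0 (?R ?e))"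
        unfolding t2_def run.simps(4) t1_def[symmetric]
        by (cases "0 < y \<and> \<not> ?R ?e < snd t ''d'' 0") (auto simp: t1 store_apply ty c cong: if_cong)
      have Z2: "fst t2 ''Z'' = (fst t ''Z'')(y := ?e)" "fst t2 ''z'' 0 = src ?e"
        by (simp_all add: t2 t1 store_apply)
      have d2: "snd t2 ''d'' 0 = (if 0 < y then min (?R ?e) (snd t ''d'' 0) else ?R ?e)"
        by (simp add: t2 store_apply min_def)
      have my: "min y l = y" "min (Suc y) l = Suc y" using True by auto
      have ly: "l - y = Suc (l - Suc y)" using True by simp
      have "trace src (bT N s) u (l - y) (fst t ''z'' 0) = trace src (bT N s) u (l - Suc y) (src ?e) @ [?e]"
        unfolding ly by simp
      moreover have "map ((fst t ''Z'')(y := ?e)) [0..<y] = map (fst t ''Z'') [0..<y]" by simp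
      ultimately have A: "trace src (bT N s) u l u = trace src (bT N s) u (l - Suc y) (fst t2 ''z'' 0) @ List.rev (map (fst t2 ''Z'') [0..<min (Suc y) l])"
        using I unfolding my Z2 by simp
      have im: "?R ` fst t2 ''Z'' ` {..<Suc y} = insert (?R ?e) (?R ` fst t ''Z'' ` {..<y})"
        unfolding Z2 lessThan_Suc by auto
      have B: "snd t2 ''d'' 0 = Min (?R ` fst t2 ''Z'' ` {..<min (Suc y) l})"
      proof (cases "0 < y")
        case True
        then have "snd t ''d'' 0 = Min (?R ` fst t ''Z'' ` {..<y})" using I \<open>y < l\<close> my by simp
        moreover have "?R ` fst t ''Z'' ` {..<y} \<noteq> {}" using True by auto
        ultimately show ?thesis unfolding my im d2 using True by (simp add: Min_insert)
      next
        case False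
        then show ?thesis unfolding my im d2 by simp
      qed
      have "run ?body t = t2" using True ty c by (simp add: t2_def del: run.simps(4))
      then show ?thesis using A B by (simp add: fst_upd)
    qed
  qed simp
  moreover have "fst s1 ''N'' 0 = N" using s by (simp add: f1 net_def)
  moreover have "run (LFor ''h'' ''N'' ?body) s1 = run prog_extract s"
    by (simp only: prog_extract_def s1_def run.simps(4))
  ultimately show "trace src (bT N s) u l u = List.rev (map Z [0..<l])"
    "0 < l \<Longrightarrow> snd (run prog_extract s) ''d'' 0 = Min (?R ` Z ` {..<l})"
    using s(4) unfolding Z_def by (simp_all add: min_absorb2)
qed

text \<open>\<open>Z\<close> lists each arc once and reversal is injective on arcs, so the
  successive updates amount to the simultaneous change by \<open>push\<close>.\<close>

lemma run_push:
  fixes s :: state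
  assumes s: "net s" "fst s ''l'' 0 = l" "l \<le> N"
  defines "Z \<equiv> fst s ''Z''" and "d \<equiv> snd s ''d'' 0"
  assumes Z: "\<And>i. i < l \<Longrightarrow> Z i < A" "inj_on Z {..<l}"
  shows "snd (run prog_push s) ''R'' e =
    snd s ''R'' e - (if e \<in> Z ` {..<l} then d else 0) + (if e \<in> rev ` Z ` {..<l} then d else 0)"
proof -
  let ?R = "snd s ''R''"
  let ?upd = "LSeq (LR ''R'' (IGet ''Z'' (Sc ''h'')) (RSub (RGet ''R'' (IGet ''Z'' (Sc ''h''))) (Rc ''d'')))
       (LR ''R'' (IGet ''V'' (IGet ''Z'' (Sc ''h''))) (RAdd (RGet ''R'' (IGet ''V'' (IGet ''Z'' (Sc ''h'')))) (Rc ''d'')))"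
  let ?body = "LIf (ILess (Sc ''h'') (Sc ''l'')) ?upd LSkip"
  have rev_inj: "rev (Z i) = rev (Z j) \<longleftrightarrow> i = j" if "i < l" "j < l" for i j
  proof
    assume "rev (Z i) = rev (Z j)"
    then have "rev (rev (Z i)) = rev (rev (Z j))" by simp
    then have "Z i = Z j" using rev_rev[of "Z i"] rev_rev[of "Z j"] Z(1)[OF that(1)] Z(1)[OF that(2)] by simp
    then show "i = j" using inj_onD[OF Z(2), of i j] that by simp
  qed simp
  have Z_inj: "Z i = Z j \<longleftrightarrow> i = j" if "i < l" "j < l" for i j
    using inj_onD[OF Z(2), of i j] that by auto
  let ?P = "\<lambda>y t. \<forall>e. snd t ''R'' e = ?R e - (if e \<in> Z ` {..<min y l} then d else 0) + (if e \<in> rev ` Z ` {..<min y l} then d else 0)"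
  have "?P (fst s ''N'' 0) (run prog_push s)"
    unfolding prog_push_def
  proof (rule run_LFor_induct[where Inv="?P"])
    show "?P 0 (upd ''h'' 0 s)" by simp
  next
    fix y and t :: state
    assume I: "?P y t" and ty: "fst t ''h'' 0 = y"
      and fi: "\<And>a. a \<notin> wi ?body \<Longrightarrow> a \<noteq> ''h'' \<Longrightarrow> fst t a = fst s a"
      and fr: "\<And>a. a \<notin> wr ?body \<Longrightarrow> snd t a = snd s a"
    have c: "fst t ''l'' 0 = l" "fst t ''Z'' = Z" "fst t ''V'' = fst s ''V''" "snd t ''d'' 0 = d"
      using s by (simp_all add: fi fr Z_def d_def)
    show "?P (Suc y) (upd ''h'' (Suc y) (run ?body t))"
    proof (cases "y < l")
      case False
      then have "run ?body t = t" using ty c by simp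
      then show ?thesis using I False by (simp add: min_def)
    next
      case True
      have V: "fst s ''V'' (Z y) = rev (Z y)" using s(1) Z(1)[OF True] by (simp add: net_def)
      have my: "min y l = y" "min (Suc y) l = Suc y" using True by auto
      have R: "snd (run ?body t) ''R'' e = snd t ''R'' e - (if e = Z y then d else 0) + (if e = rev (Z y) then d else 0)" for e
        using True by (simp add: ty c V store_apply)
      have "Z y \<notin> Z ` {..<y}"
      proof
        assume "Z y \<in> Z ` {..<y}"
        then obtain i where "i < y" "Z y = Z i" by auto
        then show False using Z_inj[of y i] True by simp
      qed
      moreover have "rev (Z y) \<notin> rev ` Z ` {..<y}"
      proof
        assume "rev (Z y) \<in> rev ` Z ` {..<y}"
        then obtain i where "i < y" "rev (Z y) = rev (Z i)" by auto
        then show False using rev_inj[of y i] True by simp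
      qed
      moreover have "Z ` {..<Suc y} = insert (Z y) (Z ` {..<y})" "rev ` Z ` {..<Suc y} = insert (rev (Z y)) (rev ` Z ` {..<y})"
        unfolding lessThan_Suc by simp_all
      ultimately show ?thesis
        using I unfolding my by (simp only: snd_upd R) auto
    qed
  qed simp
  moreover have "fst s ''N'' 0 = N" using s by (simp add: net_def)
  ultimately show ?thesis using s(3) by (simp add: min_absorb2)
qed

text \<open>If no negative closed walk is found, the length is 0 and the push loop changes no
  residual value; surplus rounds are therefore harmless.\<close>

lemma run_round:
  fixes s :: state
  assumes s: "net s" "snd s ''R'' = r"
  defines "s' \<equiv> run prog_round s"
  shows "net s'" and "mean_ge 0 r \<and> snd s' ''R'' = r \<or> (\<exists>es. min_mean_cycle r es \<and> snd s' ''R'' = push es r)"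
proof -
  define s1 where "s1 = run prog_search s"
  define s2 where "s2 = run prog_extract s1"
  have s': "s' = run prog_push s2" by (simp only: s'_def prog_round_def run.simps s1_def s2_def)
  have inv: "search_inv {(k, u). k < N \<and> u < N} r s1" unfolding s1_def by (rule run_search[OF s])
  then have n1: "net s1" "snd s1 ''R'' = r" by (simp_all add: search_inv_def)
  have f2: "fst s2 a = fst s1 a" if "a \<notin> {''z'', ''h'', ''Z''}" for a
    unfolding s2_def by (rule run_frame) (use that in \<open>simp add: wi_wr_round\<close>)
  have r2: "snd s2 a = snd s1 a" if "a \<noteq> ''d''" for a
    unfolding s2_def by (rule run_frame) (use that in \<open>simp add: wi_wr_round\<close>)
  have n2: "net s2" by (rule net_frame[OF n1(1)]) (auto simp: f2 r2)
  have f3: "fst s' a = fst s2 a" if "a \<noteq> ''h''" for a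
    unfolding s' by (rule run_frame) (use that in \<open>simp add: wi_wr_round\<close>)
  have r3: "snd s' a = snd s2 a" if "a \<noteq> ''R''" for a
    unfolding s' by (rule run_frame) (use that in \<open>simp add: wi_wr_round\<close>)
  show "net s'" by (rule net_frame[OF n2]) (auto simp: f3 r3)
  let ?l = "fst s1 ''l'' 0" and ?u = "fst s1 ''s'' 0"
  have lev: "level_ok r (oT N s1) (hT N s1) (bT N s1) k u" if "k < N" "u < N" for k u
    using inv that unfolding search_inv_def by blast
  have base: "base_ok (oT N s1) (hT N s1)" and best: "best_ok {(k, u). k < N \<and> u < N} (oT N s1) (hT N s1) ?l ?u (snd s1 ''b'' 0)"
    using inv unfolding search_inv_def by blast+
  note fin = best_ok_final[OF base lev best]
  show "mean_ge 0 r \<and> snd s' ''R'' = r \<or> (\<exists>es. min_mean_cycle r es \<and> snd s' ''R'' = push es r)"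
  proof (cases "?l = 0")
    case True
    have "snd s' ''R'' e = r e" for e
      using run_push[OF n2, of 0 e] True n1(2) unfolding s' by (simp add: f2 r2)
    then show ?thesis using fin(1) True by auto
  next
    case False
    let ?es = "trace src (bT N s1) ?u ?l ?u"
    have mc: "?l \<le> N" "min_mean_cycle r ?es" using fin(2) False by auto
    define Z where "Z = fst s2 ''Z''"
    have tr: "?es = List.rev (map Z [0..<?l])" and d: "snd s2 ''d'' 0 = Min (r ` Z ` {..<?l})"
      using run_extract[OF n1(1) refl refl mc(1)] False n1(2) unfolding Z_def s2_def by simp_all
    have set: "set ?es = Z ` {..<?l}" unfolding tr by auto
    have "distinct (map Z [0..<?l])" using min_mean_cycle_distinct[OF mc(2)] unfolding tr by simp
    then have inj: "inj_on Z {..<?l}" by (simp add: distinct_map atLeast0LessThan)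
    have esA: "set ?es \<subseteq> {..<A}"
      using min_mean_cycle_mean(4)[OF mc(2)] closed_subset res_A by blast
    then have ZA: "Z i < A" if "i < ?l" for i using that unfolding set by auto
    have "snd s' ''R'' = push ?es r"
    proof
      fix e
      have "e \<in> rev ` set ?es \<longleftrightarrow> rev e \<in> set ?es"
      proof
        assume "e \<in> rev ` set ?es"
        then show "rev e \<in> set ?es" using esA rev_rev by fastforce
      next
        assume h: "rev e \<in> set ?es"
        have "e < A"
        proof (rule ccontr)
          assume "\<not> e < A"
          then have "rev e = e" using rev_out by simp
          then show False using h esA \<open>\<not> e < A\<close> by auto
        qed
        then show "e \<in> rev ` set ?es" using h rev_rev[of e] by (metis image_eqI lessThan_iff)
      qed
      then show "snd s' ''R'' e = push ?es r e"
        using run_push[OF n2 _ mc(1), of e] ZA inj d unfolding s' push_def Z_def[symmetric] set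
        by (simp add: f2 r2 n1(2))
    qed
    then show ?thesis using mc(2) by blast
  qed
qed

text \<open>\<open>T\<close> exceeds the bound of \<open>length_bound\<close> by one. If every round
  cancelled a cycle, the chain of cancellations would be too long; so some round finds none, and
  from then on the residual values stay the same.\<close>

lemma run_rounds:
  fixes s :: state
  assumes s: "net s" "\<And>e. e < A \<Longrightarrow> 0 \<le> snd s ''R'' e"
    and L: "1 \<le> L" "A \<le> L" "N \<le> L" and T: "fst s ''T'' 0 = Suc ((L + 1) * (2 * L * L * L))"
  defines "s' \<equiv> run (LFor ''t'' ''T'' prog_round) s"
  shows "net s'" "mean_ge 0 (snd s' ''R'')" "\<And>e. e < A \<Longrightarrow> 0 \<le> snd s' ''R'' e"
    "circulation (\<lambda>e. snd s' ''R'' e - snd s ''R'' e)"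
proof -
  define chain where "chain = (\<lambda>j r. \<exists>rr es. rr 0 = snd s ''R'' \<and> rr j = r \<and>
     (\<forall>t<j. min_mean_cycle (rr t) (es t) \<and> rr (Suc t) = push (es t) (rr t)))"
  have chain_Suc: "chain (Suc j) (push e r)" if ch: "chain j r" and e: "min_mean_cycle r e" for j r e
  proof -
    obtain rr es where "rr 0 = snd s ''R''" "rr j = r" "\<forall>t<j. min_mean_cycle (rr t) (es t) \<and> rr (Suc t) = push (es t) (rr t)"
      using ch unfolding chain_def by blast
    then show ?thesis
      unfolding chain_def using e
      by (intro exI[of _ "rr(Suc j := push e r)"] exI[of _ "es(j := e)"]) (auto simp: less_Suc_eq)
  qed
  have bound: "j \<le> (L + 1) * (2 * L * L * L) \<and> (\<forall>e<A. 0 \<le> r e) \<and> circulation (\<lambda>e. r e - snd s ''R'' e)" if ch: "chain j r" for j r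
  proof -
    obtain rr es where rr: "rr 0 = snd s ''R''" "rr j = r" "\<forall>t<j. min_mean_cycle (rr t) (es t) \<and> rr (Suc t) = push (es t) (rr t)"
      using ch unfolding chain_def by blast
    interpret cancelling "{..<A}" "{..<N}" src tgt rev cost L j rr es
      by unfold_locales (use L rr s(2) in auto)
    show ?thesis using length_bound nonneg[of j] circulation_diff[of j] rr(1,2) by simp
  qed
  have no: False if "mean_ge 0 r" "min_mean_cycle r es" for r es
    using that unfolding mean_ge_def min_mean_cycle_def by force
  let ?P = "\<lambda>k t. net t \<and> (\<exists>j. chain j (snd t ''R'') \<and> (j = k \<or> mean_ge 0 (snd t ''R'')))"
  have "?P (fst s ''T'' 0) s'"
    unfolding s'_def
  proof (rule run_LFor_induct[where Inv="?P"])
    show "''t'' \<notin> wi prog_round" by (simp add: prog_round_def wi_wr_round)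
    have "net (upd ''t'' 0 s)" by (rule net_frame[OF s(1)]) (auto simp: fst_upd)
    moreover have "chain 0 (snd s ''R'')" unfolding chain_def by (intro exI[of _ "\<lambda>_. snd s ''R''"]) simp
    ultimately show "?P 0 (upd ''t'' 0 s)" by auto
  next
    fix k and t :: state
    assume I: "?P k t"
    then obtain j where j: "net t" "chain j (snd t ''R'')" "j = k \<or> mean_ge 0 (snd t ''R'')" by blast
    note R = run_round[OF j(1) refl]
    have net': "net (upd ''t'' (Suc k) (run prog_round t))"
      by (rule net_frame[OF R(1)]) (auto simp: fst_upd)
    from R(2) have "\<exists>j. chain j (snd (run prog_round t) ''R'') \<and> (j = Suc k \<or> mean_ge 0 (snd (run prog_round t) ''R''))"
    proof (elim disjE conjE exE)
      assume "mean_ge 0 (snd t ''R'')" "snd (run prog_round t) ''R'' = snd t ''R''"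
      then show ?thesis using j(2) by auto
    next
      fix es assume es: "min_mean_cycle (snd t ''R'') es" "snd (run prog_round t) ''R'' = push es (snd t ''R'')"
      then have "j = k" using j(3) no by blast
      then show ?thesis using chain_Suc[OF j(2) es(1)] es(2) by auto
    qed
    then show "?P (Suc k) (upd ''t'' (Suc k) (run prog_round t))" using net' by simp
  qed
  then obtain j where j: "net s'" "chain j (snd s' ''R'')" "j = Suc ((L + 1) * (2 * L * L * L)) \<or> mean_ge 0 (snd s' ''R'')"
    unfolding T by blast
  from bound[OF j(2)] j(3) show "mean_ge 0 (snd s' ''R'')" "\<And>e. e < A \<Longrightarrow> 0 \<le> snd s' ''R'' e"
    "circulation (\<lambda>e. snd s' ''R'' e - snd s ''R'' e)"
    by auto
  show "net s'" by fact
qed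

end

section \<open>Potentials and duality\<close>

text \<open>Every level of \<open>F\<close> is stored separately and starts as a copy of the
  previous one, so relaxation uses only values of the finished level, as \<open>bf\<close>
  prescribes.\<close>

definition prog_copy :: loop where
  "prog_copy = LFor ''v'' ''N'' (LR ''F'' (IAdd (IMul (IAdd (Sc ''k'') (INum 1)) (Sc ''N'')) (Sc ''v''))
     (RGet ''F'' (IAdd (IMul (Sc ''k'') (Sc ''N'')) (Sc ''v''))))"

abbreviation (input) "HEAD \<equiv> IAdd (IMul (IAdd (Sc ''k'') (INum 1)) (Sc ''N'')) (IGet ''Y'' (Sc ''e''))"
abbreviation (input) "VIA \<equiv> RAdd (RGet ''F'' (IAdd (IMul (Sc ''k'') (Sc ''N'')) (IGet ''X'' (Sc ''e'')))) (RGet ''G'' (Sc ''e''))"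

definition prog_improve :: loop where
  "prog_improve = LIf (BAnd (RLess (RNum 0) (RGet ''R'' (Sc ''e''))) (RLess VIA (RGet ''F'' HEAD))) (LR ''F'' HEAD VIA) LSkip"

definition prog_potentials :: loop where
  "prog_potentials = LSeq (LFor ''v'' ''N'' (LR ''F'' (Sc ''v'') (RNum 0)))
     (LFor ''k'' ''N'' (LSeq prog_copy (LFor ''e'' ''A'' prog_improve)))"

definition FN :: "iexp \<Rightarrow> rexp" where
  "FN v = RGet ''F'' (IAdd (IMul (Sc ''N'') (Sc ''N'')) v)"

text \<open>The potential is normalised to 0 at the outer vertex, and multiplication by
  \<open>S\<close> undoes the column flips.\<close>

definition prog_output :: loop where
  "prog_output = LSeq
     (LFor ''j'' ''n'' (LR ''y'' (Sc ''j'') (RMul (RGet ''S'' (Sc ''j'')) (RSub (FN (Sc ''j'')) (FN (Sc ''n''))))))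
     (LFor ''i'' ''m'' (LR ''x'' (Sc ''i'') (RAdd (RGet ''c'' (Sc ''i''))
        (RSub (FN (IGet ''X'' (Sc ''i''))) (FN (IGet ''Y'' (Sc ''i'')))))))"

lemma wi_wr_potentials:
  "wi prog_copy = {''v''}" "wr prog_copy = {''F''}" "wi prog_improve = {}" "wr prog_improve = {''F''}"
  "wi prog_potentials = {''v'', ''k'', ''e''}" "wr prog_potentials = {''F''}"
  by (auto simp: prog_copy_def prog_improve_def prog_potentials_def)

context nat_network
begin

abbreviation pot :: "(nat \<Rightarrow> real) \<Rightarrow> nat \<Rightarrow> nat \<Rightarrow> real" where
  "pot r \<equiv> bf src tgt (res r) cost"

text \<open>The value at v on level k + 1 after the arcs below y have been relaxed.\<close>

definition partial :: "(nat \<Rightarrow> real) \<Rightarrow> nat \<Rightarrow> nat \<Rightarrow> nat \<Rightarrow> real" where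
  "partial r k y v = Min (insert (pot r k v) ((\<lambda>e. pot r k (src e) + cost e) ` {e\<in>res r. tgt e = v \<and> e < y}))"

lemma partial_0: "partial r k 0 v = pot r k v"
  by (simp add: partial_def)

lemma partial_A: "partial r k A v = pot r (Suc k) v"
proof -
  have "{e\<in>res r. tgt e = v \<and> e < A} = {e\<in>res r. tgt e = v}" by (auto simp: res_iff)
  then show ?thesis by (simp add: partial_def)
qed

lemma partial_Suc:
  "partial r k (Suc e) v = (if e \<in> res r \<and> tgt e = v then min (pot r k (src e) + cost e) (partial r k e v) else partial r k e v)"
proof -
  let ?S = "\<lambda>y. {a\<in>res r. tgt a = v \<and> a < y}"
  let ?g = "\<lambda>a. pot r k (src a) + cost a"
  show ?thesis
  proof (cases "e \<in> res r \<and> tgt e = v")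
    case True
    then have "?S (Suc e) = insert e (?S e)" by auto
    then have "insert (pot r k v) (?g ` ?S (Suc e)) = insert (?g e) (insert (pot r k v) (?g ` ?S e))" by auto
    moreover have "finite (insert (pot r k v) (?g ` ?S e))" using fin_res by simp
    ultimately show ?thesis using True by (simp add: partial_def Min_insert)
  next
    case False
    then have "?S (Suc e) = ?S e" by (auto simp: less_Suc_eq)
    then show ?thesis unfolding if_not_P[OF False] partial_def by simp
  qed
qed

lemma run_copy:
  assumes s: "fst s ''N'' 0 = N" "fst s ''k'' 0 = k"
  shows "v < N \<Longrightarrow> snd (run prog_copy s) ''F'' (j * N + v) = (if j = Suc k then snd s ''F'' (k * N + v) else snd s ''F'' (j * N + v))"
proof -
  let ?body = "LR ''F'' (IAdd (IMul (IAdd (Sc ''k'') (INum 1)) (Sc ''N'')) (Sc ''v'')) (RGet ''F'' (IAdd (IMul (Sc ''k'') (Sc ''N'')) (Sc ''v'')))"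
  let ?P = "\<lambda>y t. \<forall>j v. v < N \<longrightarrow> snd t ''F'' (j * N + v) = (if j = Suc k \<and> v < y then snd s ''F'' (k * N + v) else snd s ''F'' (j * N + v))"
  have "?P (fst s ''N'' 0) (run prog_copy s)"
    unfolding prog_copy_def
  proof (rule run_LFor_induct[where Inv="?P"])
    fix y and t :: state
    assume y: "y < fst s ''N'' 0" and I: "?P y t" and ty: "fst t ''v'' 0 = y"
      and fi: "\<And>a. a \<notin> wi ?body \<Longrightarrow> a \<noteq> ''v'' \<Longrightarrow> fst t a = fst s a"
    have c: "fst t ''N'' 0 = N" "fst t ''k'' 0 = k" "y < N" using s y by (simp_all add: fi)
    have F: "snd (run ?body t) ''F'' = (snd t ''F'')(Suc k * N + y := snd t ''F'' (k * N + y))"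
      by (simp add: store_apply c ty del: mult_Suc)
    have Fk: "snd t ''F'' (k * N + y) = snd s ''F'' (k * N + y)" using I c(3) by simp
    show "?P (Suc y) (upd ''v'' (Suc y) (run ?body t))"
      unfolding snd_upd F Fk
    proof (intro allI impI)
      fix j v assume v: "v < N"
      show "((snd t ''F'')(Suc k * N + y := snd s ''F'' (k * N + y))) (j * N + v) =
          (if j = Suc k \<and> v < Suc y then snd s ''F'' (k * N + v) else snd s ''F'' (j * N + v))"
        using index_eq_iff[OF v c(3), of j "Suc k"] I v by (auto simp: less_Suc_eq simp del: mult_Suc)
    qed
  qed simp_all
  then show "v < N \<Longrightarrow> ?thesis" using s by simp
qed

lemma run_potentials:
  assumes s: "net s" "snd s ''R'' = r"
  shows "v < N \<Longrightarrow> snd (run prog_potentials s) ''F'' (N * N + v) = pot r N v"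
proof -
  let ?zero = "LR ''F'' (Sc ''v'') (RNum 0)"
  define s1 where "s1 = run (LFor ''v'' ''N'' ?zero) s"
  have f1: "fst s1 a = fst s a" if "a \<noteq> ''v''" for a unfolding s1_def by (rule run_frame) (use that in simp)
  have r1: "snd s1 a = snd s a" if "a \<noteq> ''F''" for a unfolding s1_def by (rule run_frame) (use that in simp)
  have N1: "fst s ''N'' 0 = N" "fst s1 ''N'' 0 = N" using s(1) by (simp_all add: f1 net_def)
  have z: "\<forall>v<fst s ''N'' 0. snd s1 ''F'' v = 0"
    unfolding s1_def
    by (rule run_LFor_induct[where Inv="\<lambda>x t. \<forall>v<x. snd t ''F'' v = 0"]) (auto simp: store_apply less_Suc_eq)
  have net1: "net s1" by (rule net_frame[OF s(1)]) (auto simp: f1 r1)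
  let ?body = "LSeq prog_copy (LFor ''e'' ''A'' prog_improve)"
  let ?P = "\<lambda>k t. \<forall>j\<le>k. \<forall>v<N. snd t ''F'' (j * N + v) = pot r j v"
  have "?P (fst s1 ''N'' 0) (run (LFor ''k'' ''N'' ?body) s1)"
  proof (rule run_LFor_induct[where Inv="?P"])
    show "''k'' \<notin> wi ?body" by (simp add: wi_wr_potentials)
    show "?P 0 (upd ''k'' 0 s1)" using z N1 by simp
  next
    fix k and t :: state
    assume I: "?P k t" and tk: "fst t ''k'' 0 = k"
      and fi: "\<And>a. a \<notin> wi ?body \<Longrightarrow> a \<noteq> ''k'' \<Longrightarrow> fst t a = fst s1 a"
      and fr: "\<And>a. a \<notin> wr ?body \<Longrightarrow> snd t a = snd s1 a"
    define t1 where "t1 = run prog_copy t"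
    have tN: "fst t ''N'' 0 = N" using N1 by (simp add: fi wi_wr_potentials)
    have ft1: "fst t1 a = fst t a" if "a \<noteq> ''v''" for a
      unfolding t1_def by (rule run_frame) (use that in \<open>simp add: wi_wr_potentials\<close>)
    have rt1: "snd t1 a = snd t a" if "a \<noteq> ''F''" for a
      unfolding t1_def by (rule run_frame) (use that in \<open>simp add: wi_wr_potentials\<close>)
    have F1: "snd t1 ''F'' (j * N + v) = (if j = Suc k then pot r k v else snd t ''F'' (j * N + v))" if "v < N" for j v
      using run_copy[OF tN tk that, of j] I that unfolding t1_def by auto
    let ?Q = "\<lambda>y t2. \<forall>j v. v < N \<longrightarrow> snd t2 ''F'' (j * N + v) = (if j = Suc k then partial r k y v else snd t ''F'' (j * N + v))"
    define t3 where "t3 = run (LFor ''e'' ''A'' prog_improve) t1"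
    have "?Q (fst t1 ''A'' 0) t3"
      unfolding t3_def
    proof (rule run_LFor_induct[where Inv="?Q"])
      show "''e'' \<notin> wi prog_improve" by (simp add: wi_wr_potentials)
      show "?Q 0 (upd ''e'' 0 t1)" using F1 by (simp add: partial_0)
    next
      fix y and t2 :: state
      assume y: "y < fst t1 ''A'' 0" and J: "?Q y t2" and ty: "fst t2 ''e'' 0 = y"
        and fi2: "\<And>a. a \<notin> wi prog_improve \<Longrightarrow> a \<noteq> ''e'' \<Longrightarrow> fst t2 a = fst t1 a"
        and fr2: "\<And>a. a \<notin> wr prog_improve \<Longrightarrow> snd t2 a = snd t1 a"
      have net2: "fst t2 ''N'' 0 = N" "fst t2 ''k'' 0 = k" "fst t2 ''X'' = src" "fst t2 ''Y'' = tgt" "snd t2 ''G'' = cost" "snd t2 ''R'' = r"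
        "fst t1 ''A'' 0 = A"
        using net1 s(2) tk by (simp_all add: fi fr fi2 fr2 ft1 rt1 r1 wi_wr_potentials net_def)
      have yA: "y < A" using y net2 by simp
      have ST: "src y < N" "tgt y < N" using src_V[of y] tgt_V[of y] yA by auto
      have Fs: "snd t2 ''F'' (k * N + src y) = pot r k (src y)" using J I ST by simp
      have Ft: "snd t2 ''F'' (Suc k * N + tgt y) = partial r k y (tgt y)" using J ST by (simp del: mult_Suc)
      let ?c = "y \<in> res r \<and> pot r k (src y) + cost y < partial r k y (tgt y)"
      have b: "bval (BAnd (RLess (RNum 0) (RGet ''R'' (Sc ''e''))) (RLess VIA (RGet ''F'' HEAD))) t2 \<longleftrightarrow> ?c"
        using Fs Ft yA by (simp add: ty net2 res_iff del: mult_Suc)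
      have F: "snd (run prog_improve t2) ''F'' = (if ?c then (snd t2 ''F'')(Suc k * N + tgt y := pot r k (src y) + cost y) else snd t2 ''F'')"
        unfolding prog_improve_def run.simps b using Fs by (simp add: store_apply ty net2 del: mult_Suc)
      show "?Q (Suc y) (upd ''e'' (Suc y) (run prog_improve t2))"
      proof (intro allI impI)
        fix j v assume v: "v < N"
        note ix = index_eq_iff[OF v ST(2), of j "Suc k"]
        show "snd (upd ''e'' (Suc y) (run prog_improve t2)) ''F'' (j * N + v) = (if j = Suc k then partial r k (Suc y) v else snd t ''F'' (j * N + v))"
        proof (cases "j = Suc k \<and> v = tgt y")
          case True
          then have jv: "j * N + v = Suc k * N + tgt y" by simp
          show ?thesis
            using True Ft unfolding snd_upd F jv by (auto simp: partial_Suc min_def simp del: mult_Suc)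
        next
          case False
          then have ne: "j * N + v \<noteq> Suc k * N + tgt y" using ix by simp
          have "snd (run prog_improve t2) ''F'' (j * N + v) = snd t2 ''F'' (j * N + v)"
            unfolding F using ne by (simp del: mult_Suc)
          moreover have "j = Suc k \<Longrightarrow> partial r k (Suc y) v = partial r k y v" using False by (auto simp: partial_Suc)
          ultimately show ?thesis using J v by simp
        qed
      qed
    qed
    moreover have "fst t1 ''A'' 0 = A" using net1 by (simp add: ft1 fi wi_wr_potentials net_def)
    ultimately have Q: "?Q A t3" by simp
    have "run ?body t = t3" by (simp only: run.simps(4) t1_def t3_def)
    then show "?P (Suc k) (upd ''k'' (Suc k) (run ?body t))"
      using Q I by (auto simp: partial_A le_Suc_eq simp del: mult_Suc bf.simps)
  qed
  moreover have "run prog_potentials s = run (LFor ''k'' ''N'' ?body) s1" by (simp only: prog_potentials_def run.simps(4) s1_def)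
  ultimately show "v < N \<Longrightarrow> ?thesis" using N1 by simp
qed

text \<open>Potentials are minima of sums of costs; the real capacities only decide which arcs take
  part.\<close>

lemma pot_Ints:
  assumes "\<And>e. e < A \<Longrightarrow> cost e \<in> \<int>"
  shows "pot r k v \<in> \<int>"
proof (induction k arbitrary: v)
  case (Suc k)
  let ?S = "insert (pot r k v) ((\<lambda>e. pot r k (src e) + cost e) ` {e\<in>res r. tgt e = v})"
  have "Min ?S \<in> ?S" using fin_res by (intro Min_in) auto
  moreover have "?S \<subseteq> \<int>" using Suc assms by (auto simp: res_iff)
  ultimately show ?case by auto
qed simp

text \<open>Grouped by source, the sum consists of \<open>z\<close> at each vertex times its net
  outflow.\<close>

lemma circulation_orthogonal:
  assumes "circulation h"
  shows "(\<Sum>e<A. h e * z (src e)) = 0"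
proof -
  have "(\<Sum>v<N. \<Sum>e | e \<in> {..<A} \<and> src e = v. h e * z (src e)) = (\<Sum>e<A. h e * z (src e))"
    using src_V by (intro sum.group) auto
  moreover have "(\<Sum>e | e \<in> {..<A} \<and> src e = v. h e * z (src e)) = 0" if "v < N" for v
  proof -
    have "(\<Sum>e | e \<in> {..<A} \<and> src e = v. h e * z (src e)) = (\<Sum>e | e \<in> {..<A} \<and> src e = v. h e) * z v"
      unfolding sum_distrib_right by (intro sum.cong) auto
    then show ?thesis using assms that by (simp add: circulation_def)
  qed
  ultimately show ?thesis by simp
qed

end

lemma run_output:
  fixes s :: state
  defines "s' \<equiv> run prog_output s" and "F \<equiv> \<lambda>v. snd s ''F'' (fst s ''N'' 0 * fst s ''N'' 0 + v)"
  shows "j < fst s ''n'' 0 \<Longrightarrow> snd s' ''y'' j = snd s ''S'' j * (F j - F (fst s ''n'' 0))"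
    and "i < fst s ''m'' 0 \<Longrightarrow> snd s' ''x'' i = snd s ''c'' i + (F (fst s ''X'' i) - F (fst s ''Y'' i))"
proof -
  let ?y = "LR ''y'' (Sc ''j'') (RMul (RGet ''S'' (Sc ''j'')) (RSub (FN (Sc ''j'')) (FN (Sc ''n''))))"
  let ?x = "LR ''x'' (Sc ''i'') (RAdd (RGet ''c'' (Sc ''i'')) (RSub (FN (IGet ''X'' (Sc ''i''))) (FN (IGet ''Y'' (Sc ''i'')))))"
  define s1 where "s1 = run (LFor ''j'' ''n'' ?y) s"
  have f1: "fst s1 a = fst s a" if "a \<noteq> ''j''" for a unfolding s1_def by (rule run_frame) (use that in simp)
  have r1: "snd s1 a = snd s a" if "a \<noteq> ''y''" for a unfolding s1_def by (rule run_frame) (use that in simp)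
  have s': "s' = run (LFor ''i'' ''m'' ?x) s1" by (simp only: s'_def prog_output_def run.simps(4) s1_def)
  have "\<forall>j<fst s ''n'' 0. snd s1 ''y'' j = snd s ''S'' j * (F j - F (fst s ''n'' 0))"
    unfolding s1_def
  proof (rule run_LFor_induct[where Inv="\<lambda>k t. \<forall>j<k. snd t ''y'' j = snd s ''S'' j * (F j - F (fst s ''n'' 0))"])
    fix k and t :: state
    assume I: "\<forall>j<k. snd t ''y'' j = snd s ''S'' j * (F j - F (fst s ''n'' 0))" and tk: "fst t ''j'' 0 = k"
      and fi: "\<And>a. a \<notin> wi ?y \<Longrightarrow> a \<noteq> ''j'' \<Longrightarrow> fst t a = fst s a" and fr: "\<And>a. a \<notin> wr ?y \<Longrightarrow> snd t a = snd s a"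
    have c: "fst t ''N'' = fst s ''N''" "fst t ''n'' = fst s ''n''" "snd t ''S'' = snd s ''S''" "snd t ''F'' = snd s ''F''"
      by (simp_all add: fi fr)
    show "\<forall>j<Suc k. snd (upd ''j'' (Suc k) (run ?y t)) ''y'' j = snd s ''S'' j * (F j - F (fst s ''n'' 0))"
      using I by (auto simp: store_apply tk c FN_def F_def less_Suc_eq)
  qed simp_all
  moreover have "snd s' ''y'' = snd s1 ''y''" unfolding s' by (rule run_frame) simp
  ultimately show "j < fst s ''n'' 0 \<Longrightarrow> snd s' ''y'' j = snd s ''S'' j * (F j - F (fst s ''n'' 0))" by simp
  have "\<forall>i<fst s1 ''m'' 0. snd s' ''x'' i = snd s ''c'' i + (F (fst s ''X'' i) - F (fst s ''Y'' i))"
    unfolding s'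
  proof (rule run_LFor_induct[where Inv="\<lambda>k t. \<forall>i<k. snd t ''x'' i = snd s ''c'' i + (F (fst s ''X'' i) - F (fst s ''Y'' i))"])
    fix k and t :: state
    assume I: "\<forall>i<k. snd t ''x'' i = snd s ''c'' i + (F (fst s ''X'' i) - F (fst s ''Y'' i))" and tk: "fst t ''i'' 0 = k"
      and fi: "\<And>a. a \<notin> wi ?x \<Longrightarrow> a \<noteq> ''i'' \<Longrightarrow> fst t a = fst s1 a" and fr: "\<And>a. a \<notin> wr ?x \<Longrightarrow> snd t a = snd s1 a"
    have c: "fst t ''N'' = fst s ''N''" "fst t ''X'' = fst s ''X''" "fst t ''Y'' = fst s ''Y''" "snd t ''c'' = snd s ''c''" "snd t ''F'' = snd s ''F''"
      by (simp_all add: fi fr f1 r1)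
    show "\<forall>i<Suc k. snd (upd ''i'' (Suc k) (run ?x t)) ''x'' i = snd s ''c'' i + (F (fst s ''X'' i) - F (fst s ''Y'' i))"
      using I by (auto simp: store_apply tk c FN_def F_def less_Suc_eq)
  qed simp_all
  then show "i < fst s ''m'' 0 \<Longrightarrow> snd s' ''x'' i = snd s ''c'' i + (F (fst s ''X'' i) - F (fst s ''Y'' i))"
    by (simp add: f1)
qed

section \<open>Optimality of the residual potential\<close>

lemma sum_lessThan_add: "(\<Sum>a<m + k. f a) = (\<Sum>a<m. f a) + (\<Sum>a<k. f (a + m :: nat))"
  by (induction k) (simp_all add: add_ac)

definition opp :: "nat \<Rightarrow> nat \<Rightarrow> nat" where
  "opp m a = (if a < m then a + m else if a < 2 * m then a - m else a)"

locale simplex_network =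
  fixes m n :: nat and e :: "nat \<Rightarrow> nat \<Rightarrow> real" and X Y :: "nat \<Rightarrow> nat" and G :: "nat \<Rightarrow> real"
  assumes unit: "i < m \<Longrightarrow> j < n \<Longrightarrow> e i j = 0 \<or> e i j = 1 \<or> e i j = -1"
    and cancel: "i < m \<Longrightarrow> a < n \<Longrightarrow> b < n \<Longrightarrow> a \<noteq> b \<Longrightarrow> e i a \<noteq> 0 \<Longrightarrow> e i b \<noteq> 0 \<Longrightarrow> e i a + e i b = 0"
    and ends: "i < m \<Longrightarrow> end_ok n (e i) (X i)" "i < m \<Longrightarrow> end_ok n (\<lambda>j. - e i j) (Y i)"
    and twin: "i < m \<Longrightarrow> X (i + m) = Y i" "i < m \<Longrightarrow> Y (i + m) = X i" "i < m \<Longrightarrow> G (i + m) = - G i"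
begin

lemma boundary_sum: "i < m \<Longrightarrow> z n = 0 \<Longrightarrow> (\<Sum>j<n. e i j * z j) = z (X i) - z (Y i)"
  and X_le: "i < m \<Longrightarrow> X i \<le> n" and Y_le: "i < m \<Longrightarrow> Y i \<le> n"
proof -
  show "(\<Sum>j<n. e i j * z j) = z (X i) - z (Y i)" if "i < m" "z n = 0"
    by (rule ends_sum(1)[where z=z, OF unit[OF that(1)] cancel[OF that(1)] ends(1)[OF that(1)] ends(2)[OF that(1)] that(2)])
  show "X i \<le> n" if "i < m"
    by (rule ends_sum(2)[where z="\<lambda>_. 0", OF unit[OF that] cancel[OF that] ends(1)[OF that] ends(2)[OF that] refl])
  show "Y i \<le> n" if "i < m"
    by (rule ends_sum(3)[where z="\<lambda>_. 0", OF unit[OF that] cancel[OF that] ends(1)[OF that] ends(2)[OF that] refl])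
qed

lemma arc_cases:
  assumes "a < 2 * m"
  obtains "a < m" "opp m a = a + m" | i where "i < m" "a = i + m" "opp m a = i"
proof (cases "a < m")
  case True
  then show ?thesis using that(1) by (simp add: opp_def)
next
  case False
  then show ?thesis using that(2)[of "a - m"] assms by (simp add: opp_def)
qed

sublocale nat_network "2 * m" "Suc n" X Y "opp m" G
proof unfold_locales
  fix a assume "a \<in> {..<2 * m}"
  then have a: "a < 2 * m" by simp
  show "X a \<in> {..<Suc n}" by (rule arc_cases[OF a]) (use X_le Y_le twin in \<open>auto simp: less_Suc_eq_le\<close>)
  show "Y a \<in> {..<Suc n}" by (rule arc_cases[OF a]) (use X_le Y_le twin in \<open>auto simp: less_Suc_eq_le\<close>)
  show "opp m a \<in> {..<2 * m}" by (rule arc_cases[OF a]) auto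
  show "opp m (opp m a) = a" by (rule arc_cases[OF a]) (auto simp: opp_def)
  show "X (opp m a) = Y a" by (rule arc_cases[OF a]) (use twin in auto)
  show "G (opp m a) = - G a" by (rule arc_cases[OF a]) (use twin in auto)
qed (auto simp: opp_def)

text \<open>Complementary slackness: \<open>h\<close> is an optimal dual solution, and \<open>w i * \<bar>x i\<bar> = h i * x i\<close>.\<close>

lemma residual_optimal:
  fixes r r0 w x x' z :: "nat \<Rightarrow> real"
  assumes r: "mean_ge 0 r" "\<And>a. a < 2 * m \<Longrightarrow> 0 \<le> r a" "circulation (\<lambda>a. r a - r0 a)"
    and r0: "\<And>i. i < m \<Longrightarrow> r0 i = w i" "\<And>i. i < m \<Longrightarrow> r0 (i + m) = w i"
    and x: "\<And>i. i < m \<Longrightarrow> x i = G i + (pot r (Suc n) (X i) - pot r (Suc n) (Y i))"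
    and x': "\<And>i. i < m \<Longrightarrow> x' i = G i + (z (X i) - z (Y i))"
  shows "(\<Sum>i<m. w i * \<bar>x i\<bar>) \<le> (\<Sum>i<m. w i * \<bar>x' i\<bar>)"
proof -
  define h where "h = (\<lambda>a. r a - r0 a)"
  have h_opp: "h (i + m) = - h i" if "i < m" for i
  proof -
    have "h (opp m i) = - h i" using r(3) that unfolding h_def circulation_def by simp
    then show ?thesis using that by (simp add: opp_def)
  qed
  \<comment> \<open>The arcs i and i + m have opposite values of \<open>h\<close> and exchanged
    ends, which turns the sum over all arcs into a sum of tensions.\<close>
  have orth: "(\<Sum>i<m. h i * (z (X i) - z (Y i))) = 0" for z
  proof -
    have "(\<Sum>a<2 * m. h a * z (X a)) = (\<Sum>a<m. h a * z (X a)) + (\<Sum>a<m. h (a + m) * z (X (a + m)))"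
      using sum_lessThan_add[of "\<lambda>a. h a * z (X a)" m m] by (simp only: mult_2)
    also have "\<dots> = (\<Sum>i<m. h i * (z (X i) - z (Y i)))"
      unfolding sum.distrib[symmetric] by (intro sum.cong refl) (simp add: h_opp twin algebra_simps)
    finally show ?thesis using circulation_orthogonal[OF r(3), of z] unfolding h_def by simp
  qed
  have pot: "pot r (Suc n) (Y a) \<le> pot r (Suc n) (X a) + G a" if "a < 2 * m" "0 < r a" for a
  proof (rule bf_potential[of "res r" "{..<Suc n}"])
    show "0 \<le> sum_list (map G ys)" if "ys \<noteq> []" "walk X Y (res r) w ys w" for w ys
    proof -
      have "closed (res r) ys" using that unfolding closed_def by blast
      then have "0 * real (length ys) \<le> sum_list (map G ys)" using r(1) unfolding mean_ge_def by blast
      then show ?thesis by simp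
    qed
  qed (use that fin_res src_N tgt_N in \<open>auto simp: res_iff\<close>)
  have hx: "w i * \<bar>x i\<bar> = h i * x i" and hw: "\<bar>h i\<bar> \<le> w i" if i: "i < m" for i
  proof -
    have rr: "r i = w i + h i" "r (i + m) = w i - h i" "0 \<le> r i" "0 \<le> r (i + m)"
      using r(2)[of i] r(2)[of "i + m"] r0 h_opp[OF i] i by (auto simp: h_def)
    then show "\<bar>h i\<bar> \<le> w i" by linarith
    \<comment> \<open>\<open>x i\<close> is the reduced cost of arc i and - x i that of its reverse,
      and residual arcs have non-negative reduced cost.\<close>
    have pos: "0 < r i \<Longrightarrow> 0 \<le> x i" using pot[of i] x[OF i] i by simp
    have neg: "0 < r (i + m) \<Longrightarrow> x i \<le> 0" using pot[of "i + m"] x[OF i] twin[OF i] i by simp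
    show "w i * \<bar>x i\<bar> = h i * x i"
    proof (cases "x i" "0 :: real" rule: linorder_cases)
      case less
      then have "r i = 0" using pos rr(3) by force
      then have "h i = - w i" using rr(1) by simp
      then show ?thesis using less by simp
    next
      case greater
      then have "r (i + m) = 0" using neg rr(4) by force
      then have "h i = w i" using rr(2) by simp
      then show ?thesis using greater by simp
    qed simp
  qed
  have "(\<Sum>i<m. w i * \<bar>x i\<bar>) = (\<Sum>i<m. h i * x i)" by (simp add: hx)
  also have "\<dots> = (\<Sum>i<m. h i * G i) + (\<Sum>i<m. h i * (pot r (Suc n) (X i) - pot r (Suc n) (Y i)))"
    by (simp add: x sum.distrib[symmetric] distrib_left)
  \<comment> \<open>\<open>h\<close> is orthogonal to every tension, so the computed potential can
    be traded for \<open>z\<close>.\<close>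
  also have "\<dots> = (\<Sum>i<m. h i * G i) + (\<Sum>i<m. h i * (z (X i) - z (Y i)))"
    by (simp only: orth)
  also have "\<dots> = (\<Sum>i<m. h i * x' i)" by (simp add: x' sum.distrib[symmetric] distrib_left)
  also have "\<dots> \<le> (\<Sum>i<m. w i * \<bar>x' i\<bar>)"
  proof (rule sum_mono)
    fix i assume "i \<in> {..<m}"
    then have "\<bar>h i\<bar> * \<bar>x' i\<bar> \<le> w i * \<bar>x' i\<bar>" using hw by (intro mult_right_mono) auto
    moreover have "h i * x' i \<le> \<bar>h i\<bar> * \<bar>x' i\<bar>"
      using abs_ge_self[of "h i * x' i"] unfolding abs_mult .
    ultimately show "h i * x' i \<le> w i * \<bar>x' i\<bar>" by (rule order_trans[rotated])
  qed
  finally show ?thesis .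
qed

end

section \<open>The complete program\<close>

definition prog_main :: loop where
  "prog_main = LSeq prog_boundary (LSeq prog_flips (LSeq prog_arcs
     (LSeq (LFor ''t'' ''T'' prog_round) (LSeq prog_potentials prog_output))))"

text \<open>These scalars are loop limits of the main program and must not be written inside it, so
  a separate program sets them.\<close>

definition prog_sizes :: loop where
  "prog_sizes = LSeq (LI ''d'' (INum 0) (IAdd (Sc ''p'') (INum 1))) (LSeq (LI ''f'' (INum 0) (IAdd (Sc ''p'') (INum 2)))
     (LSeq (LI ''N'' (INum 0) (IAdd (Sc ''n'') (INum 1))) (LI ''A'' (INum 0) (IMul (INum 2) (Sc ''m'')))))"

text \<open>\<open>L\<close> bounds both the number 2m of arcs and the number n + 1 of vertices;
  \<open>T\<close> is the bound on the number of cancellations plus one.\<close>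

definition prog_limit :: loop where
  "prog_limit = LSeq (LI ''L'' (INum 0) (IAdd (Sc ''A'') (Sc ''N'')))
     (LI ''T'' (INum 0) (IAdd (IMul (IAdd (Sc ''L'') (INum 1)) (IMul (IMul (IMul (INum 2) (Sc ''L'')) (Sc ''L'')) (Sc ''L''))) (INum 1)))"

text \<open>If there are neither p-simplices nor (p+1)-simplices, the number of simplices does not
  bound p, and the loop limits p + 1 and p + 2 would spoil the polynomial bound.\<close>

definition guard :: bexp where
  "guard = ILess (INum 0) (IAdd (Sc ''m'') (Sc ''n''))"

lemma wi_wr_main:
  "wi prog_boundary = {''i'', ''j'', ''k'', ''a'', ''b'', ''q''}" "wr prog_boundary = {''s'', ''D''}"
  "wi prog_flips = {''j'', ''C'', ''i'', ''a'', ''b'', ''q'', ''r''}" "wr prog_flips = {''S'', ''s''}"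
  "wi prog_arcs = {''i'', ''X'', ''Y'', ''j'', ''V''}" "wr prog_arcs = {''G'', ''R''}"
  "wi prog_round = {''l'', ''s'', ''u'', ''v'', ''O'', ''B'', ''e'', ''k'', ''z'', ''h'', ''Z''}"
  "wr prog_round = {''b'', ''l'', ''H'', ''d'', ''R''}"
  "wi prog_output = {''j'', ''i''}" "wr prog_output = {''y'', ''x''}"
  by (auto simp: prog_boundary_def prog_entry_def prog_count_def prog_inv_def prog_row_def prog_flip_def
      prog_flips_def prog_merge_def prog_relabel_def prog_arcs_def prog_ends_def prog_arc_ends_def prog_arc_data_def
      prog_round_def wi_wr_round prog_output_def)

lemma bounds_main: "bounds prog_main \<subseteq> {''m'', ''n'', ''d'', ''f'', ''N'', ''A'', ''T''}"
  by (simp add: prog_main_def prog_boundary_def prog_entry_def prog_count_def prog_inv_def prog_row_def prog_flip_def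
      prog_flips_def prog_merge_def prog_relabel_def prog_arcs_def prog_ends_def prog_arc_ends_def prog_arc_data_def
      prog_round_def prog_search_def prog_level_def prog_best_def prog_clear_def prog_relax_def prog_extract_def
      prog_push_def prog_potentials_def prog_copy_def prog_improve_def prog_output_def)

lemma counters_main: "counters_ok prog_main"
  by (simp add: prog_main_def prog_boundary_def prog_entry_def prog_count_def prog_inv_def prog_row_def prog_flip_def
      prog_flips_def prog_merge_def prog_relabel_def prog_arcs_def prog_ends_def prog_arc_ends_def prog_arc_data_def
      prog_round_def prog_search_def prog_level_def prog_best_def prog_clear_def prog_relax_def prog_extract_def
      prog_push_def prog_potentials_def prog_copy_def prog_improve_def prog_output_def)

section \<open>The problem in coordinates and the final bounds\<close>

lemma feasible_coords:
  assumes "ohcp_feasible D c x y" "D \<in> carrier_mat m n" "c \<in> carrier_vec m" "i < m"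
  shows "x $ i = c $ i + (\<Sum>j<n. D $$ (i, j) * y $ j)"
proof -
  have "dim_vec y = n" "x = c + D *\<^sub>v y" using assms(1,2) by (auto simp: ohcp_feasible_def)
  then show ?thesis
    using assms(2-4) by (simp add: scalar_prod_def atLeast0LessThan)
qed

lemma diagonal_objective:
  assumes "W \<in> carrier_mat m m" "diagonal_mat W" "x \<in> carrier_vec m"
  shows "ohcp_objective W x = (\<Sum>i<m. \<bar>W $$ (i, i)\<bar> * \<bar>real_of_int (x $ i)\<bar>)"
proof -
  have "(W *\<^sub>v map_vec real_of_int x) $ i = W $$ (i, i) * real_of_int (x $ i)" if i: "i < m" for i
  proof -
    have "(W *\<^sub>v map_vec real_of_int x) $ i = (\<Sum>j<m. W $$ (i, j) * real_of_int (x $ j))"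
      using assms(1,3) i by (simp add: scalar_prod_def atLeast0LessThan)
    also have "\<dots> = (\<Sum>j<m. if j = i then W $$ (i, i) * real_of_int (x $ i) else 0)"
      using assms(1,2) i by (intro sum.cong) (auto simp: diagonal_mat_def)
    finally show ?thesis using i by simp
  qed
  then show ?thesis
    using assms(1) by (simp add: ohcp_objective_def l1_norm_def abs_mult)
qed

lemma basis_length:
  assumes "oriented_basis K p \<sigma>s" "finite K"
  shows "length \<sigma>s \<le> card K"
proof -
  have "length \<sigma>s = card (simplices K p)"
    using assms(1) distinct_card[of "map set \<sigma>s"] by (simp add: oriented_basis_def)
  also have "\<dots> \<le> card K" using assms(2) by (intro card_mono) (auto simp: simplices_def)
  finally show ?thesis .
qed

text \<open>A p-simplex has p + 1 vertices, each of which is a member of \<open>K\<close> by itself.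
  This bounds the dimension, which also governs loops of the program.\<close>

lemma basis_dim:
  assumes K: "finite_simplicial_complex K" and \<sigma>s: "oriented_basis K p \<sigma>s" "0 < length \<sigma>s"
  shows "Suc p \<le> card K"
proof -
  have "set (\<sigma>s ! 0) \<in> simplices K p" using \<sigma>s by (auto simp: oriented_basis_def)
  then obtain S where S: "S \<in> K" "card S = Suc p" unfolding simplices_def by blast
  have "(\<lambda>v. {v}) ` S \<subseteq> K" using K S(1) by (auto simp: finite_simplicial_complex_def)
  moreover have "card ((\<lambda>v. {v}) ` S) = card S" by (intro card_image) simp
  ultimately show ?thesis
    using card_mono[of K "(\<lambda>v. {v}) ` S"] K S(2) by (simp add: finite_simplicial_complex_def)
qed

lemma run_main:
  fixes s :: state and c :: "int Matrix.vec" and W :: "real mat"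
  assumes K: "triangulates_compact_orientable_manifold K (p + 1)"
    and \<sigma>s: "oriented_basis K p \<sigma>s" and \<tau>s: "oriented_basis K (p + 1) \<tau>s"
    and c: "c \<in> carrier_vec (length \<sigma>s)" and W: "W \<in> carrier_mat (length \<sigma>s) (length \<sigma>s)" "diagonal_mat W"
    and s: "fst s ''m'' 0 = length \<sigma>s" "fst s ''n'' 0 = length \<tau>s" "fst s ''d'' 0 = p + 1" "fst s ''f'' 0 = p + 2"
      "fst s ''P'' = array (concat \<sigma>s)" "fst s ''Q'' = array (concat \<tau>s)"
    and sN: "fst s ''N'' 0 = Suc (length \<tau>s)" and sA: "fst s ''A'' 0 = 2 * length \<sigma>s"
    and L: "1 \<le> L" "2 * length \<sigma>s \<le> L" "Suc (length \<tau>s) \<le> L"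
    and sT: "fst s ''T'' 0 = Suc ((L + 1) * (2 * L * L * L))"
    and sc: "snd s ''c'' = array (map real_of_int (list_of_vec c))" and sw: "snd s ''w'' = array (diag_mat W)"
  shows "\<exists>x y. ohcp_optimal (boundary_matrix \<sigma>s \<tau>s) W c x y \<and> ohcp_output (run prog_main s) x y"
proof -
  define m n D where "m = length \<sigma>s" and "n = length \<tau>s" and "D = boundary_matrix \<sigma>s \<tau>s"
  have D: "D \<in> carrier_mat m n" by (simp add: D_def m_def n_def boundary_matrix_def)
  obtain sg :: "nat \<Rightarrow> int" where sg: "\<And>j. sg j = 1 \<or> sg j = -1"
    and Du: "\<And>i j. i < m \<Longrightarrow> j < n \<Longrightarrow> D $$ (i, j) = 0 \<or> D $$ (i, j) = 1 \<or> D $$ (i, j) = -1"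
    and Dc: "\<And>i j j'. i < m \<Longrightarrow> j < n \<Longrightarrow> j' < n \<Longrightarrow> j \<noteq> j' \<Longrightarrow>
       D $$ (i, j) \<noteq> 0 \<Longrightarrow> D $$ (i, j') \<noteq> 0 \<Longrightarrow> sg j * D $$ (i, j) + sg j' * D $$ (i, j') = 0"
  proof (rule boundary_matrix_orientable[OF K \<sigma>s \<tau>s, folded D_def m_def n_def])
    fix s :: "nat \<Rightarrow> int"
    assume "\<And>j. s j = 1 \<or> s j = -1"
      "\<And>i j. i < m \<Longrightarrow> j < n \<Longrightarrow> D $$ (i, j) = 0 \<or> D $$ (i, j) = 1 \<or> D $$ (i, j) = -1"
      "\<And>i j j'. i < m \<Longrightarrow> j < n \<Longrightarrow> j' < n \<Longrightarrow> j \<noteq> j' \<Longrightarrow>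
         D $$ (i, j) \<noteq> 0 \<Longrightarrow> D $$ (i, j') \<noteq> 0 \<Longrightarrow> s j * D $$ (i, j) + s j' * D $$ (i, j') = 0"
    then show thesis by (rule that)
  qed
  define a where "a = run prog_boundary s"
  define b where "b = run prog_flips a"
  define g where "g = run prog_arcs b"
  define h where "h = run (LFor ''t'' ''T'' prog_round) g"
  define q where "q = run prog_potentials h"
  define out where "out = run prog_output q"
  have out: "run prog_main s = out"
    by (simp only: prog_main_def run.simps(4) a_def b_def g_def h_def q_def out_def)
  have fa: "fst a x = fst s x" if "x \<notin> wi prog_boundary" for x unfolding a_def by (rule run_frame(1)[OF that])
  have ra: "snd a x = snd s x" if "x \<notin> wr prog_boundary" for x unfolding a_def by (rule run_frame(2)[OF that])
  have fb: "fst b x = fst a x" if "x \<notin> wi prog_flips" for x unfolding b_def by (rule run_frame(1)[OF that])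
  have rb: "snd b x = snd a x" if "x \<notin> wr prog_flips" for x unfolding b_def by (rule run_frame(2)[OF that])
  have fg: "fst g x = fst b x" if "x \<notin> wi prog_arcs" for x unfolding g_def by (rule run_frame(1)[OF that])
  have rg: "snd g x = snd b x" if "x \<notin> wr prog_arcs" for x unfolding g_def by (rule run_frame(2)[OF that])
  have fh: "fst h x = fst g x" if "x \<notin> wi (LFor ''t'' ''T'' prog_round)" for x unfolding h_def by (rule run_frame(1)[OF that])
  have rh: "snd h x = snd g x" if "x \<notin> wr prog_round" for x unfolding h_def by (rule run_frame(2)) (use that in simp)
  have fq: "fst q x = fst h x" if "x \<notin> wi prog_potentials" for x unfolding q_def by (rule run_frame(1)[OF that])
  have rq: "snd q x = snd h x" if "x \<notin> wr prog_potentials" for x unfolding q_def by (rule run_frame(2)[OF that])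
  note fr = wi_wr_main wi_wr_potentials fa ra fb rb fg rg fh rh fq rq
  define d where "d = snd a ''D''"
  have dD: "d (i * n + j) = real_of_int (D $$ (i, j))" if "i < m" "j < n" for i j
    using run_boundary_matrix[OF \<sigma>s \<tau>s s that[unfolded m_def n_def]] unfolding d_def a_def D_def n_def .
  interpret fl: flippable m n d "\<lambda>j. real_of_int (sg j)"
  proof unfold_locales
    show "d (i * n + j) = 0 \<or> d (i * n + j) = 1 \<or> d (i * n + j) = -1" if "i < m" "j < n" for i j
      using Du[OF that] unfolding dD[OF that] by auto
    show "real_of_int (sg j) = 1 \<or> real_of_int (sg j) = -1" for j using sg[of j] by auto
    show "real_of_int (sg a) * d (i * n + a) + real_of_int (sg b) * d (i * n + b) = 0"
      if h: "i < m" "a < n" "b < n" "a \<noteq> b" "d (i * n + a) \<noteq> 0" "d (i * n + b) \<noteq> 0" for i a b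
    proof -
      have "sg a * D $$ (i, a) + sg b * D $$ (i, b) = 0"
        by (rule Dc) (use h dD[OF h(1,2)] dD[OF h(1,3)] in auto)
      then have "real_of_int (sg a * D $$ (i, a) + sg b * D $$ (i, b)) = 0" by (simp only: of_int_0)
      then show ?thesis using dD[OF h(1,2)] dD[OF h(1,3)] by simp
    qed
  qed
  have an: "fst a ''n'' 0 = n" "fst a ''m'' 0 = m" by (simp_all add: fr s m_def n_def)
  note S = fl.run_flips[OF an d_def[symmetric], folded b_def]
  have bn: "fst b ''n'' 0 = n" "fst b ''m'' 0 = m" "snd b ''D'' = d" by (simp_all add: fr s m_def n_def d_def)
  let ?S = "snd b ''S''"
  let ?e = "\<lambda>i j. d (i * n + j) * ?S j"
  have SS: "?S j * ?S j = 1" if "j < n" for j using S(1)[OF that] by auto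
  have cancel: "?e i a + ?e i b = 0" if "i < m" "a < n" "b < n" "a \<noteq> b" "?e i a \<noteq> 0" "?e i b \<noteq> 0" for i a b
    using S(2)[OF that(1-4)] that(5,6) by (simp add: mult.commute)
  have arcs: "end_ok n (?e i) (fst g ''X'' i) \<and> end_ok n (\<lambda>j. - ?e i j) (fst g ''Y'' i) \<and>
    fst g ''X'' (i + m) = fst g ''Y'' i \<and> fst g ''Y'' (i + m) = fst g ''X'' i \<and>
    fst g ''V'' i = i + m \<and> fst g ''V'' (i + m) = i \<and>
    snd g ''G'' i = snd b ''c'' i \<and> snd g ''G'' (i + m) = - snd b ''c'' i \<and>
    snd g ''R'' i = \<bar>snd b ''w'' i\<bar> \<and> snd g ''R'' (i + m) = \<bar>snd b ''w'' i\<bar>" if "i < m" for i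
    by (rule run_arcs[of b i, unfolded bn, folded g_def]) (rule cancel, assumption+, rule that)
  interpret N: simplex_network m n ?e "fst g ''X''" "fst g ''Y''" "snd g ''G''"
  proof unfold_locales
    show "?e i j = 0 \<or> ?e i j = 1 \<or> ?e i j = -1" if "i < m" "j < n" for i j
      using fl.d[OF that] S(1)[OF that(2)] by auto
  qed (use arcs cancel in auto)
  have cb: "snd b ''c'' i = real_of_int (c $ i)" "snd b ''w'' i = W $$ (i, i)" if "i < m" for i
    using that c W by (simp_all add: fr sc sw array_def m_def diag_mat_def list_of_vec_index)
  have netg: "N.net g"
    unfolding N.net_def
  proof (intro conjI allI impI refl)
    show "fst g ''N'' 0 = Suc n" "fst g ''A'' 0 = 2 * m" by (simp_all add: fr sN sA m_def n_def)
    show "fst g ''V'' e = opp m e" if "e < 2 * m" for e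
      by (rule N.arc_cases[OF that]) (use arcs in auto)
  qed
  have R0: "0 \<le> snd g ''R'' e" if "e < 2 * m" for e
    by (rule N.arc_cases[OF that]) (use arcs in auto)
  have gT: "fst g ''T'' 0 = Suc ((L + 1) * (2 * L * L * L))" by (simp add: fr sT)
  note H = N.run_rounds[OF netg R0 L[folded m_def n_def] gT, folded h_def]
  let ?r = "snd h ''R''"
  let ?pot = "N.pot ?r (Suc n)"
  have qN: "fst q ''N'' 0 = Suc n" by (simp add: fr sN n_def)
  have F: "snd q ''F'' (fst q ''N'' 0 * fst q ''N'' 0 + v) = ?pot v" if "v < Suc n" for v
    unfolding qN unfolding q_def by (rule N.run_potentials[OF H(1) refl that])
  \<comment> \<open>Subtracting the value at the outer vertex makes it 0 there, as
    \<open>boundary_sum\<close> requires; tensions are unaffected.\<close>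
  define z where "z = (\<lambda>v. ?pot v - ?pot n)"
  have qm: "fst q ''n'' 0 = n" "fst q ''m'' 0 = m" "snd q ''S'' = ?S" "fst q ''X'' = fst g ''X''" "fst q ''Y'' = fst g ''Y''"
    "snd q ''c'' = snd b ''c''"
    by (simp_all add: fr s m_def n_def)
  have oy: "snd out ''y'' j = ?S j * z j" if "j < n" for j
    using run_output(1)[of j q] F[of j] F[of n] that unfolding out_def z_def qm by simp
  have ox: "snd out ''x'' i = real_of_int (c $ i) + (z (fst g ''X'' i) - z (fst g ''Y'' i))" if "i < m" for i
    using run_output(2)[of i q] F[of "fst g ''X'' i"] F[of "fst g ''Y'' i"] N.X_le[OF that] N.Y_le[OF that] that cb(1)[OF that]
    unfolding out_def z_def qm by simp
  have Gi: "snd g ''G'' i = real_of_int (c $ i)" if "i < m" for i using arcs[OF that] cb(1)[OF that] by simp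
  have Gint: "snd g ''G'' e \<in> \<int>" if "e < 2 * m" for e
    by (rule N.arc_cases[OF that]) (use arcs cb(1) in auto)
  have zint: "z v \<in> \<int>" for v unfolding z_def by (intro Ints_diff N.pot_Ints Gint)
  have zn: "z n = 0" by (simp add: z_def)
  \<comment> \<open>The floor only changes the type: the values are integers, since integer costs
    give integer potentials.\<close>
  define y where "y = Matrix.vec n (\<lambda>j. \<lfloor>?S j * z j\<rfloor>)"
  define x where "x = c + D *\<^sub>v y"
  have ry: "real_of_int (y $ j) = ?S j * z j" if "j < n" for j
  proof -
    have "?S j * z j \<in> \<int>" using S(1)[OF that] zint[of j] by auto
    then show ?thesis using that by (simp add: y_def)
  qed
  have feas: "ohcp_feasible D c x y"
    using D c by (auto simp: ohcp_feasible_def x_def y_def m_def)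
  \<comment> \<open>Every feasible chain differs from c by the tension of its sign-flipped
    coefficients, extended by 0 at the outer vertex. So both the computed chain and its competitors
    have the form that \<open>residual_optimal\<close> compares.\<close>
  have coords: "real_of_int (x' $ i) = snd g ''G'' i + (z' (fst g ''X'' i) - z' (fst g ''Y'' i))"
    if f: "ohcp_feasible D c x' y'" and i: "i < m" and z': "\<And>j. j < n \<Longrightarrow> z' j = ?S j * real_of_int (y' $ j)" "z' n = 0" for x' y' z' i
  proof -
    have "real_of_int (x' $ i) = real_of_int (c $ i) + (\<Sum>j<n. real_of_int (D $$ (i, j)) * real_of_int (y' $ j))"
      unfolding feasible_coords[OF f D c[folded m_def] i] by simp
    also have "(\<Sum>j<n. real_of_int (D $$ (i, j)) * real_of_int (y' $ j)) = (\<Sum>j<n. ?e i j * z' j)"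
    proof (intro sum.cong refl)
      fix j assume "j \<in> {..<n}"
      then have j: "j < n" by simp
      have eq: "?e i j * z' j = d (i * n + j) * (?S j * ?S j) * real_of_int (y' $ j)"
        unfolding z'(1)[OF j] by (simp only: mult.assoc)
      show "real_of_int (D $$ (i, j)) * real_of_int (y' $ j) = ?e i j * z' j"
        unfolding eq unfolding SS[OF j] dD[OF i j] by (simp only: mult_1_right)
    qed
    also have "\<dots> = z' (fst g ''X'' i) - z' (fst g ''Y'' i)" by (rule N.boundary_sum[where z=z', OF i z'(2)])
    finally show ?thesis using Gi[OF i] by simp
  qed
  have zy: "z j = ?S j * real_of_int (y $ j)" if "j < n" for j
    unfolding ry[OF that] mult.assoc[symmetric] SS[OF that] by simp
  note rx = coords[OF feas _ zy zn]
  have "ohcp_objective W x \<le> ohcp_objective W x'" if f: "ohcp_feasible D c x' y'" for x' y'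
  proof -
    define z' where "z' = (\<lambda>j. if j < n then ?S j * real_of_int (y' $ j) else 0)"
    have x': "real_of_int (x' $ i) = snd g ''G'' i + (z' (fst g ''X'' i) - z' (fst g ''Y'' i))" if "i < m" for i
      by (rule coords[OF f that]) (simp_all add: z'_def)
    have carr: "x \<in> carrier_vec m" "x' \<in> carrier_vec m" using feas f D by (auto simp: ohcp_feasible_def)
    have "(\<Sum>i<m. \<bar>W $$ (i, i)\<bar> * \<bar>real_of_int (x $ i)\<bar>) \<le> (\<Sum>i<m. \<bar>W $$ (i, i)\<bar> * \<bar>real_of_int (x' $ i)\<bar>)"
    proof (rule N.residual_optimal[OF H(2,3,4)])
      show "snd g ''R'' i = \<bar>W $$ (i, i)\<bar>" "snd g ''R'' (i + m) = \<bar>W $$ (i, i)\<bar>" if "i < m" for i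
        using arcs[OF that] cb(2)[OF that] by simp_all
      show "real_of_int (x $ i) = snd g ''G'' i + (?pot (fst g ''X'' i) - ?pot (fst g ''Y'' i))" if "i < m" for i
        using rx[OF that] by (simp add: z_def)
      show "real_of_int (x' $ i) = snd g ''G'' i + (z' (fst g ''X'' i) - z' (fst g ''Y'' i))" if "i < m" for i
        by (rule x'[OF that])
    qed
    then show ?thesis
      using diagonal_objective[OF W[folded m_def]] carr by simp
  qed
  then have "ohcp_optimal D W c x y" using feas unfolding ohcp_optimal_def by blast
  moreover have "ohcp_output out x y"
    unfolding ohcp_output_def
  proof (intro conjI allI impI)
    fix i assume "i < dim_vec x"
    then have i: "i < m" using D by (simp add: x_def)
    show "snd out ''x'' i = real_of_int (x $ i)" using ox[OF i] rx[OF i] Gi[OF i] by simp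
  next
    fix j assume "j < dim_vec y"
    then have j: "j < n" by (simp add: y_def)
    show "snd out ''y'' j = real_of_int (y $ j)" using oy[OF j] ry[OF j] by simp
  qed
  ultimately show ?thesis unfolding out D_def by blast
qed

text \<open>With k simplices, L = 2m + n + 1 is at most 3k + 1; inserted into the number of rounds
  this bounds every loop limit.\<close>

definition size_bound :: "nat poly" where
  "size_bound = [:1:] + [:2, 3:] * ([:2:] * [:1, 3:] * [:1, 3:] * [:1, 3:])"

lemma poly_size_bound: "poly size_bound k = Suc ((3 * k + 2) * (2 * (3 * k + 1) * (3 * k + 1) * (3 * k + 1)))"
  by (simp add: size_bound_def algebra_simps)

lemma exec_main:
  assumes K: "triangulates_compact_orientable_manifold K (p + 1)"
    and \<sigma>s: "oriented_basis K p \<sigma>s" and \<tau>s: "oriented_basis K (p + 1) \<tau>s"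
    and c: "c \<in> carrier_vec (length \<sigma>s)" and W: "W \<in> carrier_mat (length \<sigma>s) (length \<sigma>s)" "diagonal_mat W"
    and ne: "0 < length \<sigma>s + length \<tau>s"
  shows "\<exists>t s x y. exec (Seq (compile prog_sizes) (Seq (compile prog_limit) (compile prog_main))) (ohcp_input p \<sigma>s \<tau>s c W) t s \<and>
    t \<le> poly (cost_poly prog_sizes) 0 + poly (cost_poly prog_limit) 0 + poly (cost_poly prog_main) (poly size_bound (card K)) \<and>
    ohcp_optimal (boundary_matrix \<sigma>s \<tau>s) W c x y \<and> ohcp_output s x y"
proof -
  define s0 where "s0 = ohcp_input p \<sigma>s \<tau>s c W"
  define s1 where "s1 = run prog_sizes s0"
  define s2 where "s2 = run prog_limit s1"
  let ?m = "length \<sigma>s" and ?n = "length \<tau>s"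
  define L where "L = 2 * ?m + Suc ?n"
  have s0: "fst s0 ''p'' 0 = p" "fst s0 ''m'' 0 = ?m" "fst s0 ''n'' 0 = ?n" "fst s0 ''P'' = array (concat \<sigma>s)"
    "fst s0 ''Q'' = array (concat \<tau>s)" "snd s0 ''c'' = array (map real_of_int (list_of_vec c))" "snd s0 ''w'' = array (diag_mat W)"
    by (simp_all add: s0_def ohcp_input_def array_def fun_eq_iff)
  have s1: "fst s1 ''d'' 0 = p + 1" "fst s1 ''f'' 0 = p + 2" "fst s1 ''N'' 0 = Suc ?n" "fst s1 ''A'' 0 = 2 * ?m"
    by (simp_all add: s1_def prog_sizes_def store_apply s0)
  have f1: "fst s1 a = fst s0 a" if "a \<notin> {''d'', ''f'', ''N'', ''A''}" for a
    unfolding s1_def by (rule run_frame) (use that in \<open>simp add: prog_sizes_def\<close>)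
  have r1: "snd s1 a = snd s0 a" for a
    unfolding s1_def by (rule run_frame) (simp add: prog_sizes_def)
  have s2: "fst s2 ''T'' 0 = Suc ((L + 1) * (2 * L * L * L))"
    by (simp add: s2_def prog_limit_def store_apply s1 L_def)
  have f2: "fst s2 a = fst s1 a" if "a \<notin> {''L'', ''T''}" for a
    unfolding s2_def by (rule run_frame) (use that in \<open>simp add: prog_limit_def\<close>)
  have r2: "snd s2 a = snd s1 a" for a
    unfolding s2_def by (rule run_frame) (simp add: prog_limit_def)
  have K': "finite_simplicial_complex K" using K by (simp add: triangulates_compact_orientable_manifold_def)
  then have "finite K" by (simp add: finite_simplicial_complex_def)
  then have le: "?m \<le> card K" "?n \<le> card K" using basis_length[OF \<sigma>s] basis_length[OF \<tau>s] by auto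
  \<comment> \<open>One of the two lists is non-empty, so a simplex of dimension p or p + 1 bounds
    p.\<close>
  have "p + 1 \<le> card K" using basis_dim[OF K' \<sigma>s] basis_dim[OF K' \<tau>s] ne by (cases "0 < ?m") auto
  moreover have "1 \<le> card K" using le ne by linarith
  ultimately have small: "?m \<le> 3 * card K + 1" "?n \<le> 3 * card K + 1" "p + 1 \<le> 3 * card K + 1" "p + 2 \<le> 3 * card K + 1"
    "Suc ?n \<le> 3 * card K + 1" "2 * ?m \<le> 3 * card K + 1" "L \<le> 3 * card K + 1"
    using le by (simp_all add: L_def)
  let ?B = "poly size_bound (card K)"
  have big: "3 * card K + 1 \<le> ?B"
    unfolding poly_size_bound by (simp add: algebra_simps)
  have T: "Suc ((L + 1) * (2 * L * L * L)) \<le> ?B"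
    unfolding poly_size_bound using small(7) by (intro Suc_le_mono[THEN iffD2] mult_mono) auto
  have bnd: "\<forall>b\<in>bounds prog_main. fst s2 b 0 \<le> ?B"
  proof
    fix b assume "b \<in> bounds prog_main"
    then have "b \<in> {''m'', ''n'', ''d'', ''f'', ''N'', ''A'', ''T''}" using bounds_main by blast
    then show "fst s2 b 0 \<le> ?B"
      using small big T s2 by (auto simp: f2 f1 s0 s1)
  qed
  have disj: "bounds prog_main \<inter> wi prog_main = {}"
  proof -
    have "\<forall>b\<in>{''m'', ''n'', ''d'', ''f'', ''N'', ''A'', ''T''}. b \<notin> wi prog_main"
      by (simp add: prog_main_def wi_wr_main wi_wr_potentials)
    then show ?thesis using bounds_main by blast
  qed
  obtain t1 where t1: "t1 \<le> poly (cost_poly prog_sizes) 0" "exec (compile prog_sizes) s0 t1 s1"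
    using exec_compile[of prog_sizes s0 0] by (auto simp: prog_sizes_def s1_def)
  obtain t2 where t2: "t2 \<le> poly (cost_poly prog_limit) 0" "exec (compile prog_limit) s1 t2 s2"
    using exec_compile[of prog_limit s1 0] by (auto simp: prog_limit_def s2_def)
  obtain t3 where t3: "t3 \<le> poly (cost_poly prog_main) ?B" "exec (compile prog_main) s2 t3 (run prog_main s2)"
    using exec_compile[OF counters_main disj bnd] by blast
  have "\<exists>x y. ohcp_optimal (boundary_matrix \<sigma>s \<tau>s) W c x y \<and> ohcp_output (run prog_main s2) x y"
    by (rule run_main[OF K \<sigma>s \<tau>s c W, where L=L]) (simp_all add: f2 f1 r2 r1 s0 s1 s2, simp_all add: L_def)
  moreover have "exec (Seq (compile prog_sizes) (Seq (compile prog_limit) (compile prog_main))) s0 (t1 + (t2 + t3)) (run prog_main s2)"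
    by (intro exec.intros(4)[OF t1(2)] exec.intros(4)[OF t2(2)] t3(2))
  ultimately show ?thesis
    using t1(1) t2(1) t3(1) unfolding s0_def
    by (intro exI[of _ "t1 + (t2 + t3)"] exI[of _ "run prog_main s2"]) auto
qed

theorem corollary4p2:
  shows "\<exists>(prog :: com) (q :: nat poly).
    \<forall>(p :: nat) (K :: nat set set) (\<sigma>s :: nat list list) (\<tau>s :: nat list list)
      (c :: int Matrix.vec) (W :: real mat).
      triangulates_compact_orientable_manifold K (p + 1) \<longrightarrow>
      oriented_basis K p \<sigma>s \<longrightarrow>
      oriented_basis K (p + 1) \<tau>s \<longrightarrow>
      c \<in> carrier_vec (length \<sigma>s) \<longrightarrow>
      W \<in> carrier_mat (length \<sigma>s) (length \<sigma>s) \<longrightarrow>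
      diagonal_mat W \<longrightarrow>
      (\<exists>t s x y.
         exec prog (ohcp_input p \<sigma>s \<tau>s c W) t s \<and>
         t \<le> poly q (card K) \<and>
         ohcp_optimal (boundary_matrix \<sigma>s \<tau>s) W c x y \<and>
         ohcp_output s x y)"
proof -
  let ?c = "Seq (compile prog_sizes) (Seq (compile prog_limit) (compile prog_main))"
  \<comment> \<open>The constant covers the guard, the empty branch of cost 1 and the two programs
    without loops.\<close>
  let ?k = "Suc (Suc (bcost guard)) + (poly (cost_poly prog_sizes) 0 + poly (cost_poly prog_limit) 0)"
  let ?q = "[:?k:] + pcompose (cost_poly prog_main) size_bound"
  have "\<exists>t s x y. exec (Cond guard ?c Skip) (ohcp_input p \<sigma>s \<tau>s c W) t s \<and> t \<le> poly ?q (card K) \<and>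
      ohcp_optimal (boundary_matrix \<sigma>s \<tau>s) W c x y \<and> ohcp_output s x y"
    if a: "triangulates_compact_orientable_manifold K (p + 1)" "oriented_basis K p \<sigma>s" "oriented_basis K (p + 1) \<tau>s"
      "c \<in> carrier_vec (length \<sigma>s)" "W \<in> carrier_mat (length \<sigma>s) (length \<sigma>s)" "diagonal_mat W"
    for p K \<sigma>s \<tau>s and c :: "int Matrix.vec" and W :: "real mat"
  proof -
    let ?s = "ohcp_input p \<sigma>s \<tau>s c W"
    have g: "bval guard ?s \<longleftrightarrow> 0 < length \<sigma>s + length \<tau>s"
      by (simp add: guard_def ohcp_input_def array_def)
    show ?thesis
    proof (cases "0 < length \<sigma>s + length \<tau>s")
      case True
      obtain t s x y where t: "exec ?c ?s t s"
        "t \<le> poly (cost_poly prog_sizes) 0 + poly (cost_poly prog_limit) 0 + poly (cost_poly prog_main) (poly size_bound (card K))"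
        "ohcp_optimal (boundary_matrix \<sigma>s \<tau>s) W c x y" "ohcp_output s x y"
        using exec_main[OF a True] by blast
      have "exec (Cond guard ?c Skip) ?s (Suc (bcost guard + t)) s"
        using exec.intros(5)[OF _ t(1)] g True by blast
      moreover have "Suc (bcost guard + t) \<le> poly ?q (card K)" using t(2) by (simp add: poly_pcompose)
      ultimately show ?thesis using t(3,4) by blast
    next
      case False
      \<comment> \<open>All vectors have length 0, so \<open>c\<close> is optimal and nothing has to
        be computed.\<close>
      then have dims: "length \<sigma>s = 0" "length \<tau>s = 0" by auto
      let ?D = "boundary_matrix \<sigma>s \<tau>s" and ?y = "Matrix.vec 0 (\<lambda>_. 0 :: int)"
      have D: "?D \<in> carrier_mat 0 0" using dims by (simp add: boundary_matrix_def)
      have feas: "ohcp_feasible ?D c c ?y"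
        using a(4) D dims by (auto simp: ohcp_feasible_def)
      have "x' = c" if "ohcp_feasible ?D c x' y'" for x' y'
        using that a(4) D dims by (intro eq_vecI) (auto simp: ohcp_feasible_def)
      then have "ohcp_optimal ?D W c c ?y" using feas unfolding ohcp_optimal_def by blast
      moreover have "ohcp_output ?s c ?y" using a(4) dims by (simp add: ohcp_output_def)
      moreover have "exec (Cond guard ?c Skip) ?s (Suc (bcost guard + 1)) ?s"
        using exec.intros(6)[OF _ exec.intros(1)] g False by blast
      moreover have "Suc (bcost guard + 1) \<le> poly ?q (card K)" by simp
      ultimately show ?thesis by blast
    qed
  qed
  then show ?thesis by blast
qed

end
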